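(* Fix either version $B=X$ or $B=D$. Let $\mathcal K\subseteq\mathcal P$ be a compact semialgebraic (not necessarily finite) upper semilattice with $\mathfrak g\in\mathcal K$, and $\mathcal K^\#=\mathcal K\setminus\{\mathfrak g\}$. Then the compact set $/\mathcal K^\#/=\bigcup_{\varphi\in\Delta(\mathcal K^\#)}/\varphi/$ is a strong deformation retract of: (i) $B[\mathcal K]:=\bigcup_{\mathfrak k\in\mathcal K^\#}B[\mathfrak k]$, in general; (ii) $X_\varepsilon$ (for every $\varepsilon\in\,]0,1[$) and $X_1=B[\mathcal P\setminus\mathcal I]=\bigcup_{\mathfrak f\in\mathcal P\setminus\mathcal I}B[\mathfrak f]$, provided $[\mathfrak g,\mathfrak g]\not\subseteq\mathfrak h$ and $\mathcal K^{\min}\subseteq\mathcal K\subseteq\mathcal P\setminus\mathcal I$.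
   Context: $\mathfrak g$ is the Lie algebra of a compact Lie group with Euclidean inner product $Q$ satisfying $Q([X,Y],Z)=Q(X,[Y,Z])$; symmetric operators satisfy $Q(AX,Y)=Q(X,AY)$. For symmetric $A$, $F_a$ is the span of eigenvectors with eigenvalue $\le a$; $A$ is filtering if $[F_a,F_b]\subseteq F_{a+b}$ for all $a,b$; $\mathfrak F_+$ = filtering symmetric operators with nonnegative spectrum and trace $1$. $\mathfrak h\subsetneq\mathfrak g$ fixed subalgebra, $\mathcal A$ compact group of automorphisms of $\mathfrak g$ preserving $\mathfrak h$ and $Q$. $\mathcal P$ = set of $\mathcal A$-invariant subalgebras $\mathfrak k$ with $\mathfrak h\subsetneq\mathfrak k\subseteq\mathfrak g$, a subset of the disjoint union of Grassmannians of $\mathfrak g$ (compactness and semialgebraicity of $\mathcal K$ refer to this). Upper semilattice: for $\mathfrak k,\mathfrak l\in\mathcal K$ the smallest subalgebra containing both lies in $\mathcal K$. $\mathcal I=\{\mathfrak k\in\mathcal P:[\mathfrak k,\mathfrak k]\subseteq\mathfrak h\}$ (toral subalgebras). $\mathcal K^{\min}$ is the smallest upper semilattice in $\mathcal P\setminus\mathcal I$ containing $\mathfrak g$ and all minimal elements of $\mathcal P\setminus\mathcal I$. For $\mathfrak k\in\mathcal P\setminus\{\mathfrak g\}$: $\bar\chi^{\mathfrak k}=\frac{1}{\dim(\mathfrak g/\mathfrak k)}(1_{\mathfrak g}-1_{\mathfrak k})$ ($Q$-orthogonal projections); $D[\mathfrak k]$ = symmetric operators with nonnegative spectrum, trace $1$,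 commuting with $\mathcal A$, annihilating $\mathfrak k$ and commuting with $\mathrm{ad}(X)$, $X\in\mathfrak k$; $X[\mathfrak k]=D[\mathfrak k]\cap\mathfrak F_+$; $D[\mathfrak g]=X[\mathfrak g]=\emptyset$. Flags $\varphi=(\mathfrak f_1\supsetneq\dots\supsetneq\mathfrak f_r)$, $r\ge1$, $\mathfrak f_i\in\mathcal P$, $\max\varphi=\mathfrak f_1$; $\Delta(\mathcal S)$ = flags with all members in $\mathcal S$; $/\chi/$ = convex hull of $\{\bar\chi^{\mathfrak f}:\mathfrak f\in\chi\}$ for $\chi\not\ni\mathfrak g$. Butterflies: $B[(\mathfrak f)]=B[\mathfrak f]$; if $r>1$, $\mathfrak f_1=\mathfrak g$: $B[\varphi]=/(\mathfrak f_2,\dots,\mathfrak f_r)/$; if $r>1$, $\mathfrak f_1\neq\mathfrak g$: the union of closed segments joining $B[\mathfrak f_1]$ to $/(\mathfrak f_2,\dots,\mathfrak f_r)/$ (their join). $\mathbb I=\{\varphi\in\Delta(\mathcal P)\setminus\Delta(\mathcal I):\varphi\setminus\{\max\varphi\}\subseteq\mathcal I\}$, $B[\mathbb I]=\bigcup_{\varphi\in\mathbb I}B[\varphi]$. $\kappa:B[\mathbb I]\to[0,1]$: for $A\in B[\varphi]$, $\varphi\in\mathbb I$: $\kappa(A)=0$ if $\max\varphi=\mathfrak g$, $=1$ if $\varphi$ has length $1$, otherwise the coefficient $\kappa$ in $A=(1-\kappa)A_1+\kappa A_2$ with $A_1\in/(\mathfrak f_2,\dots,\mathfrak f_r)/$,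 $A_2\in B[\mathfrak f_1]$ (independent of $\varphi$). $L$ is an upper bound for the lengths of flags in $\Delta(\mathcal I)$ and $X_\varepsilon=\{A\in B[\mathbb I]:\kappa(A)\ge\varepsilon^L\}$. *)

theory Defs
  imports "HOL-Analysis.Analysis"
begin

text \<open>The Lie algebra g is modelled as a type 'g of class euclidean_space (its inner
product is Q), with a bracket br.  Operators are bounded linear maps on 'g.\<close>

definition compact_lie_algebra :: "('g::euclidean_space \<Rightarrow> 'g \<Rightarrow> 'g) \<Rightarrow> bool" where
  "compact_lie_algebra br \<longleftrightarrow>
     (\<forall>x. linear (br x)) \<and> (\<forall>y. linear (\<lambda>x. br x y)) \<and>
     (\<forall>x. br x x = 0) \<and>
     (\<forall>x y z. br x (br y z) + br y (br z x) + br z (br x y) = 0) \<and>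
     (\<forall>x y z. inner (br x y) z = inner x (br y z))"

definition subalg :: "('g::euclidean_space \<Rightarrow> 'g \<Rightarrow> 'g) \<Rightarrow> 'g set \<Rightarrow> bool" where
  "subalg br k \<longleftrightarrow> subspace k \<and> (\<forall>x\<in>k. \<forall>y\<in>k. br x y \<in> k)"

definition subalg_gen :: "('g::euclidean_space \<Rightarrow> 'g \<Rightarrow> 'g) \<Rightarrow> 'g set \<Rightarrow> 'g set" where
  "subalg_gen br S = \<Inter>{m. subalg br m \<and> S \<subseteq> m}"

definition aut_group :: "('g::euclidean_space \<Rightarrow> 'g \<Rightarrow> 'g) \<Rightarrow> 'g set \<Rightarrow> ('g \<Rightarrow>\<^sub>L 'g) set \<Rightarrow> bool" where
  "aut_group br h A \<longleftrightarrow> compact A \<and> id_blinfun \<in> A \<and>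
     (\<forall>a\<in>A. \<forall>b\<in>A. a o\<^sub>L b \<in> A) \<and>
     (\<forall>a\<in>A. \<exists>b\<in>A. a o\<^sub>L b = id_blinfun \<and> b o\<^sub>L a = id_blinfun) \<and>
     (\<forall>a\<in>A. \<forall>x y. blinfun_apply a (br x y) = br (blinfun_apply a x) (blinfun_apply a y)) \<and>
     (\<forall>a\<in>A. \<forall>x y. inner (blinfun_apply a x) (blinfun_apply a y) = inner x y) \<and>
     (\<forall>a\<in>A. blinfun_apply a ` h = h)"

definition Pset :: "('g::euclidean_space \<Rightarrow> 'g \<Rightarrow> 'g) \<Rightarrow> 'g set \<Rightarrow> ('g \<Rightarrow>\<^sub>L 'g) set \<Rightarrow> 'g set set" where
  "Pset br h A = {k. subalg br k \<and> (\<forall>a\<in>A. blinfun_apply a ` k \<subseteq> k) \<and> h \<subset> k}"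

definition Iset :: "('g::euclidean_space \<Rightarrow> 'g \<Rightarrow> 'g) \<Rightarrow> 'g set \<Rightarrow> ('g \<Rightarrow>\<^sub>L 'g) set \<Rightarrow> 'g set set" where
  "Iset br h A = {k \<in> Pset br h A. \<forall>x\<in>k. \<forall>y\<in>k. br x y \<in> h}"

definition upper_semilattice :: "('g::euclidean_space \<Rightarrow> 'g \<Rightarrow> 'g) \<Rightarrow> 'g set set \<Rightarrow> bool" where
  "upper_semilattice br K \<longleftrightarrow> (\<forall>k\<in>K. \<forall>l\<in>K. subalg_gen br (k \<union> l) \<in> K)"

definition Kmin :: "('g::euclidean_space \<Rightarrow> 'g \<Rightarrow> 'g) \<Rightarrow> 'g set \<Rightarrow> ('g \<Rightarrow>\<^sub>L 'g) set \<Rightarrow> 'g set set" where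
  "Kmin br h A = \<Inter>{S. S \<subseteq> Pset br h A - Iset br h A \<and> upper_semilattice br S \<and> UNIV \<in> S \<and>
      {k \<in> Pset br h A - Iset br h A. \<forall>m \<in> Pset br h A - Iset br h A. m \<subseteq> k \<longrightarrow> m = k} \<subseteq> S}"

definition oproj :: "'g::euclidean_space set \<Rightarrow> 'g \<Rightarrow>\<^sub>L 'g" where
  "oproj k = Blinfun (\<lambda>x. THE y. y \<in> k \<and> (\<forall>z\<in>k. inner (x - y) z = 0))"

inductive polyfun :: "('a::real_normed_vector \<Rightarrow> real) \<Rightarrow> bool" where
  pf_const: "polyfun (\<lambda>x. c)"
| pf_lin: "bounded_linear f \<Longrightarrow> polyfun f"
| pf_add: "polyfun p \<Longrightarrow> polyfun q \<Longrightarrow> polyfun (\<lambda>x. p x + q x)"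
| pf_mult: "polyfun p \<Longrightarrow> polyfun q \<Longrightarrow> polyfun (\<lambda>x. p x * q x)"

inductive semialgebraic :: "'a::real_normed_vector set \<Rightarrow> bool" where
  sa_zero: "polyfun p \<Longrightarrow> semialgebraic {x. p x = 0}"
| sa_pos: "polyfun p \<Longrightarrow> semialgebraic {x. p x > 0}"
| sa_un: "semialgebraic S \<Longrightarrow> semialgebraic T \<Longrightarrow> semialgebraic (S \<union> T)"
| sa_int: "semialgebraic S \<Longrightarrow> semialgebraic T \<Longrightarrow> semialgebraic (S \<inter> T)"
| sa_compl: "semialgebraic S \<Longrightarrow> semialgebraic (- S)"

definition symop :: "('g::euclidean_space \<Rightarrow>\<^sub>L 'g) \<Rightarrow> bool" where
  "symop M \<longleftrightarrow> (\<forall>x y. inner (blinfun_apply M x) y = inner x (blinfun_apply M y))"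

definition optrace :: "('g::euclidean_space \<Rightarrow>\<^sub>L 'g) \<Rightarrow> real" where
  "optrace M = (\<Sum>b\<in>Basis. inner (blinfun_apply M b) b)"

definition nonneg_spectrum :: "('g::euclidean_space \<Rightarrow>\<^sub>L 'g) \<Rightarrow> bool" where
  "nonneg_spectrum M \<longleftrightarrow> (\<forall>c x. x \<noteq> 0 \<and> blinfun_apply M x = c *\<^sub>R x \<longrightarrow> c \<ge> 0)"

definition Fsp :: "('g::euclidean_space \<Rightarrow>\<^sub>L 'g) \<Rightarrow> real \<Rightarrow> 'g set" where
  "Fsp M a = span {x. \<exists>c\<le>a. blinfun_apply M x = c *\<^sub>R x}"

definition filtering :: "('g::euclidean_space \<Rightarrow> 'g \<Rightarrow> 'g) \<Rightarrow> ('g \<Rightarrow>\<^sub>L 'g) \<Rightarrow> bool" where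
  "filtering br M \<longleftrightarrow> (\<forall>a b. \<forall>x\<in>Fsp M a. \<forall>y\<in>Fsp M b. br x y \<in> Fsp M (a + b))"

definition Fplus :: "('g::euclidean_space \<Rightarrow> 'g \<Rightarrow> 'g) \<Rightarrow> ('g \<Rightarrow>\<^sub>L 'g) set" where
  "Fplus br = {M. symop M \<and> filtering br M \<and> nonneg_spectrum M \<and> optrace M = 1}"

definition chibar :: "'g::euclidean_space set \<Rightarrow> 'g \<Rightarrow>\<^sub>L 'g" where
  "chibar k = (1 / real (DIM('g) - dim k)) *\<^sub>R (id_blinfun - oproj k)"

definition Dset :: "('g::euclidean_space \<Rightarrow> 'g \<Rightarrow> 'g) \<Rightarrow> ('g \<Rightarrow>\<^sub>L 'g) set \<Rightarrow> 'g set \<Rightarrow> ('g \<Rightarrow>\<^sub>L 'g) set" where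
  "Dset br A k = (if k = UNIV then {} else
     {M. symop M \<and> nonneg_spectrum M \<and> optrace M = 1 \<and>
         (\<forall>a\<in>A. M o\<^sub>L a = a o\<^sub>L M) \<and>
         (\<forall>x\<in>k. blinfun_apply M x = 0) \<and>
         (\<forall>X\<in>k. \<forall>y. blinfun_apply M (br X y) = br X (blinfun_apply M y))})"

definition Xset :: "('g::euclidean_space \<Rightarrow> 'g \<Rightarrow> 'g) \<Rightarrow> ('g \<Rightarrow>\<^sub>L 'g) set \<Rightarrow> 'g set \<Rightarrow> ('g \<Rightarrow>\<^sub>L 'g) set" where
  "Xset br A k = Dset br A k \<inter> Fplus br"

datatype version = VerX | VerD

definition Bk :: "version \<Rightarrow> ('g::euclidean_space \<Rightarrow> 'g \<Rightarrow> 'g) \<Rightarrow> ('g \<Rightarrow>\<^sub>L 'g) set \<Rightarrow> 'g set \<Rightarrow> ('g \<Rightarrow>\<^sub>L 'g) set" where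
  "Bk v br A k = (case v of VerX \<Rightarrow> Xset br A k | VerD \<Rightarrow> Dset br A k)"

definition flag_in :: "'g set set \<Rightarrow> 'g set list \<Rightarrow> bool" where
  "flag_in S fl \<longleftrightarrow> fl \<noteq> [] \<and> sorted_wrt (\<lambda>a b. b \<subset> a) fl \<and> set fl \<subseteq> S"

definition simp_hull :: "'g::euclidean_space set list \<Rightarrow> ('g \<Rightarrow>\<^sub>L 'g) set" where
  "simp_hull chi = convex hull (chibar ` set chi)"

definition Bflag :: "version \<Rightarrow> ('g::euclidean_space \<Rightarrow> 'g \<Rightarrow> 'g) \<Rightarrow> ('g \<Rightarrow>\<^sub>L 'g) set \<Rightarrow> 'g set list \<Rightarrow> ('g \<Rightarrow>\<^sub>L 'g) set" where
  "Bflag v br A fl =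
     (if length fl = 1 then Bk v br A (hd fl)
      else if hd fl = UNIV then simp_hull (tl fl)
      else {(1 - t) *\<^sub>R M1 + t *\<^sub>R M2 | t M1 M2. t \<in> {0..1} \<and> M1 \<in> simp_hull (tl fl) \<and> M2 \<in> Bk v br A (hd fl)})"

definition simp_complex :: "'g::euclidean_space set set \<Rightarrow> ('g \<Rightarrow>\<^sub>L 'g) set" where
  "simp_complex S = (\<Union>fl\<in>{fl. flag_in S fl}. simp_hull fl)"

definition BK :: "version \<Rightarrow> ('g::euclidean_space \<Rightarrow> 'g \<Rightarrow> 'g) \<Rightarrow> ('g \<Rightarrow>\<^sub>L 'g) set \<Rightarrow> 'g set set \<Rightarrow> ('g \<Rightarrow>\<^sub>L 'g) set" where
  "BK v br A K = (\<Union>k\<in>K - {UNIV}. Bk v br A k)"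

definition IIflags :: "('g::euclidean_space \<Rightarrow> 'g \<Rightarrow> 'g) \<Rightarrow> 'g set \<Rightarrow> ('g \<Rightarrow>\<^sub>L 'g) set \<Rightarrow> 'g set list set" where
  "IIflags br h A = {fl. flag_in (Pset br h A) fl \<and> \<not> flag_in (Iset br h A) fl \<and>
                        set (tl fl) \<subseteq> Iset br h A}"

definition BII :: "version \<Rightarrow> ('g::euclidean_space \<Rightarrow> 'g \<Rightarrow> 'g) \<Rightarrow> 'g set \<Rightarrow> ('g \<Rightarrow>\<^sub>L 'g) set \<Rightarrow> ('g \<Rightarrow>\<^sub>L 'g) set" where
  "BII v br h A = (\<Union>fl\<in>IIflags br h A. Bflag v br A fl)"

definition kappa_rel :: "version \<Rightarrow> ('g::euclidean_space \<Rightarrow> 'g \<Rightarrow> 'g) \<Rightarrow> ('g \<Rightarrow>\<^sub>L 'g) set \<Rightarrow> 'g set list \<Rightarrow> ('g \<Rightarrow>\<^sub>L 'g) \<Rightarrow> real \<Rightarrow> bool" where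
  "kappa_rel v br A fl M c \<longleftrightarrow>
     (if hd fl = UNIV then c = 0
      else if length fl = 1 then c = 1
      else c \<in> {0..1} \<and> (\<exists>M1\<in>simp_hull (tl fl). \<exists>M2\<in>Bk v br A (hd fl). M = (1 - c) *\<^sub>R M1 + c *\<^sub>R M2))"

definition kappa :: "version \<Rightarrow> ('g::euclidean_space \<Rightarrow> 'g \<Rightarrow> 'g) \<Rightarrow> 'g set \<Rightarrow> ('g \<Rightarrow>\<^sub>L 'g) set \<Rightarrow> ('g \<Rightarrow>\<^sub>L 'g) \<Rightarrow> real" where
  "kappa v br h A M = (THE c. \<exists>fl\<in>IIflags br h A. M \<in> Bflag v br A fl \<and> kappa_rel v br A fl M c)"

definition Xeps :: "version \<Rightarrow> ('g::euclidean_space \<Rightarrow> 'g \<Rightarrow> 'g) \<Rightarrow> 'g set \<Rightarrow> ('g \<Rightarrow>\<^sub>L 'g) set \<Rightarrow> nat \<Rightarrow> real \<Rightarrow> ('g \<Rightarrow>\<^sub>L 'g) set" where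
  "Xeps v br h A L e = {M \<in> BII v br h A. kappa v br h A M \<ge> e ^ L}"

definition strong_deformation_retract :: "'a::topological_space set \<Rightarrow> 'a set \<Rightarrow> bool" where
  "strong_deformation_retract S X \<longleftrightarrow> S \<subseteq> X \<and>
     (\<exists>H :: real \<times> 'a \<Rightarrow> 'a. continuous_on ({0..1} \<times> X) H \<and> H ` ({0..1} \<times> X) \<subseteq> X \<and>
        (\<forall>x\<in>X. H (0, x) = x) \<and> (\<forall>x\<in>X. H (1, x) \<in> S) \<and>
        (\<forall>t\<in>{0..1}. \<forall>s\<in>S. H (t, s) = s))"

end

theory Submission
  imports Defs "HOL-Computational_Algebra.Polynomial_Factorial" "HOL-Computational_Algebra.Field_as_Ring"
    "HOL-Computational_Algebra.Fundamental_Theorem_Algebra"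
begin

text \<open>
Both $B[k]$ and the simplices are star-shaped about $\bar\chi^k$, and $B[k] \cap B[l] = B[k \vee l]$. So the
retraction is built by adding the strata of $\mathcal K$ in order of decreasing dimension $d$: the pairs $(k, M)$ with
$\dim k = d$ and $M \in B[k]$ form a bundle of cones over the compact set of such $k$, and it suffices to
retract each cone onto the union of its part already present in the earlier strata and the simplicial cone over the
link. This follows from the homotopy extension property as soon as all sets in question are absolute
neighbourhood retracts. They are compact and semialgebraic, so this is provided by a cylindrical algebraic
decomposition for the class of sets that are unions of connected components of sign strata of finitely many
polynomials. The induction needs the statement for families over a compact semialgebraic
base of positive operators $w$ that remember a flag of subalgebras already chosen.

For the second part, $\mathcal P \setminus \mathcal I$ may be replaced by $\mathcal K$ since $B$ is antitone. In a decomposition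
$A = (1-\kappa) A_1 + \kappa A_2$ the operator $(1-\kappa) A_1$ is the truncation $\min(A, m)$ for the only
number $m$ such that the eigenspaces of $A$ below $m$ span a toral subalgebra but those up to $m$ contain a nontoral
one. So it is unique, it depends continuously on $A$ by compactness, and $\kappa$ can be moved linearly to $1$.
\<close>

subsection \<open>Polynomial functions\<close>

text \<open>\<open>K\<close> may be infinite, so the homotopy extension property calls for
  semialgebraic geometry. No triangulation is used: a cell is only asked to have an absolute retract
  as closure, and closed unions of cells are glued inductively. The map from the bundle of cones to
  the space of operators is not injective, since an operator may lie in \<open>B k\<close> for
  several \<open>k\<close> of the same dimension. By the semilattice property this happens only
  where it also lies in \<open>B j\<close> for a larger \<open>j\<close> in \<open>K\<close>, hence
  in the part built before; a deformation that fixes this part descends to the image. The link of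
  \<open>k\<close> varies with \<open>k\<close>, so its retraction is needed as a statement on
  families, and the links of its members come next. Adding the projection onto the new subalgebra to
  the parameter \<open>w\<close> encodes the longer flag by a single operator again, so every stage
  of the induction concerns the same types. Subalgebras are replaced by their orthogonal
  projections, whereby inclusion, dimension and membership in \<open>B k\<close> become conditions
  on operators that are closed and definable.\<close>

lemma polyfun_sum:
  assumes "finite I" "\<And>i. i \<in> I \<Longrightarrow> polyfun (f i)"
  shows "polyfun (\<lambda>x. \<Sum>i\<in>I. f i x)"
  using assms
proof (induction I rule: finite_induct)
  case empty
  show ?case using pf_const[of 0] by simp
next
  case (insert i I)
  then have "polyfun (\<lambda>x. f i x + (\<Sum>i\<in>I. f i x))" by (intro pf_add) auto
  with insert show ?case by simp
qed

lemma polyfun_cmult: "polyfun p \<Longrightarrow> polyfun (\<lambda>x. c * p x)"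
  by (intro pf_mult pf_const)

lemma polyfun_minus: "polyfun p \<Longrightarrow> polyfun (\<lambda>x. - p x)"
  using polyfun_cmult[of p "-1"] by simp

lemma polyfun_diff: "polyfun p \<Longrightarrow> polyfun q \<Longrightarrow> polyfun (\<lambda>x. p x - q x)"
  using pf_add[OF _ polyfun_minus, of p q] by simp

lemma polyfun_continuous: "polyfun f \<Longrightarrow> continuous_on S f"
  by (induction rule: polyfun.induct)
    (auto intro: continuous_on_add continuous_on_mult linear_continuous_on)

lemma polyfun_compose:
  assumes "polyfun p" "\<And>l. bounded_linear l \<Longrightarrow> polyfun (\<lambda>x. l (g x) :: real)"
  shows "polyfun (\<lambda>x. p (g x))"
  using assms(1)
  by (induction rule: polyfun.induct) (auto intro: polyfun.intros assms(2))

text \<open>Polynomials in a further variable whose coefficients depend polynomially on a parameter.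
  The uniform degree bound is a separate demand: it does not follow from the polynomiality of the
  single coefficients.\<close>

definition polyfam :: "('a::real_normed_vector \<Rightarrow> real poly) \<Rightarrow> bool" where
  "polyfam p \<longleftrightarrow> (\<forall>i. polyfun (\<lambda>x. coeff (p x) i)) \<and> (\<exists>d. \<forall>x. degree (p x) \<le> d)"

lemma polyfam_const: "polyfam (\<lambda>x. p)"
  by (auto simp: polyfam_def pf_const)

lemma polyfam_add: 
  assumes "polyfam p" "polyfam q" shows "polyfam (\<lambda>x. p x + q x)"
proof -
  obtain d e where "\<And>x. degree (p x) \<le> d" "\<And>x. degree (q x) \<le> e"
    using assms by (auto simp: polyfam_def)
  then have "\<forall>x. degree (p x + q x) \<le> max d e"
    by (meson degree_add_le le_max_iff_disj order_trans max.cobounded1 max.cobounded2)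
  then show ?thesis using assms by (auto simp: polyfam_def intro: pf_add)
qed

lemma polyfam_mult:
  assumes "polyfam p" "polyfam q" shows "polyfam (\<lambda>x. p x * q x)"
proof -
  obtain d e where "\<And>x. degree (p x) \<le> d" "\<And>x. degree (q x) \<le> e"
    using assms by (auto simp: polyfam_def)
  then have "\<forall>x. degree (p x * q x) \<le> d + e"
    by (meson degree_mult_le add_mono order_trans)
  moreover have "polyfun (\<lambda>x. coeff (p x * q x) i)" for i
    unfolding coeff_mult using assms by (intro polyfun_sum pf_mult) (auto simp: polyfam_def)
  ultimately show ?thesis by (auto simp: polyfam_def)
qed

lemma polyfam_prod:
  assumes "finite I" "\<And>i. i \<in> I \<Longrightarrow> polyfam (p i)"
  shows "polyfam (\<lambda>x. \<Prod>i\<in>I. p i x)"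
  using assms
  by (induction I rule: finite_induct) (auto intro: polyfam_const polyfam_mult)

lemma polyfam_sum:
  assumes "finite I" "\<And>i. i \<in> I \<Longrightarrow> polyfam (p i)"
  shows "polyfam (\<lambda>x. \<Sum>i\<in>I. p i x)"
  using assms
  by (induction I rule: finite_induct) (auto intro: polyfam_const polyfam_add)

lemma polyfam_pCons0: "polyfun a \<Longrightarrow> polyfam (\<lambda>x. [:a x:])"
proof -
  assume "polyfun a"
  then have "polyfun (\<lambda>x. coeff [:a x:] i)" for i
    using pf_const[of 0] by (cases i) (auto simp: coeff_pCons)
  moreover have "\<forall>x. degree [:a x:] \<le> 0" by simp
  ultimately show ?thesis unfolding polyfam_def by blast
qed

lemma polyfam_smult:
  assumes "polyfun a" "polyfam p" shows "polyfam (\<lambda>x. smult (a x) (p x))"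
  using polyfam_mult[OF polyfam_pCons0[OF assms(1)] assms(2)] by simp

lemma polyfam_monom:
  assumes "polyfun a" shows "polyfam (\<lambda>x. monom (a x) n)"
  using polyfam_smult[OF assms polyfam_const[of "monom 1 n"]] by (simp add: smult_monom)

lemma polyfam_diff:
  assumes "polyfam p" "polyfam q" shows "polyfam (\<lambda>x. p x - q x)"
  using polyfam_add[OF assms(1) polyfam_smult[OF pf_const[of "-1"] assms(2)]] by simp

lemma polyfam_pderiv:
  assumes "polyfam p" shows "polyfam (\<lambda>x. pderiv (p x))"
proof -
  obtain d where "\<And>x. degree (p x) \<le> d" using assms by (auto simp: polyfam_def)
  then have "\<forall>x. degree (pderiv (p x)) \<le> d" by (metis degree_pderiv diff_le_self order_trans)
  moreover have "polyfun (\<lambda>x. coeff (pderiv (p x)) i)" for i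
    unfolding coeff_pderiv using assms by (intro polyfun_cmult) (auto simp: polyfam_def)
  ultimately show ?thesis by (auto simp: polyfam_def)
qed

text \<open>Restriction to lines of direction \<open>v\<close> follows the way in which
  \<open>f\<close> is built from linear functionals. The base point ranges over the whole space; a
  complement of \<open>v\<close> is chosen only later.\<close>

lemma line_polyfam:
  assumes "polyfun f"
  shows "\<exists>p. polyfam p \<and> (\<forall>x y. poly (p x) y = f (x + y *\<^sub>R v))"
  using assms
proof (induction rule: polyfun.induct)
  case (pf_const c)
  show ?case by (rule exI[of _ "\<lambda>x. [:c:]"]) (simp add: polyfam_const)
next
  case (pf_lin f)
  then interpret f: bounded_linear f .
  have "polyfam (\<lambda>x. [:f x:] + monom (f v) 1)"
    by (intro polyfam_add polyfam_pCons0 polyfam_monom polyfun.pf_lin polyfun.pf_const pf_lin)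
  moreover have "poly ([:f x:] + monom (f v) 1) y = f (x + y *\<^sub>R v)" for x y
    by (simp add: f.add f.scaleR poly_monom algebra_simps)
  ultimately show ?case by blast
next
  case (pf_add f g)
  then obtain p q where "polyfam p" "polyfam q" "\<And>x y. poly (p x) y = f (x + y *\<^sub>R v)"
    "\<And>x y. poly (q x) y = g (x + y *\<^sub>R v)" by blast
  then show ?case by (intro exI[of _ "\<lambda>x. p x + q x"]) (auto intro: polyfam_add)
next
  case (pf_mult f g)
  then obtain p q where "polyfam p" "polyfam q" "\<And>x y. poly (p x) y = f (x + y *\<^sub>R v)"
    "\<And>x y. poly (q x) y = g (x + y *\<^sub>R v)" by blast
  then show ?case by (intro exI[of _ "\<lambda>x. p x * q x"]) (auto intro: polyfam_mult)
qed

section \<open>Homogeneous components and monic directions\<close>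

inductive homog :: "nat \<Rightarrow> ('a::real_normed_vector \<Rightarrow> real) \<Rightarrow> bool" where
  homog_zero: "homog n (\<lambda>x. 0)"
| homog_const: "homog 0 (\<lambda>x. c)"
| homog_lin: "bounded_linear f \<Longrightarrow> homog 1 f"
| homog_add: "homog n p \<Longrightarrow> homog n q \<Longrightarrow> homog n (\<lambda>x. p x + q x)"
| homog_mult: "homog n p \<Longrightarrow> homog m q \<Longrightarrow> homog (n + m) (\<lambda>x. p x * q x)"

lemma homog_sum:
  assumes "finite I" "\<And>i. i \<in> I \<Longrightarrow> homog n (f i)"
  shows "homog n (\<lambda>x. \<Sum>i\<in>I. f i x)"
  using assms
proof (induction I rule: finite_induct)
  case empty
  show ?case using homog_zero by simp
next
  case (insert i I)
  then have "homog n (\<lambda>x. f i x + (\<Sum>i\<in>I. f i x))" by (intro homog_add) auto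
  with insert show ?case by simp
qed

lemma homog_imp_polyfun: "homog n f \<Longrightarrow> polyfun f"
  by (induction rule: homog.induct) (auto intro: polyfun.intros)

text \<open>Moving the base point \<open>x\<close> affects only the powers of \<open>y\<close> below
  \<open>n\<close>, so the top coefficient is the value at \<open>v\<close>. A direction with
  \<open>f v \<noteq> 0\<close> therefore gives a constant leading coefficient.\<close>

lemma homog_line_polyfam:
  assumes "homog n f"
  shows "\<exists>p. polyfam p \<and> (\<forall>x. degree (p x) \<le> n \<and> coeff (p x) n = f v) \<and>
    (\<forall>x y. poly (p x) y = f (x + y *\<^sub>R v))"
  using assms
proof (induction rule: homog.induct)
  case (homog_zero n)
  show ?case by (rule exI[of _ "\<lambda>x. 0"]) (simp add: polyfam_const)
next
  case (homog_const c)
  show ?case by (rule exI[of _ "\<lambda>x. [:c:]"]) (simp add: polyfam_const)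
next
  case (homog_lin f)
  then interpret f: bounded_linear f .
  have "polyfam (\<lambda>x. [:f x:] + monom (f v) 1)"
    by (intro polyfam_add polyfam_pCons0 polyfam_monom polyfun.pf_lin polyfun.pf_const homog_lin)
  moreover have "poly ([:f x:] + monom (f v) 1) y = f (x + y *\<^sub>R v)" for x y
    by (simp add: f.add f.scaleR poly_monom algebra_simps)
  moreover have "degree ([:f x:] + monom (f v) 1) \<le> 1" for x
    by (intro degree_add_le) (auto simp: degree_monom_le)
  moreover have "coeff ([:f x:] + monom (f v) 1) 1 = f v" for x by simp
  ultimately show ?case by blast
next
  case (homog_add n f g)
  then obtain p q where "polyfam p" "polyfam q" "\<And>x y. poly (p x) y = f (x + y *\<^sub>R v)"
    "\<And>x y. poly (q x) y = g (x + y *\<^sub>R v)" 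
    "\<And>x. degree (p x) \<le> n" "\<And>x. coeff (p x) n = f v"
    "\<And>x. degree (q x) \<le> n" "\<And>x. coeff (q x) n = g v" by blast
  then show ?case by (intro exI[of _ "\<lambda>x. p x + q x"]) (auto intro: polyfam_add degree_add_le)
next
  case (homog_mult n f m g)
  then obtain p q where "polyfam p" "polyfam q" "\<And>x y. poly (p x) y = f (x + y *\<^sub>R v)"
    "\<And>x y. poly (q x) y = g (x + y *\<^sub>R v)" and
    d: "\<And>x. degree (p x) \<le> n" "\<And>x. coeff (p x) n = f v"
    "\<And>x. degree (q x) \<le> m" "\<And>x. coeff (q x) m = g v" by blast
  moreover have "degree (p x * q x) \<le> n + m" for x
    using d by (meson degree_mult_le add_mono order_trans)
  moreover have "coeff (p x * q x) (n + m) = f v * g v" for x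
  proof -
    have "coeff (p x * q x) (n + m) = (\<Sum>i\<le>n + m. coeff (p x) i * coeff (q x) (n + m - i))"
      by (simp add: coeff_mult)
    \<comment> \<open>By the two degree bounds an index below \<open>n\<close> kills the second
      factor and one above \<open>n\<close> the first.\<close>
    also have "\<dots> = (\<Sum>i\<in>{n}. coeff (p x) i * coeff (q x) (n + m - i))"
    proof (rule sum.mono_neutral_right)
      show "\<forall>i\<in>{..n + m} - {n}. coeff (p x) i * coeff (q x) (n + m - i) = 0"
      proof
        fix i assume i: "i \<in> {..n + m} - {n}"
        show "coeff (p x) i * coeff (q x) (n + m - i) = 0"
        proof (cases "i < n")
          case True
          then have "degree (q x) < n + m - i" using d(3)[of x] by linarith
          then show ?thesis by (simp add: coeff_eq_0)
        next
          case False
          then have "degree (p x) < i" using i d(1)[of x] by auto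
          then show ?thesis by (simp add: coeff_eq_0)
        qed
      qed
    qed auto
    finally show ?thesis using d by simp
  qed
  ultimately show ?case by (intro exI[of _ "\<lambda>x. p x * q x"]) (auto intro: polyfam_mult)
qed

text \<open>The components are stored as the coefficients of \<open>f (s *\<^sub>R x)\<close>, seen
  as a polynomial in the scaling variable \<open>s\<close>, so that products of functions become
  products of polynomials. Evaluation at \<open>1\<close> gives back \<open>f\<close>.\<close>

lemma polyfun_homog_decomposition:
  assumes "polyfun f"
  shows "\<exists>p. (\<forall>i. homog i (\<lambda>x. coeff (p x) i)) \<and> (\<exists>d. \<forall>x. degree (p x) \<le> d) \<and> (\<forall>x. f x = poly (p x) 1)"
  using assms
proof (induction rule: polyfun.induct)
  case (pf_const c)
  show ?case
    by (rule exI[of _ "\<lambda>x. [:c:]"]) (auto simp: coeff_pCons intro: homog.intros split: nat.split)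
next
  case (pf_lin f)
  have "homog i (\<lambda>x. coeff [:0, f x:] i)" for i
    using homog_lin[OF pf_lin] homog_zero
    by (cases i; cases "i - 1") (auto simp: coeff_pCons split: nat.split)
  moreover have "\<forall>x. degree [:0, f x:] \<le> 1" by simp
  ultimately show ?case by (intro exI[of _ "\<lambda>x. [:0, f x:]"]) auto
next
  case (pf_add f g)
  then obtain p q d e where *: "\<And>i. homog i (\<lambda>x. coeff (p x) i)" "\<And>x. degree (p x) \<le> d"
     "\<And>x. f x = poly (p x) 1" "\<And>i. homog i (\<lambda>x. coeff (q x) i)" "\<And>x. degree (q x) \<le> e" 
     "\<And>x. g x = poly (q x) 1" by blast
  then have "\<forall>x. degree (p x + q x) \<le> max d e"
    by (meson degree_add_le le_max_iff_disj order_trans max.cobounded1 max.cobounded2)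
  then show ?case using * by (intro exI[of _ "\<lambda>x. p x + q x"]) (auto intro: homog_add)
next
  case (pf_mult f g)
  then obtain p q d e where *: "\<And>i. homog i (\<lambda>x. coeff (p x) i)" "\<And>x. degree (p x) \<le> d"
     "\<And>x. f x = poly (p x) 1" "\<And>i. homog i (\<lambda>x. coeff (q x) i)" "\<And>x. degree (q x) \<le> e" 
     "\<And>x. g x = poly (q x) 1" by blast
  then have "\<forall>x. degree (p x * q x) \<le> d + e"
    by (meson degree_mult_le add_mono order_trans)
  moreover have "homog n (\<lambda>x. coeff (p x * q x) n)" for n
    unfolding coeff_mult
  proof (rule homog_sum)
    show "homog n (\<lambda>x. coeff (p x) i * coeff (q x) (n - i))" if "i \<in> {..n}" for i
      using homog_mult[OF *(1)[of i] *(4)[of "n - i"]] that by simp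
  qed auto
  ultimately show ?case using * by (intro exI[of _ "\<lambda>x. p x * q x"]) auto
qed

text \<open>By induction some \<open>v\<close> is good for all of \<open>H\<close>, and some
  \<open>w\<close> for the new function. On the line through both, every function is a nonzero
  polynomial in \<open>t\<close>, so only finitely many \<open>t\<close> are excluded.\<close>

lemma polyfun_common_nonzero:
  assumes "subspace V" "finite H" "\<And>h. h \<in> H \<Longrightarrow> polyfun h" "\<And>h. h \<in> H \<Longrightarrow> \<exists>x\<in>V. h x \<noteq> 0"
  shows "\<exists>v\<in>V. \<forall>h\<in>H. h v \<noteq> 0"
  using assms(2,3,4)
proof (induction H rule: finite_induct)
  case empty
  show ?case using subspace_0[OF assms(1)] by auto
next
  case (insert h H)
  then obtain v where v: "v \<in> V" "\<forall>h\<in>H. h v \<noteq> 0" by auto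
  obtain w where w: "w \<in> V" "h w \<noteq> 0" using insert.prems(2)[of h] by auto
  have "finite {t. k (v + t *\<^sub>R (w - v)) = 0}" if k: "k \<in> insert h H" for k
  proof -
    obtain p where p: "\<And>x y. poly (p x) y = k (x + y *\<^sub>R (w - v))"
      using line_polyfam[of k "w - v"] insert.prems(1)[OF k] by blast
    have "poly (p v) (if k \<in> H then 0 else 1) \<noteq> 0"
      using k v w by (auto simp: p)
    then have "p v \<noteq> 0" by auto
    then show ?thesis using poly_roots_finite[of "p v"] by (simp add: p)
  qed
  then have "finite (\<Union>k\<in>insert h H. {t. k (v + t *\<^sub>R (w - v)) = 0})"
    using insert.hyps by blast
  then obtain t where "t \<notin> (\<Union>k\<in>insert h H. {t. k (v + t *\<^sub>R (w - v)) = 0})"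
    using ex_new_if_finite[OF infinite_UNIV_char_0] by metis
  then have "\<forall>k\<in>insert h H. k (v + t *\<^sub>R (w - v)) \<noteq> 0" by auto
  moreover have "v + t *\<^sub>R (w - v) \<in> V"
    using assms(1) v w by (intro subspace_add subspace_scale subspace_diff) auto
  ultimately show ?case by blast
qed

text \<open>A weak form of Noether normalisation: \<open>v\<close> avoids the zeros of the top
  homogeneous component of every \<open>f\<close>. Constant degree and leading coefficient keep
  roots bounded and let them be followed to boundary points.\<close>

lemma monic_direction:
  fixes V :: "'a::real_normed_vector set"
  assumes V: "subspace V" and F: "finite F" "\<And>f. f \<in> F \<Longrightarrow> polyfun f"
    and nz: "\<And>f. f \<in> F \<Longrightarrow> \<exists>x\<in>V. f x \<noteq> 0"
  shows "\<exists>v\<in>V. \<forall>f\<in>F. \<exists>p n c. polyfam p \<and> c \<noteq> 0 \<and>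
    (\<forall>x\<in>V. degree (p x) = n \<and> coeff (p x) n = c \<and> (\<forall>y. poly (p x) y = f (x + y *\<^sub>R v)))"
proof -
  have "\<exists>h n. homog n (h n) \<and> (\<exists>x\<in>V. h n x \<noteq> 0) \<and> (\<forall>i. homog i (h i)) \<and> (\<forall>x\<in>V. f x = (\<Sum>i\<le>n. h i x))"
    if "f \<in> F" for f
  proof -
    obtain p d where p: "\<And>i. homog i (\<lambda>x. coeff (p x) i)" "\<And>x. degree (p x) \<le> d" "\<And>x. f x = poly (p x) 1"
      using polyfun_homog_decomposition[OF F(2)[OF \<open>f \<in> F\<close>]] by metis
    have f_eq: "f x = (\<Sum>i\<le>d. coeff (p x) i)" for x
    proof -
      have "f x = (\<Sum>i\<le>degree (p x). coeff (p x) i)" by (simp add: p(3) poly_altdef)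
      also have "\<dots> = (\<Sum>i\<le>d. coeff (p x) i)"
        using p(2)[of x] by (intro sum.mono_neutral_left) (auto intro: coeff_eq_0)
      finally show ?thesis .
    qed
    \<comment> \<open>The top degree is taken relative to \<open>V\<close>: a higher component may
      be nonzero on the whole space and vanish on \<open>V\<close>, so \<open>f\<close> is only
      recovered on \<open>V\<close>.\<close>
    define n where "n = (GREATEST i. i \<le> d \<and> (\<exists>x\<in>V. coeff (p x) i \<noteq> 0))"
    have ex: "\<exists>i. i \<le> d \<and> (\<exists>x\<in>V. coeff (p x) i \<noteq> 0)"
    proof (rule ccontr)
      assume "\<not> ?thesis"
      then have "f x = 0" if "x \<in> V" for x using that by (auto simp: f_eq intro!: sum.neutral)
      then show False using nz \<open>f \<in> F\<close> by blast
    qed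
    have n: "n \<le> d \<and> (\<exists>x\<in>V. coeff (p x) n \<noteq> 0)"
      unfolding n_def using GreatestI_ex_nat[OF ex, of d] by blast
    have z: "coeff (p x) i = 0" if "i \<le> d" "n < i" "x \<in> V" for i x
      using Greatest_le_nat[of "\<lambda>i. i \<le> d \<and> (\<exists>x\<in>V. coeff (p x) i \<noteq> 0)" i d] that
      unfolding n_def by force
    have "f x = (\<Sum>i\<le>n. coeff (p x) i)" if "x \<in> V" for x
      unfolding f_eq using n z[OF _ _ that] by (intro sum.mono_neutral_right) auto
    then show ?thesis using n p(1) by (intro exI[of _ "\<lambda>i x. coeff (p x) i"] exI[of _ n]) auto
  qed
  then obtain h n where h: "\<And>f. f \<in> F \<Longrightarrow> \<exists>x\<in>V. h f (n f) x \<noteq> 0" "\<And>f i. f \<in> F \<Longrightarrow> homog i (h f i)"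
    "\<And>f x. f \<in> F \<Longrightarrow> x \<in> V \<Longrightarrow> f x = (\<Sum>i\<le>n f. h f i x)" by metis
  obtain v where v: "v \<in> V" "\<forall>f\<in>F. h f (n f) v \<noteq> 0"
    using polyfun_common_nonzero[OF V, of "(\<lambda>f. h f (n f)) ` F"] F(1) h(1) homog_imp_polyfun[OF h(2)]
    by auto
  have "\<exists>p n c. polyfam p \<and> c \<noteq> 0 \<and>
    (\<forall>x\<in>V. degree (p x) = n \<and> coeff (p x) n = c \<and> (\<forall>y. poly (p x) y = f (x + y *\<^sub>R v)))" if f: "f \<in> F" for f
  proof -
    have "\<forall>i. \<exists>p. polyfam p \<and> (\<forall>x. degree (p x) \<le> i \<and> coeff (p x) i = h f i v) \<and>
       (\<forall>x y. poly (p x) y = h f i (x + y *\<^sub>R v))"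
      using homog_line_polyfam[OF h(2)[OF f]] by blast
    then obtain q where q: "\<And>i. polyfam (q i)" "\<And>i x. degree (q i x) \<le> i" "\<And>i x. coeff (q i x) i = h f i v"
      "\<And>i x y. poly (q i x) y = h f i (x + y *\<^sub>R v)" by metis
    define p where "p x = (\<Sum>i\<le>n f. q i x)" for x
    have "polyfam p" unfolding p_def by (intro polyfam_sum q) auto
    moreover have "coeff (p x) (n f) = h f (n f) v" for x
    proof -
      have "coeff (p x) (n f) = (\<Sum>i\<in>{n f}. coeff (q i x) (n f))"
        unfolding p_def coeff_sum
        by (rule sum.mono_neutral_right) (use q(2) in \<open>auto intro!: coeff_eq_0 le_less_trans[OF q(2)]\<close>)
      then show ?thesis by (simp add: q)
    qed
    moreover have "degree (p x) \<le> n f" for x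
      unfolding p_def by (intro degree_sum_le) (auto intro: order_trans[OF q(2)])
    moreover have "degree (p x) = n f" if "coeff (p x) (n f) \<noteq> 0" "degree (p x) \<le> n f" for x
      using that le_degree[of "p x" "n f"] by auto
    moreover have "poly (p x) y = f (x + y *\<^sub>R v)" if "x \<in> V" for x y
    proof -
      have "x + y *\<^sub>R v \<in> V" using V v that by (intro subspace_add subspace_scale) auto
      then show ?thesis using h(3)[OF f] by (simp add: p_def poly_sum q)
    qed
    ultimately show ?thesis using v f by (intro exI[of _ p] exI[of _ "n f"] exI[of _ "h f (n f) v"]) auto
  qed
  then show ?thesis using v(1) by blast
qed

subsection \<open>Counting distinct complex roots\<close>

lemma degree_normalize_eq: "degree (normalize p) = degree (p :: real poly)"
proof (cases "p = 0")
  case False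
  then have "degree (normalize p) \<le> degree p" "degree p \<le> degree (normalize p)"
    by (auto intro!: dvd_imp_degree_le)
  then show ?thesis by simp
qed simp

text \<open>One step of pseudo-division at a time, so that only vanishing of polynomial functions of the
  parameter matters.\<close>

lemma degree_gcd_vanishing_pattern:
  fixes p q :: "'a::real_normed_vector \<Rightarrow> real poly"
  assumes "polyfam p" "polyfam q" "\<And>x. degree (p x) \<le> n" "\<And>x. degree (q x) \<le> m"
  shows "\<exists>T. finite T \<and> (\<forall>t\<in>T. polyfun t) \<and>
    (\<forall>x x'. (\<forall>t\<in>T. t x = 0 \<longleftrightarrow> t x' = 0) \<longrightarrow> degree (gcd (p x) (q x)) = degree (gcd (p x') (q x')))"
  using assms
proof (induction "n + m" arbitrary: n m p q rule: less_induct)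
  case less
  have main: "\<exists>T. finite T \<and> (\<forall>t\<in>T. polyfun t) \<and>
    (\<forall>x x'. (\<forall>t\<in>T. t x = 0 \<longleftrightarrow> t x' = 0) \<longrightarrow> degree (gcd (p x) (q x)) = degree (gcd (p x') (q x')))"
    if fam: "polyfam p" "polyfam q" and dp: "\<And>x. degree (p x) \<le> n'" and dq: "\<And>x. degree (q x) \<le> m'" 
      and nm: "n' + m' = n + m" and le: "m' \<le> n'"
    for p q :: "'a \<Rightarrow> real poly" and n' m'
  proof (cases "m' = 0")
    case True
    \<comment> \<open>With \<open>q\<close> constant, the gcd is a unit, or \<open>p\<close> up to a
      unit if the constant vanishes; the degree of \<open>p\<close> is read off from the vanishing
      of its coefficients.\<close>
    define T where "T = insert (\<lambda>x. coeff (q x) 0) ((\<lambda>i x. coeff (p x) i) ` {..n'})"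
    have "degree (gcd (p x) (q x)) = degree (gcd (p x') (q x'))"
      if eq: "\<forall>t\<in>T. t x = 0 \<longleftrightarrow> t x' = 0" for x x'
    proof (cases "coeff (q x) 0 = 0")
      case True
      then have "coeff (q x') 0 = 0" using eq by (simp add: T_def)
      with True have "q x = 0" "q x' = 0" using dq[of x] dq[of x'] \<open>m' = 0\<close>
        by (metis le_zero_eq leading_coeff_0_iff)+
      moreover have "\<forall>i. coeff (p x) i = 0 \<longleftrightarrow> coeff (p x') i = 0"
      proof
        fix i show "coeff (p x) i = 0 \<longleftrightarrow> coeff (p x') i = 0"
          using eq dp[of x] dp[of x'] by (cases "i \<le> n'") (auto simp: T_def coeff_eq_0)
      qed
      then have "degree (p x) = degree (p x')"
        unfolding degree_def by simp
      ultimately show ?thesis by (simp add: degree_normalize_eq)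
    next
      case False
      then have "coeff (q x') 0 \<noteq> 0" using eq by (simp add: T_def)
      then have "q x \<noteq> 0" "q x' \<noteq> 0" using False by auto
      then have "is_unit (q x)" "is_unit (q x')" using dq[of x] dq[of x'] \<open>m' = 0\<close>
        by (auto simp: is_unit_iff_degree)
      then have "gcd (p x) (q x) = 1" "gcd (p x') (q x') = 1" by (simp_all add: is_unit_right_imp_coprime flip: coprime_iff_gcd_eq_1)
      then show ?thesis by simp
    qed
    moreover have "finite T" "\<forall>t\<in>T. polyfun t" using fam by (auto simp: T_def polyfam_def)
    ultimately show ?thesis by blast
  next
    case False
    \<comment> \<open>\<open>b\<close> is the coefficient of \<open>q\<close> at the degree bound
      \<open>m'\<close>. Where it vanishes, \<open>q\<close> equals the truncation
      \<open>q'\<close>, which has a smaller bound; elsewhere it is a unit, and \<open>p'\<close>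
      cancels the top term of \<open>p\<close> without changing the gcd with
      \<open>q\<close>.\<close>
    define b where "b x = coeff (q x) m'" for x
    define q' where "q' x = q x - monom (b x) m'" for x
    define p' where "p' x = smult (b x) (p x) - monom (coeff (p x) n') (n' - m') * q x" for x
    have b: "polyfun b" using fam unfolding b_def[abs_def] by (simp add: polyfam_def)
    have c: "polyfun (\<lambda>x. coeff (p x) n')" using fam by (simp add: polyfam_def)
    have fam': "polyfam q'" "polyfam p'" unfolding p'_def[abs_def] q'_def[abs_def]
      by (intro polyfam_diff polyfam_smult polyfam_mult polyfam_monom fam b c)+
    have dq': "degree (q' x) \<le> m' - 1" for x
    proof (rule degree_le, intro allI impI)
      fix i assume "m' - 1 < i"
      then show "coeff (q' x) i = 0" using dq[of x]
        by (cases "i = m'") (auto simp: q'_def b_def intro: coeff_eq_0)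
    qed
    have dp': "degree (p' x) \<le> n' - 1" for x
    proof (rule degree_le, intro allI impI)
      fix i assume i: "n' - 1 < i"
      have c: "coeff (monom (coeff (p x) n') (n' - m') * q x) i = coeff (p x) n' * coeff (q x) (i - (n' - m'))"
        using i le False by (simp add: coeff_monom_mult)
      show "coeff (p' x) i = 0"
      proof (cases "i = n'")
        case True
        then show ?thesis using le by (simp add: p'_def c[simplified True] b_def)
      next
        case False
        with i have "n' < i" by simp
        then have "coeff (p x) i = 0" "coeff (q x) (i - (n' - m')) = 0" using dp[of x] dq[of x] le
          by (auto intro!: coeff_eq_0)
        then show ?thesis by (simp add: p'_def c)
      qed
    qed
    have lt: "n' + (m' - 1) < n + m" "n' - 1 + m' < n + m" using nm False le by linarith+
    obtain T1 where T1: "finite T1" "\<forall>t\<in>T1. polyfun t" 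
      "\<And>x x'. (\<forall>t\<in>T1. t x = 0 \<longleftrightarrow> t x' = 0) \<Longrightarrow> degree (gcd (p x) (q' x)) = degree (gcd (p x') (q' x'))"
      using less.hyps[OF lt(1) fam(1) fam'(1) dp dq'] by metis
    obtain T2 where T2: "finite T2" "\<forall>t\<in>T2. polyfun t" 
      "\<And>x x'. (\<forall>t\<in>T2. t x = 0 \<longleftrightarrow> t x' = 0) \<Longrightarrow> degree (gcd (p' x) (q x)) = degree (gcd (p' x') (q x'))"
      using less.hyps[OF lt(2) fam'(2) fam(2) dp' dq] by metis
    have red: "gcd (p x) (q x) = gcd (p' x) (q x)" if "b x \<noteq> 0" for x
    proof -
      have "gcd (p' x) (q x) = gcd (q x) (smult (b x) (p x))"
        using gcd_add_mult[of "q x" "- monom (coeff (p x) n') (n' - m')" "smult (b x) (p x)"]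
        by (simp add: p'_def gcd.commute)
      also have "smult (b x) (p x) = p x * [:b x:]" by simp
      also have "gcd (q x) (p x * [:b x:]) = gcd (q x) (p x)"
        using that by (intro gcd_mult_unit2) (auto simp: is_unit_pCons_iff dvd_field_iff)
      finally show ?thesis by (simp add: gcd.commute)
    qed
    have "degree (gcd (p x) (q x)) = degree (gcd (p x') (q x'))"
      if eq: "\<forall>t\<in>insert b (T1 \<union> T2). t x = 0 \<longleftrightarrow> t x' = 0" for x x'
    proof (cases "b x = 0")
      case True
      then have "b x' = 0" using eq by simp
      then have "q' x = q x" "q' x' = q x'" using True by (auto simp: q'_def)
      then show ?thesis using T1(3)[of x x'] eq by simp
    next
      case False
      then have "b x' \<noteq> 0" using eq by simp
      then show ?thesis using T2(3)[of x x'] eq False by (simp add: red)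
    qed
    then show ?thesis using T1 T2 b by (intro exI[of _ "insert b (T1 \<union> T2)"]) auto
  qed
  show ?case
  proof (cases "m \<le> n")
    case True
    then show ?thesis using main[OF less.prems] by blast
  next
    case False
    then show ?thesis using main[OF less.prems(2,1,4,3)] by (simp add: gcd.commute add.commute)
  qed
qed

definition cpoly :: "real poly \<Rightarrow> complex poly" where "cpoly = map_poly complex_of_real"

lemma coeff_cpoly [simp]: "coeff (cpoly p) i = complex_of_real (coeff p i)"
  by (simp add: cpoly_def coeff_map_poly)

lemma cpoly_add: "cpoly (p + q) = cpoly p + cpoly q"
  and cpoly_mult: "cpoly (p * q) = cpoly p * cpoly q"
  and cpoly_pderiv: "cpoly (pderiv p) = pderiv (cpoly p)"
  by (auto simp: poly_eq_iff coeff_mult coeff_pderiv)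

lemma degree_cpoly [simp]: "degree (cpoly p) = degree p"
  by (simp add: cpoly_def degree_map_poly)

lemma cpoly_eq_0_iff [simp]: "cpoly p = 0 \<longleftrightarrow> p = 0"
  by (auto simp: poly_eq_iff)

lemma poly_cpoly_of_real [simp]: "poly (cpoly p) (complex_of_real y) = complex_of_real (poly p y)"
  by (simp add: poly_altdef)

lemma poly_cpoly_cnj: "poly (cpoly p) (cnj z) = cnj (poly (cpoly p) z)"
  by (simp add: poly_altdef)

text \<open>The roots with multiplicity form a multiset with \<open>degree q\<close> elements, and
  square-freeness says that every multiplicity in it is at most one.\<close>

lemma card_roots_rsquarefree:
  fixes q :: "complex poly"
  assumes "rsquarefree q"
  shows "card {z. poly q z = 0} = degree q"
proof -
  have q0: "q \<noteq> 0" using assms by (simp add: rsquarefree_def)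
  obtain A where A: "size A = degree q" "q = smult (lead_coeff q) (\<Prod>x\<in>#A. [:-x, 1:])"
    using alg_closed_imp_factorization[OF q0] by blast
  have "order z q = count A z" for z
  proof -
    have "order z q = order z (\<Prod>x\<in>#A. [:-x, 1:])"
      using A(2) q0 by (metis leading_coeff_0_iff order_smult)
    also have "\<dots> = count A z"
    proof (induction A)
      case empty
      then show ?case by (simp add: order_0I)
    next
      case (add x A)
      have "[:-x, 1:] * (\<Prod>x\<in>#A. [:-x, 1:]) \<noteq> 0"
        by (simp only: mult_eq_0_iff prod_mset_zero_iff) auto
      then have "order z ([:-x, 1:] * (\<Prod>x\<in>#A. [:-x, 1:])) = order z [:-x, 1:] + order z (\<Prod>x\<in>#A. [:-x, 1:])"
        by (rule order_mult)
      also have "order z [:-x, 1:] = (if x = z then 1 else 0)"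
        using order_power_n_n[of z 1] by (auto simp: order_0I)
      finally show ?case using add by simp
    qed
    finally show ?thesis .
  qed
  then have c: "count A z \<le> 1" for z
    using assms by (metis rsquarefree_def le_numeral_extra(4) zero_le_one)
  have "set_mset A = {z. poly q z = 0}"
  proof -
    have "poly q z = 0 \<longleftrightarrow> z \<in># A" for z
      using \<open>order z q = count A z\<close> q0 order_root[of q z] by (metis count_eq_zero_iff)
    then show ?thesis by auto
  qed
  moreover have "size A = card (set_mset A)"
  proof -
    have "(\<Sum>z\<in>set_mset A. count A z) = (\<Sum>z\<in>set_mset A. 1)"
    proof (rule sum.cong)
      fix z assume "z \<in># A"
      then have "count A z > 0" by simp
      with c[of z] show "count A z = 1" by linarith
    qed simp
    then show ?thesis by (simp add: size_multiset_overloaded_eq)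
  qed
  ultimately show ?thesis using A by simp
qed

text \<open>Dividing \<open>p\<close> by its gcd with the derivative leaves the same complex roots,
  all of them simple. The count is thus given by two degrees, and these are controlled by vanishing
  patterns of polynomial functions of the parameter.\<close>

lemma card_complex_roots:
  assumes "p \<noteq> 0"
  shows "card {z. poly (cpoly p) z = 0} = degree p - degree (gcd p (pderiv p))"
proof (cases "pderiv p = 0")
  case True
  then have "degree p = 0" by (simp add: pderiv_eq_0_iff)
  then obtain c where "p = [:c:]" by (metis degree_eq_zeroE)
  with assms have "poly (cpoly p) z \<noteq> 0" for z
    by (simp add: poly_altdef)
  then show ?thesis using \<open>degree p = 0\<close> by simp
next
  case False
  define d where "d = gcd p (pderiv p)"
  obtain q e where q: "p = q * d" "pderiv p = e * d"
    unfolding d_def by (metis dvd_def gcd_dvd1 gcd_dvd2 mult.commute)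
  \<comment> \<open>A Bezout identity over the reals remains valid over the complex numbers; this
    saves comparing the real gcd with a complex one.\<close>
  obtain r s where rs: "d = r * p + s * pderiv p"
    unfolding d_def by (metis bezout_coefficients_fst_snd)
  have "rsquarefree (cpoly q) \<and> (\<forall>a. poly (cpoly q) a = 0 \<longleftrightarrow> poly (cpoly p) a = 0)"
  proof (rule poly_squarefree_decomp)
    show "pderiv (cpoly p) \<noteq> 0" using False by (simp flip: cpoly_pderiv)
    show "cpoly p = cpoly q * cpoly d" using q by (metis cpoly_mult)
    show "pderiv (cpoly p) = cpoly e * cpoly d" using q by (metis cpoly_mult cpoly_pderiv)
    show "cpoly d = cpoly r * cpoly p + cpoly s * pderiv (cpoly p)"
      using rs by (metis cpoly_mult cpoly_pderiv cpoly_add)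
  qed
  then have "card {z. poly (cpoly p) z = 0} = degree q"
    using card_roots_rsquarefree[of "cpoly q"] by simp
  moreover have "degree p = degree q + degree d"
    using q(1) assms by (metis degree_mult_eq mult_eq_0_iff)
  ultimately show ?thesis by (simp add: d_def)
qed

subsection \<open>Continuity of roots and delineation\<close>

text \<open>Bolzano-Weierstrass, one coordinate after the other. Tuples are functions on the indices
  below \<open>d\<close>, which serves root vectors and eigenbases alike.\<close>

lemma tuple_convergent_subseq:
  fixes z :: "nat \<Rightarrow> nat \<Rightarrow> 'a::metric_space"
  assumes "\<And>i. i < d \<Longrightarrow> \<exists>C. compact C \<and> (\<forall>n. z n i \<in> C)"
  shows "\<exists>s l. strict_mono s \<and> (\<forall>i<d. (\<lambda>n. z (s n) i) \<longlonglongrightarrow> l i)"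
  using assms
proof (induction d)
  case 0
  show ?case by (rule exI[of _ id]) (auto simp: strict_mono_def)
next
  case (Suc d)
  then obtain s l where s: "strict_mono s" "\<And>i. i < d \<Longrightarrow> (\<lambda>n. z (s n) i) \<longlonglongrightarrow> l i"
    by (metis less_SucI)
  obtain C where C: "compact C" "\<forall>n. z n d \<in> C" using Suc.prems by blast
  then have "\<forall>n. z (s n) d \<in> C" by simp
  then obtain m r where r: "strict_mono r" "((\<lambda>n. z (s n) d) \<circ> r) \<longlonglongrightarrow> m"
    using seq_compactE[OF compact_imp_seq_compact[OF C(1)], of "\<lambda>n. z (s n) d"] by metis
  have "(\<lambda>n. z ((s \<circ> r) n) i) \<longlonglongrightarrow> (if i < d then l i else m)" if "i < Suc d" for i
    using that s(2)[of i, THEN LIMSEQ_subseq_LIMSEQ, OF _ r(1)] r(2)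
    by (cases "i = d") (auto simp: o_def)
  then have "\<forall>i<Suc d. (\<lambda>n. z ((s \<circ> r) n) i) \<longlonglongrightarrow> (if i < d then l i else m)" by simp
  moreover have "strict_mono (s \<circ> r)" using s(1) r(1) by (rule strict_mono_o)
  ultimately show ?case by (intro exI[of _ "s \<circ> r"] exI[of _ "\<lambda>i. if i < d then l i else m"]) (simp add: o_def)
qed

text \<open>If continuity failed at \<open>a\<close>, some sequence of values would keep a distance
  \<open>e\<close> from \<open>f a\<close>, and no subsequence of it could converge to
  \<open>f a\<close>. Continuity proofs by compactness naturally produce such subsequences.\<close>

lemma continuous_on_subseqI:
  fixes f :: "'a::metric_space \<Rightarrow> 'b::metric_space"
  assumes "\<And>x a. a \<in> C \<Longrightarrow> (\<And>n. x n \<in> C) \<Longrightarrow> x \<longlonglongrightarrow> a \<Longrightarrow>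
    \<exists>s::nat \<Rightarrow> nat. strict_mono s \<and> (\<lambda>n. f (x (s n))) \<longlonglongrightarrow> f a"
  shows "continuous_on C f"
  unfolding continuous_on_sequentially
proof (intro allI ballI impI, elim conjE)
  fix x a assume x: "a \<in> C" "\<forall>n. x n \<in> C" "x \<longlonglongrightarrow> a"
  show "(f \<circ> x) \<longlonglongrightarrow> f a"
  proof (rule ccontr)
    assume "\<not> ?thesis"
    then obtain e where e: "e > 0" "\<not> eventually (\<lambda>n. dist (f (x n)) (f a) < e) sequentially"
      unfolding tendsto_iff by auto
    then obtain r :: "nat \<Rightarrow> nat" where r: "strict_mono r" "\<And>n. \<not> dist (f (x (r n))) (f a) < e"
      using not_eventually_sequentiallyD by blast
    obtain s :: "nat \<Rightarrow> nat" where "strict_mono s" "(\<lambda>n. f ((x \<circ> r) (s n))) \<longlonglongrightarrow> f a"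
      using assms[of a "x \<circ> r"] x r(1) LIMSEQ_subseq_LIMSEQ[OF x(3) r(1)] by auto
    then have "eventually (\<lambda>n. dist (f (x (r (s n)))) (f a) < e) sequentially"
      using e(1) unfolding tendsto_iff by auto
    then show False using r(2) by (auto simp: eventually_sequentially)
  qed
qed

text \<open>Cauchy's bound. It confines roots to a compact set when the coefficients converge and
  the leading one has a nonzero limit.\<close>

lemma poly_root_bound:
  fixes p :: "'a::{real_normed_field,idom} poly"
  assumes "p \<noteq> 0" "poly p z = 0"
  shows "norm z \<le> 1 + (\<Sum>i<degree p. norm (coeff p i)) / norm (lead_coeff p)"
proof (cases "norm z \<le> 1")
  case True
  have "0 \<le> (\<Sum>i<degree p. norm (coeff p i)) / norm (lead_coeff p)" by (intro divide_nonneg_nonneg sum_nonneg) auto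
  with True show ?thesis by linarith
next
  case False
  define n where "n = degree p"
  have "n \<noteq> 0"
  proof
    assume "n = 0"
    then obtain c where "p = [:c:]" unfolding n_def by (metis degree_eq_zeroE)
    with assms show False by simp
  qed
  have "0 = (\<Sum>i\<le>n. coeff p i * z ^ i)" using assms by (simp add: poly_altdef n_def)
  also have "\<dots> = (\<Sum>i<n. coeff p i * z ^ i) + coeff p n * z ^ n"
    by (simp add: lessThan_Suc_atMost[symmetric])
  finally have "(\<Sum>i<n. coeff p i * z ^ i) + coeff p n * z ^ n = 0" by (rule sym)
  then have "coeff p n * z ^ n = - (\<Sum>i<n. coeff p i * z ^ i)"
    by (simp add: eq_neg_iff_add_eq_0 add.commute)
  then have "norm (coeff p n) * norm z ^ n = norm (\<Sum>i<n. coeff p i * z ^ i)"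
    using norm_mult[of "coeff p n" "z ^ n"] by (simp add: norm_power)
  also have "\<dots> \<le> (\<Sum>i<n. norm (coeff p i) * norm z ^ i)"
    by (rule order_trans[OF norm_sum]) (simp add: norm_mult norm_power)
  also have "\<dots> \<le> (\<Sum>i<n. norm (coeff p i) * norm z ^ (n - 1))"
    using False by (intro sum_mono mult_left_mono power_increasing) auto
  also have "\<dots> = (\<Sum>i<n. norm (coeff p i)) * norm z ^ (n - 1)" by (simp add: sum_distrib_right)
  finally have "(norm (coeff p n) * norm z) * norm z ^ (n - 1) \<le> (\<Sum>i<n. norm (coeff p i)) * norm z ^ (n - 1)"
    using \<open>n \<noteq> 0\<close> by (metis mult.assoc power_eq_if)
  then have "norm (coeff p n) * norm z \<le> (\<Sum>i<n. norm (coeff p i))"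
  proof (rule mult_right_le_imp_le)
    show "0 < norm z ^ (n - 1)" using False by (intro zero_less_power) linarith
  qed
  moreover have "norm (coeff p n) > 0" using assms(1) by (simp add: n_def)
  ultimately have "norm z \<le> (\<Sum>i<n. norm (coeff p i)) / norm (coeff p n)"
    by (simp add: field_simps)
  then show ?thesis by (simp add: n_def)
qed

lemma complex_root_vector:
  assumes "q \<noteq> 0"
  shows "\<exists>z::nat \<Rightarrow> complex. \<forall>w. poly q w = lead_coeff q * (\<Prod>i<degree q. w - z i)"
proof -
  obtain A where A: "size A = degree q" "q = smult (lead_coeff q) (\<Prod>x\<in>#A. [:-x, 1:])"
    using alg_closed_imp_factorization[OF assms] by blast
  obtain xs where xs: "mset xs = A" by (metis ex_mset)
  have "poly q w = lead_coeff q * (\<Prod>i<degree q. w - xs ! i)" for w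
  proof -
    have "poly q w = lead_coeff q * poly (\<Prod>x\<in>#A. [:-x, 1:]) w"
      by (subst (1) A(2)) (simp only: poly_smult)
    also have "poly (\<Prod>x\<in>#A. [:-x, 1:]) w = prod_list (map (\<lambda>x. w - x) xs)"
      unfolding xs[symmetric] by (induction xs) (auto simp: algebra_simps)
    also have "\<dots> = (\<Prod>i<length xs. w - xs ! i)"
      by (simp add: prod.list_conv_set_nth atLeast0LessThan)
    finally show ?thesis using A(1) xs by auto
  qed
  then show ?thesis by blast
qed

text \<open>Any enumeration of the roots with multiplicity will do: it is bounded by
  \<open>poly_root_bound\<close>, and along a convergent subsequence the product formula tends to a
  factorisation of \<open>q\<close>. No continuous choice of complex roots is involved.\<close>

lemma root_vectors_limit:
  fixes p :: "nat \<Rightarrow> real poly"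
  assumes deg: "\<And>n. degree (p n) = d" "\<And>n. p n \<noteq> 0" "degree q = d" "q \<noteq> 0"
    and lim: "\<And>i. (\<lambda>n. coeff (p n) i) \<longlonglongrightarrow> coeff q i"
  obtains s z l where "strict_mono (s :: nat \<Rightarrow> nat)"
    "\<And>n w. poly (cpoly (p (s n))) w = of_real (lead_coeff (p (s n))) * (\<Prod>i<d. w - z n i)"
    "\<And>i. i < d \<Longrightarrow> (\<lambda>n. z n i) \<longlonglongrightarrow> l i"
    "\<And>w. poly (cpoly q) w = of_real (lead_coeff q) * (\<Prod>i<d. w - l i)"
proof -
  have "\<forall>n. \<exists>z::nat \<Rightarrow> complex. \<forall>w. poly (cpoly (p n)) w = of_real (lead_coeff (p n)) * (\<Prod>i<d. w - z i)"
    using complex_root_vector[of "cpoly (p n)" for n] deg by (metis coeff_cpoly cpoly_eq_0_iff degree_cpoly)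
  then obtain y :: "nat \<Rightarrow> nat \<Rightarrow> complex" where
    y: "\<And>n w. poly (cpoly (p n)) w = of_real (lead_coeff (p n)) * (\<Prod>i<d. w - y n i)" by metis
  define B where "B n = 1 + (\<Sum>i<d. \<bar>coeff (p n) i\<bar>) / \<bar>coeff (p n) d\<bar>" for n
  have "B \<longlonglongrightarrow> 1 + (\<Sum>i<d. \<bar>coeff q i\<bar>) / \<bar>coeff q d\<bar>"
    unfolding B_def using deg by (intro tendsto_intros lim) auto
  then have "Bseq B" by (intro convergent_imp_Bseq convergentI)
  then obtain M where M: "\<And>n. \<bar>B n\<bar> \<le> M" by (auto simp: Bseq_def)
  have "norm (y n i) \<le> M" if "i < d" for n i
  proof -
    have "(\<Prod>j<d. y n i - y n j) = 0" using that by (intro prod_zero) auto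
    then have "poly (cpoly (p n)) (y n i) = 0" using y by simp
    then have "norm (y n i) \<le> B n"
      using poly_root_bound[of "cpoly (p n)" "y n i"] deg by (simp add: B_def)
    then show ?thesis using M[of n] by linarith
  qed
  then have "\<exists>C. compact C \<and> (\<forall>n. y n i \<in> C)" if "i < d" for i
    using that by (intro exI[of _ "cball 0 M"]) auto
  then obtain s l where s: "strict_mono s" "\<And>i. i < d \<Longrightarrow> (\<lambda>n. y (s n) i) \<longlonglongrightarrow> l i"
    using tuple_convergent_subseq[of d y] by blast
  have "poly (cpoly q) w = of_real (lead_coeff q) * (\<Prod>i<d. w - l i)" for w
  proof (rule LIMSEQ_unique)
    have "(\<lambda>n. \<Sum>i\<le>d. of_real (coeff (p n) i) * w ^ i) \<longlonglongrightarrow> (\<Sum>i\<le>d. of_real (coeff q i) * w ^ i)"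
      by (intro tendsto_intros lim)
    then have "(\<lambda>n. poly (cpoly (p n)) w) \<longlonglongrightarrow> poly (cpoly q) w"
      using deg by (simp add: poly_altdef)
    then show "(\<lambda>n. poly (cpoly (p (s n))) w) \<longlonglongrightarrow> poly (cpoly q) w"
      using LIMSEQ_subseq_LIMSEQ[OF _ s(1)] by (simp add: o_def)
    have "(\<lambda>n. coeff (p (s n)) d) \<longlonglongrightarrow> coeff q d"
      using LIMSEQ_subseq_LIMSEQ[OF lim s(1)] by (simp add: o_def)
    then have "(\<lambda>n. of_real (coeff (p (s n)) d) * (\<Prod>i<d. w - y (s n) i)) \<longlonglongrightarrow> of_real (coeff q d) * (\<Prod>i<d. w - l i)"
      by (intro tendsto_intros tendsto_prod s) auto
    then show "(\<lambda>n. poly (cpoly (p (s n))) w) \<longlonglongrightarrow> of_real (lead_coeff q) * (\<Prod>i<d. w - l i)"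
      by (simp add: y deg)
  qed
  with s y show ?thesis by (intro that[of s "\<lambda>n. y (s n)" l]) auto
qed

definition real_roots :: "real poly \<Rightarrow> real list" where
  "real_roots p = sorted_list_of_set {y. poly p y = 0}"

lemma set_real_roots: "p \<noteq> 0 \<Longrightarrow> set (real_roots p) = {y. poly p y = 0}"
  by (simp add: real_roots_def poly_roots_finite)

lemma real_roots_strict_mono: 
  "i < j \<Longrightarrow> j < length (real_roots p) \<Longrightarrow> real_roots p ! i < real_roots p ! j"
  using strict_sorted_list_of_set[of "{y. poly p y = 0}"]
  by (simp add: real_roots_def sorted_wrt_iff_nth_less)

text \<open>Since \<open>p n\<close> and \<open>q\<close> have the same number of distinct complex
  roots, roots with a common limit must coincide for late \<open>n\<close>. Since conjugation
  permutes the roots of a real polynomial, a root with real limit is then real itself. So the real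
  roots correspond one to one and in order.\<close>

lemma real_roots_limit:
  fixes p :: "nat \<Rightarrow> real poly"
  assumes deg: "\<And>n. degree (p n) = d" "\<And>n. p n \<noteq> 0" "degree q = d" "q \<noteq> 0"
    and lim: "\<And>i. (\<lambda>n. coeff (p n) i) \<longlonglongrightarrow> coeff q i"
    and card: "\<And>n. card {z. poly (cpoly (p n)) z = 0} = card {z. poly (cpoly q) z = 0}"
  shows "\<exists>s. strict_mono (s::nat \<Rightarrow> nat) \<and> (\<forall>n. length (real_roots (p (s n))) = length (real_roots q)) \<and>
    (\<forall>i<length (real_roots q). (\<lambda>n. real_roots (p (s n)) ! i) \<longlonglongrightarrow> real_roots q ! i)"
proof -
  obtain s z l where s: "strict_mono (s :: nat \<Rightarrow> nat)"
    and z: "\<And>n w. poly (cpoly (p (s n))) w = of_real (lead_coeff (p (s n))) * (\<Prod>i<d. w - z n i)"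
    and zl: "\<And>i. i < d \<Longrightarrow> (\<lambda>n. z n i) \<longlonglongrightarrow> l i"
    and l: "\<And>w. poly (cpoly q) w = of_real (lead_coeff q) * (\<Prod>i<d. w - l i)"
    using root_vectors_limit[OF deg lim] by blast
  have roots_z: "{w. poly (cpoly (p (s n))) w = 0} = z n ` {..<d}" for n
  proof -
    have "lead_coeff (p (s n)) \<noteq> 0" using deg(2) by (metis leading_coeff_0_iff)
    then show ?thesis by (auto simp only: z mult_eq_0_iff of_real_eq_0_iff prod_zero_iff finite_lessThan) auto
  qed
  have roots_l: "{w. poly (cpoly q) w = 0} = l ` {..<d}"
  proof -
    have "lead_coeff q \<noteq> 0" using deg(4) by (metis leading_coeff_0_iff)
    then show ?thesis by (auto simp only: l mult_eq_0_iff of_real_eq_0_iff prod_zero_iff finite_lessThan) auto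
  qed
  \<comment> \<open>\<open>D\<close> collects the distances between distinct limit roots and the
    distances of nonreal ones from the real axis; the element \<open>1\<close> makes it nonempty. A
    quarter of its minimum separates the clusters of roots.\<close>
  define D where "D = insert 1 ((\<lambda>(i,j). dist (l i) (l j)) ` {(i,j). i < d \<and> j < d \<and> l i \<noteq> l j} \<union>
     (\<lambda>i. \<bar>Im (l i)\<bar>) ` {i. i < d \<and> Im (l i) \<noteq> 0})"
  have "finite {(i,j). i < d \<and> j < d \<and> l i \<noteq> l j}"
    by (rule finite_subset[of _ "{..<d} \<times> {..<d}"]) auto
  then have finD: "finite D" by (auto simp: D_def)
  have posD: "0 < x" if "x \<in> D" for x using that by (auto simp: D_def)
  define \<delta> where "\<delta> = Min D / 4"
  have \<delta>: "\<delta> > 0" unfolding \<delta>_def using posD[OF Min_in[OF finD]] by (auto simp: D_def)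
  have sep: "dist (l i) (l j) \<ge> 4 * \<delta>" if "i < d" "j < d" "l i \<noteq> l j" for i j
    unfolding \<delta>_def using Min_le[OF finD, of "dist (l i) (l j)"] that by (force simp: D_def)
  have sepI: "\<bar>Im (l i)\<bar> \<ge> 4 * \<delta>" if "i < d" "Im (l i) \<noteq> 0" for i
    unfolding \<delta>_def using Min_le[OF finD, of "\<bar>Im (l i)\<bar>"] that by (force simp: D_def)
  have "eventually (\<lambda>n. \<forall>i\<in>{..<d}. dist (z n i) (l i) < \<delta>) sequentially"
    using zl \<delta> by (intro eventually_ball_finite) (auto simp: tendsto_iff)
  then obtain N where N: "\<And>n i. n \<ge> N \<Longrightarrow> i < d \<Longrightarrow> dist (z n i) (l i) < \<delta>"
    by (auto simp: eventually_sequentially)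
  define \<iota> where "\<iota> w = (SOME i. i < d \<and> l i = w)" for w
  have \<iota>: "\<iota> w < d \<and> l (\<iota> w) = w" if "w \<in> l ` {..<d}" for w
    unfolding \<iota>_def by (rule someI_ex) (use that in auto)
  have a: "l i = l j" if "n \<ge> N" "i < d" "j < d" "z n i = z n j" for n i j
  proof (rule ccontr)
    assume "l i \<noteq> l j"
    from sep[OF that(2,3) this] have "4 * \<delta> \<le> dist (l i) (z n i) + dist (z n j) (l j)"
      using dist_triangle[of "l i" "l j" "z n i"] that by simp
    with N[OF that(1,2)] N[OF that(1,3)] \<delta> show False by (simp add: dist_commute)
  qed
  \<comment> \<open>Representatives of distinct limits have distinct nearby roots. By the equal
    counts there are no further roots, so every root of a cluster equals that of its
    representative.\<close>
  have b: "z n i = z n (\<iota> (l i))" if n: "n \<ge> N" and i: "i < d" for n i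
  proof -
    have inj: "inj_on (\<lambda>w. z n (\<iota> w)) (l ` {..<d})"
    proof (rule inj_onI)
      fix w w' assume "w \<in> l ` {..<d}" "w' \<in> l ` {..<d}" "z n (\<iota> w) = z n (\<iota> w')"
      then show "w = w'" using a[OF n, of "\<iota> w" "\<iota> w'"] \<iota> by metis
    qed
    have "(\<lambda>w. z n (\<iota> w)) ` (l ` {..<d}) = z n ` {..<d}"
    proof (rule card_subset_eq)
      show "(\<lambda>w. z n (\<iota> w)) ` l ` {..<d} \<subseteq> z n ` {..<d}" using \<iota> by auto
      show "card ((\<lambda>w. z n (\<iota> w)) ` l ` {..<d}) = card (z n ` {..<d})"
        using card[of "s n"] by (simp add: card_image[OF inj] roots_z roots_l)
    qed auto
    then obtain w where w: "w \<in> l ` {..<d}" "z n i = z n (\<iota> w)" using i by (metis (no_types, lifting) imageE imageI lessThan_iff)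
    then have "l i = w" using a[OF n i, of "\<iota> w"] \<iota>[OF w(1)] by simp
    with w show ?thesis by simp
  qed
  have b': "z n i = z n j" if "n \<ge> N" "i < d" "j < d" "l i = l j" for n i j
    using b[OF that(1,2)] b[OF that(1,3)] that(4) by simp
  have re: "Im (z n i) = 0 \<longleftrightarrow> Im (l i) = 0" if n: "n \<ge> N" and i: "i < d" for n i
  proof
    assume "Im (z n i) = 0"
    then have "\<bar>Im (l i)\<bar> \<le> dist (z n i) (l i)"
      using abs_Im_le_cmod[of "z n i - l i"] by (simp add: dist_norm)
    then have "\<not> \<bar>Im (l i)\<bar> \<ge> 4 * \<delta>" using N[OF n i] \<delta> by linarith
    then show "Im (l i) = 0" using sepI[OF i] by blast
  next
    \<comment> \<open>The conjugate root lies in the cluster of the same real limit and hence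
      coincides with the root itself.\<close>
    assume im: "Im (l i) = 0"
    then have cl: "cnj (l i) = l i" by (simp add: complex_eq_iff)
    have "z n i \<in> {w. poly (cpoly (p (s n))) w = 0}" using i unfolding roots_z by blast
    then have "cnj (z n i) \<in> {w. poly (cpoly (p (s n))) w = 0}" by (simp add: poly_cpoly_cnj)
    then obtain j where j: "j < d" "cnj (z n i) = z n j" unfolding roots_z by auto
    have "dist (cnj (z n i)) (l i) < \<delta>"
      using N[OF n i] cl by (metis complex_cnj_diff complex_mod_cnj dist_norm)
    then have "dist (l i) (l j) < 2 * \<delta>"
      using N[OF n j(1)] dist_triangle[of "l i" "l j" "z n j"] j by (simp add: dist_commute)
    then have "l i = l j" using sep[OF i j(1)] \<delta> by force
    then have "cnj (z n i) = z n i" using b'[OF n i j(1)] j by simp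
    then show "Im (z n i) = 0" by (simp add: complex_eq_iff)
  qed
  have Rq: "{y. poly q y = 0} = Re ` l ` {i. i < d \<and> Im (l i) = 0}"
  proof (intro equalityI subsetI)
    fix y assume "y \<in> {y. poly q y = 0}"
    then have "complex_of_real y \<in> {w. poly (cpoly q) w = 0}" by simp
    then obtain i where "i < d" "complex_of_real y = l i" unfolding roots_l by auto
    then show "y \<in> Re ` l ` {i. i < d \<and> Im (l i) = 0}"
      by (metis (mono_tags, lifting) Im_complex_of_real Re_complex_of_real image_eqI mem_Collect_eq)
  next
    fix y assume "y \<in> Re ` l ` {i. i < d \<and> Im (l i) = 0}"
    then obtain i where i: "i < d" "Im (l i) = 0" "y = Re (l i)" by auto
    then have "complex_of_real y = l i" by (simp add: complex_eq_iff)
    moreover have "l i \<in> {w. poly (cpoly q) w = 0}" unfolding roots_l using i by auto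
    ultimately have "poly (cpoly q) (complex_of_real y) = 0" by simp
    then show "y \<in> {y. poly q y = 0}" unfolding poly_cpoly_of_real by simp
  qed
  have Rp: "{y. poly (p (s n)) y = 0} = Re ` z n ` {i. i < d \<and> Im (z n i) = 0}" for n
  proof (intro equalityI subsetI)
    fix y assume "y \<in> {y. poly (p (s n)) y = 0}"
    then have "complex_of_real y \<in> {w. poly (cpoly (p (s n))) w = 0}" by simp
    then obtain i where "i < d" "complex_of_real y = z n i" unfolding roots_z by auto
    then show "y \<in> Re ` z n ` {i. i < d \<and> Im (z n i) = 0}"
      by (metis (mono_tags, lifting) Im_complex_of_real Re_complex_of_real image_eqI mem_Collect_eq)
  next
    fix y assume "y \<in> Re ` z n ` {i. i < d \<and> Im (z n i) = 0}"
    then obtain i where i: "i < d" "Im (z n i) = 0" "y = Re (z n i)" by auto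
    then have "complex_of_real y = z n i" by (simp add: complex_eq_iff)
    moreover have "z n i \<in> {w. poly (cpoly (p (s n))) w = 0}" unfolding roots_z using i by auto
    ultimately have "poly (cpoly (p (s n))) (complex_of_real y) = 0" by simp
    then show "y \<in> {y. poly (p (s n)) y = 0}" unfolding poly_cpoly_of_real by simp
  qed
  \<comment> \<open>\<open>g n\<close> sends a real root of \<open>q\<close> to the root of
    \<open>p (s n)\<close> near it. For late \<open>n\<close> it is a strictly increasing bijection,
    so it matches the two sorted lists entry by entry.\<close>
  define g where "g n y = Re (z n (\<iota> (complex_of_real y)))" for n y
  have root_l: "complex_of_real y \<in> l ` {..<d}" "\<iota> (complex_of_real y) < d" "l (\<iota> (complex_of_real y)) = complex_of_real y"
    if "poly q y = 0" for y
  proof -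
    show "complex_of_real y \<in> l ` {..<d}" unfolding roots_l[symmetric] using that by simp
    then show "\<iota> (complex_of_real y) < d" "l (\<iota> (complex_of_real y)) = complex_of_real y" using \<iota> by auto
  qed
  have g_im: "g n ` {y. poly q y = 0} = {y. poly (p (s n)) y = 0}" if n: "n \<ge> N" for n
  proof (intro equalityI subsetI)
    fix y assume "y \<in> g n ` {y. poly q y = 0}"
    then obtain x where x: "poly q x = 0" "y = g n x" by auto
    then show "y \<in> {y. poly (p (s n)) y = 0}" unfolding Rp g_def 
      using root_l[OF x(1)] re[OF n, of "\<iota> (complex_of_real x)"] by auto
  next
    fix y assume "y \<in> {y. poly (p (s n)) y = 0}"
    then obtain i where i: "i < d" "Im (z n i) = 0" "y = Re (z n i)" unfolding Rp by auto
    then have im: "Im (l i) = 0" using re[OF n] by simp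
    then have e: "complex_of_real (Re (l i)) = l i" by (simp add: complex_eq_iff)
    have "Re (l i) \<in> {y. poly q y = 0}" unfolding Rq using i im by auto
    moreover have "y = g n (Re (l i))" unfolding g_def e using i b[OF n i(1)] by simp
    ultimately show "y \<in> g n ` {y. poly q y = 0}" by blast
  qed
  have g_mono: "g n y < g n y'" if n: "n \<ge> N" and y: "poly q y = 0" "poly q y' = 0" "y < y'" for n y y'
  proof -
    let ?i = "\<iota> (complex_of_real y)" and ?j = "\<iota> (complex_of_real y')"
    have "l ?i \<noteq> l ?j" using root_l[OF y(1)] root_l[OF y(2)] y(3) by simp
    from sep[OF root_l(2)[OF y(1)] root_l(2)[OF y(2)] this] have "4 * \<delta> \<le> dist (complex_of_real y) (complex_of_real y')"
      using root_l[OF y(1)] root_l[OF y(2)] by simp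
    also have "dist (complex_of_real y) (complex_of_real y') = y' - y"
      using y(3) by (simp add: dist_norm flip: of_real_diff)
    finally have "4 * \<delta> \<le> y' - y" .
    moreover have "\<bar>g n y - y\<bar> < \<delta>"
      using N[OF n root_l(2)[OF y(1)]] abs_Re_le_cmod[of "z n ?i - l ?i"] root_l[OF y(1)]
      by (simp add: dist_norm g_def)
    moreover have "\<bar>g n y' - y'\<bar> < \<delta>"
      using N[OF n root_l(2)[OF y(2)]] abs_Re_le_cmod[of "z n ?j - l ?j"] root_l[OF y(2)]
      by (simp add: dist_norm g_def)
    ultimately show ?thesis using \<delta> by linarith
  qed
  have rr: "real_roots (p (s n)) = map (g n) (real_roots q)" if n: "n \<ge> N" for n
  proof -
    have fin: "finite {y. poly q y = 0}" "finite {y. poly (p (s n)) y = 0}"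
      using deg by (auto intro: poly_roots_finite)
    have "sorted_wrt (<) (map (g n) (real_roots q))"
      unfolding sorted_wrt_map
      by (rule sorted_wrt_mono_rel[of _ "(<)"])
        (use fin g_mono[OF n] in \<open>auto simp: real_roots_def\<close>)
    moreover have "set (map (g n) (real_roots q)) = {y. poly (p (s n)) y = 0}"
      using g_im[OF n] fin by (simp add: real_roots_def)
    ultimately show ?thesis unfolding real_roots_def[of "p (s n)"]
      by (metis sorted_list_of_set_unique strict_sorted_iff distinct_card fin(2))
  qed
  have "(\<lambda>n. real_roots (p ((\<lambda>n. s (n + N)) n)) ! i) \<longlonglongrightarrow> real_roots q ! i" if i: "i < length (real_roots q)" for i
  proof -
    define y where "y = real_roots q ! i"
    have "y \<in> set (real_roots q)" using i by (simp add: y_def)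
    then have "poly q y = 0" using deg by (simp add: set_real_roots)
    note r = root_l[OF this]
    have "(\<lambda>n. Re (z n (\<iota> (complex_of_real y)))) \<longlonglongrightarrow> Re (l (\<iota> (complex_of_real y)))"
      by (intro tendsto_Re zl r)
    then have "(\<lambda>n. g n y) \<longlonglongrightarrow> y" by (simp add: g_def r)
    then have "(\<lambda>n. g (n + N) y) \<longlonglongrightarrow> y" by (rule LIMSEQ_ignore_initial_segment)
    then show ?thesis using i by (simp add: rr y_def)
  qed
  moreover have "strict_mono (\<lambda>n. s (n + N))" using s by (simp add: strict_mono_def)
  ultimately show ?thesis by (intro exI[of _ "\<lambda>n. s (n + N)"]) (simp add: rr)
qed

text \<open>The length of the list of real roots is continuous with integer values, hence constant
  on the connected set \<open>C\<close>.\<close>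

lemma real_roots_continuous:
  fixes P :: "'a::metric_space \<Rightarrow> real poly"
  assumes C: "connected C" and cont: "\<And>i. continuous_on C (\<lambda>x. coeff (P x) i)"
    and deg: "\<And>x. x \<in> C \<Longrightarrow> degree (P x) = d" "\<And>x. x \<in> C \<Longrightarrow> P x \<noteq> 0"
    and card: "\<And>x. x \<in> C \<Longrightarrow> card {z. poly (cpoly (P x)) z = 0} = r"
  shows "\<exists>m. (\<forall>x\<in>C. length (real_roots (P x)) = m) \<and> (\<forall>i<m. continuous_on C (\<lambda>x. real_roots (P x) ! i))"
proof (cases "C = {}")
  case False
  then obtain x0 where x0: "x0 \<in> C" by auto
  have lim: "\<exists>s. strict_mono (s::nat \<Rightarrow> nat) \<and> (\<forall>n. length (real_roots (P (x (s n)))) = length (real_roots (P a))) \<and>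
    (\<forall>i<length (real_roots (P a)). (\<lambda>n. real_roots (P (x (s n))) ! i) \<longlonglongrightarrow> real_roots (P a) ! i)"
    if "a \<in> C" "\<And>n. x n \<in> C" "x \<longlonglongrightarrow> a" for x a
  proof (rule real_roots_limit[of "\<lambda>n. P (x n)" d])
    show "(\<lambda>n. coeff (P (x n)) i) \<longlonglongrightarrow> coeff (P a) i" for i
      using cont[of i] that unfolding continuous_on_sequentially by (auto simp: o_def)
  qed (use that deg card in auto)
  have "continuous_on C (\<lambda>x. real (length (real_roots (P x))))"
  proof (rule continuous_on_subseqI)
    fix x a assume "a \<in> C" "\<And>n. x n \<in> C" "x \<longlonglongrightarrow> a"
    from lim[OF this] show "\<exists>s::nat\<Rightarrow>nat. strict_mono s \<and> (\<lambda>n. real (length (real_roots (P (x (s n)))))) \<longlonglongrightarrow> real (length (real_roots (P a)))"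
      by auto
  qed
  have "(\<lambda>x. real (length (real_roots (P x)))) constant_on C"
  proof (rule continuous_discrete_range_constant[OF C \<open>continuous_on C (\<lambda>x. real (length (real_roots (P x))))\<close>])
    fix x assume "x \<in> C"
    show "\<exists>e>0. \<forall>y. y \<in> C \<and> real (length (real_roots (P y))) \<noteq> real (length (real_roots (P x))) \<longrightarrow>
              e \<le> norm (real (length (real_roots (P y))) - real (length (real_roots (P x))))"
      by (intro exI[of _ 1]) auto
  qed
  then have m: "\<And>x. x \<in> C \<Longrightarrow> length (real_roots (P x)) = length (real_roots (P x0))"
    using x0 unfolding constant_on_def by (metis of_nat_eq_iff)
  have "continuous_on C (\<lambda>x. real_roots (P x) ! i)" if "i < length (real_roots (P x0))" for i
  proof (rule continuous_on_subseqI)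
    fix x a assume *: "a \<in> C" "\<And>n. x n \<in> C" "x \<longlonglongrightarrow> a"
    from lim[OF this] that m[OF *(1)] 
    show "\<exists>s::nat\<Rightarrow>nat. strict_mono s \<and> (\<lambda>n. real_roots (P (x (s n))) ! i) \<longlonglongrightarrow> real_roots (P a) ! i"
      by auto
  qed
  with m show ?thesis by blast
qed auto

text \<open>The sets on which \<open>\<eta>\<close> agrees with a given \<open>\<xi> j\<close> are
  finitely many disjoint relatively closed sets covering \<open>C\<close>; connectedness leaves only
  one of them.\<close>

lemma continuous_selection_unique:
  fixes \<xi> :: "nat \<Rightarrow> 'a::metric_space \<Rightarrow> real"
  assumes C: "connected C" "C \<noteq> {}" and \<eta>: "continuous_on C \<eta>" and \<xi>: "\<And>i. i < m \<Longrightarrow> continuous_on C (\<xi> i)"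
    and mono: "\<And>i j x. i < j \<Longrightarrow> j < m \<Longrightarrow> x \<in> C \<Longrightarrow> \<xi> i x < \<xi> j x"
    and sel: "\<And>x. x \<in> C \<Longrightarrow> \<exists>i<m. \<eta> x = \<xi> i x"
  shows "\<exists>i<m. \<forall>x\<in>C. \<eta> x = \<xi> i x"
proof -
  obtain x0 i where i: "x0 \<in> C" "i < m" "\<eta> x0 = \<xi> i x0" using C sel by blast
  define Z where "Z j = {x \<in> C. \<eta> x - \<xi> j x = 0}" for j
  have cl: "closedin (top_of_set C) (Z j)" if "j < m" for j
    unfolding Z_def by (intro continuous_closedin_preimage_constant continuous_intros \<eta> \<xi> that)
  have "C - Z i = (\<Union>j\<in>{..<m} - {i}. Z j)"
  proof (intro equalityI subsetI)
    fix x assume x: "x \<in> C - Z i"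
    then obtain j where "j < m" "\<eta> x = \<xi> j x" using sel by blast
    with x show "x \<in> (\<Union>j\<in>{..<m} - {i}. Z j)" by (auto simp: Z_def)
  next
    fix x assume "x \<in> (\<Union>j\<in>{..<m} - {i}. Z j)"
    then obtain j where j: "j < m" "j \<noteq> i" "x \<in> C" "\<eta> x = \<xi> j x" by (auto simp: Z_def)
    then have "\<xi> i x \<noteq> \<xi> j x" using mono[of i j x] mono[of j i x] i(2) by (cases "i < j") auto
    with j show "x \<in> C - Z i" by (auto simp: Z_def)
  qed
  then have "closedin (top_of_set C) (C - Z i)" using cl by (auto intro!: closedin_Union)
  then have "openin (top_of_set C) (Z i)"
    unfolding openin_closedin_eq topspace_euclidean_subtopology by (auto simp: Z_def)
  then have "Z i = {} \<or> Z i = C" using C(1) cl[OF i(2)] unfolding connected_clopen by blast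
  moreover have "x0 \<in> Z i" using i by (simp add: Z_def)
  ultimately have "Z i = C" by blast
  with i(2) show ?thesis by (auto simp: Z_def)
qed

section \<open>Delineation of real roots over connected sets\<close>

definition sign_const :: "('a \<Rightarrow> real) set \<Rightarrow> 'a set \<Rightarrow> bool" where
  "sign_const G C \<longleftrightarrow> (\<forall>g\<in>G. \<forall>x\<in>C. \<forall>y\<in>C. sgn (g x) = sgn (g y))"

lemma sign_const_zero_iff: "sign_const G C \<Longrightarrow> g \<in> G \<Longrightarrow> x \<in> C \<Longrightarrow> y \<in> C \<Longrightarrow> g x = 0 \<longleftrightarrow> g y = 0"
  unfolding sign_const_def by (metis sgn_0_0)

lemma sign_const_mono: "sign_const G C \<Longrightarrow> G' \<subseteq> G \<Longrightarrow> sign_const G' C"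
  by (auto simp: sign_const_def)

text \<open>The last clause makes every \<open>\<xi> i\<close> an actual root of some nonzero
  member. It is what later identifies all sections as roots of a single product, so that they extend
  to closures.\<close>

definition delineated :: "'j set \<Rightarrow> ('j \<Rightarrow> 'a::topological_space \<Rightarrow> real poly) \<Rightarrow> 'a set \<Rightarrow> nat \<Rightarrow> (nat \<Rightarrow> 'a \<Rightarrow> real) \<Rightarrow> bool" where
  "delineated J p C m \<xi> \<longleftrightarrow>
    (\<forall>i<m. continuous_on C (\<xi> i)) \<and> (\<forall>i j x. i < j \<longrightarrow> j < m \<longrightarrow> x \<in> C \<longrightarrow> \<xi> i x < \<xi> j x) \<and>
    (\<forall>j\<in>J. (\<forall>x\<in>C. p j x = 0) \<or> (\<forall>x\<in>C. p j x \<noteq> 0) \<and>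
        (\<exists>I\<subseteq>{..<m}. \<forall>x\<in>C. {y. poly (p j x) y = 0} = (\<lambda>i. \<xi> i x) ` I)) \<and>
    (\<forall>x\<in>C. \<forall>i<m. \<exists>j\<in>J. p j x \<noteq> 0 \<and> poly (p j x) (\<xi> i x) = 0)"

text \<open>Constant signs of \<open>G\<close> fix the degrees of all members and the numbers of
  distinct complex roots of their products; over a connected set the real roots are then continuous
  functions in a fixed order.\<close>

lemma delineation:
  fixes p :: "'j \<Rightarrow> 'a::real_normed_vector \<Rightarrow> real poly"
  assumes J: "finite J" and fam: "\<And>j. j \<in> J \<Longrightarrow> polyfam (p j)"
  shows "\<exists>G. finite G \<and> (\<forall>g\<in>G. polyfun g) \<and>
    (\<forall>C. connected C \<longrightarrow> C \<noteq> {} \<longrightarrow> sign_const G C \<longrightarrow> (\<exists>m \<xi>. delineated J p C m \<xi>))"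
proof -
  define P where "P J' x = (\<Prod>j\<in>J'. p j x)" for J' x
  have famP: "polyfam (P J')" if "J' \<subseteq> J" for J'
    unfolding P_def using that J fam by (intro polyfam_prod) (auto intro: finite_subset)
  have "\<exists>T. finite T \<and> (\<forall>t\<in>T. polyfun t) \<and>
    (\<forall>x x'. (\<forall>t\<in>T. t x = 0 \<longleftrightarrow> t x' = 0) \<longrightarrow> degree (gcd (P J' x) (pderiv (P J' x))) = degree (gcd (P J' x') (pderiv (P J' x'))))"
    if "J' \<subseteq> J" for J'
  proof -
    note f = famP[OF that] polyfam_pderiv[OF famP[OF that]]
    then obtain d e where "\<And>x. degree (P J' x) \<le> d" "\<And>x. degree (pderiv (P J' x)) \<le> e"
      by (auto simp: polyfam_def)
    from degree_gcd_vanishing_pattern[OF f this] show ?thesis .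
  qed
  then obtain T where T: "\<And>J'. J' \<subseteq> J \<Longrightarrow> finite (T J')" "\<And>J' t. J' \<subseteq> J \<Longrightarrow> t \<in> T J' \<Longrightarrow> polyfun t"
    "\<And>J' x x'. J' \<subseteq> J \<Longrightarrow> (\<forall>t\<in>T J'. t x = 0 \<longleftrightarrow> t x' = 0) \<Longrightarrow> 
        degree (gcd (P J' x) (pderiv (P J' x))) = degree (gcd (P J' x') (pderiv (P J' x')))"
    by metis
  have "\<forall>j\<in>J. \<exists>d. \<forall>x. degree (p j x) \<le> d" using fam by (auto simp: polyfam_def)
  then obtain d where d: "\<And>j x. j \<in> J \<Longrightarrow> degree (p j x) \<le> d j" by metis
  \<comment> \<open>Which members vanish identically depends on \<open>C\<close>, so the patterns
    are taken for the products over all subsets of \<open>J\<close>: the nonvanishing members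
    together give the sections, the single ones tell which sections are their roots.\<close>
  define G where "G = (\<Union>j\<in>J. (\<lambda>i x. coeff (p j x) i) ` {..d j}) \<union> (\<Union>J'\<in>Pow J. T J')"
  have "finite G" "\<forall>g\<in>G. polyfun g" using J T fam by (auto simp: G_def polyfam_def)
  moreover have "\<exists>m \<xi>. delineated J p C m \<xi>"
    if C: "connected C" "C \<noteq> {}" "sign_const G C" for C
  proof -
    obtain x0 where x0: "x0 \<in> C" using C by blast
    have coeff0: "coeff (p j x) i = 0 \<longleftrightarrow> coeff (p j x0) i = 0" if "j \<in> J" "x \<in> C" for j x i
    proof (cases "i \<le> d j")
      case True
      then have "(\<lambda>x. coeff (p j x) i) \<in> G" using that by (auto simp: G_def)
      from sign_const_zero_iff[OF C(3) this that(2) x0] show ?thesis .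
    next
      case False
      then show ?thesis using d[OF that(1), of x] d[OF that(1), of x0] by (auto intro!: coeff_eq_0)
    qed
    then have degp: "degree (p j x) = degree (p j x0)" if "j \<in> J" "x \<in> C" for j x
      using that by (simp add: degree_def)
    have p0: "p j x = 0 \<longleftrightarrow> p j x0 = 0" if "j \<in> J" "x \<in> C" for j x
      using coeff0[OF that] by (simp add: poly_eq_iff)
    define J0 where "J0 = {j\<in>J. p j x0 \<noteq> 0}"
    have real: "\<exists>m. (\<forall>x\<in>C. length (real_roots (P J' x)) = m) \<and> (\<forall>i<m. continuous_on C (\<lambda>x. real_roots (P J' x) ! i))"
      if J': "J' \<subseteq> J0" for J'
    proof (rule real_roots_continuous)
      have sub: "J' \<subseteq> J" "finite J'" using J' J by (auto simp: J0_def intro: finite_subset)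
      show "continuous_on C (\<lambda>x. coeff (P J' x) i)" for i
        using famP[OF sub(1)] by (intro polyfun_continuous) (auto simp: polyfam_def)
      have nz: "p j x \<noteq> 0" if "x \<in> C" "j \<in> J'" for x j
        using p0[of j x] that J' by (auto simp: J0_def)
      show nzP: "P J' x \<noteq> 0" if "x \<in> C" for x using nz[OF that] sub by (simp add: P_def)
      show degP: "degree (P J' x) = degree (P J' x0)" if "x \<in> C" for x
      proof -
        have "degree (P J' x) = (\<Sum>j\<in>J'. degree (p j x))" if "x \<in> C" for x
          unfolding P_def by (rule degree_prod_eq_sum_degree) (use nz that in blast)
        then show ?thesis using degp that x0 sub(1) by (auto intro!: sum.cong)
      qed
      show "card {z. poly (cpoly (P J' x)) z = 0} = degree (P J' x0) - degree (gcd (P J' x0) (pderiv (P J' x0)))"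
        if "x \<in> C" for x
      proof -
        have "\<forall>t\<in>T J'. t x = 0 \<longleftrightarrow> t x0 = 0"
          using sign_const_zero_iff[OF C(3) _ that x0] sub(1) by (auto simp: G_def)
        from T(3)[OF sub(1) this] show ?thesis
          by (simp add: card_complex_roots nzP that degP)
      qed
    qed (rule C)
    obtain m where m: "\<And>x. x \<in> C \<Longrightarrow> length (real_roots (P J0 x)) = m"
      "\<And>i. i < m \<Longrightarrow> continuous_on C (\<lambda>x. real_roots (P J0 x) ! i)" using real[of J0] by blast
    define \<xi> where "\<xi> i x = real_roots (P J0 x) ! i" for i x
    have nz: "p j x \<noteq> 0" if "x \<in> C" "j \<in> J0" for x j
      using p0[of j x] that by (auto simp: J0_def)
    have finJ0: "finite J0" using J by (auto simp: J0_def)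
    have nzP: "P J0 x \<noteq> 0" if "x \<in> C" for x using nz[OF that] finJ0 by (simp add: P_def)
    have mono: "\<xi> i x < \<xi> j x" if "i < j" "j < m" "x \<in> C" for i j x
      using real_roots_strict_mono[of i j] that m(1) by (simp add: \<xi>_def)
    have roots: "{y. poly (P J0 x) y = 0} = (\<lambda>i. \<xi> i x) ` {..<m}" if "x \<in> C" for x
      using set_real_roots[OF nzP[OF that]] m(1)[OF that] unfolding \<xi>_def
      by (auto simp: set_conv_nth)
    have one: "\<exists>I\<subseteq>{..<m}. \<forall>x\<in>C. {y. poly (p j x) y = 0} = (\<lambda>i. \<xi> i x) ` I" if j: "j \<in> J0" for j
    proof -
      have Pj: "P {j} x = p j x" for x by (simp add: P_def)
      obtain k where k: "\<And>x. x \<in> C \<Longrightarrow> length (real_roots (p j x)) = k"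
        "\<And>i. i < k \<Longrightarrow> continuous_on C (\<lambda>x. real_roots (p j x) ! i)" using real[of "{j}"] j by (auto simp: Pj)
      \<comment> \<open>The \<open>i\<close>-th root of a single member is a continuous selection
        among the roots of the product, so it follows one of them throughout.\<close>
      have "\<exists>i'<m. \<forall>x\<in>C. real_roots (p j x) ! i = \<xi> i' x" if i: "i < k" for i
      proof (rule continuous_selection_unique[OF C(1,2) k(2)[OF i]])
        show "continuous_on C (\<xi> i')" if "i' < m" for i' using m(2)[OF that] by (simp add: \<xi>_def[abs_def])
        show "\<exists>i'<m. real_roots (p j x) ! i = \<xi> i' x" if "x \<in> C" for x
        proof -
          have "real_roots (p j x) ! i \<in> {y. poly (p j x) y = 0}"
            using nth_mem[of i "real_roots (p j x)"] k(1)[OF that] i set_real_roots[OF nz[OF that j]] by simp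
          then have "poly (P J0 x) (real_roots (p j x) ! i) = 0"
            using j finJ0 by (auto simp: P_def poly_prod)
          then have "real_roots (p j x) ! i \<in> (\<lambda>i. \<xi> i x) ` {..<m}" using roots[OF that] by blast
          then show ?thesis by auto
        qed
      qed (use mono in auto)
      then obtain f where f: "\<And>i. i < k \<Longrightarrow> f i < m \<and> (\<forall>x\<in>C. real_roots (p j x) ! i = \<xi> (f i) x)" by metis
      have "{y. poly (p j x) y = 0} = (\<lambda>i. \<xi> i x) ` f ` {..<k}" if x: "x \<in> C" for x
      proof -
        have "{y. poly (p j x) y = 0} = (\<lambda>i. real_roots (p j x) ! i) ` {..<k}"
          using set_real_roots[OF nz[OF x j]] k(1)[OF x] by (auto simp: set_conv_nth)
        also have "\<dots> = (\<lambda>i. \<xi> (f i) x) ` {..<k}" using f x by (intro image_cong) auto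
        finally show ?thesis by (simp add: image_image)
      qed
      then show ?thesis using f by (intro exI[of _ "f ` {..<k}"]) auto
    qed
    have "delineated J p C m \<xi>"
      unfolding delineated_def
    proof (intro conjI allI impI ballI)
      show "continuous_on C (\<xi> i)" if "i < m" for i using m(2)[OF that] by (simp add: \<xi>_def[abs_def])
      show "(\<forall>x\<in>C. p j x = 0) \<or> (\<forall>x\<in>C. p j x \<noteq> 0) \<and>
        (\<exists>I\<subseteq>{..<m}. \<forall>x\<in>C. {y. poly (p j x) y = 0} = (\<lambda>i. \<xi> i x) ` I)" if "j \<in> J" for j
        using that p0[OF that] one[of j] nz[of _ j] by (cases "j \<in> J0") (auto simp: J0_def)
      show "\<exists>j\<in>J. p j x \<noteq> 0 \<and> poly (p j x) (\<xi> i x) = 0" if x: "x \<in> C" and i: "i < m" for x i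
      proof -
        have "poly (P J0 x) (\<xi> i x) = 0" using roots[OF x] i by blast
        then obtain j where "j \<in> J0" "poly (p j x) (\<xi> i x) = 0"
          using finJ0 by (auto simp: P_def poly_prod)
        with nz[OF x] show ?thesis by (auto simp: J0_def)
      qed
    qed (use mono in auto)
    then show ?thesis by blast
  qed
  ultimately show ?thesis by blast
qed

subsection \<open>Cylinders over connected sets\<close>

text \<open>Base and cylinder lie in the same space, with the fibre coordinate along
  \<open>v\<close>; an induction over subspaces therefore never changes the type.\<close>

definition cyl :: "'a::real_vector \<Rightarrow> 'a set \<Rightarrow> ('a \<Rightarrow> real set) \<Rightarrow> 'a set" where
  "cyl v C I = {x + y *\<^sub>R v | x y. x \<in> C \<and> y \<in> I x}"

text \<open>Every fibre is attached to the graph of \<open>s\<close>, which is connected as a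
  continuous image of \<open>C\<close>.\<close>

lemma connected_cyl:
  fixes C :: "'a::real_normed_vector set"
  assumes C: "connected C" and s: "continuous_on C s" "\<And>x. x \<in> C \<Longrightarrow> s x \<in> I x"
    and I: "\<And>x. x \<in> C \<Longrightarrow> convex (I x)"
  shows "connected (cyl v C I)"
proof (cases "C = {}")
  case True
  then show ?thesis by (simp add: cyl_def)
next
  case False
  define G where "G = (\<lambda>x. x + s x *\<^sub>R v) ` C"
  have G: "connected G" unfolding G_def by (intro connected_continuous_image continuous_intros s C)
  define A where "A x = G \<union> (\<lambda>y. x + y *\<^sub>R v) ` I x" for x
  have "connected (A x)" if "x \<in> C" for x
    unfolding A_def
  proof (rule connected_Un[OF G])
    show "connected ((\<lambda>y. x + y *\<^sub>R v) ` I x)"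
      by (intro connected_continuous_image continuous_intros convex_connected I that)
    show "G \<inter> (\<lambda>y. x + y *\<^sub>R v) ` I x \<noteq> {}" using s(2)[OF that] that by (auto simp: G_def)
  qed
  moreover have "\<Inter> (A ` C) \<noteq> {}" using False by (auto simp: A_def G_def)
  ultimately have "connected (\<Union> (A ` C))" by (intro connected_Union) auto
  moreover have "\<Union> (A ` C) = cyl v C I" using s(2) by (auto simp: A_def G_def cyl_def)
  ultimately show ?thesis by simp
qed

lemma connected_nonzero_sgn:
  assumes "connected T" "continuous_on T g" "\<And>x. x \<in> T \<Longrightarrow> g x \<noteq> (0::real)" "x \<in> T" "y \<in> T"
  shows "sgn (g x) = sgn (g y)"
proof (rule ccontr)
  assume *: "sgn (g x) \<noteq> sgn (g y)"
  have "connected (g ` T)" using assms by (intro connected_continuous_image)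
  then have iv: "is_interval (g ` T)" by (simp add: is_interval_connected_1)
  have "g x \<noteq> 0" "g y \<noteq> 0" using assms by auto
  then consider "g x < 0" "0 < g y" | "g y < 0" "0 < g x" using * by (auto simp: sgn_real_def split: if_splits)
  then have "0 \<in> g ` T"
    using iv[unfolded is_interval_1] assms(4,5) by cases (meson imageI less_imp_le)+
  then show False using assms(3) by auto
qed

text \<open>Band \<open>i\<close> lies between the roots with indices \<open>i - 1\<close> and
  \<open>i\<close>. The guards make band \<open>0\<close> unbounded below and band \<open>m\<close>
  unbounded above, so for \<open>m = 0\<close> there is one band, the whole line.\<close>

definition band :: "nat \<Rightarrow> (nat \<Rightarrow> 'a \<Rightarrow> real) \<Rightarrow> nat \<Rightarrow> 'a \<Rightarrow> real set" where
  "band m \<xi> i x = {y. (0 < i \<longrightarrow> \<xi> (i - 1) x < y) \<and> (i < m \<longrightarrow> y < \<xi> i x)}"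

definition band_section :: "nat \<Rightarrow> (nat \<Rightarrow> 'a \<Rightarrow> real) \<Rightarrow> nat \<Rightarrow> 'a \<Rightarrow> real" where
  "band_section m \<xi> i x = (if 0 < i then if i < m then (\<xi> (i - 1) x + \<xi> i x) / 2 else \<xi> (i - 1) x + 1
     else if i < m then \<xi> i x - 1 else 0)"

lemma band_section_continuous:
  assumes "\<And>i. i < m \<Longrightarrow> continuous_on C (\<xi> i)" "i \<le> m"
  shows "continuous_on C (band_section m \<xi> i)"
  unfolding band_section_def[abs_def] using assms
  by (cases "0 < i"; cases "i < m") (auto intro!: continuous_intros)

lemma band_section_in_band:
  assumes "\<And>i j. i < j \<Longrightarrow> j < m \<Longrightarrow> \<xi> i x < \<xi> j x" "i \<le> m"
  shows "band_section m \<xi> i x \<in> band m \<xi> i x"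
  using assms(1)[of "i - 1" i] assms(2) by (auto simp: band_def band_section_def)

lemma band_convex: "convex (band m \<xi> i x)"
proof -
  have "band m \<xi> i x = (if 0 < i then {\<xi> (i - 1) x<..} else UNIV) \<inter> (if i < m then {..<\<xi> i x} else UNIV)"
    by (auto simp: band_def)
  then show ?thesis by (auto intro!: convex_Int)
qed

text \<open>The least index \<open>k\<close> whose root is not below \<open>y\<close>, or
  \<open>m\<close> if there is none, decides the case.\<close>

lemma band_or_root:
  fixes \<xi> :: "nat \<Rightarrow> 'a \<Rightarrow> real"
  shows "(\<exists>i<m. y = \<xi> i x) \<or> (\<exists>i\<le>m. y \<in> band m \<xi> i x)"
proof -
  define k where "k = (LEAST k. m \<le> k \<or> y \<le> \<xi> k x)"
  have k: "m \<le> k \<or> y \<le> \<xi> k x" unfolding k_def by (rule LeastI[of _ m]) simp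
  have km: "k \<le> m" unfolding k_def by (rule Least_le) simp
  have lt: "\<xi> j x < y" if "j < k" for j
    using not_less_Least[of j "\<lambda>k. m \<le> k \<or> y \<le> \<xi> k x"] that unfolding k_def by auto
  show ?thesis
  proof (cases "k < m \<and> y = \<xi> k x")
    case False
    then have "y \<in> band m \<xi> k x" using k km lt[of "k - 1"] by (auto simp: band_def)
    then show ?thesis using km by blast
  qed auto
qed

lemma band_not_root:
  assumes "\<And>i j. i < j \<Longrightarrow> j < m \<Longrightarrow> \<xi> i x < \<xi> j x" "i \<le> m" "k < m"
  shows "\<xi> k x \<notin> band m \<xi> i x"
proof
  assume *: "\<xi> k x \<in> band m \<xi> i x"
  show False
  proof (cases "k < i")
    case True
    then have "k = i - 1 \<or> k < i - 1 \<and> i - 1 < m" using assms(2) by linarith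
    then have "\<xi> k x \<le> \<xi> (i - 1) x" using assms(1)[of k "i - 1"] by auto
    then show False using * True by (auto simp: band_def)
  next
    case False
    then have "\<xi> i x \<le> \<xi> k x" using assms(1)[of i k] assms(3) by (cases "k = i") auto
    then show False using * False assms(3) by (auto simp: band_def)
  qed
qed

lemma delineatedD:
  assumes "delineated J p C m \<xi>" "j \<in> J"
  shows "(\<forall>x\<in>C. p j x = 0) \<or> (\<exists>I\<subseteq>{..<m}. \<forall>x\<in>C. {y. poly (p j x) y = 0} = (\<lambda>i. \<xi> i x) ` I)"
  using assms unfolding delineated_def by metis

text \<open>A member that vanishes at one point of a section has this section among its roots and
  vanishes on all of it; otherwise it has no zero there and keeps its sign by connectedness.\<close>

lemma delineated_section:
  fixes C :: "'a::real_normed_vector set"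
  assumes del: "delineated F p C m \<xi>" and C: "connected C"
    and p: "\<And>f x y. f \<in> F \<Longrightarrow> x \<in> C \<Longrightarrow> poly (p f x) y = f (x + y *\<^sub>R v)"
    and F: "\<And>f. f \<in> F \<Longrightarrow> polyfun f" and i: "i < m"
  shows "connected (cyl v C (\<lambda>x. {\<xi> i x}))" "sign_const F (cyl v C (\<lambda>x. {\<xi> i x}))"
proof -
  show con: "connected (cyl v C (\<lambda>x. {\<xi> i x}))"
    using del i by (intro connected_cyl[of C "\<xi> i"] C) (auto simp: delineated_def)
  show "sign_const F (cyl v C (\<lambda>x. {\<xi> i x}))"
    unfolding sign_const_def
  proof (intro ballI)
    fix f x y assume f: "f \<in> F" and xy: "x \<in> cyl v C (\<lambda>x. {\<xi> i x})" "y \<in> cyl v C (\<lambda>x. {\<xi> i x})"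
    then obtain a b where ab: "a \<in> C" "x = a + \<xi> i a *\<^sub>R v" "b \<in> C" "y = b + \<xi> i b *\<^sub>R v"
      by (auto simp: cyl_def)
    consider "\<forall>x\<in>C. p f x = 0" | I where "I \<subseteq> {..<m}" "\<And>x. x \<in> C \<Longrightarrow> {y. poly (p f x) y = 0} = (\<lambda>i. \<xi> i x) ` I"
      using delineatedD[OF del f] by metis
    then show "sgn (f x) = sgn (f y)"
    proof cases
      case 1
      then show ?thesis using p[OF f ab(1), of "\<xi> i a"] p[OF f ab(3), of "\<xi> i b"] ab by simp
    next
      case 2
      show ?thesis
      proof (rule ccontr)
        assume ns: "sgn (f x) \<noteq> sgn (f y)"
        have "f z \<noteq> 0" if "z \<in> cyl v C (\<lambda>x. {\<xi> i x})" for z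
        proof
          assume "f z = 0"
          from that obtain c where c: "c \<in> C" "z = c + \<xi> i c *\<^sub>R v" by (auto simp: cyl_def)
          then have "\<xi> i c \<in> {y. poly (p f c) y = 0}" using p[OF f c(1)] \<open>f z = 0\<close> by simp
          then obtain j where j: "j \<in> I" "\<xi> i c = \<xi> j c" using 2(2)[OF c(1)] by auto
          have "j < m" using j 2(1) by auto
          have mono: "\<xi> k c < \<xi> l c" if "k < l" "l < m" for k l
            using del that c(1) by (simp add: delineated_def)
          have "j = i" using mono[of i j] mono[of j i] i \<open>j < m\<close> j(2) by (cases i j rule: linorder_cases) auto
          then have "\<xi> i a \<in> {y. poly (p f a) y = 0}" "\<xi> i b \<in> {y. poly (p f b) y = 0}"
            unfolding 2(2)[OF ab(1)] 2(2)[OF ab(3)] using j by auto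
          then have "f x = 0" "f y = 0" using ab p[OF f ab(1)] p[OF f ab(3)] by auto
          then show False using ns by simp
        qed
        from connected_nonzero_sgn[OF con polyfun_continuous[OF F[OF f]] this xy] ns show False by simp
      qed
    qed
  qed
qed

lemma delineated_band:
  fixes C :: "'a::real_normed_vector set"
  assumes del: "delineated F p C m \<xi>" and C: "connected C"
    and p: "\<And>f x y. f \<in> F \<Longrightarrow> x \<in> C \<Longrightarrow> poly (p f x) y = f (x + y *\<^sub>R v)"
    and F: "\<And>f. f \<in> F \<Longrightarrow> polyfun f" and i: "i \<le> m"
  shows "connected (cyl v C (band m \<xi> i))" "sign_const F (cyl v C (band m \<xi> i))"
proof -
  have mono: "\<And>x i j. x \<in> C \<Longrightarrow> i < j \<Longrightarrow> j < m \<Longrightarrow> \<xi> i x < \<xi> j x" 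
    and cont: "\<And>i. i < m \<Longrightarrow> continuous_on C (\<xi> i)"
    using del by (auto simp: delineated_def)
  show con: "connected (cyl v C (band m \<xi> i))"
    using mono cont i by (intro connected_cyl[of C "band_section m \<xi> i"] C band_section_continuous
        band_section_in_band band_convex) auto
  show "sign_const F (cyl v C (band m \<xi> i))"
    unfolding sign_const_def
  proof (intro ballI)
    fix f x y assume f: "f \<in> F" and xy: "x \<in> cyl v C (band m \<xi> i)" "y \<in> cyl v C (band m \<xi> i)"
    then obtain a s b t where ab: "a \<in> C" "x = a + s *\<^sub>R v" "b \<in> C" "y = b + t *\<^sub>R v"
      by (auto simp: cyl_def)
    consider "\<forall>x\<in>C. p f x = 0" | I where "I \<subseteq> {..<m}" "\<And>x. x \<in> C \<Longrightarrow> {y. poly (p f x) y = 0} = (\<lambda>i. \<xi> i x) ` I"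
      using delineatedD[OF del f] by metis
    then show "sgn (f x) = sgn (f y)"
    proof cases
      case 1
      then show ?thesis using p[OF f ab(1), of s] p[OF f ab(3), of t] ab by simp
    next
      case 2
      show ?thesis
      proof (rule connected_nonzero_sgn[OF con polyfun_continuous[OF F[OF f]] _ xy])
        fix z assume "z \<in> cyl v C (band m \<xi> i)"
        then obtain c u where c: "c \<in> C" "z = c + u *\<^sub>R v" "u \<in> band m \<xi> i c" by (auto simp: cyl_def)
        show "f z \<noteq> 0"
        proof
          assume "f z = 0"
          then have "u \<in> {y. poly (p f c) y = 0}" using p[OF f c(1)] c by simp
          then obtain j where "j \<in> I" "u = \<xi> j c" using 2(2)[OF c(1)] by auto
          then show False using band_not_root[of m \<xi> c i j] mono[OF c(1)] i 2(1) c(3) by auto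
        qed
      qed
    qed
  qed
qed

lemma sign_constD: "sign_const G C \<Longrightarrow> g \<in> G \<Longrightarrow> x \<in> C \<Longrightarrow> y \<in> C \<Longrightarrow> sgn (g x) = sgn (g y)"
  unfolding sign_const_def by blast

subsection \<open>Constructible sets\<close>

text \<open>By delineation this class is closed under projections without any analysis of which sign
  conditions are realised; it contains the semialgebraic sets.\<close>

definition constructible :: "'a::real_normed_vector set \<Rightarrow> bool" where
  "constructible S \<longleftrightarrow> (\<exists>G. finite G \<and> (\<forall>g\<in>G. polyfun g) \<and>
     (\<forall>C. connected C \<longrightarrow> sign_const G C \<longrightarrow> C \<subseteq> S \<or> C \<inter> S = {}))"

lemma constructibleE:
  assumes "constructible S"
  obtains G where "finite G" "\<forall>g\<in>G. polyfun g"
    "\<forall>C. connected C \<longrightarrow> sign_const G C \<longrightarrow> C \<subseteq> S \<or> C \<inter> S = {}"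
  using assms unfolding constructible_def by (elim exE conjE)

lemma constructible_sgn:
  assumes "polyfun p" shows "constructible {x. Q (sgn (p x))}"
proof -
  have "C \<subseteq> {x. Q (sgn (p x))} \<or> C \<inter> {x. Q (sgn (p x))} = {}" if "sign_const {p} C" for C
  proof (cases "\<exists>x\<in>C. Q (sgn (p x))")
    case True
    then obtain x where x: "x \<in> C" "Q (sgn (p x))" by blast
    have "sgn (p y) = sgn (p x)" if "y \<in> C" for y
      using \<open>sign_const {p} C\<close> x(1) that unfolding sign_const_def by blast
    then show ?thesis using x(2) by auto
  qed auto
  then show ?thesis unfolding constructible_def using assms by (intro exI[of _ "{p}"]) blast
qed

lemma constructible_Compl: "constructible S \<Longrightarrow> constructible (- S)"
  unfolding constructible_def by (elim exE, rule exI) auto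

lemma constructible_Un:
  assumes "constructible S" "constructible T" shows "constructible (S \<union> T)"
proof -
  obtain G where G: "finite G" "\<forall>g\<in>G. polyfun g" "\<forall>C. connected C \<longrightarrow> sign_const G C \<longrightarrow> C \<subseteq> S \<or> C \<inter> S = {}"
    by (rule constructibleE[OF assms(1)])
  obtain H where H: "finite H" "\<forall>g\<in>H. polyfun g" "\<forall>C. connected C \<longrightarrow> sign_const H C \<longrightarrow> C \<subseteq> T \<or> C \<inter> T = {}"
    by (rule constructibleE[OF assms(2)])
  have "C \<subseteq> S \<union> T \<or> C \<inter> (S \<union> T) = {}" if C: "connected C" "sign_const (G \<union> H) C" for C
  proof -
    have "sign_const G C" "sign_const H C" using sign_const_mono[OF C(2)] by auto
    then show ?thesis using G(3) H(3) C(1) by (metis Int_Un_distrib Un_empty le_supI1 le_supI2)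
  qed
  then show ?thesis unfolding constructible_def
    by (intro exI[of _ "G \<union> H"]) (use G H in auto)
qed

lemma constructible_Int:
  assumes "constructible S" "constructible T" shows "constructible (S \<inter> T)"
  using constructible_Compl[OF constructible_Un[OF assms[THEN constructible_Compl]]] by simp

lemma constructible_eq: "polyfun p \<Longrightarrow> polyfun q \<Longrightarrow> constructible {x. p x = q x}"
  using constructible_sgn[OF polyfun_diff, of p q "\<lambda>s. s = 0"] by (simp add: sgn_0_0)

lemma constructible_less: "polyfun p \<Longrightarrow> polyfun q \<Longrightarrow> constructible {x. p x < q x}"
  using constructible_sgn[OF polyfun_diff, of q p "\<lambda>s. s = 1"] by (simp add: sgn_1_pos)

lemma constructible_le: "polyfun p \<Longrightarrow> polyfun q \<Longrightarrow> constructible {x. p x \<le> q x}"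
  using constructible_Compl[OF constructible_less, of q p] by (simp add: Compl_eq not_less)

lemma constructible_Collect_conj: "constructible {x. P x} \<Longrightarrow> constructible {x. Q x} \<Longrightarrow> constructible {x. P x \<and> Q x}"
  using constructible_Int[of "{x. P x}" "{x. Q x}"] by (simp add: Collect_conj_eq)

lemma constructible_Collect_disj: "constructible {x. P x} \<Longrightarrow> constructible {x. Q x} \<Longrightarrow> constructible {x. P x \<or> Q x}"
  using constructible_Un[of "{x. P x}" "{x. Q x}"] by (simp add: Collect_disj_eq)

lemma constructible_Collect_not: "constructible {x. P x} \<Longrightarrow> constructible {x. \<not> P x}"
  using constructible_Compl[of "{x. P x}"] by (simp add: Collect_neg_eq)

lemma constructible_Collect_True: "constructible {x. b}"
  using constructible_sgn[OF pf_const, of "\<lambda>_. b"] by simp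

lemma constructible_Collect_ball:
  assumes "finite I" "\<And>i. i \<in> I \<Longrightarrow> constructible {x. P i x}"
  shows "constructible {x. \<forall>i\<in>I. P i x}"
  using assms
proof (induction I rule: finite_induct)
  case empty
  show ?case using constructible_Collect_True[of True] by simp
next
  case (insert i I)
  then have "constructible {x. P i x \<and> (\<forall>i\<in>I. P i x)}" by (intro constructible_Collect_conj) auto
  then show ?case by simp
qed

lemma semialgebraic_imp_constructible: "semialgebraic S \<Longrightarrow> constructible S"
proof (induction rule: semialgebraic.induct)
  case (sa_zero p)
  then show ?case using constructible_eq[OF _ pf_const, of p 0] by simp
next
  case (sa_pos p)
  then show ?case using constructible_less[OF pf_const, of p 0] by simp
qed (auto intro: constructible_Un constructible_Int constructible_Compl)

lemma constructible_vimage: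
  assumes S: "constructible S" and cont: "continuous_on UNIV f"
    and pf: "\<And>l. bounded_linear l \<Longrightarrow> polyfun (\<lambda>x. l (f x) :: real)"
  shows "constructible {x. f x \<in> S}"
proof -
  obtain G where G: "finite G" "\<forall>g\<in>G. polyfun g" "\<forall>C. connected C \<longrightarrow> sign_const G C \<longrightarrow> C \<subseteq> S \<or> C \<inter> S = {}"
    by (rule constructibleE[OF S])
  define H where "H = (\<lambda>g x. g (f x)) ` G"
  have "finite H" using G by (auto simp: H_def)
  moreover have "\<forall>h\<in>H. polyfun h"
  proof
    fix h assume "h \<in> H"
    then obtain g where g: "g \<in> G" "h = (\<lambda>x. g (f x))" by (auto simp: H_def)
    then have "polyfun g" using G(2) by simp
    then show "polyfun h" unfolding g(2) by (rule polyfun_compose) (rule pf)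
  qed
  moreover have "C \<subseteq> {x. f x \<in> S} \<or> C \<inter> {x. f x \<in> S} = {}" if "connected C" "sign_const H C" for C
  proof -
    have "connected (f ` C)" using that cont by (meson connected_continuous_image continuous_on_subset subset_UNIV)
    moreover have "sign_const G (f ` C)"
      unfolding sign_const_def
    proof (intro ballI, elim imageE)
      fix g x y a b assume *: "g \<in> G" "x = f a" "a \<in> C" "y = f b" "b \<in> C"
      then have "(\<lambda>x. g (f x)) \<in> H" by (simp add: H_def)
      from sign_constD[OF that(2) this *(3,5)] show "sgn (g x) = sgn (g y)" unfolding *(2,4) .
    qed
    ultimately have "f ` C \<subseteq> S \<or> f ` C \<inter> S = {}" using G(3) by blast
    then show ?thesis by blast
  qed
  ultimately show ?thesis unfolding constructible_def by (intro exI[of _ H]) auto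
qed

lemma constructible_vimage_linear:
  assumes "constructible S" "bounded_linear f" shows "constructible {x. f x \<in> S}"
  by (rule constructible_vimage[OF assms(1) linear_continuous_on[OF assms(2)]])
    (rule pf_lin, erule bounded_linear_compose[OF _ assms(2)])

text \<open>A fibre point in \<open>S\<close> lies on a section or in a band over \<open>C\<close>.
  That cell is connected with constant signs, hence contained in \<open>S\<close>, and it has points
  over all of \<open>C\<close>.\<close>

lemma constructible_exists_line:
  assumes "constructible S"
  shows "constructible {x. \<exists>y. x + y *\<^sub>R v \<in> S}"
proof -
  obtain F where F0: "finite F" "\<forall>f\<in>F. polyfun f" 
    "\<forall>C. connected C \<longrightarrow> sign_const F C \<longrightarrow> C \<subseteq> S \<or> C \<inter> S = {}"
    by (rule constructibleE[OF assms])
  then have F: "finite F" "\<And>f. f \<in> F \<Longrightarrow> polyfun f" 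
    "\<And>C. connected C \<Longrightarrow> sign_const F C \<Longrightarrow> C \<subseteq> S \<or> C \<inter> S = {}" by auto
  have "\<forall>f\<in>F. \<exists>p. polyfam p \<and> (\<forall>x y. poly (p x) y = f (x + y *\<^sub>R v))"
    using line_polyfam F(2) by blast
  then obtain p where p: "\<And>f. f \<in> F \<Longrightarrow> polyfam (p f)" "\<And>f x y. f \<in> F \<Longrightarrow> poly (p f x) y = f (x + y *\<^sub>R v)"
    by metis
  obtain G where G: "finite G \<and> (\<forall>g\<in>G. polyfun g) \<and>
    (\<forall>C. connected C \<longrightarrow> C \<noteq> {} \<longrightarrow> sign_const G C \<longrightarrow> (\<exists>m \<xi>. delineated F p C m \<xi>))"
    using delineation[OF F(1) p(1)] by (rule exE)
  have "C \<subseteq> {x. \<exists>y. x + y *\<^sub>R v \<in> S} \<or> C \<inter> {x. \<exists>y. x + y *\<^sub>R v \<in> S} = {}"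
    if C: "connected C" "sign_const G C" for C
  proof (rule disjCI)
    assume "C \<inter> {x. \<exists>y. x + y *\<^sub>R v \<in> S} \<noteq> {}"
    then obtain x y where xy: "x \<in> C" "x + y *\<^sub>R v \<in> S" by blast
    then obtain m \<xi> where del: "delineated F p C m \<xi>" using G C by blast
    have mono: "\<And>x i j. x \<in> C \<Longrightarrow> i < j \<Longrightarrow> j < m \<Longrightarrow> \<xi> i x < \<xi> j x" 
      using del by (auto simp: delineated_def)
    have key: "C \<subseteq> {x. \<exists>y. x + y *\<^sub>R v \<in> S}" if "connected (cyl v C I)" "sign_const F (cyl v C I)" "y \<in> I x"
      and ne: "\<And>x. x \<in> C \<Longrightarrow> I x \<noteq> {}" for I
    proof -
      have "x + y *\<^sub>R v \<in> cyl v C I" using that(3) xy(1) by (auto simp: cyl_def)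
      then have sub: "cyl v C I \<subseteq> S" using F(3)[OF that(1,2)] xy(2) by blast
      show ?thesis
      proof
        fix a assume a: "a \<in> C"
        then obtain b where "b \<in> I a" using ne by blast
        then have "a + b *\<^sub>R v \<in> cyl v C I" using a by (auto simp: cyl_def)
        then show "a \<in> {x. \<exists>y. x + y *\<^sub>R v \<in> S}" using sub by blast
      qed
    qed
    from band_or_root[of m y \<xi> x] consider i where "i < m" "y = \<xi> i x" | i where "i \<le> m" "y \<in> band m \<xi> i x" by blast
    then show "C \<subseteq> {x. \<exists>y. x + y *\<^sub>R v \<in> S}"
    proof cases
      case 1
      show ?thesis 
        using key[OF delineated_section[OF del C(1) p(2) F(2) 1(1)]] 1(2) by blast
    next
      case 2
      have "band m \<xi> i a \<noteq> {}" if "a \<in> C" for a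
        using band_section_in_band[of m \<xi> a i] mono[OF that] 2(1) by blast
      then show ?thesis
        using key[OF delineated_band[OF del C(1) p(2) F(2) 2(1)] 2(2)] by blast
    qed
  qed
  then show ?thesis unfolding constructible_def using G by (intro exI[of _ G]) auto
qed

text \<open>The coordinates of \<open>y\<close> are eliminated one by one along lines of direction
  \<open>(0, b)\<close>; afterwards the second component is set to zero.\<close>

lemma constructible_Collect_ex:
  fixes P :: "'a::real_normed_vector \<Rightarrow> 'b::euclidean_space \<Rightarrow> bool"
  assumes "constructible {z. P (fst z) (snd z)}"
  shows "constructible {x. \<exists>y. P x y}"
proof -
  define S where "S = {z. P (fst z) (snd z)}"
  have "constructible {z. \<exists>c. z + (\<Sum>b\<in>B. c b *\<^sub>R (0, b)) \<in> S}" if "finite B" for B :: "'b set"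
    using that
  proof (induction B rule: finite_induct)
    case empty
    then show ?case using assms by (simp add: S_def)
  next
    case (insert b B)
    have "{z. \<exists>c. z + (\<Sum>b\<in>insert b B. c b *\<^sub>R (0, b)) \<in> S} = 
      {z. \<exists>y. z + y *\<^sub>R (0, b) \<in> {z. \<exists>c. z + (\<Sum>b\<in>B. c b *\<^sub>R (0, b)) \<in> S}}" (is "?L = ?R")
    proof (intro equalityI subsetI)
      fix z assume "z \<in> ?L"
      then obtain c where "z + (\<Sum>b\<in>insert b B. c b *\<^sub>R (0, b)) \<in> S" by blast
      then have "z + c b *\<^sub>R (0, b) + (\<Sum>b\<in>B. c b *\<^sub>R (0, b)) \<in> S"
        using insert.hyps by (simp add: add.assoc)
      then show "z \<in> ?R" by blast
    next
      fix z assume "z \<in> ?R"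
      then obtain y c where c: "z + y *\<^sub>R (0, b) + (\<Sum>b\<in>B. c b *\<^sub>R (0, b)) \<in> S" by blast
      have "(\<Sum>x\<in>B. (c(b := y)) x *\<^sub>R (0, x)) = (\<Sum>b\<in>B. c b *\<^sub>R (0, b) :: 'a \<times> 'b)"
        using insert.hyps by (intro sum.cong) auto
      then have "z + (\<Sum>x\<in>insert b B. (c(b := y)) x *\<^sub>R (0, x)) \<in> S"
        using insert.hyps c by (simp add: add.assoc del: fun_upd_apply) simp
      then show "z \<in> ?L" by blast
    qed
    then show ?case using constructible_exists_line[OF insert.IH, of "(0, b)"] by simp
  qed
  from this[OF finite_Basis]
  have "constructible {x. (x, 0) \<in> {z. \<exists>c. z + (\<Sum>b\<in>Basis. c b *\<^sub>R (0, b)) \<in> S}}"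
    by (rule constructible_vimage_linear) (intro bounded_linear_Pair bounded_linear_ident bounded_linear_zero)
  moreover have "{x. (x, 0) \<in> {z. \<exists>c. z + (\<Sum>b\<in>Basis. c b *\<^sub>R (0, b)) \<in> S}} = {x. \<exists>y. P x y}"
  proof (intro equalityI subsetI)
    fix x assume "x \<in> {x. \<exists>y. P x y}"
    then obtain y where "P x y" by blast
    have "(\<Sum>b\<in>Basis. (y \<bullet> b) *\<^sub>R (0, b)) = (0::'a, y)"
      by (auto simp: prod_eq_iff fst_sum snd_sum euclidean_representation)
    then have "(x, 0) + (\<Sum>b\<in>Basis. (y \<bullet> b) *\<^sub>R (0, b)) \<in> S" using \<open>P x y\<close> by (simp add: S_def)
    then show "x \<in> {x. (x, 0) \<in> {z. \<exists>c. z + (\<Sum>b\<in>Basis. c b *\<^sub>R (0, b)) \<in> S}}" by blast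
  next
    fix x assume "x \<in> {x. (x, 0) \<in> {z. \<exists>c. z + (\<Sum>b\<in>Basis. c b *\<^sub>R (0, b)) \<in> S}}"
    then obtain c where "(x, 0) + (\<Sum>b\<in>Basis. c b *\<^sub>R (0, b)) \<in> S" by blast
    then show "x \<in> {x. \<exists>y. P x y}" by (auto simp: S_def fst_sum snd_sum)
  qed
  ultimately show ?thesis by simp
qed

subsection \<open>Cylindrical decomposition\<close>

text \<open>Local connectedness of \<open>D\<close> at all points of its closure, not only at its
  own points. It prevents \<open>D\<close> from approaching a boundary point from two sides, where a
  continuous root could have two different limits.\<close>

definition lconn :: "'a::metric_space set \<Rightarrow> bool" where
  "lconn D \<longleftrightarrow> (\<forall>x\<in>closure D. \<forall>e>0. \<exists>d>0. \<exists>N. connected N \<and> N \<subseteq> D \<inter> ball x e \<and> D \<inter> ball x d \<subseteq> N)"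

section \<open>Extension of roots to the closure of a cell\<close>

lemma extend_to_closure:
  fixes f :: "'a::metric_space \<Rightarrow> real"
  assumes lim: "\<And>x0. x0 \<in> closure S \<Longrightarrow> \<exists>l. \<forall>e>0. \<exists>d>0. \<forall>x\<in>S. dist x x0 < d \<longrightarrow> \<bar>f x - l\<bar> < e"
  shows "\<exists>g. continuous_on (closure S) g \<and> (\<forall>x\<in>S. g x = f x)"
proof -
  obtain g where g: "\<And>x0 e. x0 \<in> closure S \<Longrightarrow> e > 0 \<Longrightarrow> \<exists>d>0. \<forall>x\<in>S. dist x x0 < d \<longrightarrow> \<bar>f x - g x0\<bar> < e"
    using lim by metis
  have "g x = f x" if "x \<in> S" for x
  proof (rule ccontr)
    assume "g x \<noteq> f x"
    then have "\<bar>f x - g x\<bar> > 0" by simp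
    from g[OF subsetD[OF closure_subset that] this] that show False by auto
  qed
  moreover have "continuous_on (closure S) g"
    unfolding continuous_on_iff
  proof (intro ballI allI impI)
    fix x0 e :: real and x0' assume x0: "x0' \<in> closure S" and e: "0 < e"
    obtain d where d: "d > 0" "\<And>x. x \<in> S \<Longrightarrow> dist x x0' < d \<Longrightarrow> \<bar>f x - g x0'\<bar> < e / 2"
      using g[OF x0, of "e / 2"] e by auto
    show "\<exists>d>0. \<forall>x'\<in>closure S. dist x' x0' < d \<longrightarrow> dist (g x') (g x0') < e"
    proof (intro exI[of _ "d / 2"] conjI ballI impI)
      fix y assume y: "y \<in> closure S" "dist y x0' < d / 2"
      obtain d' where d': "d' > 0" "\<And>x. x \<in> S \<Longrightarrow> dist x y < d' \<Longrightarrow> \<bar>f x - g y\<bar> < e / 2"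
        using g[OF y(1), of "e / 2"] e by auto
      obtain x where x: "x \<in> S" "dist x y < min d' (d / 2)"
        using y(1) d(1) d'(1) unfolding closure_approachable by (metis half_gt_zero min_less_iff_conj)
      have "dist x x0' < d" using dist_triangle[of x x0' y] x(2) y(2) by linarith
      then have "\<bar>f x - g x0'\<bar> < e / 2" "\<bar>f x - g y\<bar> < e / 2" using d(2) d'(2) x by auto
      then show "dist (g y) (g x0') < e" unfolding dist_real_def by linarith
    qed (use d in auto)
  qed
  ultimately show ?thesis by blast
qed

text \<open>Near a boundary point the values of \<open>\<xi>\<close> are close to the finitely many
  roots of the limit polynomial. A connected neighbourhood within \<open>sig\<close> keeps them near
  one and the same root, which is the limit.\<close>

lemma root_extends_to_closure:
  fixes sig :: "'a::metric_space set" and P :: "'a \<Rightarrow> real poly"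
  assumes lc: "lconn sig" and \<xi>: "continuous_on sig \<xi>"
    and P: "\<And>i. continuous_on (closure sig) (\<lambda>x. coeff (P x) i)"
    and deg: "\<And>x. x \<in> closure sig \<Longrightarrow> degree (P x) = d" "\<And>x. x \<in> closure sig \<Longrightarrow> coeff (P x) d = c" "c \<noteq> 0"
    and root: "\<And>x. x \<in> sig \<Longrightarrow> poly (P x) (\<xi> x) = 0"
  shows "\<exists>g. continuous_on (closure sig) g \<and> (\<forall>x\<in>sig. g x = \<xi> x) \<and> (\<forall>x\<in>closure sig. poly (P x) (g x) = 0)"
proof -
  have polyc: "continuous_on (closure sig) (\<lambda>x. poly (P x) (h x))" if "continuous_on (closure sig) h" for h
  proof -
    have "continuous_on (closure sig) (\<lambda>x. \<Sum>i\<le>d. coeff (P x) i * h x ^ i)"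
      by (intro continuous_intros P that)
    then show ?thesis
      by (rule continuous_on_eq) (simp add: poly_altdef deg)
  qed
  have nz: "P x \<noteq> 0" if "x \<in> closure sig" for x
  proof
    assume "P x = 0"
    then show False using deg(2)[OF that] deg(3) by simp
  qed
  have "\<exists>l. \<forall>e>0. \<exists>\<delta>>0. \<forall>x\<in>sig. dist x x0 < \<delta> \<longrightarrow> \<bar>\<xi> x - l\<bar> < e" if x0: "x0 \<in> closure sig" for x0
  proof -
    define R where "R = {y. poly (P x0) y = 0}"
    have finR: "finite R" unfolding R_def using nz[OF x0] by (rule poly_roots_finite)
    \<comment> \<open>Otherwise a sequence of roots stays away from \<open>R\<close>. It is bounded
      because the leading coefficient is the constant \<open>c\<close>, and a limit point of it
      would be a root of \<open>P x0\<close>.\<close>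
    have near: "\<exists>\<delta>>0. \<forall>x\<in>sig. dist x x0 < \<delta> \<longrightarrow> (\<exists>r\<in>R. \<bar>\<xi> x - r\<bar> < e)" if e: "e > 0" for e
    proof (rule ccontr)
      assume *: "\<not> ?thesis"
      have "\<exists>x\<in>sig. dist x x0 < 1 / Suc n \<and> (\<forall>r\<in>R. \<not> \<bar>\<xi> x - r\<bar> < e)" for n
        using * by (metis of_nat_0_less_iff zero_less_Suc zero_less_divide_1_iff)
      then obtain X where X: "\<And>n. X n \<in> sig" "\<And>n. dist (X n) x0 < 1 / Suc n" "\<And>n r. r \<in> R \<Longrightarrow> \<not> \<bar>\<xi> (X n) - r\<bar> < e"
        by metis
      have Xlim: "X \<longlonglongrightarrow> x0"
      proof (rule metric_tendsto_imp_tendsto[OF LIMSEQ_inverse_real_of_nat])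
        show "\<forall>\<^sub>F n in sequentially. dist (X n) x0 \<le> dist (inverse (real (Suc n))) 0"
          using X(2) by (intro always_eventually) (auto simp: less_imp_le divide_inverse)
      qed
      have Xc: "X n \<in> closure sig" for n using X(1) closure_subset by blast
      define B where "B n = 1 + (\<Sum>i<d. \<bar>coeff (P (X n)) i\<bar>) / \<bar>c\<bar>" for n
      have cl: "(\<lambda>n. coeff (P (X n)) i) \<longlonglongrightarrow> coeff (P x0) i" for i
        using P[of i] Xlim Xc x0 unfolding continuous_on_sequentially by (auto simp: o_def)
      have "B \<longlonglongrightarrow> 1 + (\<Sum>i<d. \<bar>coeff (P x0) i\<bar>) / \<bar>c\<bar>"
        unfolding B_def using deg by (intro tendsto_intros cl) auto
      then have "Bseq B" by (intro convergent_imp_Bseq convergentI)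
      then obtain M where M: "\<And>n. \<bar>B n\<bar> \<le> M" by (auto simp: Bseq_def)
      have "\<xi> (X n) \<in> cball 0 M" for n
        using poly_root_bound[OF nz[OF Xc] root[OF X(1)], of n] M[of n] deg Xc[of n] by (simp add: B_def)
      then obtain y s where s: "strict_mono s" "((\<lambda>n. \<xi> (X n)) \<circ> s) \<longlonglongrightarrow> y"
        using seq_compactE[OF compact_imp_seq_compact[OF compact_cball], of "\<lambda>n. \<xi> (X n)" 0 M] by metis
      have "(\<lambda>n. \<Sum>i\<le>d. coeff (P (X (s n))) i * \<xi> (X (s n)) ^ i) \<longlonglongrightarrow> (\<Sum>i\<le>d. coeff (P x0) i * y ^ i)"
        using s(2) LIMSEQ_subseq_LIMSEQ[OF cl s(1)] by (intro tendsto_intros) (auto simp: o_def)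
      moreover have "(\<Sum>i\<le>d. coeff (P (X (s n))) i * \<xi> (X (s n)) ^ i) = 0" for n
        using root[OF X(1), of "s n"] deg(1)[OF Xc[of "s n"]] by (simp add: poly_altdef)
      moreover have "(\<Sum>i\<le>d. coeff (P x0) i * y ^ i) = poly (P x0) y"
        using deg(1)[OF x0] by (simp add: poly_altdef)
      ultimately have "poly (P x0) y = 0" by (simp add: LIMSEQ_const_iff)
      then have "y \<in> R" by (simp add: R_def)
      have "eventually (\<lambda>n. dist (((\<lambda>n. \<xi> (X n)) \<circ> s) n) y < e) sequentially"
        using s(2) e unfolding tendsto_iff by blast
      then obtain n where "dist (\<xi> (X (s n))) y < e" by (auto simp: eventually_sequentially)
      then show False using X(3)[OF \<open>y \<in> R\<close>, of "s n"] by (simp add: dist_real_def)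
    qed
    \<comment> \<open>\<open>4 * s\<close> bounds the gaps between the roots from below, so balls of
      radius \<open>s\<close> about them are disjoint; the element \<open>1\<close> covers the case
      of fewer than two roots.\<close>
    obtain s where s: "s > 0" "\<And>r r'. r \<in> R \<Longrightarrow> r' \<in> R \<Longrightarrow> r \<noteq> r' \<Longrightarrow> 4 * s \<le> \<bar>r - r'\<bar>"
    proof -
      define D where "D = insert 1 ((\<lambda>(r,r'). \<bar>r - r'\<bar>) ` {(r,r'). r \<in> R \<and> r' \<in> R \<and> r \<noteq> r'})"
      have "finite {(r,r'). r \<in> R \<and> r' \<in> R \<and> r \<noteq> r'}"
        by (rule finite_subset[of _ "R \<times> R"]) (use finR in auto)
      then have finD: "finite D" by (auto simp: D_def)
      have "Min D \<in> D" using finD by (intro Min_in) (auto simp: D_def)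
      then have "0 < Min D / 4" by (auto simp: D_def)
      moreover have "4 * (Min D / 4) \<le> \<bar>r - r'\<bar>" if "r \<in> R" "r' \<in> R" "r \<noteq> r'" for r r'
        using Min_le[OF finD, of "\<bar>r - r'\<bar>"] that by (force simp: D_def)
      ultimately show ?thesis using that by blast
    qed
    obtain \<delta> where \<delta>: "\<delta> > 0" "\<And>x. x \<in> sig \<Longrightarrow> dist x x0 < \<delta> \<Longrightarrow> \<exists>r\<in>R. \<bar>\<xi> x - r\<bar> < s"
      using near[OF s(1)] by blast
    obtain \<delta>' N where N: "\<delta>' > 0" "connected N" "N \<subseteq> sig \<inter> ball x0 \<delta>" "sig \<inter> ball x0 \<delta>' \<subseteq> N"
      using lc x0 \<delta>(1) unfolding lconn_def by metis
    obtain x1 where x1: "x1 \<in> sig" "dist x1 x0 < \<delta>'" using x0 N(1) by (auto simp: closure_approachable)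
    then have x1N: "x1 \<in> N" using N(4) by (auto simp: dist_commute)
    have Nnear: "\<exists>r\<in>R. \<bar>\<xi> x - r\<bar> < s" if "x \<in> N" for x
    proof (rule \<delta>(2))
      show "x \<in> sig" "dist x x0 < \<delta>" using that N(3) by (auto simp: dist_commute)
    qed
    then obtain l where l: "l \<in> R" "\<bar>\<xi> x1 - l\<bar> < s" using x1N by blast
    have Nl: "\<bar>\<xi> x - l\<bar> < s" if x: "x \<in> N" for x
    proof (rule ccontr)
      assume far: "\<not> \<bar>\<xi> x - l\<bar> < s"
      have con: "connected (\<xi> ` N)"
        using N(2,3) \<xi> by (metis connected_continuous_image continuous_on_subset le_inf_iff)
      define U where "U = (\<Union>r\<in>R - {l}. ball r s)"
      have "\<xi> ` N \<subseteq> ball l s \<union> U"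
      proof
        fix y assume "y \<in> \<xi> ` N"
        then obtain a where a: "a \<in> N" "y = \<xi> a" by blast
        then obtain r where "r \<in> R" "\<bar>y - r\<bar> < s" using Nnear[of a] by blast
        then show "y \<in> ball l s \<union> U" by (cases "r = l") (auto simp: U_def dist_real_def abs_minus_commute)
      qed
      moreover have "ball l s \<inter> U \<inter> \<xi> ` N = {}"
      proof -
        have "False" if y: "y \<in> ball l s" "r \<in> R" "r \<noteq> l" "y \<in> ball r s" for y r
          using s(2)[OF y(2) l(1) y(3)] s(1) y(1,4) by (auto simp: dist_real_def)
        then show ?thesis unfolding U_def by blast
      qed
      moreover have "open U" "open (ball l s)" by (auto simp: U_def)
      moreover have "\<xi> x1 \<in> ball l s \<inter> \<xi> ` N" using x1N l by (auto simp: dist_real_def abs_minus_commute)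
      moreover have "\<xi> x \<in> \<xi> ` N" "\<xi> x \<notin> ball l s" using x far by (auto simp: dist_real_def abs_minus_commute)
      ultimately show False using connectedD[OF con, of "ball l s" U] by blast
    qed
    show ?thesis
    proof (rule exI[of _ l], intro allI impI)
      fix e :: real assume "e > 0"
      then obtain \<delta>2 where d2: "\<delta>2 > 0" "\<And>x. x \<in> sig \<Longrightarrow> dist x x0 < \<delta>2 \<Longrightarrow> \<exists>r\<in>R. \<bar>\<xi> x - r\<bar> < min e s"
        using near[of "min e s"] s(1) by (metis min_less_iff_conj)
      show "\<exists>\<delta>>0. \<forall>x\<in>sig. dist x x0 < \<delta> \<longrightarrow> \<bar>\<xi> x - l\<bar> < e"
      proof (intro exI[of _ "min \<delta>' \<delta>2"] conjI ballI impI)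
        fix x assume x: "x \<in> sig" "dist x x0 < min \<delta>' \<delta>2"
        then obtain r where r: "r \<in> R" "\<bar>\<xi> x - r\<bar> < min e s" using d2(2)[of x] by auto
        have "x \<in> N" using x N(4) by (auto simp: dist_commute)
        then have "\<bar>\<xi> x - l\<bar> < s" by (rule Nl)
        then have "r = l" using s(2)[OF r(1) l(1)] r(2) s(1) by (cases "r = l") auto
        then show "\<bar>\<xi> x - l\<bar> < e" using r by simp
      qed (use N d2 in auto)
    qed
  qed
  then obtain g where g: "continuous_on (closure sig) g" "\<forall>x\<in>sig. g x = \<xi> x"
    using extend_to_closure[of sig \<xi>] by blast
  have "poly (P x) (g x) = 0" if "x \<in> closure sig" for x
    by (rule continuous_constant_on_closure[OF polyc[OF g(1)] _ that]) (use g root in auto)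
  with g show ?thesis by blast
qed

section \<open>Cylinders over the closure of a cell\<close>

definition prj :: "'a::real_inner \<Rightarrow> 'a \<Rightarrow> 'a" where "prj v z = z - ((z \<bullet> v) / (v \<bullet> v)) *\<^sub>R v"
definition hgt :: "'a::real_inner \<Rightarrow> 'a \<Rightarrow> real" where "hgt v z = (z \<bullet> v) / (v \<bullet> v)"

lemma prj_hgt: "prj v z + hgt v z *\<^sub>R v = z"
  by (simp add: prj_def hgt_def)

lemma prj_eq: "v \<noteq> 0 \<Longrightarrow> w \<bullet> v = 0 \<Longrightarrow> prj v (w + y *\<^sub>R v) = w"
  and hgt_eq: "v \<noteq> 0 \<Longrightarrow> w \<bullet> v = 0 \<Longrightarrow> hgt v (w + y *\<^sub>R v) = y"
  by (auto simp: prj_def hgt_def inner_add_left)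

lemma continuous_on_prj [continuous_intros]: "continuous_on S f \<Longrightarrow> continuous_on S (\<lambda>x. prj v (f x))"
  and continuous_on_hgt [continuous_intros]: "continuous_on S f \<Longrightarrow> continuous_on S (\<lambda>x. hgt v (f x))"
proof -
  assume f: "continuous_on S f"
  have 1: "continuous_on S (\<lambda>x. f x \<bullet> v * inverse (v \<bullet> v))"
    by (rule continuous_on_mult[OF _ continuous_on_const]) (intro continuous_intros f)
  then show "continuous_on S (\<lambda>x. hgt v (f x))" by (simp add: hgt_def divide_inverse)
  show "continuous_on S (\<lambda>x. prj v (f x))"
    unfolding prj_def divide_inverse
    by (intro continuous_on_diff f continuous_on_scaleR 1 continuous_on_const)
qed

lemma cylI: "w \<in> C \<Longrightarrow> y \<in> I w \<Longrightarrow> w + y *\<^sub>R v \<in> cyl v C I"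
  by (auto simp: cyl_def)

lemma mem_cyl_iff:
  assumes "v \<noteq> 0" "\<And>w. w \<in> sig \<Longrightarrow> w \<bullet> v = 0"
  shows "z \<in> cyl v sig I \<longleftrightarrow> prj v z \<in> sig \<and> hgt v z \<in> I (prj v z)"
proof
  assume "z \<in> cyl v sig I"
  then show "prj v z \<in> sig \<and> hgt v z \<in> I (prj v z)" using assms by (auto simp: cyl_def prj_eq hgt_eq)
next
  assume "prj v z \<in> sig \<and> hgt v z \<in> I (prj v z)"
  then show "z \<in> cyl v sig I" unfolding cyl_def using prj_hgt[of v z] by (metis (mono_tags, lifting) mem_Collect_eq)
qed

text \<open>In the next two lemmas \<open>c\<close> clamps a height into the closed fibre and \<open>s\<close> is a section of the
  open fibre towards which closed fibres contract.\<close>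

lemma
  fixes v :: "'a::euclidean_space"
  assumes v: "v \<noteq> 0" and orth: "\<And>w. w \<in> closure sig \<Longrightarrow> w \<bullet> v = 0"
    and c: "continuous_on (closure sig \<times> UNIV) (\<lambda>(w, y). c w y)"
    and c1: "\<And>w y. w \<in> closure sig \<Longrightarrow> c w y \<in> Ib w" and c2: "\<And>w y. w \<in> closure sig \<Longrightarrow> y \<in> Ib w \<Longrightarrow> c w y = y"
    and s: "continuous_on (closure sig) s"
    and s1: "\<And>w y t. w \<in> sig \<Longrightarrow> y \<in> Ib w \<Longrightarrow> 0 < t \<Longrightarrow> t \<le> 1 \<Longrightarrow> (1 - t) * y + t * s w \<in> I w"
    and I: "\<And>w. w \<in> sig \<Longrightarrow> I w \<subseteq> Ib w"
  shows closure_cyl: "closure (cyl v sig I) = cyl v (closure sig) Ib"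
    and AR_closure_cyl: "AR (closure sig) \<Longrightarrow> AR (cyl v (closure sig) Ib)"
    and lconn_cyl: "lconn sig \<Longrightarrow> (\<And>w. w \<in> sig \<Longrightarrow> convex (I w)) \<Longrightarrow> lconn (cyl v sig I)"
proof -
  have sigcl: "w \<in> closure sig" if "w \<in> sig" for w using that closure_subset by blast
  have mem: "z \<in> cyl v sig I \<longleftrightarrow> prj v z \<in> sig \<and> hgt v z \<in> I (prj v z)" for z
    by (rule mem_cyl_iff[OF v]) (use orth sigcl in blast)
  have memb: "z \<in> cyl v (closure sig) Ib \<longleftrightarrow> prj v z \<in> closure sig \<and> hgt v z \<in> Ib (prj v z)" for z
    by (rule mem_cyl_iff[OF v]) (use orth in blast)
  have cc: "continuous_on T (\<lambda>z. c (f z) (g z))" if "continuous_on T f" "continuous_on T g" "f ` T \<subseteq> closure sig"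
    for T :: "'b::topological_space set" and f g
  proof -
    have "continuous_on T (\<lambda>z. (\<lambda>(w, y). c w y) (f z, g z))"
      by (rule continuous_on_compose2[OF c]) (use that in \<open>auto intro!: continuous_intros\<close>)
    then show ?thesis by simp
  qed
  define A where "A = {z. prj v z \<in> closure sig}"
  have "A = prj v -` closure sig" by (auto simp: A_def)
  then have clA: "closed A"
    using closed_vimage[OF closed_closure[of sig], of "prj v"] continuous_on_prj[OF continuous_on_id, of UNIV v] by simp
  have conA: "continuous_on A (\<lambda>z. c (prj v z) (hgt v z))"
    by (rule cc) (auto simp: A_def intro!: continuous_intros)
  \<comment> \<open>The closed cylinder consists of the points over \<open>closure sig\<close> whose
    height the clamp does not move, which is a closed condition.\<close>
  have "cyl v (closure sig) Ib = {z \<in> A. c (prj v z) (hgt v z) - hgt v z = 0}"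
  proof (intro set_eqI)
    fix z
    show "z \<in> cyl v (closure sig) Ib \<longleftrightarrow> z \<in> {z \<in> A. c (prj v z) (hgt v z) - hgt v z = 0}"
      using c1[of "prj v z" "hgt v z"] c2[of "prj v z" "hgt v z"] by (auto simp: memb A_def)
  qed
  moreover have "continuous_on A (\<lambda>z. c (prj v z) (hgt v z) - hgt v z)" by (intro continuous_intros conA)
  ultimately have clcyl: "closed (cyl v (closure sig) Ib)"
    using continuous_closed_preimage_constant[OF _ clA, of "\<lambda>z. c (prj v z) (hgt v z) - hgt v z" 0] by metis
  show cl: "closure (cyl v sig I) = cyl v (closure sig) Ib"
  proof
    have "cyl v sig I \<subseteq> cyl v (closure sig) Ib"
      by (intro subsetI) (simp add: mem memb sigcl subsetD[OF I])
    then show "closure (cyl v sig I) \<subseteq> cyl v (closure sig) Ib" using clcyl by (rule closure_minimal)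
    show "cyl v (closure sig) Ib \<subseteq> closure (cyl v sig I)"
    proof
      fix z assume "z \<in> cyl v (closure sig) Ib"
      then obtain w y where z: "z = w + y *\<^sub>R v" "w \<in> closure sig" "y \<in> Ib w" by (auto simp: cyl_def)
      have "(\<lambda>w'. w' + c w' y *\<^sub>R v) ` closure sig \<subseteq> closure (cyl v sig I)"
      proof (rule image_closure_subset)
        show "continuous_on (closure sig) (\<lambda>w'. w' + c w' y *\<^sub>R v)"
          by (intro continuous_intros cc) auto
        show "(\<lambda>w'. w' + c w' y *\<^sub>R v) ` sig \<subseteq> closure (cyl v sig I)"
        proof (intro image_subsetI)
          fix w' assume w': "w' \<in> sig"
          \<comment> \<open>Heights in the closed fibre are limits of heights pushed slightly
            towards the section, and by \<open>s1\<close> these belong to the open fibre.\<close>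
          have "((\<lambda>n. w' + ((1 - inverse (Suc n)) * c w' y + inverse (Suc n) * s w') *\<^sub>R v) \<longlongrightarrow>
             w' + ((1 - 0) * c w' y + 0 * s w') *\<^sub>R v) sequentially"
            by (intro tendsto_intros LIMSEQ_inverse_real_of_nat)
          moreover have "w' + ((1 - inverse (Suc n)) * c w' y + inverse (Suc n) * s w') *\<^sub>R v \<in> cyl v sig I" for n
            using s1[OF w' c1[OF sigcl[OF w']], of "inverse (Suc n)" y] w'
            by (intro cylI) (auto simp: inverse_le_1_iff)
          ultimately show "w' + c w' y *\<^sub>R v \<in> closure (cyl v sig I)"
            unfolding closure_sequential by (metis (no_types, lifting) add_0_right diff_zero mult_1 mult_zero_left)
        qed
      qed auto
      then show "z \<in> closure (cyl v sig I)" using z c2[OF z(2,3)] by force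
    qed
  qed
  show "AR (cyl v (closure sig) Ib)" if AR: "AR (closure sig)"
  proof -
    \<comment> \<open>The full cylinder \<open>T\<close> is a product with a line, and clamping the
      height retracts it onto the closed cylinder.\<close>
    define T where "T = cyl v (closure sig) (\<lambda>_. UNIV)"
    have memT: "z \<in> T \<longleftrightarrow> prj v z \<in> closure sig" for z
      unfolding T_def using mem_cyl_iff[OF v, of "closure sig" z "\<lambda>_. UNIV"] orth by auto
    have "T homeomorphic (closure sig \<times> (UNIV::real set))"
      unfolding homeomorphic_minimal
    proof (intro exI[of _ "\<lambda>z. (prj v z, hgt v z)"] exI[of _ "\<lambda>(w,y). w + y *\<^sub>R v"] conjI ballI)
      show "continuous_on T (\<lambda>z. (prj v z, hgt v z))" by (intro continuous_intros)
      show "continuous_on (closure sig \<times> UNIV) (\<lambda>(w,y). w + y *\<^sub>R v)"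
        unfolding split_beta by (intro continuous_intros)
    qed (use orth v in \<open>auto simp: memT prj_hgt prj_eq hgt_eq\<close>)
    then have "AR T" using AR_Times[OF AR AR_UNIV] homeomorphic_AR_iff_AR by blast
    moreover have "cyl v (closure sig) Ib retract_of T"
      unfolding retract_of_def retraction_def
    proof (intro exI[of _ "\<lambda>z. prj v z + c (prj v z) (hgt v z) *\<^sub>R v"] conjI)
      show "cyl v (closure sig) Ib \<subseteq> T" by (auto simp: T_def cyl_def)
      have "T \<subseteq> A" by (auto simp: A_def memT)
      then show "continuous_on T (\<lambda>z. prj v z + c (prj v z) (hgt v z) *\<^sub>R v)"
        by (intro continuous_intros continuous_on_subset[OF conA])
      show "(\<lambda>z. prj v z + c (prj v z) (hgt v z) *\<^sub>R v) \<in> T \<rightarrow> cyl v (closure sig) Ib"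
        by (auto simp: memT intro!: cylI c1)
      show "\<forall>z\<in>cyl v (closure sig) Ib. prj v z + c (prj v z) (hgt v z) *\<^sub>R v = z"
        using c2 by (auto simp: memb prj_hgt)
    qed
    ultimately show ?thesis by (rule AR_retract_of_AR)
  qed
  show "lconn (cyl v sig I)" if lc: "lconn sig" and conv: "\<And>w. w \<in> sig \<Longrightarrow> convex (I w)"
    unfolding lconn_def
  proof (intro ballI allI impI)
    fix z and e :: real assume "z \<in> closure (cyl v sig I)" and e: "e > 0"
    then obtain w y where z: "z = w + y *\<^sub>R v" "w \<in> closure sig" "y \<in> Ib w" unfolding cl by (auto simp: cyl_def)
    define \<eta> where "\<eta> = e / (2 * (norm v + 1))"
    have nv: "norm v + 1 > 0" by (simp add: add_nonneg_pos)
    have \<eta>: "\<eta> > 0" using e nv by (simp add: \<eta>_def)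
    have \<eta>v: "\<eta> * norm v \<le> e / 2"
    proof -
      have "\<eta> * norm v \<le> \<eta> * (norm v + 1)" using \<eta> by (intro mult_left_mono) auto
      also have "\<dots> = e / 2" using nv by (simp add: \<eta>_def field_simps)
      finally show ?thesis .
    qed
    \<comment> \<open>\<open>M\<close> bounds the distance between the clamped height and the
      section near \<open>w\<close>; then \<open>t\<close> is chosen so small that the pushed height
      stays within \<open>\<eta>\<close> of \<open>y\<close> while lying in the open fibre.\<close>
    define M where "M = \<bar>s w\<bar> + \<bar>y\<bar> + 2"
    have M: "M > 0" by (simp add: M_def add_nonneg_pos)
    define t where "t = min 1 (\<eta> / (4 * M))"
    have t: "0 < t" "t \<le> 1" "t * M \<le> \<eta> / 4"
    proof -
      show "0 < t" "t \<le> 1" using \<eta> M by (auto simp: t_def)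
      have "t * M \<le> \<eta> / (4 * M) * M" using M by (intro mult_right_mono) (auto simp: t_def)
      then show "t * M \<le> \<eta> / 4" using M by simp
    qed
    have "continuous_on (closure sig) (\<lambda>w'. c w' y)" by (intro cc continuous_intros) auto
    then obtain e1 where e1: "e1 > 0" "\<And>w'. w' \<in> closure sig \<Longrightarrow> dist w' w < e1 \<Longrightarrow> \<bar>c w' y - y\<bar> < min (\<eta> / 4) 1"
      using z c2[OF z(2,3)] \<eta> unfolding continuous_on_iff dist_real_def
      by (metis divide_pos_pos min_less_iff_conj zero_less_numeral zero_less_one)
    obtain e2 where e2: "e2 > 0" "\<And>w'. w' \<in> closure sig \<Longrightarrow> dist w' w < e2 \<Longrightarrow> \<bar>s w' - s w\<bar> < 1"
      using z s unfolding continuous_on_iff dist_real_def by (metis zero_less_one)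
    obtain d1 N where N: "d1 > 0" "connected N" "N \<subseteq> sig \<inter> ball w (min (e / 2) (min e1 e2))" "sig \<inter> ball w d1 \<subseteq> N"
      using lc z(2) e e1(1) e2(1) unfolding lconn_def by (metis half_gt_zero min_less_iff_conj)
    define J where "J w' = I w' \<inter> {y'. \<bar>y' - y\<bar> < \<eta>}" for w'
    have Nw: "w' \<in> sig" "w' \<in> closure sig" "dist w' w < e / 2" "dist w' w < e1" "dist w' w < e2" if "w' \<in> N" for w'
      using N(3) that sigcl by (auto simp: dist_commute)
    have "connected (cyl v N J)"
    proof (rule connected_cyl[OF N(2)])
      show "continuous_on N (\<lambda>w'. (1 - t) * c w' y + t * s w')"
        using Nw by (intro continuous_intros cc continuous_on_subset[OF s]) auto
      show "(1 - t) * c w' y + t * s w' \<in> J w'" if w': "w' \<in> N" for w'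
      proof -
        note n = Nw[OF w']
        have c': "\<bar>c w' y - y\<bar> < min (\<eta> / 4) 1" and s': "\<bar>s w' - s w\<bar> < 1" using e1(2) e2(2) n by auto
        have "\<bar>s w' - c w' y\<bar> \<le> M" using c' s' unfolding M_def by linarith
        then have "t * \<bar>s w' - c w' y\<bar> \<le> \<eta> / 4" using t(3) mult_left_mono[of "\<bar>s w' - c w' y\<bar>" M t] t(1) by linarith
        moreover have "(1 - t) * c w' y + t * s w' - y = (c w' y - y) + t * (s w' - c w' y)" by (simp add: algebra_simps)
        moreover have "\<bar>t * (s w' - c w' y)\<bar> = t * \<bar>s w' - c w' y\<bar>" using t(1) by (simp add: abs_mult)
        ultimately have "\<bar>(1 - t) * c w' y + t * s w' - y\<bar> < \<eta>" using c' \<eta> by linarith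
        then show ?thesis using s1[OF n(1) c1[OF n(2)] t(1,2)] by (simp add: J_def)
      qed
      show "convex (J w')" if "w' \<in> N" for w'
      proof -
        have "{y'. \<bar>y' - y\<bar> < \<eta>} = ball y \<eta>" by (auto simp: dist_real_def)
        then show ?thesis using conv[OF Nw(1)[OF that]] unfolding J_def by (simp add: convex_Int)
      qed
    qed
    moreover have "cyl v N J \<subseteq> cyl v sig I \<inter> ball z e"
    proof
      fix z' assume "z' \<in> cyl v N J"
      then obtain w' y' where z': "z' = w' + y' *\<^sub>R v" "w' \<in> N" "y' \<in> I w'" "\<bar>y' - y\<bar> < \<eta>" by (auto simp: cyl_def J_def)
      have "norm (z' - z) \<le> norm (w' - w) + norm ((y' - y) *\<^sub>R v)"
        using norm_triangle_ineq[of "w' - w" "(y' - y) *\<^sub>R v"] by (simp add: z' z algebra_simps)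
      also have "norm ((y' - y) *\<^sub>R v) \<le> \<eta> * norm v" using z'(4) by (simp add: mult_right_mono)
      finally have "dist z' z < e" using Nw(3)[OF z'(2)] \<eta>v by (simp add: dist_norm)
      then show "z' \<in> cyl v sig I \<inter> ball z e" using z' Nw(1)[OF z'(2)] by (auto simp: dist_commute intro!: cylI)
    qed
    moreover have "\<exists>d>0. cyl v sig I \<inter> ball z d \<subseteq> cyl v N J"
    proof -
      have pz: "prj v z = w" "hgt v z = y" using z orth v by (auto simp: prj_eq hgt_eq)
      have "continuous_on UNIV (prj v)" "continuous_on UNIV (hgt v)" by (intro continuous_intros)+
      then obtain a b where ab: "a > 0" "\<And>z'. dist z' z < a \<Longrightarrow> dist (prj v z') w < d1"
        "b > 0" "\<And>z'. dist z' z < b \<Longrightarrow> dist (hgt v z') y < \<eta>"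
        using N(1) \<eta> unfolding continuous_on_iff pz[symmetric] by (metis UNIV_I)
      have "cyl v sig I \<inter> ball z (min a b) \<subseteq> cyl v N J"
      proof
        fix z' assume "z' \<in> cyl v sig I \<inter> ball z (min a b)"
        then have z': "prj v z' \<in> sig" "hgt v z' \<in> I (prj v z')" "dist (prj v z') w < d1" "dist (hgt v z') y < \<eta>"
          using ab by (auto simp: mem dist_commute)
        then have "prj v z' \<in> N" using N(4) by (auto simp: dist_commute)
        moreover have "hgt v z' \<in> J (prj v z')" using z' by (auto simp: J_def dist_real_def)
        ultimately have "prj v z' + hgt v z' *\<^sub>R v \<in> cyl v N J" by (rule cylI)
        then show "z' \<in> cyl v N J" by (simp add: prj_hgt)
      qed
      then show ?thesis using ab by (intro exI[of _ "min a b"]) auto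
    qed
    ultimately show "\<exists>d>0. \<exists>N. connected N \<and> N \<subseteq> cyl v sig I \<inter> ball z e \<and> cyl v sig I \<inter> ball z d \<subseteq> N"
      by metis
  qed
qed

text \<open>Apart from constant signs, a cell is only asked for what gluing and lifting require: an
  absolute retract as closure and a closed frontier for the gluing, \<open>lconn\<close> for
  extending sections over it. By the last clause the closure of a cell is a union of cells.\<close>

definition cad :: "('a::euclidean_space \<Rightarrow> real) set \<Rightarrow> 'a set \<Rightarrow> 'a set set \<Rightarrow> bool" where
  "cad F V \<D> \<longleftrightarrow> finite \<D> \<and> \<Union>\<D> = V \<and>
    (\<forall>D\<in>\<D>. D \<noteq> {} \<and> connected D \<and> sign_const F D \<and> AR (closure D) \<and> closed (closure D - D) \<and> lconn D) \<and>
    (\<forall>D\<in>\<D>. \<forall>D'\<in>\<D>. D = D' \<or> D \<inter> D' = {}) \<and>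
    (\<forall>D\<in>\<D>. \<forall>D'\<in>\<D>. D' \<inter> closure D \<noteq> {} \<longrightarrow> D' \<subseteq> closure D)"

section \<open>Existence of cylindrical decompositions\<close>

definition cband :: "nat \<Rightarrow> (nat \<Rightarrow> 'a \<Rightarrow> real) \<Rightarrow> nat \<Rightarrow> 'a \<Rightarrow> real set" where
  "cband m \<xi> i x = {y. (0 < i \<longrightarrow> \<xi> (i - 1) x \<le> y) \<and> (i < m \<longrightarrow> y \<le> \<xi> i x)}"

definition clamp_up :: "nat \<Rightarrow> (nat \<Rightarrow> 'a \<Rightarrow> real) \<Rightarrow> nat \<Rightarrow> 'a \<Rightarrow> real \<Rightarrow> real" where
  "clamp_up m \<xi> i x y = (if i < m then min y (\<xi> i x) else y)"

definition clamp_band :: "nat \<Rightarrow> (nat \<Rightarrow> 'a \<Rightarrow> real) \<Rightarrow> nat \<Rightarrow> 'a \<Rightarrow> real \<Rightarrow> real" where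
  "clamp_band m \<xi> i x y = (if 0 < i then max (clamp_up m \<xi> i x y) (\<xi> (i - 1) x) else clamp_up m \<xi> i x y)"

lemma continuous_on_clamp_band:
  assumes "\<And>i. i < m \<Longrightarrow> continuous_on S (\<xi> i)" "i \<le> m"
  shows "continuous_on (S \<times> UNIV) (\<lambda>(x, y). clamp_band m \<xi> i x y)"
proof -
  have fst: "continuous_on (S \<times> UNIV) (\<lambda>z. \<xi> j (fst z))" if "j < m" for j
    by (rule continuous_on_compose2[OF assms(1)[OF that]]) (auto intro!: continuous_intros)
  have "continuous_on (S \<times> UNIV) (\<lambda>z. clamp_up m \<xi> i (fst z) (snd z))"
    unfolding clamp_up_def by (cases "i < m") (auto intro!: continuous_intros fst)
  then show ?thesis unfolding clamp_band_def split_beta using assms(2)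
    by (cases "0 < i") (auto intro!: continuous_intros fst)
qed

lemma convex_comb_gt:
  fixes a :: real
  assumes "a \<le> y" "a < s" "0 < t" "t \<le> 1"
  shows "a < (1 - t) * y + t * s"
proof -
  have "(1 - t) * y + t * s - a = (1 - t) * (y - a) + t * (s - a)" by (simp add: algebra_simps)
  moreover have "0 \<le> (1 - t) * (y - a)" "0 < t * (s - a)" using assms by auto
  ultimately show ?thesis by linarith
qed

lemma convex_comb_lt:
  fixes a :: real
  assumes "y \<le> a" "s < a" "0 < t" "t \<le> 1"
  shows "(1 - t) * y + t * s < a"
  using convex_comb_gt[of "-a" "-y" "-s" t] assms by (simp add: algebra_simps)

lemma cad_trivial:
  fixes F :: "('a::euclidean_space \<Rightarrow> real) set"
  shows "cad F {0} {{0}}"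
proof -
  have "lconn {0::'a}" unfolding lconn_def
  proof (intro ballI allI impI)
    fix x :: 'a and e :: real assume "x \<in> closure {0}" "0 < e"
    then show "\<exists>d>0. \<exists>N. connected N \<and> N \<subseteq> {0} \<inter> ball x e \<and> {0} \<inter> ball x d \<subseteq> N"
      by (intro exI[of _ 1] conjI exI[of _ "{0}"]) auto
  qed
  then show ?thesis by (simp add: cad_def AR_singleton sign_const_def)
qed

text \<open>The cells over a base cell are the graphs of its delineated roots and the bands between
  them. Because the direction \<open>v\<close> is monic, these roots extend continuously to the
  closure of the base cell, so the closures are again cylinders over closures.\<close>

lemma cad_step:
  fixes V :: "'a::euclidean_space set"
  assumes V: "subspace V" and F: "finite F" "\<And>f. f \<in> F \<Longrightarrow> polyfun f" and dim: "dim V \<noteq> 0"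
    and IH: "\<And>(W::'a set) G. subspace W \<Longrightarrow> dim V = Suc (dim W) \<Longrightarrow> finite G \<Longrightarrow> (\<And>g. g \<in> G \<Longrightarrow> polyfun g) \<Longrightarrow> \<exists>\<D>. cad G W \<D>"
  shows "\<exists>\<D>. cad F V \<D>"
proof -
  \<comment> \<open>Members that vanish on all of \<open>V\<close> have constant sign anyway and
    could not be made monic.\<close>
  define F0 where "F0 = {f\<in>F. \<exists>x\<in>V. f x \<noteq> 0}"
  have F0: "finite F0" "\<And>f. f \<in> F0 \<Longrightarrow> polyfun f" using F by (auto simp: F0_def)
  obtain u where u: "u \<in> V" "u \<noteq> 0" using dim by (metis dim_eq_0 subsetI singletonI)
  \<comment> \<open>Making the nonzero functional \<open>l\<close> monic as well forces
    \<open>v \<noteq> 0\<close>, even if \<open>F0\<close> is empty.\<close>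
  define l where "l x = x \<bullet> u" for x
  have "polyfun l" unfolding l_def[abs_def] by (intro pf_lin bounded_linear_inner_left)
  moreover have "\<exists>x\<in>V. l x \<noteq> 0" using u by (intro bexI[of _ u]) (auto simp: l_def)
  ultimately have "\<exists>v\<in>V. \<forall>f\<in>insert l F0. \<exists>p n c. polyfam p \<and> c \<noteq> 0 \<and>
    (\<forall>x\<in>V. degree (p x) = n \<and> coeff (p x) n = c \<and> (\<forall>y. poly (p x) y = f (x + y *\<^sub>R v)))"
    using F0 by (intro monic_direction[OF V]) (auto simp: F0_def)
  then obtain v where v: "v \<in> V" and ex: "\<forall>f\<in>insert l F0. \<exists>p n c. polyfam p \<and> c \<noteq> 0 \<and>
    (\<forall>x\<in>V. degree (p x) = n \<and> coeff (p x) n = c \<and> (\<forall>y. poly (p x) y = f (x + y *\<^sub>R v)))" by blast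
  from bchoice[OF ex] obtain p where "\<forall>f\<in>insert l F0. \<exists>n c. polyfam (p f) \<and> c \<noteq> 0 \<and>
    (\<forall>x\<in>V. degree (p f x) = n \<and> coeff (p f x) n = c \<and> (\<forall>y. poly (p f x) y = f (x + y *\<^sub>R v)))" by blast
  then obtain n c where pf: "\<forall>f\<in>insert l F0. polyfam (p f) \<and> c f \<noteq> 0 \<and>
    (\<forall>x\<in>V. degree (p f x) = n f \<and> coeff (p f x) (n f) = c f \<and> (\<forall>y. poly (p f x) y = f (x + y *\<^sub>R v)))"
    by metis
  have v0: "v \<noteq> 0"
  proof
    assume "v = 0"
    have "0 \<in> V" using V by (rule subspace_0)
    then have "\<forall>y. poly (p l 0) y = 0" "coeff (p l 0) (n l) = c l" "c l \<noteq> 0" using pf \<open>v = 0\<close> by (auto simp: l_def)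
    then show False by (metis poly_all_0_iff_0 coeff_0)
  qed
  have fam: "\<And>f. f \<in> F0 \<Longrightarrow> polyfam (p f)" and c0: "\<And>f. f \<in> F0 \<Longrightarrow> c f \<noteq> 0"
    and deg: "\<And>f x. f \<in> F0 \<Longrightarrow> x \<in> V \<Longrightarrow> degree (p f x) = n f" 
    and lead: "\<And>f x. f \<in> F0 \<Longrightarrow> x \<in> V \<Longrightarrow> coeff (p f x) (n f) = c f"
    and val: "\<And>f x y. f \<in> F0 \<Longrightarrow> x \<in> V \<Longrightarrow> poly (p f x) y = f (x + y *\<^sub>R v)"
    using pf by auto
  have pnz: "p f x \<noteq> 0" if "f \<in> F0" "x \<in> V" for f x using lead[OF that] c0[OF that(1)] by auto
  define W where "W = {x\<in>V. x \<bullet> v = 0}"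
  have W: "subspace W" using V by (auto simp: W_def subspace_def inner_add_left)
  have WV: "w \<in> V" "w \<bullet> v = 0" if "w \<in> W" for w using that by (auto simp: W_def)
  have prjW: "prj v z \<in> W" if "z \<in> V" for z
    using that V v v0 by (auto simp: W_def prj_def inner_diff_left intro!: subspace_diff subspace_scale)
  have dimW: "dim V = Suc (dim W)"
  proof -
    have "span W = W" using W by (simp only: span_eq_iff)
    moreover have "v \<notin> W" using v0 WV(2)[of v] by auto
    ultimately have "v \<notin> span W" by metis
    then have "dim (insert v W) = Suc (dim W)" by (simp add: dim_insert)
    moreover have "span (insert v W) = V"
    proof
      show "span (insert v W) \<subseteq> V" using V v by (intro span_minimal) (auto simp: W_def)
      show "V \<subseteq> span (insert v W)"
      proof
        fix z assume z: "z \<in> V"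
        have "prj v z + hgt v z *\<^sub>R v \<in> span (insert v W)"
          using prjW[OF z] by (intro span_add span_scale span_base) auto
        then show "z \<in> span (insert v W)" by (simp add: prj_hgt)
      qed
    qed
    ultimately show ?thesis by (metis dim_span)
  qed
  obtain G where G: "finite G \<and> (\<forall>g\<in>G. polyfun g) \<and>
    (\<forall>C. connected C \<longrightarrow> C \<noteq> {} \<longrightarrow> sign_const G C \<longrightarrow> (\<exists>m \<xi>. delineated F0 p C m \<xi>))"
    using delineation[OF F0(1) fam] by (rule exE)
  obtain \<B> where "cad G W \<B>" using IH[OF W dimW, of G] G by blast
  then have \<B>: "finite \<B>" "\<Union>\<B> = W" "\<And>sig. sig \<in> \<B> \<Longrightarrow> sig \<noteq> {}" "\<And>sig. sig \<in> \<B> \<Longrightarrow> connected sig"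
    "\<And>sig. sig \<in> \<B> \<Longrightarrow> sign_const G sig" "\<And>sig. sig \<in> \<B> \<Longrightarrow> AR (closure sig)" "\<And>sig. sig \<in> \<B> \<Longrightarrow> closed (closure sig - sig)"
    "\<And>sig. sig \<in> \<B> \<Longrightarrow> lconn sig" "\<And>sig tau. sig \<in> \<B> \<Longrightarrow> tau \<in> \<B> \<Longrightarrow> sig = tau \<or> sig \<inter> tau = {}"
    "\<And>sig tau. sig \<in> \<B> \<Longrightarrow> tau \<in> \<B> \<Longrightarrow> tau \<inter> closure sig \<noteq> {} \<Longrightarrow> tau \<subseteq> closure sig"
    by (auto simp: cad_def)
  have clsigW: "closure sig \<subseteq> W" if "sig \<in> \<B>" for sig
    using that \<B>(2) closed_subspace[OF W] by (intro closure_minimal) auto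
  have clsig: "sig \<subseteq> closure sig" for sig :: "'a set" by (rule closure_subset)
  have "\<forall>sig\<in>\<B>. \<exists>m \<xi>. delineated F0 p sig m \<xi>" using G \<B>(3,4,5) by blast
  then obtain m \<xi> where del: "\<And>sig. sig \<in> \<B> \<Longrightarrow> delineated F0 p sig (m sig) (\<xi> sig)" by metis
  have mono: "\<xi> sig i x < \<xi> sig j x" if "sig \<in> \<B>" "x \<in> sig" "i < j" "j < m sig" for sig x i j
    using del[OF that(1)] that by (simp add: delineated_def)
  have cont: "continuous_on sig (\<xi> sig i)" if "sig \<in> \<B>" "i < m sig" for sig i
    using del[OF that(1)] that by (simp add: delineated_def)
  \<comment> \<open>All sections are roots of this one polynomial, whose degree and leading
    coefficient are constant on \<open>V\<close>; limits of sections at boundary points are again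
    roots of it.\<close>
  define P where "P x = (\<Prod>f\<in>F0. p f x)" for x
  have famP: "polyfam P" unfolding P_def[abs_def] by (intro polyfam_prod F0 fam)
  have degP: "degree (P x) = sum n F0" and leadP: "coeff (P x) (sum n F0) = prod c F0" if "x \<in> V" for x
  proof -
    have "degree (P x) = (\<Sum>f\<in>F0. degree (p f x))"
      unfolding P_def by (rule degree_prod_eq_sum_degree) (use pnz that in blast)
    then show d: "degree (P x) = sum n F0" using deg[OF _ that] by simp
    have "lead_coeff (P x) = (\<Prod>f\<in>F0. lead_coeff (p f x))" unfolding P_def by (rule lead_coeff_prod)
    also have "\<dots> = prod c F0" using deg[OF _ that] lead[OF _ that] by simp
    finally show "coeff (P x) (sum n F0) = prod c F0" using d by simp
  qed
  have leadnz: "prod c F0 \<noteq> 0" using c0 F0(1) by simp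
  have root\<xi>: "poly (P x) (\<xi> sig i x) = 0" if sig: "sig \<in> \<B>" "x \<in> sig" "i < m sig" for sig i x
  proof -
    obtain f where "f \<in> F0" "poly (p f x) (\<xi> sig i x) = 0"
      using del[OF sig(1)] sig unfolding delineated_def by metis
    then show ?thesis using F0(1) by (auto simp: P_def poly_prod)
  qed
  have root_ex: "\<exists>k<m sig. y = \<xi> sig k x" if sig: "sig \<in> \<B>" "x \<in> sig" "poly (P x) y = 0" for sig x y
  proof -
    have xV: "x \<in> V" using sig(1,2) \<B>(2) WV by blast
    obtain f where f: "f \<in> F0" "poly (p f x) y = 0" using sig(3) F0(1) by (auto simp: P_def poly_prod)
    then obtain I where I: "I \<subseteq> {..<m sig}" "\<forall>x\<in>sig. {y. poly (p f x) y = 0} = (\<lambda>i. \<xi> sig i x) ` I"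
      using delineatedD[OF del[OF sig(1)] f(1)] pnz[OF f(1) xV] sig(2) by blast
    then have "y \<in> (\<lambda>i. \<xi> sig i x) ` I" using f(2) sig(2) by blast
    then show ?thesis using I(1) by blast
  qed
  have "\<exists>g. continuous_on (closure sig) g \<and> (\<forall>x\<in>sig. g x = \<xi> sig i x) \<and> (\<forall>x\<in>closure sig. poly (P x) (g x) = 0)"
    if "sig \<in> \<B>" "i < m sig" for sig i
  proof (rule root_extends_to_closure[OF \<B>(8)[OF that(1)] cont[OF that]])
    show "continuous_on (closure sig) (\<lambda>x. coeff (P x) i)" for i
      using famP by (intro polyfun_continuous) (auto simp: polyfam_def)
    show "degree (P x) = sum n F0" "coeff (P x) (sum n F0) = prod c F0" if "x \<in> closure sig" for x
      using degP leadP clsigW[OF \<open>sig \<in> \<B>\<close>] that WV by blast+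
  qed (use leadnz root\<xi> that in auto)
  then have "\<forall>sig i. \<exists>g. sig \<in> \<B> \<longrightarrow> i < m sig \<longrightarrow> continuous_on (closure sig) g \<and> (\<forall>x\<in>sig. g x = \<xi> sig i x) \<and> (\<forall>x\<in>closure sig. poly (P x) (g x) = 0)"
    by blast
  then obtain \<zeta> where \<zeta>: "\<forall>sig i. sig \<in> \<B> \<longrightarrow> i < m sig \<longrightarrow> continuous_on (closure sig) (\<zeta> sig i) \<and> (\<forall>x\<in>sig. \<zeta> sig i x = \<xi> sig i x) \<and> (\<forall>x\<in>closure sig. poly (P x) (\<zeta> sig i x) = 0)"
    by metis
  have \<zeta>cont: "continuous_on (closure sig) (\<zeta> sig i)" and \<zeta>eq: "\<And>x. x \<in> sig \<Longrightarrow> \<zeta> sig i x = \<xi> sig i x"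
    and \<zeta>root: "\<And>x. x \<in> closure sig \<Longrightarrow> poly (P x) (\<zeta> sig i x) = 0" if "sig \<in> \<B>" "i < m sig" for sig i
    using \<zeta> that by blast+
  have \<zeta>mono: "\<zeta> sig i x \<le> \<zeta> sig j x" if "sig \<in> \<B>" "x \<in> closure sig" "i < j" "j < m sig" for sig x i j
  proof -
    have "continuous_on (closure sig) (\<lambda>x. \<zeta> sig j x - \<zeta> sig i x)" using that by (intro continuous_intros \<zeta>cont) auto
    then have "0 \<le> \<zeta> sig j x - \<zeta> sig i x"
      by (rule continuous_ge_on_closure[OF _ that(2)]) (use mono[OF that(1)] that \<zeta>eq[OF that(1)] in force)
    then show ?thesis by simp
  qed
  \<comment> \<open>Over a face \<open>tau\<close> an extended section is a continuous root of
    \<open>P\<close>, so it agrees with one section of \<open>tau\<close> throughout.\<close>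
  have sel: "\<exists>k<m tau. \<forall>x\<in>tau. \<zeta> sig i x = \<xi> tau k x" if st: "sig \<in> \<B>" "tau \<in> \<B>" "tau \<subseteq> closure sig" "i < m sig" for sig tau i
    by (rule continuous_selection_unique[OF \<B>(4)[OF st(2)] \<B>(3)[OF st(2)] continuous_on_subset[OF \<zeta>cont[OF st(1,4)] st(3)]])
      (use cont[OF st(2)] mono[OF st(2)] root_ex[OF st(2)] \<zeta>root[OF st(1,4)] st(3) in blast)+
  define sec where "sec sig i = cyl v sig (\<lambda>x. {\<xi> sig i x})" for sig i
  define bnd where "bnd sig i = cyl v sig (band (m sig) (\<xi> sig) i)" for sig i
  have orth: "w \<bullet> v = 0" if "sig \<in> \<B>" "w \<in> closure sig" for sig w using clsigW that WV by blast
  have orth': "w \<bullet> v = 0" if "sig \<in> \<B>" "w \<in> sig" for sig w using orth[OF that(1)] clsig that by blast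
  have mem_sec: "z \<in> sec sig i \<longleftrightarrow> prj v z \<in> sig \<and> hgt v z = \<xi> sig i (prj v z)" if "sig \<in> \<B>" for sig i z
    unfolding sec_def using mem_cyl_iff[OF v0, of sig z] orth'[OF that] by auto
  have mem_bnd: "z \<in> bnd sig i \<longleftrightarrow> prj v z \<in> sig \<and> hgt v z \<in> band (m sig) (\<xi> sig) i (prj v z)" if "sig \<in> \<B>" for sig i z
    unfolding bnd_def using mem_cyl_iff[OF v0, of sig z] orth'[OF that] by auto

  have sec_facts: "closure (sec sig i) = cyl v (closure sig) (\<lambda>x. {\<zeta> sig i x}) \<and> AR (closure (sec sig i)) \<and> lconn (sec sig i)"
    if sig: "sig \<in> \<B>" and i: "i < m sig" for sig i
  proof -
    have cc: "continuous_on (closure sig \<times> UNIV) (\<lambda>(w, y). \<zeta> sig i w)"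
      unfolding split_beta by (rule continuous_on_compose2[OF \<zeta>cont[OF sig i]]) (auto intro!: continuous_intros)
    have s1: "(1 - t) * y + t * \<zeta> sig i w \<in> {\<xi> sig i w}" if "w \<in> sig" "y \<in> {\<zeta> sig i w}" for w y and t :: real
      using \<zeta>eq[OF sig i that(1)] that(2) by (simp add: algebra_simps)
    have c1: "\<zeta> sig i w \<in> {\<zeta> sig i w}" if "w \<in> closure sig" for w and y :: real by simp
    have c2: "\<zeta> sig i w = y" if "w \<in> closure sig" "y \<in> {\<zeta> sig i w}" for w and y :: real using that by simp
    have sub: "{\<xi> sig i w} \<subseteq> {\<zeta> sig i w}" if "w \<in> sig" for w using \<zeta>eq[OF sig i that] by simp
    have cv: "convex {\<xi> sig i w}" if "w \<in> sig" for w by simp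
    note prem = v0 orth[OF sig] cc c1 c2 \<zeta>cont[OF sig i] s1 sub
    have 1: "closure (sec sig i) = cyl v (closure sig) (\<lambda>x. {\<zeta> sig i x})" unfolding sec_def
      by (rule closure_cyl[where Ib = "\<lambda>x. {\<zeta> sig i x}" and I = "\<lambda>x. {\<xi> sig i x}" and c = "\<lambda>w y. \<zeta> sig i w" and s = "\<zeta> sig i", OF prem])
    moreover have "AR (cyl v (closure sig) (\<lambda>x. {\<zeta> sig i x}))"
      by (rule AR_closure_cyl[where Ib = "\<lambda>x. {\<zeta> sig i x}" and I = "\<lambda>x. {\<xi> sig i x}" and c = "\<lambda>w y. \<zeta> sig i w" and s = "\<zeta> sig i", OF prem \<B>(6)[OF sig]])
    moreover have "lconn (sec sig i)" unfolding sec_def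
      by (rule lconn_cyl[where Ib = "\<lambda>x. {\<zeta> sig i x}" and I = "\<lambda>x. {\<xi> sig i x}" and c = "\<lambda>w y. \<zeta> sig i w" and s = "\<zeta> sig i", OF prem \<B>(8)[OF sig] cv])
    ultimately show ?thesis by metis
  qed
  have bnd_facts: "closure (bnd sig i) = cyl v (closure sig) (cband (m sig) (\<zeta> sig) i) \<and> AR (closure (bnd sig i)) \<and> lconn (bnd sig i)"
    if sig: "sig \<in> \<B>" and i: "i \<le> m sig" for sig i
  proof -
    have cc: "continuous_on (closure sig \<times> UNIV) (\<lambda>(w, y). clamp_band (m sig) (\<zeta> sig) i w y)"
      by (rule continuous_on_clamp_band[OF \<zeta>cont[OF sig] i])
    have c1: "clamp_band (m sig) (\<zeta> sig) i w y \<in> cband (m sig) (\<zeta> sig) i w" if "w \<in> closure sig" for w y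
      using \<zeta>mono[OF sig that, of "i - 1" i] by (auto simp: clamp_band_def clamp_up_def cband_def)
    have c2: "clamp_band (m sig) (\<zeta> sig) i w y = y" if "y \<in> cband (m sig) (\<zeta> sig) i w" for w y
      using that by (auto simp: clamp_band_def clamp_up_def cband_def)
    have sc: "continuous_on (closure sig) (band_section (m sig) (\<zeta> sig) i)"
      by (rule band_section_continuous[OF \<zeta>cont[OF sig] i])
    have s1: "(1 - t) * y + t * band_section (m sig) (\<zeta> sig) i w \<in> band (m sig) (\<xi> sig) i w"
      if w: "w \<in> sig" and y: "y \<in> cband (m sig) (\<zeta> sig) i w" and t: "0 < t" "t \<le> 1" for w y t
    proof -
      have "band_section (m sig) (\<zeta> sig) i w = band_section (m sig) (\<xi> sig) i w"
        using \<zeta>eq[OF sig _ w] i by (simp add: band_section_def)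
      then have "band_section (m sig) (\<zeta> sig) i w \<in> band (m sig) (\<xi> sig) i w"
        using band_section_in_band[of "m sig" "\<xi> sig" w i] mono[OF sig w] i by simp
      moreover have "y \<in> cband (m sig) (\<xi> sig) i w" using y \<zeta>eq[OF sig _ w] i by (auto simp: cband_def)
      ultimately show ?thesis unfolding band_def cband_def
        using convex_comb_gt[OF _ _ t] convex_comb_lt[OF _ _ t] by simp
    qed
    have sub: "band (m sig) (\<xi> sig) i w \<subseteq> cband (m sig) (\<zeta> sig) i w" if "w \<in> sig" for w
      using \<zeta>eq[OF sig _ that] i by (auto simp: band_def cband_def)
    have 1: "closure (bnd sig i) = cyl v (closure sig) (cband (m sig) (\<zeta> sig) i)" unfolding bnd_def
      by (rule closure_cyl[OF v0 orth[OF sig] cc c1 c2 sc s1 sub])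
    moreover have "AR (cyl v (closure sig) (cband (m sig) (\<zeta> sig) i))"
      by (rule AR_closure_cyl[OF v0 orth[OF sig] cc c1 c2 sc s1 sub \<B>(6)[OF sig]])
    moreover have "lconn (bnd sig i)" unfolding bnd_def
      by (rule lconn_cyl[OF v0 orth[OF sig] cc c1 c2 sc s1 sub \<B>(8)[OF sig] band_convex])
    ultimately show ?thesis by metis
  qed
  have mem_cl_sec: "z \<in> closure (sec sig i) \<longleftrightarrow> prj v z \<in> closure sig \<and> hgt v z = \<zeta> sig i (prj v z)" 
    if "sig \<in> \<B>" "i < m sig" for sig i z
    using sec_facts[OF that] mem_cyl_iff[OF v0, of "closure sig" z] orth[OF that(1)] by auto
  have mem_cl_bnd: "z \<in> closure (bnd sig i) \<longleftrightarrow> prj v z \<in> closure sig \<and> hgt v z \<in> cband (m sig) (\<zeta> sig) i (prj v z)"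
    if "sig \<in> \<B>" "i \<le> m sig" for sig i z
    using bnd_facts[OF that] mem_cyl_iff[OF v0, of "closure sig" z] orth[OF that(1)] by auto
  have clprj: "closed (prj v -` (closure sig - sig))" if "sig \<in> \<B>" for sig
    using closed_vimage[OF \<B>(7)[OF that], of "prj v"] continuous_on_prj[OF continuous_on_id, of UNIV v] by simp
  have sec_fr: "closed (closure (sec sig i) - sec sig i)" if "sig \<in> \<B>" "i < m sig" for sig i
  proof -
    have "closure (sec sig i) - sec sig i = closure (sec sig i) \<inter> prj v -` (closure sig - sig)"
      using \<zeta>eq[OF that] by (auto simp: mem_cl_sec[OF that] mem_sec[OF that(1)])
    then show ?thesis using clprj[OF that(1)] by (simp add: closed_Int)
  qed
  have bnd_fr: "closed (closure (bnd sig i) - bnd sig i)" if sig: "sig \<in> \<B>" and i: "i \<le> m sig" for sig i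
  proof -
    \<comment> \<open>Besides the part over the frontier of the base cell, the frontier of a band
      consists of the closed graphs below and above it.\<close>
    define Lo where "Lo = (if 0 < i then closure (sec sig (i - 1)) else {})"
    define Up where "Up = (if i < m sig then closure (sec sig i) else {})"
    have "closure (bnd sig i) - bnd sig i = closure (bnd sig i) \<inter> (prj v -` (closure sig - sig) \<union> Lo \<union> Up)" (is "?L = ?R")
    proof (intro set_eqI)
      fix z
      have lo: "z \<in> Lo \<longleftrightarrow> 0 < i \<and> prj v z \<in> closure sig \<and> hgt v z = \<zeta> sig (i - 1) (prj v z)"
        using mem_cl_sec[OF sig, of "i - 1" z] i by (auto simp: Lo_def)
      have up: "z \<in> Up \<longleftrightarrow> i < m sig \<and> prj v z \<in> closure sig \<and> hgt v z = \<zeta> sig i (prj v z)"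
        using mem_cl_sec[OF sig, of i z] by (auto simp: Up_def)
      have bz: "hgt v z \<in> band (m sig) (\<xi> sig) i (prj v z) \<longleftrightarrow> hgt v z \<in> band (m sig) (\<zeta> sig) i (prj v z)" if "prj v z \<in> sig"
      proof -
        have "\<zeta> sig (i - 1) (prj v z) = \<xi> sig (i - 1) (prj v z)" if "0 < i" using \<zeta>eq[OF sig _ \<open>prj v z \<in> sig\<close>, of "i - 1"] i that by linarith
        moreover have "\<zeta> sig i (prj v z) = \<xi> sig i (prj v z)" if "i < m sig" using \<zeta>eq[OF sig that \<open>prj v z \<in> sig\<close>] .
        ultimately show ?thesis unfolding band_def mem_Collect_eq by metis
      qed
      have cb: "hgt v z \<in> band (m sig) (\<zeta> sig) i (prj v z) \<longleftrightarrow>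
         \<not> (0 < i \<and> hgt v z = \<zeta> sig (i - 1) (prj v z)) \<and> \<not> (i < m sig \<and> hgt v z = \<zeta> sig i (prj v z))"
        if "hgt v z \<in> cband (m sig) (\<zeta> sig) i (prj v z)"
        using that unfolding band_def cband_def mem_Collect_eq by (metis order_le_less less_irrefl)
      show "z \<in> ?L \<longleftrightarrow> z \<in> ?R"
        unfolding Diff_iff Int_iff Un_iff vimage_eq lo up mem_cl_bnd[OF sig i] mem_bnd[OF sig] using bz cb by blast
    qed
    moreover have "closed Lo" "closed Up" by (auto simp: Lo_def Up_def)
    ultimately show ?thesis using clprj[OF sig] by (simp add: closed_Int closed_Un)
  qed
  define \<D> where "\<D> = (\<Union>sig\<in>\<B>. sec sig ` {..<m sig} \<union> bnd sig ` {..m sig})"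
  have cellE: "\<exists>sig\<in>\<B>. (\<exists>i<m sig. D = sec sig i) \<or> (\<exists>i\<le>m sig. D = bnd sig i)" if "D \<in> \<D>" for D
    using that unfolding \<D>_def by auto
  have valsig: "poly (p f x) y = f (x + y *\<^sub>R v)" if "sig \<in> \<B>" "f \<in> F0" "x \<in> sig" for sig f x y
    using val[OF that(2)] that(1,3) \<B>(2) WV by blast
  have sgnF: "sign_const F D" if "sign_const F0 D" "D \<subseteq> V" for D
    unfolding sign_const_def
  proof (intro ballI)
    fix f x y assume f: "f \<in> F" "x \<in> D" "y \<in> D"
    show "sgn (f x) = sgn (f y)"
    proof (cases "f \<in> F0")
      case True
      then show ?thesis using sign_constD[OF that(1) _ f(2,3)] by blast
    next
      case False
      then have "f x = 0" "f y = 0" using f that(2) by (auto simp: F0_def)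
      then show ?thesis by simp
    qed
  qed
  have cylV: "cyl v sig I \<subseteq> V" if "sig \<in> \<B>" for sig I
    using V v \<B>(2) that WV by (auto simp: cyl_def intro!: subspace_add subspace_scale)
  have "finite \<D>" using \<B>(1) by (auto simp: \<D>_def)
  moreover have "\<Union>\<D> = V"
  proof
    show "\<Union>\<D> \<subseteq> V" using cylV by (auto simp: \<D>_def sec_def bnd_def)
    show "V \<subseteq> \<Union>\<D>"
    proof
      fix z assume "z \<in> V"
      then obtain sig where sig: "sig \<in> \<B>" "prj v z \<in> sig" using prjW \<B>(2) by blast
      from band_or_root[of "m sig" "hgt v z" "\<xi> sig" "prj v z"]
      show "z \<in> \<Union>\<D>"
      proof
        assume "\<exists>i<m sig. hgt v z = \<xi> sig i (prj v z)"
        then obtain i where "i < m sig" "z \<in> sec sig i" using mem_sec[OF sig(1)] sig(2) by blast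
        then show ?thesis using sig(1) by (auto simp: \<D>_def)
      next
        assume "\<exists>i\<le>m sig. hgt v z \<in> band (m sig) (\<xi> sig) i (prj v z)"
        then obtain i where "i \<le> m sig" "z \<in> bnd sig i" using mem_bnd[OF sig(1)] sig(2) by blast
        then show ?thesis using sig(1) by (auto simp: \<D>_def)
      qed
    qed
  qed
  moreover have "D \<noteq> {} \<and> connected D \<and> sign_const F D \<and> AR (closure D) \<and> closed (closure D - D) \<and> lconn D"
    if D: "D \<in> \<D>" for D
  proof -
    obtain sig where sig: "sig \<in> \<B>" and "(\<exists>i<m sig. D = sec sig i) \<or> (\<exists>i\<le>m sig. D = bnd sig i)" using cellE[OF D] by blast
    then consider i where "i < m sig" "D = sec sig i" | i where "i \<le> m sig" "D = bnd sig i" by blast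
    then show ?thesis
    proof cases
      case 1
      obtain x where "x \<in> sig" using \<B>(3)[OF sig] by blast
      then have "sec sig i \<noteq> {}" by (auto simp: sec_def cyl_def)
      then show ?thesis unfolding 1(2) using sec_facts[OF sig 1(1)] sec_fr[OF sig 1(1)]
          delineated_section[OF del[OF sig] \<B>(4)[OF sig] valsig[OF sig] F0(2) 1(1)]
          sgnF[OF _ cylV[OF sig]] by (auto simp: sec_def)
    next
      case 2
      obtain x where x: "x \<in> sig" using \<B>(3)[OF sig] by blast
      have "band_section (m sig) (\<xi> sig) i x \<in> band (m sig) (\<xi> sig) i x"
        using band_section_in_band[of "m sig" "\<xi> sig" x i] mono[OF sig x] 2(1) by simp
      then have "bnd sig i \<noteq> {}" unfolding bnd_def using cylI[OF x] by fast
      then show ?thesis unfolding 2(2) using bnd_facts[OF sig 2(1)] bnd_fr[OF sig 2(1)]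
          delineated_band[OF del[OF sig] \<B>(4)[OF sig] valsig[OF sig] F0(2) 2(1)]
          sgnF[OF _ cylV[OF sig]] by (auto simp: bnd_def)
    qed
  qed
  moreover have "D = D' \<or> D \<inter> D' = {}" if D: "D \<in> \<D>" "D' \<in> \<D>" for D D'
  proof (rule disjCI)
    assume "D \<inter> D' \<noteq> {}"
    then obtain z where z: "z \<in> D" "z \<in> D'" by blast
    obtain sig where sig: "sig \<in> \<B>" and 1: "(\<exists>i<m sig. D = sec sig i) \<or> (\<exists>i\<le>m sig. D = bnd sig i)" using cellE[OF D(1)] by blast
    obtain tau where tau: "tau \<in> \<B>" and 2: "(\<exists>i<m tau. D' = sec tau i) \<or> (\<exists>i\<le>m tau. D' = bnd tau i)" using cellE[OF D(2)] by blast
    have zs: "prj v z \<in> sig" "prj v z \<in> tau" using z 1 2 mem_sec[OF sig] mem_bnd[OF sig] mem_sec[OF tau] mem_bnd[OF tau] by auto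
    then have [simp]: "tau = sig" using \<B>(9)[OF sig tau] by blast
    note mo = mono[OF sig zs(1)]
    have mo': "i = j" if "i < m sig" "j < m sig" "\<xi> sig i (prj v z) = \<xi> sig j (prj v z)" for i j
      using mo[of i j] mo[of j i] that by (cases i j rule: linorder_cases) auto
    have bb: "i = j" if "i \<le> m sig" "j \<le> m sig" "hgt v z \<in> band (m sig) (\<xi> sig) i (prj v z)" "hgt v z \<in> band (m sig) (\<xi> sig) j (prj v z)" for i j
    proof -
      have "\<not> i < j" if ij: "i \<le> m sig" "j \<le> m sig" "hgt v z \<in> band (m sig) (\<xi> sig) i (prj v z)" "hgt v z \<in> band (m sig) (\<xi> sig) j (prj v z)" for i j
      proof
        assume "i < j"
        then have "i = j - 1 \<or> i < j - 1 \<and> j - 1 < m sig" using ij(2) by linarith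
        then have "\<xi> sig i (prj v z) \<le> \<xi> sig (j - 1) (prj v z)" using mo[of i "j - 1"] by auto
        then show False using ij \<open>i < j\<close> by (auto simp: band_def)
      qed
      from this[OF that] this[OF that(2,1,4,3)] show ?thesis by linarith
    qed
    have nr: "\<xi> sig k (prj v z) \<notin> band (m sig) (\<xi> sig) i (prj v z)" if "i \<le> m sig" "k < m sig" for i k
      by (rule band_not_root[of "m sig" "\<xi> sig" "prj v z", OF mo that])
    from 1 show "D = D'"
    proof
      assume "\<exists>i<m sig. D = sec sig i"
      then obtain i where i: "i < m sig" "D = sec sig i" by blast
      then have hi: "hgt v z = \<xi> sig i (prj v z)" using z(1) mem_sec[OF sig] by simp
      from 2 show ?thesis
      proof
        assume "\<exists>i<m tau. D' = sec tau i"
        then obtain j where j: "j < m sig" "D' = sec sig j" by auto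
        then have "\<xi> sig i (prj v z) = \<xi> sig j (prj v z)" using z(2) mem_sec[OF sig] hi by simp
        then show ?thesis using mo'[OF i(1) j(1)] i j by simp
      next
        assume "\<exists>i\<le>m tau. D' = bnd tau i"
        then obtain j where j: "j \<le> m sig" "D' = bnd sig j" by auto
        then have "\<xi> sig i (prj v z) \<in> band (m sig) (\<xi> sig) j (prj v z)" using z(2) mem_bnd[OF sig] hi by simp
        then show ?thesis using nr[OF j(1) i(1)] by blast
      qed
    next
      assume "\<exists>i\<le>m sig. D = bnd sig i"
      then obtain i where i: "i \<le> m sig" "D = bnd sig i" by blast
      then have hi: "hgt v z \<in> band (m sig) (\<xi> sig) i (prj v z)" using z(1) mem_bnd[OF sig] by simp
      from 2 show ?thesis
      proof
        assume "\<exists>i<m tau. D' = sec tau i"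
        then obtain j where j: "j < m sig" "D' = sec sig j" by auto
        then have "\<xi> sig j (prj v z) \<in> band (m sig) (\<xi> sig) i (prj v z)" using z(2) mem_sec[OF sig] hi by simp
        then show ?thesis using nr[OF i(1) j(1)] by blast
      next
        assume "\<exists>i\<le>m tau. D' = bnd tau i"
        then obtain j where j: "j \<le> m sig" "D' = bnd sig j" by auto
        then have "hgt v z \<in> band (m sig) (\<xi> sig) j (prj v z)" using z(2) mem_bnd[OF sig] by simp
        then show ?thesis using bb[OF i(1) j(1) hi] i j by simp
      qed
    qed
  qed
  moreover have "D' \<subseteq> closure D" if D: "D \<in> \<D>" "D' \<in> \<D>" and ne: "D' \<inter> closure D \<noteq> {}" for D D'
  proof -
    obtain z where z: "z \<in> D'" "z \<in> closure D" using ne by blast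
    obtain sig where sig: "sig \<in> \<B>" and 1: "(\<exists>i<m sig. D = sec sig i) \<or> (\<exists>i\<le>m sig. D = bnd sig i)" using cellE[OF D(1)] by blast
    obtain tau where tau: "tau \<in> \<B>" and 2: "(\<exists>i<m tau. D' = sec tau i) \<or> (\<exists>i\<le>m tau. D' = bnd tau i)" using cellE[OF D(2)] by blast
    define w where "w = prj v z"
    have wtau: "w \<in> tau" and wsig: "w \<in> closure sig"
      using z 1 2 mem_cl_sec[OF sig] mem_cl_bnd[OF sig] mem_sec[OF tau] mem_bnd[OF tau] by (auto simp: w_def)
    have sub: "tau \<subseteq> closure sig" using \<B>(10)[OF sig tau] wtau wsig by blast
    \<comment> \<open>\<open>k\<close> translates section indices of \<open>sig\<close> into those
      of \<open>tau\<close>. Whether a point over \<open>tau\<close> lies in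
      \<open>closure D\<close> then depends only on the index of its cell, so one point of
      \<open>D'\<close> decides for all.\<close>
    obtain k where k: "\<And>i. i < m sig \<Longrightarrow> k i < m tau \<and> (\<forall>x\<in>tau. \<zeta> sig i x = \<xi> tau (k i) x)"
      using sel[OF sig tau sub] by metis
    have lt: "\<xi> tau i x < \<xi> tau j x \<longleftrightarrow> i < j" if "x \<in> tau" "i < m tau" "j < m tau" for i j x
      using mono[OF tau that(1), of i j] mono[OF tau that(1), of j i] that by (cases i j rule: linorder_cases) auto
    have le: "\<xi> tau i x \<le> \<xi> tau j x \<longleftrightarrow> i \<le> j" if "x \<in> tau" "i < m tau" "j < m tau" for i j x
      using lt[OF that(1,3,2)] by linarith
    have above: "\<xi> tau i x < y \<longleftrightarrow> i < j" and above_le: "\<xi> tau i x \<le> y \<longleftrightarrow> i < j" and below_le: "y \<le> \<xi> tau i x \<longleftrightarrow> j \<le> i"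
      if x: "x \<in> tau" and y: "y \<in> band (m tau) (\<xi> tau) j x" and ij: "i < m tau" "j \<le> m tau" for i j x y
    proof -
      have "\<xi> tau i x < y" if "i < j"
      proof -
        have "i \<le> j - 1" "j - 1 < m tau" using that ij by linarith+
        then have "\<xi> tau i x \<le> \<xi> tau (j - 1) x" using le[OF x ij(1), of "j - 1"] by blast
        then show ?thesis using y that by (auto simp: band_def)
      qed
      moreover have "y < \<xi> tau i x" if "\<not> i < j"
      proof -
        have "\<xi> tau j x \<le> \<xi> tau i x" using le[OF x, of j i] that ij by simp
        then show ?thesis using y that ij by (auto simp: band_def)
      qed
      ultimately show "\<xi> tau i x < y \<longleftrightarrow> i < j" "\<xi> tau i x \<le> y \<longleftrightarrow> i < j" "y \<le> \<xi> tau i x \<longleftrightarrow> j \<le> i" by force+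
    qed
    from 2 consider j where "j < m tau" "D' = sec tau j" | j where "j \<le> m tau" "D' = bnd tau j" by blast
    then show ?thesis
    proof cases
      case 21: 1
      have hz: "hgt v z = \<xi> tau j w" using z(1) mem_sec[OF tau] by (simp add: 21 w_def)
      from 1 consider i where "i < m sig" "D = sec sig i" | i where "i \<le> m sig" "D = bnd sig i" by blast
      then show ?thesis
      proof cases
        case 1
        then have "hgt v z = \<zeta> sig i w" using z(2) mem_cl_sec[OF sig 1(1)] by (simp add: w_def)
        then have "\<xi> tau j w = \<xi> tau (k i) w" using hz k[OF 1(1)] wtau by simp
        then have "j = k i" using le[OF wtau 21(1), of "k i"] le[OF wtau _ 21(1), of "k i"] k[OF 1(1)] by simp
        then show ?thesis using k[OF 1(1)] sub by (auto simp: 1 21 mem_cl_sec[OF sig 1(1)] mem_sec[OF tau])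
      next
        case 2
        have hb: "hgt v z \<in> cband (m sig) (\<zeta> sig) i w" using z(2) mem_cl_bnd[OF sig 2(1)] by (simp add: 2 w_def)
        have lo: "k (i - 1) \<le> j" if "0 < i"
          using hb that 2(1) k[of "i - 1"] le[OF wtau _ 21(1), of "k (i - 1)"] wtau by (auto simp: cband_def hz)
        have up: "j \<le> k i" if "i < m sig"
          using hb that k[of i] le[OF wtau 21(1), of "k i"] wtau by (auto simp: cband_def hz)
        show ?thesis
        proof
          fix z' assume "z' \<in> D'"
          then have z': "prj v z' \<in> tau" "hgt v z' = \<xi> tau j (prj v z')" using mem_sec[OF tau] by (auto simp: 21)
          have "\<zeta> sig (i - 1) (prj v z') \<le> hgt v z'" if "0 < i"
            using lo[OF that] le[OF z'(1) _ 21(1), of "k (i - 1)"] k[of "i - 1"] z' that 2(1) by simp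
          moreover have "hgt v z' \<le> \<zeta> sig i (prj v z')" if "i < m sig"
            using up[OF that] le[OF z'(1) 21(1), of "k i"] k[OF that] z' by simp
          ultimately show "z' \<in> closure D" using z' sub by (auto simp: 2 mem_cl_bnd[OF sig 2(1)] cband_def)
        qed
      qed
    next
      case 22: 2
      have hz: "hgt v z \<in> band (m tau) (\<xi> tau) j w" using z(1) mem_bnd[OF tau] by (simp add: 22 w_def)
      from 1 consider i where "i < m sig" "D = sec sig i" | i where "i \<le> m sig" "D = bnd sig i" by blast
      then show ?thesis
      proof cases
        case 1
        then have "hgt v z = \<xi> tau (k i) w" using z(2) mem_cl_sec[OF sig 1(1)] k[OF 1(1)] wtau by (simp add: w_def)
        then have False using band_not_root[of "m tau" "\<xi> tau" w j "k i"] mono[OF tau wtau] 22(1) k[OF 1(1)] hz by simp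
        then show ?thesis ..
      next
        case 2
        have hb: "hgt v z \<in> cband (m sig) (\<zeta> sig) i w" using z(2) mem_cl_bnd[OF sig 2(1)] by (simp add: 2 w_def)
        have lo: "k (i - 1) < j" if "0 < i"
          using hb that 2(1) k[of "i - 1"] above_le[OF wtau hz, of "k (i - 1)"] wtau 22(1) by (auto simp: cband_def)
        have up: "j \<le> k i" if "i < m sig"
          using hb that k[of i] below_le[OF wtau hz, of "k i"] wtau 22(1) by (auto simp: cband_def)
        show ?thesis
        proof
          fix z' assume "z' \<in> D'"
          then have z': "prj v z' \<in> tau" "hgt v z' \<in> band (m tau) (\<xi> tau) j (prj v z')" using mem_bnd[OF tau] by (auto simp: 22)
          have "\<zeta> sig (i - 1) (prj v z') \<le> hgt v z'" if "0 < i"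
            using lo[OF that] above_le[OF z', of "k (i - 1)"] k[of "i - 1"] z'(1) that 2(1) 22(1) by simp
          moreover have "hgt v z' \<le> \<zeta> sig i (prj v z')" if "i < m sig"
            using up[OF that] below_le[OF z', of "k i"] k[OF that] z'(1) 22(1) by simp
          ultimately show "z' \<in> closure D" using z' sub by (auto simp: 2 mem_cl_bnd[OF sig 2(1)] cband_def)
        qed
      qed
    qed
  qed
  ultimately have "cad F V \<D>" unfolding cad_def by blast
  then show ?thesis by blast
qed

lemma cad_exists:
  fixes V :: "'a::euclidean_space set"
  assumes "subspace V" "finite F" "\<And>f. f \<in> F \<Longrightarrow> polyfun f"
  shows "\<exists>\<D>. cad F V \<D>"
  using assms
proof (induction "dim V" arbitrary: V F)
  case 0
  then have "V = {0}" using subspace_0[of V] dim_eq_0[of V] by auto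
  then show ?case using cad_trivial by blast
next
  case (Suc k)
  show ?case
  proof (rule cad_step[OF Suc.prems])
    show "dim V \<noteq> 0" using Suc.hyps(2) by linarith
    show "\<exists>\<D>. cad G W \<D>" if "subspace W" "dim V = Suc (dim W)" "finite G" "\<And>g. g \<in> G \<Longrightarrow> polyfun g" for W :: "'a set" and G
      using Suc.hyps(1)[of W G] Suc.hyps(2) that by simp
  qed
qed

section \<open>Closed unions of cells\<close>

lemma cad_cell: "cad F V \<D> \<Longrightarrow> D \<in> \<D> \<Longrightarrow> D \<noteq> {} \<and> connected D \<and> sign_const F D \<and> AR (closure D) \<and> closed (closure D - D)"
  and cad_disjoint: "cad F V \<D> \<Longrightarrow> D \<in> \<D> \<Longrightarrow> D' \<in> \<D> \<Longrightarrow> D = D' \<or> D \<inter> D' = {}"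
  and cad_frontier: "cad F V \<D> \<Longrightarrow> D \<in> \<D> \<Longrightarrow> D' \<in> \<D> \<Longrightarrow> D' \<inter> closure D \<noteq> {} \<Longrightarrow> D' \<subseteq> closure D"
  unfolding cad_def by simp_all

text \<open>A cell whose closure is maximal can be removed without destroying closedness. Its
  closure is glued to the rest along \<open>closure D - D\<close>, which is a closed union of fewer
  cells.\<close>

lemma cad_closed_union_ANR:
  fixes V :: "'a::euclidean_space set"
  assumes cad: "cad F V \<D>" and "\<U> \<subseteq> \<D>" "closed (\<Union>\<U>)"
  shows "ANR (\<Union>\<U>)"
  using assms(2,3)
proof (induction "card \<U>" arbitrary: \<U> rule: less_induct)
  case less
  have fin: "finite \<U>" using cad less.prems(1) by (auto simp: cad_def intro: finite_subset)
  show ?case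
  proof (cases "\<U> = {}")
    case False
    have disj: "D = D' \<or> D \<inter> D' = {}" if "D \<in> \<U>" "D' \<in> \<U>" for D D'
      using cad_disjoint[OF cad] less.prems(1) that by blast
    have fr: "D' \<inter> closure D \<noteq> {} \<Longrightarrow> D' \<subseteq> closure D" if "D \<in> \<U>" "D' \<in> \<U>" for D D'
      using cad_frontier[OF cad, of D D'] less.prems(1) that by blast
    have cell: "D \<noteq> {} \<and> AR (closure D) \<and> closed (closure D - D)" if "D \<in> \<U>" for D
      using cad_cell[OF cad] less.prems(1) that by blast
    obtain C where "C \<in> closure ` \<U>" "\<forall>b\<in>closure ` \<U>. C \<subseteq> b \<longrightarrow> C = b"
      using finite_has_maximal[of "closure ` \<U>"] fin False by auto
    then obtain D where D: "D \<in> \<U>" "\<And>D'. D' \<in> \<U> \<Longrightarrow> closure D \<subseteq> closure D' \<Longrightarrow> closure D = closure D'" by auto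
    have max: "D' = D" if D': "D' \<in> \<U>" "D \<subseteq> closure D'" for D'
    proof (rule ccontr)
      assume "D' \<noteq> D"
      have "closure D \<subseteq> closure D'" using D'(2) by (simp add: closure_minimal)
      then have "closure D = closure D'" using D(2)[OF D'(1)] by blast
      \<comment> \<open>Distinct cells cannot have the same closure: the closed set
        \<open>closure D - D\<close> would contain \<open>D'\<close> and hence
        \<open>closure D'\<close>, to which \<open>D\<close> belongs.\<close>
      then have "D' \<subseteq> closure D - D" using closure_subset[of D'] disj[OF D'(1) D(1)] \<open>D' \<noteq> D\<close> by blast
      then have "closure D' \<subseteq> closure D - D" using cell[OF D(1)] by (intro closure_minimal) auto
      then show False using D'(2) cell[OF D(1)] by blast
    qed
    define \<U>' where "\<U>' = \<U> - {D}"
    have U': "\<Union>\<U>' = \<Union>\<U> - D" using disj[OF D(1)] by (auto simp: \<U>'_def)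
    have clD: "closure D \<subseteq> \<Union>\<U>" using D(1) less.prems(2) by (intro closure_minimal) auto
    have "closed (\<Union>\<U>')"
    proof -
      have "closure (\<Union>\<U>') \<subseteq> \<Union> (closure ` \<U>')"
      proof (rule closure_minimal)
        show "\<Union>\<U>' \<subseteq> \<Union> (closure ` \<U>')" using closure_subset by blast
        show "closed (\<Union> (closure ` \<U>'))" using fin by (intro closed_Union) (auto simp: \<U>'_def)
      qed
      also have "\<dots> \<subseteq> \<Union>\<U> - D"
      proof
        fix x assume "x \<in> \<Union> (closure ` \<U>')"
        then obtain D' where D': "D' \<in> \<U>" "D' \<noteq> D" "x \<in> closure D'" by (auto simp: \<U>'_def)
        have "closure D' \<subseteq> \<Union>\<U>" using D'(1) less.prems(2) by (intro closure_minimal) auto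
        moreover have "x \<notin> D" using fr[OF D'(1) D(1)] max[OF D'(1)] D'(2,3) by blast
        ultimately show "x \<in> \<Union>\<U> - D" using D'(3) by blast
      qed
      finally show ?thesis unfolding U'[symmetric] by (simp only: closure_subset_eq)
    qed
    moreover have "card \<U>' < card \<U>" unfolding \<U>'_def using D(1) fin by (rule card_Diff1_less[rotated])
    ultimately have ANR': "ANR (\<Union>\<U>')" using less.hyps[of \<U>'] less.prems(1) by (auto simp: \<U>'_def)
    define \<U>2 where "\<U>2 = {D'\<in>\<U>'. D' \<subseteq> closure D}"
    have I: "\<Union>\<U>' \<inter> closure D = closure D - D" using clD U' by blast
    have U2: "\<Union>\<U>2 = closure D - D"
    proof
      show "\<Union>\<U>2 \<subseteq> closure D - D" using I by (auto simp: \<U>2_def)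
      show "closure D - D \<subseteq> \<Union>\<U>2"
      proof
        fix x assume "x \<in> closure D - D"
        then obtain D' where "D' \<in> \<U>'" "x \<in> D'" "x \<in> closure D" using I by blast
        then show "x \<in> \<Union>\<U>2" using fr[OF D(1), of D'] by (auto simp: \<U>2_def \<U>'_def)
      qed
    qed
    have "card \<U>2 \<le> card \<U>'" using fin by (intro card_mono) (auto simp: \<U>2_def \<U>'_def)
    then have "ANR (\<Union>\<U>2)" using less.hyps[of \<U>2] \<open>card \<U>' < card \<U>\<close> less.prems(1) U2 cell[OF D(1)]
      by (auto simp: \<U>2_def \<U>'_def)
    then have "ANR (\<Union>\<U>' \<union> closure D)"
      using \<open>closed (\<Union>\<U>')\<close> ANR' cell[OF D(1)] by (intro ANR_closed_Un) (auto simp: I U2 AR_imp_ANR)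
    moreover have "\<Union>\<U>' \<union> closure D = \<Union>\<U>" using clD U' closure_subset[of D] by blast
    ultimately show ?thesis by simp
  qed simp
qed

text \<open>Cells are connected with constant signs, so a decomposition adapted to the polynomials
  of \<open>S\<close> has \<open>S\<close> as a union of cells.\<close>

theorem closed_constructible_ANR:
  fixes S :: "'a::euclidean_space set"
  assumes "closed S" "constructible S"
  shows "ANR S"
proof -
  obtain G where G: "finite G" "\<forall>g\<in>G. polyfun g" "\<forall>C. connected C \<longrightarrow> sign_const G C \<longrightarrow> C \<subseteq> S \<or> C \<inter> S = {}"
    by (rule constructibleE[OF assms(2)])
  obtain \<D> where cad: "cad G (UNIV :: 'a set) \<D>" using cad_exists[OF subspace_UNIV G(1)] G(2) by blast
  have "\<Union>{D\<in>\<D>. D \<subseteq> S} = S"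
  proof (intro equalityI subsetI)
    fix x assume x: "x \<in> S"
    have "x \<in> \<Union>\<D>" using cad by (simp add: cad_def)
    then obtain D where D: "D \<in> \<D>" "x \<in> D" by blast
    then have "connected D" "sign_const G D" using cad_cell[OF cad] by blast+
    then have "D \<subseteq> S" using G(3) D x by blast
    then show "x \<in> \<Union>{D\<in>\<D>. D \<subseteq> S}" using D by blast
  qed auto
  then show ?thesis using cad_closed_union_ANR[OF cad, of "{D\<in>\<D>. D \<subseteq> S}"] assms(1) by auto
qed

subsection \<open>Strong deformation retracts\<close>

abbreviation "sdr \<equiv> strong_deformation_retract"

lemma sdrE:
  assumes "sdr S X"
  obtains H where "continuous_on ({0..1::real} \<times> X) H" "\<And>t x. t \<in> {0..1} \<Longrightarrow> x \<in> X \<Longrightarrow> H (t, x) \<in> X"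
    "\<And>x. x \<in> X \<Longrightarrow> H (0, x) = x" "\<And>x. x \<in> X \<Longrightarrow> H (1, x) \<in> S" "\<And>t s. t \<in> {0..1} \<Longrightarrow> s \<in> S \<Longrightarrow> H (t, s) = s"
    "S \<subseteq> X"
proof -
  from assms obtain H where H: "S \<subseteq> X \<and> continuous_on ({0..1::real} \<times> X) H \<and> H ` ({0..1} \<times> X) \<subseteq> X \<and>
        (\<forall>x\<in>X. H (0, x) = x) \<and> (\<forall>x\<in>X. H (1, x) \<in> S) \<and> (\<forall>t\<in>{0..1}. \<forall>s\<in>S. H (t, s) = s)"
    unfolding strong_deformation_retract_def by blast
  show ?thesis by (rule that[of H]) (use H in auto)
qed

lemma sdrI:
  assumes "S \<subseteq> X" "continuous_on ({0..1::real} \<times> X) H" "\<And>t x. t \<in> {0..1} \<Longrightarrow> x \<in> X \<Longrightarrow> H (t, x) \<in> X"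
    "\<And>x. x \<in> X \<Longrightarrow> H (0, x) = x" "\<And>x. x \<in> X \<Longrightarrow> H (1, x) \<in> S" "\<And>t s. t \<in> {0..1} \<Longrightarrow> s \<in> S \<Longrightarrow> H (t, s) = s"
  shows "sdr S X"
  unfolding strong_deformation_retract_def using assms by blast

lemma sdr_refl: "sdr S S"
  by (rule sdrI[of _ _ snd]) (auto intro!: continuous_intros)

lemma sdr_trans:
  assumes "sdr S T" "sdr T X" shows "sdr S X"
proof -
  obtain H where H: "continuous_on ({0..1::real} \<times> T) H" "\<And>t x. t \<in> {0..1} \<Longrightarrow> x \<in> T \<Longrightarrow> H (t, x) \<in> T"
    "\<And>x. x \<in> T \<Longrightarrow> H (0, x) = x" "\<And>x. x \<in> T \<Longrightarrow> H (1, x) \<in> S" "\<And>t s. t \<in> {0..1} \<Longrightarrow> s \<in> S \<Longrightarrow> H (t, s) = s"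
    "S \<subseteq> T" using sdrE[OF assms(1)] by blast
  obtain K where K: "continuous_on ({0..1::real} \<times> X) K" "\<And>t x. t \<in> {0..1} \<Longrightarrow> x \<in> X \<Longrightarrow> K (t, x) \<in> X"
    "\<And>x. x \<in> X \<Longrightarrow> K (0, x) = x" "\<And>x. x \<in> X \<Longrightarrow> K (1, x) \<in> T" "\<And>t s. t \<in> {0..1} \<Longrightarrow> s \<in> T \<Longrightarrow> K (t, s) = s"
    "T \<subseteq> X" using sdrE[OF assms(2)] by blast
  define G where "G z = (if fst z \<le> 1/2 then K (2 * fst z, snd z) else H (2 * fst z - 1, K (1, snd z)))" for z :: "real \<times> 'a"
  show ?thesis
  proof (rule sdrI[of _ _ G])
    show "continuous_on ({0..1} \<times> X) G"
      unfolding G_def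
    proof (rule continuous_on_cases_le)
      show "continuous_on {z \<in> {0..1} \<times> X. fst z \<le> 1/2} (\<lambda>z. K (2 * fst z, snd z))"
        by (rule continuous_on_compose2[OF K(1)]) (auto intro!: continuous_intros)
      have c: "continuous_on {z \<in> {0..1} \<times> X. (1/2::real) \<le> fst z} (\<lambda>z. K (1, snd z))"
        by (rule continuous_on_compose2[OF K(1)]) (auto intro!: continuous_intros)
      show "continuous_on {z \<in> {0..1} \<times> X. 1/2 \<le> fst z} (\<lambda>z. H (2 * fst z - 1, K (1, snd z)))"
      proof (rule continuous_on_compose2[OF H(1)])
        show "continuous_on {z \<in> {0..1} \<times> X. (1/2::real) \<le> fst z} (\<lambda>z. (2 * fst z - 1, K (1, snd z)))"
          by (intro continuous_intros c)
      qed (use K(4) in auto)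
      show "K (2 * fst z, snd z) = H (2 * fst z - 1, K (1, snd z))" if "z \<in> {0..1} \<times> X" "fst z = 1/2" for z
      proof -
        have "2 * fst z = 1" "snd z \<in> X" using that by auto
        then show ?thesis using H(3)[OF K(4)] by simp
      qed
    qed (intro continuous_intros)
    show "G (t, x) \<in> X" if "t \<in> {0..1}" "x \<in> X" for t x
      using that K(2)[of "2 * t" x] H(2)[of "2 * t - 1" "K (1, x)"] K(4) K(6) by (auto simp: G_def)
    show "G (t, s) = s" if "t \<in> {0..1}" "s \<in> S" for t s
      using that K(5)[of "2 * t" s] K(5)[of 1 s] H(5)[of "2 * t - 1" s] H(6) by (auto simp: G_def)
  qed (use H K in \<open>auto simp: G_def\<close>)
qed

text \<open>The deformation of \<open>X\<close> is extended by the identity of \<open>T\<close>. On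
  the overlap it is the identity because \<open>X \<inter> T \<subseteq> S\<close>, and closedness
  makes the union continuous.\<close>

lemma sdr_glue:
  assumes "sdr S X" "closed X" "closed T" "X \<inter> T \<subseteq> S" "S \<subseteq> T"
  shows "sdr T (X \<union> T)"
proof -
  obtain H where H: "continuous_on ({0..1::real} \<times> X) H" "\<And>t x. t \<in> {0..1} \<Longrightarrow> x \<in> X \<Longrightarrow> H (t, x) \<in> X"
    "\<And>x. x \<in> X \<Longrightarrow> H (0, x) = x" "\<And>x. x \<in> X \<Longrightarrow> H (1, x) \<in> S" "\<And>t s. t \<in> {0..1} \<Longrightarrow> s \<in> S \<Longrightarrow> H (t, s) = s"
    "S \<subseteq> X" using sdrE[OF assms(1)] by blast
  define G where "G z = (if snd z \<in> X then H z else snd z)" for z :: "real \<times> 'a"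
  have GT: "G (t, x) = x" if "t \<in> {0..1}" "x \<in> T" for t x using that assms(4) H(5) by (auto simp: G_def)
  show ?thesis
  proof (rule sdrI[of _ _ G])
    have "continuous_on ({0..1} \<times> X \<union> {0..1} \<times> T) G"
    proof (rule continuous_on_closed_Un)
      show "continuous_on ({0..1} \<times> X) G" by (rule continuous_on_eq[OF H(1)]) (auto simp: G_def)
      show "continuous_on ({0..1} \<times> T) G" by (rule continuous_on_eq[of _ snd]) (auto intro!: continuous_intros simp: GT)
    qed (use assms in \<open>auto intro: closed_Times\<close>)
    then show "continuous_on ({0..1} \<times> (X \<union> T)) G" by (simp add: Sigma_Un_distrib2)
    show "G (t, x) \<in> X \<union> T" if "t \<in> {0..1}" "x \<in> X \<union> T" for t x
      using that H(2) GT by (auto simp: G_def)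
    show "G (0, x) = x" if "x \<in> X \<union> T" for x using that H(3) by (auto simp: G_def)
    show "G (1, x) \<in> T" if "x \<in> X \<union> T" for x using that H(4) assms(5) by (auto simp: G_def)
  qed (use GT in auto)
qed

text \<open>A continuous map from a compact set is a quotient map onto its image: convergent
  sequences in the image lift to sequences with convergent subsequences.\<close>

lemma continuous_on_quotient:
  fixes q :: "'a::metric_space \<Rightarrow> 'b::metric_space" and f :: "'b \<Rightarrow> 'c::metric_space"
  assumes "compact Y" "continuous_on Y q" "continuous_on Y (\<lambda>y. f (q y))"
  shows "continuous_on (q ` Y) f"
proof (rule continuous_on_subseqI)
  fix x a assume x: "a \<in> q ` Y" "\<And>n. x n \<in> q ` Y" "x \<longlonglongrightarrow> a"
  have "\<forall>n. \<exists>y\<in>Y. x n = q y" using x(2) by blast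
  then obtain y where y: "\<And>n. y n \<in> Y" "\<And>n. x n = q (y n)" by metis
  obtain b s where s: "b \<in> Y" "strict_mono s" "(y \<circ> s) \<longlonglongrightarrow> b"
    using seq_compactE[OF compact_imp_seq_compact[OF assms(1)], of y] y(1) by metis
  have ys: "\<forall>n. (y \<circ> s) n \<in> Y" using y(1) by simp
  have lim: "(\<lambda>n. q (y (s n))) \<longlonglongrightarrow> q b" "(\<lambda>n. f (q (y (s n)))) \<longlonglongrightarrow> f (q b)"
    using continuous_on_tendsto_compose[OF assms(2) s(3,1)] continuous_on_tendsto_compose[OF assms(3) s(3,1)] ys by (simp_all add: o_def)
  have "(\<lambda>n. q (y (s n))) \<longlonglongrightarrow> a"
    using LIMSEQ_subseq_LIMSEQ[OF x(3) s(2)] by (simp add: o_def y(2))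
  then have "q b = a" using LIMSEQ_unique[OF lim(1)] by blast
  then have "(\<lambda>n. f (x (s n))) \<longlonglongrightarrow> f a" using lim(2) by (simp add: y(2))
  with s(2) show "\<exists>s. strict_mono (s::nat\<Rightarrow>nat) \<and> (\<lambda>n. f (x (s n))) \<longlonglongrightarrow> f a" by blast
qed

text \<open>Distinct points that \<open>\<pi>\<close> identifies lie in \<open>E'\<close>, which is
  mapped into \<open>X\<close> and fixed by the deformation since \<open>E' \<subseteq> F\<close>.
  The deformation therefore descends to the image and agrees with the identity of
  \<open>X\<close>.\<close>

lemma sdr_push:
  fixes \<pi> :: "'a::metric_space \<Rightarrow> 'b::metric_space"
  assumes sdr: "sdr F E" and E: "compact E" and \<pi>: "continuous_on E \<pi>" and X: "closed X"
    and X_iff: "\<And>e. e \<in> E \<Longrightarrow> \<pi> e \<in> X \<longleftrightarrow> e \<in> E'" and E': "E' \<subseteq> F"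
    and inj: "\<And>e e'. e \<in> E \<Longrightarrow> e' \<in> E \<Longrightarrow> \<pi> e = \<pi> e' \<Longrightarrow> e \<notin> E' \<Longrightarrow> e = e'"
  shows "sdr (X \<union> \<pi> ` F) (X \<union> \<pi> ` E)"
proof -
  obtain H where H: "continuous_on ({0..1::real} \<times> E) H" "\<And>t x. t \<in> {0..1} \<Longrightarrow> x \<in> E \<Longrightarrow> H (t, x) \<in> E"
    "\<And>x. x \<in> E \<Longrightarrow> H (0, x) = x" "\<And>x. x \<in> E \<Longrightarrow> H (1, x) \<in> F" "\<And>t s. t \<in> {0..1} \<Longrightarrow> s \<in> F \<Longrightarrow> H (t, s) = s"
    "F \<subseteq> E" using sdrE[OF sdr] by blast
  \<comment> \<open>Outside \<open>X\<close> the preimage in \<open>E\<close> is unique, so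
    \<open>inv_into\<close> yields it.\<close>
  define G where "G z = (if snd z \<in> X then snd z else \<pi> (H (fst z, inv_into E \<pi> (snd z))))" for z :: "real \<times> 'b"
  have Gq: "G (t, \<pi> e) = \<pi> (H (t, e))" if "t \<in> {0..1}" "e \<in> E" for t e
  proof (cases "\<pi> e \<in> X")
    case True
    then have "e \<in> F" using X_iff[OF that(2)] E' by blast
    then show ?thesis using True H(5)[OF that(1)] by (simp add: G_def)
  next
    case False
    then have "e \<notin> E'" using X_iff[OF that(2)] by blast
    moreover have "inv_into E \<pi> (\<pi> e) \<in> E" "\<pi> (inv_into E \<pi> (\<pi> e)) = \<pi> e"
      using that(2) by (auto intro: inv_into_into f_inv_into_f)
    ultimately have "inv_into E \<pi> (\<pi> e) = e" using inj[OF that(2)] by metis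
    then show ?thesis using False by (simp add: G_def)
  qed
  show ?thesis
  proof (rule sdrI[of _ _ G])
    have "continuous_on ({0..1} \<times> X \<union> {0..1} \<times> \<pi> ` E) G"
    proof (rule continuous_on_closed_Un)
      show "continuous_on ({0..1} \<times> X) G" by (rule continuous_on_eq[of _ snd]) (auto intro!: continuous_intros simp: G_def)
      have "continuous_on ((\<lambda>z. (fst z, \<pi> (snd z))) ` ({0..1} \<times> E)) G"
      proof (rule continuous_on_quotient)
        show "compact ({0..1::real} \<times> E)" using E by (intro compact_Times) auto
        show "continuous_on ({0..1} \<times> E) (\<lambda>z. (fst z, \<pi> (snd z)))"
          by (intro continuous_intros continuous_on_compose2[OF \<pi>]) auto
        have "continuous_on ({0..1} \<times> E) (\<lambda>z. \<pi> (H z))"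
          by (rule continuous_on_compose2[OF \<pi> H(1)]) (use H(2) in auto)
        then show "continuous_on ({0..1} \<times> E) (\<lambda>z. G (fst z, \<pi> (snd z)))"
          by (rule continuous_on_eq) (auto simp: Gq)
      qed
      moreover have "(\<lambda>z. (fst z, \<pi> (snd z))) ` ({0..1::real} \<times> E) = {0..1} \<times> \<pi> ` E" by force
      ultimately show "continuous_on ({0..1} \<times> \<pi> ` E) G" by simp
      show "closed ({0..1::real} \<times> \<pi> ` E)"
        using E \<pi> by (intro closed_Times compact_imp_closed compact_continuous_image) auto
      show "closed ({0..1::real} \<times> X)" using X by (intro closed_Times) auto
    qed
    then show "continuous_on ({0..1} \<times> (X \<union> \<pi> ` E)) G" by (simp add: Sigma_Un_distrib2)
    show "X \<union> \<pi> ` F \<subseteq> X \<union> \<pi> ` E" using H(6) by blast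
    show "G (t, x) \<in> X \<union> \<pi> ` E" if "t \<in> {0..1}" "x \<in> X \<union> \<pi> ` E" for t x
      using that H(2) by (cases "x \<in> X") (auto simp: Gq, auto simp: G_def)
    show "G (0, x) = x" if "x \<in> X \<union> \<pi> ` E" for x
      using that H(3) by (cases "x \<in> X") (auto simp: Gq, auto simp: G_def)
    show "G (1, x) \<in> X \<union> \<pi> ` F" if "x \<in> X \<union> \<pi> ` E" for x
      using that H(4) by (cases "x \<in> X") (auto simp: Gq, auto simp: G_def)
    show "G (t, x) = x" if t: "t \<in> {0..1}" and x: "x \<in> X \<union> \<pi> ` F" for t x
    proof (cases "x \<in> X")
      case False
      then obtain e where "e \<in> F" "x = \<pi> e" using x by blast
      then show ?thesis using Gq[OF t, of e] H(5)[OF t] H(6) by auto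
    qed (simp add: G_def)
  qed
qed

lemma sdr_homeomorphism:
  assumes hom: "homeomorphism X Y h g" and sdr: "sdr S X"
  shows "sdr (h ` S) Y"
proof -
  obtain H where H: "continuous_on ({0..1::real} \<times> X) H" "\<And>t x. t \<in> {0..1} \<Longrightarrow> x \<in> X \<Longrightarrow> H (t, x) \<in> X"
    "\<And>x. x \<in> X \<Longrightarrow> H (0, x) = x" "\<And>x. x \<in> X \<Longrightarrow> H (1, x) \<in> S" "\<And>t s. t \<in> {0..1} \<Longrightarrow> s \<in> S \<Longrightarrow> H (t, s) = s"
    "S \<subseteq> X" using sdrE[OF sdr] by blast
  have h: "continuous_on X h" "continuous_on Y g" "\<And>x. x \<in> X \<Longrightarrow> g (h x) = x" "\<And>y. y \<in> Y \<Longrightarrow> h (g y) = y"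
    "h ` X = Y" "g ` Y = X" using hom by (auto simp: homeomorphism_def)
  have gY: "g y \<in> X" if "y \<in> Y" for y using h(6) that by blast
  show ?thesis
  proof (rule sdrI[of _ _ "\<lambda>z. h (H (fst z, g (snd z)))"])
    have "continuous_on ({0..1} \<times> Y) (\<lambda>z. H (fst z, g (snd z)))"
      by (intro continuous_on_compose2[OF H(1)] continuous_intros continuous_on_compose2[OF h(2)]) (auto simp: gY)
    then show "continuous_on ({0..1} \<times> Y) (\<lambda>z. h (H (fst z, g (snd z))))"
      by (rule continuous_on_compose2[OF h(1)]) (use H(2) gY in auto)
    show "h ` S \<subseteq> Y" using h(5) H(6) by blast
    show "h (H (fst (t, s), g (snd (t, s)))) = s" if "t \<in> {0..1}" "s \<in> h ` S" for t s
      using that H(5,6) h(3) by auto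
    show "h (H (fst (t, x), g (snd (t, x)))) \<in> Y" if "t \<in> {0..1}" "x \<in> Y" for t x
      using H(2)[OF that(1) gY[OF that(2)]] h(5) by auto
  qed (use H h gY in auto)
qed

lemma homotopic_canon_iff:
  "homotopic_with_canon (\<lambda>x. True) S T f g \<longleftrightarrow>
   (\<exists>h. continuous_on ({0..1::real} \<times> S) h \<and> h ` ({0..1} \<times> S) \<subseteq> T \<and> (\<forall>x\<in>S. h (0, x) = f x) \<and> (\<forall>x\<in>S. h (1, x) = g x))"
  by (subst homotopic_with) (auto simp: image_subset_iff_funcset)

text \<open>Up to homotopy \<open>E\<close> and \<open>F\<close> are both \<open>T\<close>; the homotopy extension property turns the resulting
  homotopy inverse of the inclusion into a strong deformation retraction.\<close>

lemma sdr_of_ANR: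
  fixes E :: "'a::euclidean_space set"
  assumes ANR: "ANR E" "ANR F" and F: "closedin (top_of_set E) F" and sdr: "sdr T F"
    and C: "continuous_on ({0..1::real} \<times> E) C" "\<And>t x. t \<in> {0..1} \<Longrightarrow> x \<in> E \<Longrightarrow> C (t, x) \<in> E"
      "\<And>x. x \<in> E \<Longrightarrow> C (0, x) = x" "\<And>x. x \<in> E \<Longrightarrow> C (1, x) \<in> T" "\<And>t x. t \<in> {0..1} \<Longrightarrow> x \<in> T \<Longrightarrow> C (t, x) \<in> T"
  shows "sdr F E"
proof -
  have FE: "F \<subseteq> E" using F by (rule closedin_imp_subset)
  obtain R where R: "continuous_on ({0..1::real} \<times> F) R" "\<And>t x. t \<in> {0..1} \<Longrightarrow> x \<in> F \<Longrightarrow> R (t, x) \<in> F"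
    "\<And>x. x \<in> F \<Longrightarrow> R (0, x) = x" "\<And>x. x \<in> F \<Longrightarrow> R (1, x) \<in> T" "\<And>t s. t \<in> {0..1} \<Longrightarrow> s \<in> T \<Longrightarrow> R (t, s) = s"
    "T \<subseteq> F" using sdrE[OF sdr] by blast
  have RE: "R (1, x) \<in> E" if "x \<in> F" for x using R(4)[OF that] R(6) FE by blast
  \<comment> \<open>On \<open>F\<close> the end map of \<open>C\<close> is homotopic to the
    identity: \<open>R\<close> joins the identity to its end map, \<open>C\<close> moves that map
    within \<open>T\<close>, and the end map of \<open>C\<close> applied to \<open>R\<close> joins
    the result to the end map of \<open>C\<close>.\<close>
  have h1: "homotopic_with_canon (\<lambda>x. True) F F (\<lambda>x. x) (\<lambda>x. R (1, x))"
    unfolding homotopic_canon_iff by (intro exI[of _ R]) (use R in auto)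
  have h2: "homotopic_with_canon (\<lambda>x. True) F F (\<lambda>x. R (1, x)) (\<lambda>x. C (1, R (1, x)))"
    unfolding homotopic_canon_iff
  proof (intro exI[of _ "\<lambda>z. C (fst z, R (1, snd z))"] conjI ballI)
    have "continuous_on ({0..1::real} \<times> F) (\<lambda>z. R (1, snd z))"
      by (intro continuous_on_compose2[OF R(1)] continuous_intros) auto
    then show "continuous_on ({0..1::real} \<times> F) (\<lambda>z. C (fst z, R (1, snd z)))"
      by (intro continuous_on_compose2[OF C(1)] continuous_intros) (use RE in auto)
    show "(\<lambda>z. C (fst z, R (1, snd z))) ` ({0..1} \<times> F) \<subseteq> F" using C(5) R(4,6) by auto
  qed (use C(3) RE in auto)
  have h3: "homotopic_with_canon (\<lambda>x. True) F F (\<lambda>x. C (1, x)) (\<lambda>x. C (1, R (1, x)))"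
    unfolding homotopic_canon_iff
  proof (intro exI[of _ "\<lambda>z. C (1, R z)"] conjI ballI)
    show "continuous_on ({0..1::real} \<times> F) (\<lambda>z. C (1, R z))"
      by (intro continuous_on_compose2[OF C(1)] continuous_intros R(1)) (use R(2) FE in auto)
    show "(\<lambda>z. C (1, R z)) ` ({0..1} \<times> F) \<subseteq> F"
    proof (intro image_subsetI)
      fix z assume "z \<in> {0..1::real} \<times> F"
      then have "R z \<in> E" using R(2)[of "fst z" "snd z"] FE by auto
      then show "C (1, R z) \<in> F" using C(4) R(6) by blast
    qed
  qed (use R(3) in auto)
  have "homotopic_with_canon (\<lambda>x. True) F F (\<lambda>x. C (1, x)) (\<lambda>x. x)"
    using homotopic_with_trans[OF h3 homotopic_with_symD[OF homotopic_with_trans[OF h1 h2]]] .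
  moreover have C1: "continuous_on E (\<lambda>x. C (1, x))"
    by (intro continuous_on_compose2[OF C(1)] continuous_intros) auto
  \<comment> \<open>Homotopy extension along \<open>F\<close> replaces the end map of
    \<open>C\<close> by a homotopic map \<open>r\<close> into \<open>F\<close> that is the identity
    on \<open>F\<close>.\<close>
  ultimately obtain r where r: "homotopic_with_canon (\<lambda>x. True) E F (\<lambda>x. C (1, x)) r" "continuous_on E r" "r ` E \<subseteq> F"
      "\<And>x. x \<in> F \<Longrightarrow> r x = x"
    using Borsuk_homotopy_extension_homotopic[OF F, of F "\<lambda>x. C (1, x)" "\<lambda>x. x"] ANR(2) C(4) R(6) by blast
  have "homotopic_with_canon (\<lambda>x. True) E E (\<lambda>x. x) (\<lambda>x. C (1, x))"
    unfolding homotopic_canon_iff by (intro exI[of _ C]) (use C in auto)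
  moreover have "homotopic_with_canon (\<lambda>x. True) E E (\<lambda>x. C (1, x)) r"
    using r(1) FE by (rule homotopic_with_subset_right)
  ultimately have "homotopic_with_canon (\<lambda>x. True) E E (\<lambda>x. x) r" by (rule homotopic_with_trans)
  then obtain D where D: "continuous_on ({0..1::real} \<times> E) D" "D ` ({0..1} \<times> E) \<subseteq> E"
    "\<And>x. x \<in> E \<Longrightarrow> D (0, x) = x" "\<And>x. x \<in> E \<Longrightarrow> D (1, x) = r x"
    unfolding homotopic_canon_iff by blast
  define Y where "Y = {0..1::real} \<times> E"
  \<comment> \<open>On three sides of the cylinder over \<open>E\<close> the homotopy
    \<open>D\<close> is to be replaced by \<open>u\<close>, which is constant in time on
    \<open>F\<close>. Running \<open>D\<close> backwards from \<open>D\<close> to \<open>u\<close>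
    is consistent at the end of the cylinder because \<open>r\<close> is idempotent.\<close>
  define S where "S = ({0} \<times> E \<union> {0..1::real} \<times> F) \<union> {1} \<times> E"
  define u where "u z = (if fst z = 1 then r (snd z) else snd z)" for z :: "real \<times> 'a"
  have rE: "r x \<in> F" if "x \<in> E" for x using r(3) that by blast
  have rE': "r x \<in> E" if "x \<in> E" for x using rE[OF that] FE by blast
  have uE: "u z \<in> E" if "z \<in> S" for z using that rE' FE by (auto simp: u_def S_def)
  have SY: "S \<subseteq> Y" using FE by (auto simp: S_def Y_def)
  have cl: "closedin (top_of_set Y) ({0} \<times> E \<union> {0..1::real} \<times> F)" "closedin (top_of_set Y) ({1} \<times> E)"
    unfolding Y_def by (intro closedin_Un closedin_Times F closedin_self closed_subset; simp)+
  have cu: "continuous_on S u"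
    unfolding S_def
  proof (rule continuous_on_Un_local)
    show "closedin (top_of_set ({0} \<times> E \<union> {0..1::real} \<times> F \<union> {1} \<times> E)) ({0} \<times> E \<union> {0..1} \<times> F)"
      by (rule closedin_subset_trans[OF cl(1)]) (use SY in \<open>auto simp: S_def\<close>)
    show "closedin (top_of_set ({0} \<times> E \<union> {0..1::real} \<times> F \<union> {1} \<times> E)) ({1} \<times> E)"
      by (rule closedin_subset_trans[OF cl(2)]) (use SY in \<open>auto simp: S_def\<close>)
    show "continuous_on ({0} \<times> E \<union> {0..1::real} \<times> F) u"
      by (rule continuous_on_eq[of _ snd]) (auto intro!: continuous_intros simp: u_def r(4))
    have "continuous_on ({1} \<times> E) (\<lambda>z. r (snd z))"
      by (intro continuous_on_compose2[OF r(2)] continuous_intros) auto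
    then show "continuous_on ({1} \<times> E) u" by (rule continuous_on_eq) (auto simp: u_def)
  qed
  have "homotopic_with_canon (\<lambda>x. True) S E D u"
    unfolding homotopic_canon_iff
  proof (intro exI[of _ "\<lambda>w. D ((1 - fst w) * fst (snd w), u (snd w))"] conjI ballI)
    have "(1 - s) * t \<in> {0..1}" if "s \<in> {0..1}" "t \<in> {0..1}" for s t :: real
      using that by (auto intro: mult_le_one)
    then have b: "((1 - fst w) * fst (snd w), u (snd w)) \<in> {0..1} \<times> E" if "w \<in> {0..1} \<times> S" for w
      using that uE[of "snd w"] SY by (auto simp: Y_def)
    have us: "continuous_on ({0..1::real} \<times> S) (\<lambda>w. u (snd w))"
      by (intro continuous_on_compose2[OF cu] continuous_intros) auto
    show "continuous_on ({0..1} \<times> S) (\<lambda>w. D ((1 - fst w) * fst (snd w), u (snd w)))"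
      by (intro continuous_on_compose2[OF D(1)] continuous_intros image_subsetI us) (rule b)
    show "(\<lambda>w. D ((1 - fst w) * fst (snd w), u (snd w))) ` ({0..1} \<times> S) \<subseteq> E"
    proof (rule image_subsetI)
      fix w assume "w \<in> {0..1::real} \<times> S"
      from b[OF this] show "D ((1 - fst w) * fst (snd w), u (snd w)) \<in> E" using D(2) by blast
    qed
    show "D ((1 - fst (0, z)) * fst (snd (0, z)), u (snd (0, z))) = D z" if "z \<in> S" for z
    proof (cases "fst z = 1")
      case True
      then have "snd z \<in> E" using that SY by (auto simp: Y_def)
      then have "D (1, r (snd z)) = D (1, snd z)" using rE FE D(4) r(4) by (metis subsetD)
      then show ?thesis using True by (cases z) (auto simp: u_def)
    qed (cases z, auto simp: u_def)
    show "D ((1 - fst (1, z)) * fst (snd (1, z)), u (snd (1, z))) = u z" if "z \<in> S" for z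
      using D(3)[OF uE[OF that]] by simp
  qed
  moreover have "closedin (top_of_set Y) S" unfolding S_def by (intro closedin_Un cl[unfolded closedin_Un])
  moreover have "continuous_on Y D" "D \<in> Y \<rightarrow> E" using D(1,2) by (auto simp: Y_def)
  ultimately obtain H where H: "continuous_on Y H" "H ` Y \<subseteq> E" "\<And>z. z \<in> S \<Longrightarrow> H z = u z"
    using Borsuk_homotopy_extension_homotopic[of Y S E D u] ANR(1) by metis
  show ?thesis
  proof (rule sdrI[of _ _ H])
    show "H (t, s) = s" if "t \<in> {0..1}" "s \<in> F" for t s
      using H(3)[of "(t, s)"] that r(4) by (auto simp: S_def u_def)
    show "H (0, x) = x" if "x \<in> E" for x using H(3)[of "(0, x)"] that by (auto simp: S_def u_def)
    show "H (1, x) \<in> F" if "x \<in> E" for x using H(3)[of "(1, x)"] that rE by (auto simp: S_def u_def)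
  qed (use FE H in \<open>auto simp: Y_def\<close>)
qed

subsection \<open>Operators as a Euclidean space\<close>

type_synonym 'g opr = "'g \<Rightarrow>\<^sub>L 'g"

text \<open>Basis vectors as indices turn operators into vectors of columns, a type of class
  \<open>euclidean_space\<close>, in which the results on absolute neighbourhood retracts are
  formulated.\<close>

typedef (overloaded) 'g bidx = "Basis :: 'g::euclidean_space set"
  using nonempty_Basis by blast

instance bidx :: (euclidean_space) finite
proof
  have "range (Rep_bidx :: 'a bidx \<Rightarrow> 'a) \<subseteq> Basis" using Rep_bidx by auto
  then have "finite (range (Rep_bidx :: 'a bidx \<Rightarrow> 'a))" by (rule finite_subset) simp
  then show "finite (UNIV :: 'a bidx set)"
    by (rule finite_imageD) (simp add: inj_on_def Rep_bidx_inject)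
qed

definition mat_of_op :: "'g::euclidean_space opr \<Rightarrow> 'g ^ 'g bidx" where
  "mat_of_op M = (\<chi> i. blinfun_apply M (Rep_bidx i))"

definition op_of_mat :: "'g::euclidean_space ^ 'g bidx \<Rightarrow> 'g opr" where
  "op_of_mat m = Blinfun (\<lambda>x. \<Sum>i\<in>UNIV. (x \<bullet> Rep_bidx i) *\<^sub>R (m $ i))"

lemma sum_bidx: "(\<Sum>i\<in>UNIV. f (Rep_bidx i :: 'g::euclidean_space)) = (\<Sum>b\<in>Basis. f b)"
proof -
  have "range (Rep_bidx :: 'g bidx \<Rightarrow> 'g) = Basis"
    using Rep_bidx Abs_bidx_inverse by (metis image_eqI subsetI subset_antisym image_subset_iff UNIV_I)
  moreover have "inj (Rep_bidx :: 'g bidx \<Rightarrow> 'g)" by (simp add: inj_on_def Rep_bidx_inject)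
  ultimately show ?thesis by (metis (no_types, lifting) sum.reindex_cong)
qed

lemma op_of_mat_apply: "blinfun_apply (op_of_mat m) x = (\<Sum>i\<in>UNIV. (x \<bullet> Rep_bidx i) *\<^sub>R (m $ i))"
  unfolding op_of_mat_def
  by (subst bounded_linear_Blinfun_apply)
    (auto intro!: bounded_linear_sum bounded_linear_scaleR_const bounded_linear_inner_left)

lemma op_of_mat_of_op [simp]: "op_of_mat (mat_of_op M) = M"
proof (rule blinfun_eqI)
  fix x
  have "blinfun_apply (op_of_mat (mat_of_op M)) x = (\<Sum>b\<in>Basis. (x \<bullet> b) *\<^sub>R blinfun_apply M b)"
    using sum_bidx[of "\<lambda>b. (x \<bullet> b) *\<^sub>R blinfun_apply M b"] by (simp add: op_of_mat_apply mat_of_op_def)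
  also have "\<dots> = blinfun_apply M (\<Sum>b\<in>Basis. (x \<bullet> b) *\<^sub>R b)"
    by (simp add: blinfun.sum_right blinfun.scaleR_right)
  finally show "blinfun_apply (op_of_mat (mat_of_op M)) x = blinfun_apply M x" by (simp add: euclidean_representation)
qed

lemma mat_of_op_of_mat [simp]: "mat_of_op (op_of_mat m) = m"
proof -
  have "(\<Sum>i\<in>UNIV. (Rep_bidx j \<bullet> Rep_bidx i) *\<^sub>R (m $ i)) = m $ j" for j
  proof -
    have "(\<Sum>i\<in>UNIV. (Rep_bidx j \<bullet> Rep_bidx i) *\<^sub>R (m $ i)) = (\<Sum>i\<in>UNIV. if i = j then m $ i else 0)"
      by (intro sum.cong refl) (simp add: inner_Basis Rep_bidx Rep_bidx_inject eq_commute[of j])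
    then show ?thesis by simp
  qed
  then show ?thesis by (simp add: vec_eq_iff mat_of_op_def op_of_mat_apply)
qed

lemma bounded_linear_mat_of_op: "bounded_linear mat_of_op"
proof -
  have "bounded_linear (\<lambda>M :: 'a \<Rightarrow>\<^sub>L 'a. \<Sum>i\<in>UNIV. axis i (blinfun_apply M (Rep_bidx i)))"
  proof (intro bounded_linear_sum)
    fix i :: "'a bidx"
    have "linear (axis i :: 'a \<Rightarrow> 'a ^ 'a bidx)" by (rule linearI) (auto simp: vec_eq_iff axis_def)
    then have "bounded_linear (axis i :: 'a \<Rightarrow> 'a ^ 'a bidx)" by (simp add: linear_conv_bounded_linear)
    then show "bounded_linear (\<lambda>M :: 'a \<Rightarrow>\<^sub>L 'a. axis i (blinfun_apply M (Rep_bidx i)))"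
      by (rule bounded_linear_compose) (rule blinfun.bounded_linear_left)
  qed
  moreover have "mat_of_op M = (\<Sum>i\<in>UNIV. axis i (blinfun_apply M (Rep_bidx i)))" for M :: "'a \<Rightarrow>\<^sub>L 'a"
    by (simp add: vec_eq_iff mat_of_op_def axis_def if_distrib cong: if_cong)
  ultimately show ?thesis by (metis (no_types, lifting) ext)
qed

lemma bounded_linear_op_of_mat: "bounded_linear op_of_mat"
proof -
  have "linear (op_of_mat :: 'a ^ 'a bidx \<Rightarrow> 'a \<Rightarrow>\<^sub>L 'a)"
    by (rule linearI; rule blinfun_eqI)
      (auto simp: op_of_mat_apply blinfun.add_left blinfun.scaleR_left scaleR_right_distrib sum.distrib scaleR_sum_right mult.commute)
  then show ?thesis by (simp add: linear_conv_bounded_linear)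
qed

lemma constructible_Collect_ex_op:
  fixes P :: "'a::real_normed_vector \<Rightarrow> 'g::euclidean_space opr \<Rightarrow> bool"
  assumes "constructible {z. P (fst z) (snd z)}"
  shows "constructible {x. \<exists>y. P x y}"
proof -
  have "bounded_linear (\<lambda>z :: 'a \<times> ('g ^ 'g bidx). (fst z, op_of_mat (snd z)))"
    by (intro bounded_linear_Pair bounded_linear_fst bounded_linear_compose[OF bounded_linear_op_of_mat bounded_linear_snd])
  from constructible_vimage_linear[OF assms this]
  have "constructible {z. P (fst z) (op_of_mat (snd z))}" by simp
  from constructible_Collect_ex[OF this] have "constructible {x. \<exists>m. P x (op_of_mat m)}" .
  moreover have "{x. \<exists>m. P x (op_of_mat m)} = {x. \<exists>y. P x y}" by (metis op_of_mat_of_op)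
  ultimately show ?thesis by simp
qed

text \<open>The form of \<open>sdr_of_ANR\<close> for families: a linear isomorphism with pairs of
  matrices transports it, and closed constructible sets supply both absolute neighbourhood
  retracts.\<close>

lemma sdr_of_constructible:
  fixes E F :: "('g::euclidean_space opr \<times> 'g opr) set"
  assumes E: "closed E" "constructible E" and F: "closed F" "constructible F" "F \<subseteq> E" and sdr: "sdr T F"
    and C: "continuous_on ({0..1::real} \<times> E) C" "\<And>t x. t \<in> {0..1} \<Longrightarrow> x \<in> E \<Longrightarrow> C (t, x) \<in> E"
      "\<And>x. x \<in> E \<Longrightarrow> C (0, x) = x" "\<And>x. x \<in> E \<Longrightarrow> C (1, x) \<in> T" "\<And>t x. t \<in> {0..1} \<Longrightarrow> x \<in> T \<Longrightarrow> C (t, x) \<in> T"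
  shows "sdr F E"
proof -
  define f where "f z = (mat_of_op (fst z), mat_of_op (snd z))" for z :: "'g opr \<times> 'g opr"
  define g where "g z = (op_of_mat (fst z), op_of_mat (snd z))" for z :: "('g ^ 'g bidx) \<times> ('g ^ 'g bidx)"
  have fg [simp]: "f (g z) = z" "g (f w) = w" for z w by (simp_all add: f_def g_def)
  have lin: "bounded_linear f" "bounded_linear g" unfolding f_def[abs_def] g_def[abs_def]
    by (intro bounded_linear_Pair bounded_linear_compose[OF bounded_linear_op_of_mat] bounded_linear_compose[OF bounded_linear_mat_of_op] bounded_linear_fst bounded_linear_snd)+
  have cont: "continuous_on S f" "continuous_on S' g" for S S' using lin by (auto intro: linear_continuous_on)
  have im: "f ` S = {z. g z \<in> S}" for S     by (auto intro: image_eqI[of _ _ "g _"])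
  have hom: "homeomorphism S (f ` S) f g" "homeomorphism (f ` S) S g f" for S
    by (auto simp: homeomorphism_def cont image_image)
  have cl: "closed (f ` S)" if "closed S" for S
    unfolding im using closed_vimage[OF that cont(2)] by (simp add: vimage_def)
  have con: "constructible (f ` S)" if "constructible S" for S
    unfolding im by (rule constructible_vimage_linear[OF that lin(2)])
  have "sdr (f ` F) (f ` E)"
  proof (rule sdr_of_ANR)
    show "ANR (f ` E)" "ANR (f ` F)" using E F cl con by (auto intro: closed_constructible_ANR)
    show "closedin (top_of_set (f ` E)) (f ` F)" using cl[OF F(1)] F(3) by (intro closed_subset) auto
    show "sdr (f ` T) (f ` F)" by (rule sdr_homeomorphism[OF hom(1) sdr])
    have "continuous_on ({0..1} \<times> f ` E) (\<lambda>z. C (fst z, g (snd z)))"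
      by (intro continuous_on_compose2[OF C(1)] continuous_intros continuous_on_compose2[OF cont(2)[of UNIV]]) auto
    then show "continuous_on ({0..1} \<times> f ` E) (\<lambda>z. f (C (fst z, g (snd z))))"
      by (rule continuous_on_compose2[OF cont(1)[of UNIV]]) auto
  qed (use C in auto)
  from sdr_homeomorphism[OF hom(2) this] show ?thesis by (simp add: image_image)
qed

subsection \<open>Symmetric operators\<close>

text \<open>First-order condition at an extremum: at \<open>t = - a / (\<bar>c\<bar> + 1)\<close>
  the value is at most \<open>- a\<^sup>2 / (\<bar>c\<bar> + 1)\<close>.\<close>

lemma quadratic_nonneg_linear_zero:
  fixes a c :: real
  assumes "\<And>t. 0 \<le> 2 * t * a + t\<^sup>2 * c"
  shows "a = 0"
proof (rule ccontr)
  assume "a \<noteq> 0"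
  define s where "s = \<bar>c\<bar> + 1"
  define t where "t = - a / s"
  have s: "s > 0" "\<bar>c\<bar> + 1 = s" by (auto simp: s_def)
  have ts: "t * s = - a" using s by (simp add: t_def)
  have "2 * t * a + t\<^sup>2 * c \<le> 2 * t * a + t\<^sup>2 * (\<bar>c\<bar> + 1)" by (intro add_left_mono mult_left_mono) auto
  also have "t\<^sup>2 * (\<bar>c\<bar> + 1) = t * (t * s)" by (simp add: power2_eq_square s(2))
  also have "2 * t * a + t * (t * s) = - (a\<^sup>2 / s)" unfolding ts by (simp add: t_def power2_eq_square field_simps)
  also have "\<dots> < 0" using \<open>a \<noteq> 0\<close> s by simp
  finally show False using assms[of t] by linarith
qed

text \<open>The spectral theorem by successive maximisation: on the orthogonal complement of the
  eigenvectors found so far, a maximiser of the quadratic form on the unit sphere is an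
  eigenvector.\<close>

lemma symop_eigenbasis:
  fixes M :: "'g::euclidean_space opr"
  assumes M: "symop M"
  shows "\<exists>e \<mu>. (\<forall>i<DIM('g). \<forall>j<DIM('g). e i \<bullet> e j = (if i = j then 1 else 0)) \<and> (\<forall>i<DIM('g). M (e i) = \<mu> i *\<^sub>R e i)"
proof -
  have "n \<le> DIM('g) \<Longrightarrow> \<exists>e \<mu>. (\<forall>i<n. \<forall>j<n. e i \<bullet> e j = (if i = j then 1 else 0)) \<and> (\<forall>i<n. M (e i) = \<mu> i *\<^sub>R e i)" for n
  proof (induction n)
    case (Suc n)
    then obtain e :: "nat \<Rightarrow> 'g" and \<mu> where e: "\<And>i j. i < n \<Longrightarrow> j < n \<Longrightarrow> e i \<bullet> e j = (if i = j then 1 else 0)"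
      "\<And>i. i < n \<Longrightarrow> M (e i) = \<mu> i *\<^sub>R e i" by auto
    define V where "V = {x. \<forall>i<n. x \<bullet> e i = 0}"
    have V: "subspace V" by (auto simp: V_def subspace_def inner_add_left)
    have MV: "M x \<in> V" if "x \<in> V" for x
    proof -
      have "M x \<bullet> e i = 0" if i: "i < n" for i
        using M \<open>x \<in> V\<close> i by (simp add: symop_def e(2) V_def)
      then show ?thesis by (simp add: V_def)
    qed
    have "dim (e ` {..<n}) < DIM('g)"
      using dim_le_card[of "e ` {..<n}" "e ` {..<n}"] card_image_le[of "{..<n}" e] Suc.prems span_superset by fastforce
    then obtain x where x: "x \<noteq> 0" "\<And>y. y \<in> span (e ` {..<n}) \<Longrightarrow> orthogonal x y"
      using orthogonal_to_subspace_exists by blast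
    then have xV: "x \<in> V" by (auto simp: V_def orthogonal_def span_base)
    define K where "K = V \<inter> sphere 0 1"
    have "compact K" unfolding K_def by (intro closed_Int_compact closed_subspace V compact_sphere)
    moreover have "x /\<^sub>R norm x \<in> K" using x xV V by (simp add: K_def subspace_scale)
    moreover have "continuous_on K (\<lambda>x. M x \<bullet> x)" by (intro continuous_intros)
    ultimately obtain u where u: "u \<in> K" "\<And>y. y \<in> K \<Longrightarrow> M y \<bullet> y \<le> M u \<bullet> u"
      using continuous_attains_sup[of K "\<lambda>x. M x \<bullet> x"] by blast
    define l where "l = M u \<bullet> u"
    have uV: "u \<in> V" and uu: "u \<bullet> u = 1" using u(1) by (auto simp: K_def norm_eq_1)
    have le: "M y \<bullet> y \<le> l * (y \<bullet> y)" if "y \<in> V" for y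
    proof (cases "y = 0")
      case False
      then have "y /\<^sub>R norm y \<in> K" using that V by (simp add: K_def subspace_scale)
      from u(2)[OF this] have "(M y \<bullet> y) / (norm y * norm y) \<le> l"
        using False by (simp add: l_def blinfun.scaleR_right field_simps)
      then show ?thesis using False by (simp add: field_simps dot_square_norm power2_eq_square)
    qed (simp add: blinfun.zero_right)
    \<comment> \<open>The quadratic form of \<open>l - M\<close> is nonnegative on \<open>V\<close>
      and vanishes at \<open>u\<close>, so its first variation at \<open>u\<close> vanishes.\<close>
    have "(M u - l *\<^sub>R u) \<bullet> w = 0" if w: "w \<in> V" for w
    proof -
      have "0 \<le> 2 * t * (l * (u \<bullet> w) - M u \<bullet> w) + t\<^sup>2 * (l * (w \<bullet> w) - M w \<bullet> w)" for t
      proof -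
        have "u + t *\<^sub>R w \<in> V" using uV w V by (intro subspace_add subspace_scale)
        from le[OF this] have "M (u + t *\<^sub>R w) \<bullet> (u + t *\<^sub>R w) \<le> l * ((u + t *\<^sub>R w) \<bullet> (u + t *\<^sub>R w))" .
        moreover have "M w \<bullet> u = M u \<bullet> w" using M by (metis symop_def inner_commute)
        ultimately show ?thesis using uu
          by (simp add: blinfun.add_right blinfun.scaleR_right inner_add_left inner_add_right inner_commute[of w u]
             l_def[symmetric] power2_eq_square algebra_simps)
      qed
      then have "l * (u \<bullet> w) - M u \<bullet> w = 0" by (rule quadratic_nonneg_linear_zero)
      then show ?thesis by (simp add: inner_diff_left)
    qed
    moreover have "M u - l *\<^sub>R u \<in> V" using MV[OF uV] uV V by (intro subspace_diff subspace_scale)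
    ultimately have "(M u - l *\<^sub>R u) \<bullet> (M u - l *\<^sub>R u) = 0" by blast
    then have Mu: "M u = l *\<^sub>R u" by simp
    define e' where "e' = e(n := u)"
    define \<mu>' where "\<mu>' = \<mu>(n := l)"
    have "e' i \<bullet> e' j = (if i = j then 1 else 0)" if "i < Suc n" "j < Suc n" for i j
      using that e(1)[of i j] uV uu by (auto simp: e'_def V_def less_Suc_eq inner_commute)
    moreover have "M (e' i) = \<mu>' i *\<^sub>R e' i" if "i < Suc n" for i
      using that e(2)[of i] Mu by (auto simp: e'_def \<mu>'_def less_Suc_eq)
    ultimately show ?case by blast
  qed auto
  then show ?thesis by blast
qed

lemma orthonormal_expansion:
  fixes e :: "nat \<Rightarrow> 'g::euclidean_space"
  assumes e: "\<forall>i<DIM('g). \<forall>j<DIM('g). e i \<bullet> e j = (if i = j then 1 else 0)"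
  shows "x = (\<Sum>i<DIM('g). (x \<bullet> e i) *\<^sub>R e i)"
proof -
  define B where "B = e ` {..<DIM('g)}"
  have inj: "inj_on e {..<DIM('g)}"
  proof (rule inj_onI)
    fix i j assume "i \<in> {..<DIM('g)}" "j \<in> {..<DIM('g)}" "e i = e j"
    then show "i = j" using e by (metis lessThan_iff zero_neq_one)
  qed
  have "pairwise orthogonal B" using e by (auto simp: B_def pairwise_image pairwise_def orthogonal_def)
  moreover have "0 \<notin> B" using e by (auto simp: B_def) (metis inner_zero_left zero_neq_one)
  ultimately have "independent B" by (rule pairwise_orthogonal_independent)
  then have "dim B = DIM('g)" using card_image[OF inj] by (simp add: dim_eq_card_independent B_def)
  then have span: "span B = UNIV" by (simp add: dim_eq_full)
  define y where "y = x - (\<Sum>i<DIM('g). (x \<bullet> e i) *\<^sub>R e i)"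
  have "y \<bullet> e j = 0" if "j < DIM('g)" for j
  proof -
    have "(\<Sum>i<DIM('g). (x \<bullet> e i) * (e i \<bullet> e j)) = (\<Sum>i<DIM('g). if i = j then x \<bullet> e i else 0)"
      using e that by (intro sum.cong) auto
    then show ?thesis using that by (simp add: y_def inner_diff_left inner_sum_left)
  qed
  then have "\<And>b. b \<in> B \<Longrightarrow> orthogonal y b" by (auto simp: B_def orthogonal_def)
  then have "orthogonal y y" using orthogonal_to_span[of y B y] span by auto
  then show ?thesis by (simp add: y_def orthogonal_self)
qed

lemma nonneg_spectrum_iff:
  fixes M :: "'g::euclidean_space opr"
  assumes M: "symop M"
  shows "nonneg_spectrum M \<longleftrightarrow> (\<forall>x. 0 \<le> M x \<bullet> x)"
proof
  assume n: "nonneg_spectrum M"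
  obtain e \<mu> where e: "\<forall>i<DIM('g). \<forall>j<DIM('g). e i \<bullet> e j = (if i = j then 1 else 0)"
    and l: "\<forall>i<DIM('g). M (e i) = \<mu> i *\<^sub>R e i" using symop_eigenbasis[OF M] by blast
  have pos: "0 \<le> \<mu> i" if "i < DIM('g)" for i
  proof -
    have "e i \<noteq> 0" using e that by (metis inner_zero_left zero_neq_one)
    then show ?thesis using n l that unfolding nonneg_spectrum_def by blast
  qed
  show "\<forall>x. 0 \<le> M x \<bullet> x"
  proof
    fix x
    have "M x = M (\<Sum>i<DIM('g). (x \<bullet> e i) *\<^sub>R e i)" using orthonormal_expansion[OF e, of x] by simp
    also have "\<dots> = (\<Sum>i<DIM('g). ((x \<bullet> e i) * \<mu> i) *\<^sub>R e i)"
      using l by (simp add: blinfun.sum_right blinfun.scaleR_right)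
    finally have "M x \<bullet> x = (\<Sum>i<DIM('g). \<mu> i * (x \<bullet> e i)\<^sup>2)"
      by (simp add: inner_sum_left inner_commute[of "e _" x] power2_eq_square mult_ac)
    moreover have "0 \<le> (\<Sum>i<DIM('g). \<mu> i * (x \<bullet> e i)\<^sup>2)" using pos by (intro sum_nonneg mult_nonneg_nonneg) auto
    ultimately show "0 \<le> M x \<bullet> x" by simp
  qed
next
  assume *: "\<forall>x. 0 \<le> M x \<bullet> x"
  show "nonneg_spectrum M"
    unfolding nonneg_spectrum_def
  proof (intro allI impI, elim conjE)
    fix c x assume x: "x \<noteq> 0" "M x = c *\<^sub>R x"
    then have "0 \<le> c * (x \<bullet> x)" using *[rule_format, of x] by simp
    moreover have "0 < x \<bullet> x" using x(1) by simp
    ultimately show "0 \<le> c" by (simp add: zero_le_mult_iff)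
  qed
qed

lemma eigenvectors_orthogonal:
  assumes "symop M" "M x = a *\<^sub>R x" "M z = b *\<^sub>R z" "a \<noteq> b"
  shows "x \<bullet> z = 0"
proof -
  have "a * (x \<bullet> z) = b * (x \<bullet> z)" using assms(1)[unfolded symop_def, rule_format, of x z] assms(2,3) by simp
  then show ?thesis using assms(4) by simp
qed

text \<open>Eigenspaces are mutually orthogonal and span, so lying in the span of the lower ones
  amounts to orthogonality to the higher ones. Filtering can then be expressed by inner products of
  eigenvectors.\<close>

lemma Fsp_iff:
  fixes M :: "'g::euclidean_space opr"
  assumes M: "symop M"
  shows "y \<in> Fsp M a \<longleftrightarrow> (\<forall>z c. M z = c *\<^sub>R z \<longrightarrow> a < c \<longrightarrow> y \<bullet> z = 0)"
proof
  assume "y \<in> Fsp M a"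
  show "\<forall>z c. M z = c *\<^sub>R z \<longrightarrow> a < c \<longrightarrow> y \<bullet> z = 0"
  proof (intro allI impI)
    fix z c assume z: "M z = c *\<^sub>R z" "a < c"
    have "orthogonal z y"
    proof (rule orthogonal_to_span[OF \<open>y \<in> Fsp M a\<close>[unfolded Fsp_def]])
      fix x assume "x \<in> {x. \<exists>c\<le>a. M x = c *\<^sub>R x}"
      then obtain b where "b \<le> a" "M x = b *\<^sub>R x" by blast
      then show "orthogonal z x" using eigenvectors_orthogonal[OF M z(1), of x b] z(2) by (simp add: orthogonal_def)
    qed
    then show "y \<bullet> z = 0" by (simp add: orthogonal_def inner_commute)
  qed
next
  assume *: "\<forall>z c. M z = c *\<^sub>R z \<longrightarrow> a < c \<longrightarrow> y \<bullet> z = 0"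
  obtain e \<mu> where e: "\<forall>i<DIM('g). \<forall>j<DIM('g). e i \<bullet> e j = (if i = j then 1 else 0)"
    and l: "\<forall>i<DIM('g). M (e i) = \<mu> i *\<^sub>R e i" using symop_eigenbasis[OF M] by blast
  have "(y \<bullet> e i) *\<^sub>R e i \<in> Fsp M a" if "i < DIM('g)" for i
  proof (cases "\<mu> i \<le> a")
    case True
    then have "e i \<in> Fsp M a" unfolding Fsp_def using l that by (intro span_base) auto
    then show ?thesis unfolding Fsp_def by (rule span_scale)
  next
    case False
    then have "y \<bullet> e i = 0" using *[rule_format, of "e i" "\<mu> i"] l that by simp
    then show ?thesis by (simp add: Fsp_def span_zero)
  qed
  then have "(\<Sum>i<DIM('g). (y \<bullet> e i) *\<^sub>R e i) \<in> Fsp M a" unfolding Fsp_def by (intro span_sum) auto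
  then show "y \<in> Fsp M a" using orthonormal_expansion[OF e, of y] by simp
qed

text \<open>Filtering as a first-order condition on eigenvectors and eigenvalues: in this form it is
  constructible by quantifier elimination, and the strict inequality \<open>a + b < c\<close>
  persists near a limit.\<close>

definition eigen_filtering :: "('g::euclidean_space \<Rightarrow> 'g \<Rightarrow> 'g) \<Rightarrow> 'g opr \<Rightarrow> bool" where
  "eigen_filtering br M \<longleftrightarrow> (\<forall>x y z a b c. M x = a *\<^sub>R x \<longrightarrow> M y = b *\<^sub>R y \<longrightarrow> M z = c *\<^sub>R z \<longrightarrow> a + b < c \<longrightarrow> br x y \<bullet> z = 0)"

lemma filtering_iff:
  assumes br: "compact_lie_algebra br" and M: "symop M"
  shows "filtering br M \<longleftrightarrow> eigen_filtering br M"
proof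
  assume f: "filtering br M"
  show "eigen_filtering br M"
    unfolding eigen_filtering_def
  proof (intro allI impI)
    fix x y z a b c assume *: "M x = a *\<^sub>R x" "M y = b *\<^sub>R y" "M z = c *\<^sub>R z" "a + b < c"
    then have "x \<in> Fsp M a" "y \<in> Fsp M b" unfolding Fsp_def by (auto intro!: span_base)
    then have "br x y \<in> Fsp M (a + b)" using f by (simp add: filtering_def)
    then show "br x y \<bullet> z = 0" using *(3,4) Fsp_iff[OF M] by blast
  qed
next
  assume f: "eigen_filtering br M"
  have lin: "linear (br x)" "linear (\<lambda>x. br x y)" for x y using br by (auto simp: compact_lie_algebra_def)
  show "filtering br M"
    unfolding filtering_def
  proof (intro allI ballI)
    fix a b x y assume x: "x \<in> Fsp M a" and y: "y \<in> Fsp M b"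
    show "br x y \<in> Fsp M (a + b)"
      unfolding Fsp_iff[OF M]
    proof (intro allI impI)
      fix z c assume z: "M z = c *\<^sub>R z" "a + b < c"
      have 1: "br u w \<bullet> z = 0" if u: "u \<in> {x. \<exists>c\<le>a. M x = c *\<^sub>R x}" and w: "w \<in> Fsp M b" for u w
        using w unfolding Fsp_def
      proof (induction rule: span_induct)
        case base
        show ?case by (simp add: subspace_def linear_add[OF lin(1)] linear_scale[OF lin(1)] linear_0[OF lin(1)] inner_add_left)
      next
        case (step v)
        then obtain b' where "b' \<le> b" "M v = b' *\<^sub>R v" by blast
        moreover obtain a' where "a' \<le> a" "M u = a' *\<^sub>R u" using u by blast
        moreover have "a' + b' < c" using calculation z(2) by linarith
        ultimately show ?case using f z(1) unfolding eigen_filtering_def by blast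
      qed
      show "br x y \<bullet> z = 0"
        using x unfolding Fsp_def
      proof (induction rule: span_induct)
        case base
        show ?case by (simp add: subspace_def linear_add[OF lin(2)] linear_scale[OF lin(2)] linear_0[OF lin(2)] inner_add_left)
      next
        case (step u)
        then show ?case using 1[OF _ y] by blast
      qed
    qed
  qed
qed

lemma bounded_bilinear_br:
  assumes "compact_lie_algebra br" shows "bounded_bilinear br"
  using assms unfolding compact_lie_algebra_def bilinear_conv_bounded_bilinear[symmetric] bilinear_def by auto

text \<open>Orthonormal eigenbases of the \<open>M n\<close> subconverge to one of \<open>A\<close>
  with convergent eigenvalues. A strict inequality between limit eigenvalues already holds for late
  \<open>n\<close>, where the bracket component vanishes.\<close>

lemma eigen_filtering_limit:
  fixes M :: "nat \<Rightarrow> 'g::euclidean_space opr"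
  assumes br: "compact_lie_algebra br" and M: "\<And>n. symop (M n)" "\<And>n. eigen_filtering br (M n)" and lim: "M \<longlonglongrightarrow> A"
  shows "eigen_filtering br A"
proof -
  interpret br: bounded_bilinear br by (rule bounded_bilinear_br[OF br])
  let ?N = "DIM('g)"
  have "\<forall>n. \<exists>e \<mu>. (\<forall>i<?N. \<forall>j<?N. e i \<bullet> e j = (if i = j then 1 else 0)) \<and> (\<forall>i<?N. M n (e i) = \<mu> i *\<^sub>R e i)"
    using symop_eigenbasis[OF M(1)] by blast
  then obtain e \<mu> where e: "\<And>n. \<forall>i<?N. \<forall>j<?N. e n i \<bullet> e n j = (if i = j then 1 else 0)"
    and l: "\<And>n i. i < ?N \<Longrightarrow> M n (e n i) = \<mu> n i *\<^sub>R e n i" by metis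
  have "\<exists>C. compact C \<and> (\<forall>n. e n i \<in> C)" if "i < ?N" for i
    using e that by (intro exI[of _ "sphere 0 1"]) (auto simp: norm_eq_1)
  then obtain s f where s: "strict_mono s" "\<And>i. i < ?N \<Longrightarrow> (\<lambda>n. e (s n) i) \<longlonglongrightarrow> f i"
    using tuple_convergent_subseq[of ?N e] by blast
  have Ms: "(\<lambda>n. M (s n)) \<longlonglongrightarrow> A" using LIMSEQ_subseq_LIMSEQ[OF lim s(1)] by (simp add: o_def)
  have f: "\<forall>i<?N. \<forall>j<?N. f i \<bullet> f j = (if i = j then 1 else 0)"
  proof (intro allI impI)
    fix i j assume ij: "i < ?N" "j < ?N"
    have "(\<lambda>n. e (s n) i \<bullet> e (s n) j) \<longlonglongrightarrow> f i \<bullet> f j" by (intro tendsto_intros s ij)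
    moreover have "(\<lambda>n. e (s n) i \<bullet> e (s n) j) = (\<lambda>n. if i = j then 1 else 0)" using e ij by auto
    ultimately show "f i \<bullet> f j = (if i = j then 1 else 0)" by (simp add: LIMSEQ_const_iff)
  qed
  define m where "m i = A (f i) \<bullet> f i" for i
  have lm: "(\<lambda>n. \<mu> (s n) i) \<longlonglongrightarrow> m i" if i: "i < ?N" for i
  proof -
    have "(\<lambda>n. M (s n) (e (s n) i) \<bullet> e (s n) i) \<longlonglongrightarrow> m i" unfolding m_def by (intro tendsto_intros s i Ms)
    moreover have "M (s n) (e (s n) i) \<bullet> e (s n) i = \<mu> (s n) i" for n using l[OF i, of "s n"] e i by simp
    ultimately show ?thesis by simp
  qed
  have Af: "A (f i) = m i *\<^sub>R f i" if i: "i < ?N" for i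
  proof (rule LIMSEQ_unique)
    show "(\<lambda>n. M (s n) (e (s n) i)) \<longlonglongrightarrow> A (f i)" by (intro tendsto_intros s i Ms)
    show "(\<lambda>n. M (s n) (e (s n) i)) \<longlonglongrightarrow> m i *\<^sub>R f i" unfolding l[OF i] by (intro tendsto_intros s lm i)
  qed
  have A: "symop A"
    unfolding symop_def
  proof (intro allI)
    fix x y
    have "(\<lambda>n. M n x \<bullet> y) \<longlonglongrightarrow> A x \<bullet> y" "(\<lambda>n. x \<bullet> M n y) \<longlonglongrightarrow> x \<bullet> A y" by (intro tendsto_intros lim)+
    moreover have "M n x \<bullet> y = x \<bullet> M n y" for n using M(1)[of n] by (simp add: symop_def)
    ultimately show "A x \<bullet> y = x \<bullet> A y" using LIMSEQ_unique by fastforce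
  qed
  have brf: "br (f i) (f j) \<bullet> f k = 0" if ijk: "i < ?N" "j < ?N" "k < ?N" and lt: "m i + m j < m k" for i j k
  proof (rule LIMSEQ_unique)
    show "(\<lambda>n. br (e (s n) i) (e (s n) j) \<bullet> e (s n) k) \<longlonglongrightarrow> br (f i) (f j) \<bullet> f k"
      by (intro tendsto_intros br.tendsto s ijk)
    have "(\<lambda>n. \<mu> (s n) k - \<mu> (s n) i - \<mu> (s n) j) \<longlonglongrightarrow> m k - m i - m j" by (intro tendsto_intros lm ijk)
    then have "eventually (\<lambda>n. 0 < \<mu> (s n) k - \<mu> (s n) i - \<mu> (s n) j) sequentially"
      using lt by (intro order_tendstoD(1)) auto
    then have "eventually (\<lambda>n. br (e (s n) i) (e (s n) j) \<bullet> e (s n) k = 0) sequentially"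
    proof (rule eventually_mono)
      fix n assume "0 < \<mu> (s n) k - \<mu> (s n) i - \<mu> (s n) j"
      then have "\<mu> (s n) i + \<mu> (s n) j < \<mu> (s n) k" by linarith
      then show "br (e (s n) i) (e (s n) j) \<bullet> e (s n) k = 0"
        using M(2)[of "s n"] l[OF ijk(1), of "s n"] l[OF ijk(2), of "s n"] l[OF ijk(3), of "s n"]
        unfolding eigen_filtering_def by blast
    qed
    then show "(\<lambda>n. br (e (s n) i) (e (s n) j) \<bullet> e (s n) k) \<longlonglongrightarrow> 0" by (rule tendsto_eventually)
  qed
  show ?thesis
    unfolding eigen_filtering_def
  proof (intro allI impI)
    fix x y z a b c assume *: "A x = a *\<^sub>R x" "A y = b *\<^sub>R y" "A z = c *\<^sub>R z" "a + b < c"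
    \<comment> \<open>An eigenvector with eigenvalue \<open>a\<close> involves only those
      \<open>f i\<close> with \<open>m i = a\<close>, so the trilinear expansion reduces to triples
      covered by \<open>brf\<close>.\<close>
    have co: "x \<bullet> f i = 0 \<or> m i = a" if "A x = a *\<^sub>R x" "i < ?N" for x a i
      using eigenvectors_orthogonal[OF A that(1) Af[OF that(2)]] by blast
    have "br x y \<bullet> z = br (\<Sum>i<?N. (x \<bullet> f i) *\<^sub>R f i) (\<Sum>j<?N. (y \<bullet> f j) *\<^sub>R f j) \<bullet> (\<Sum>k<?N. (z \<bullet> f k) *\<^sub>R f k)"
      using orthonormal_expansion[OF f, of x] orthonormal_expansion[OF f, of y] orthonormal_expansion[OF f, of z] by simp
    also have "\<dots> = (\<Sum>k<?N. \<Sum>j<?N. \<Sum>i<?N. (z \<bullet> f k) * ((y \<bullet> f j) * ((x \<bullet> f i) * (br (f i) (f j) \<bullet> f k))))"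
      by (simp add: br.sum_left br.sum_right br.scaleR_left br.scaleR_right inner_sum_left inner_sum_right sum_distrib_left)
    also have "\<dots> = 0"
    proof (intro sum.neutral ballI)
      fix i j k assume "k \<in> {..<?N}" "i \<in> {..<?N}" "j \<in> {..<?N}"
      then show "(z \<bullet> f k) * ((y \<bullet> f j) * ((x \<bullet> f i) * (br (f i) (f j) \<bullet> f k))) = 0"
        using co[OF *(1), of i] co[OF *(2), of j] co[OF *(3), of k] brf[of i j k] *(4) by auto
    qed
    finally show "br x y \<bullet> z = 0" .
  qed
qed

subsection \<open>Orthogonal projections\<close>

lemma oproj_works:
  assumes k: "subspace k"
  shows oproj_in: "oproj k x \<in> k" and oproj_orth: "z \<in> k \<Longrightarrow> (x - oproj k x) \<bullet> z = 0"
    and oproj_eqI: "y \<in> k \<Longrightarrow> (\<And>z. z \<in> k \<Longrightarrow> (x - y) \<bullet> z = 0) \<Longrightarrow> oproj k x = y"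
proof -
  define f where "f x = (THE y. y \<in> k \<and> (\<forall>z\<in>k. (x - y) \<bullet> z = 0))" for x
  have uniq: "y = y'" if "y \<in> k" "\<forall>z\<in>k. (x - y) \<bullet> z = 0" "y' \<in> k" "\<forall>z\<in>k. (x - y') \<bullet> z = 0" for x y y'
  proof -
    have "y' - y \<in> k" using that k by (simp add: subspace_diff)
    then have "(x - y) \<bullet> (y' - y) = 0" "(x - y') \<bullet> (y' - y) = 0" using that by blast+
    then have "((x - y) - (x - y')) \<bullet> (y' - y) = 0" by (simp only: inner_diff_left[of "x - y"])
    then have "(y' - y) \<bullet> (y' - y) = 0" by simp
    then show ?thesis by simp
  qed
  have ex: "\<exists>y. y \<in> k \<and> (\<forall>z\<in>k. (x - y) \<bullet> z = 0)" for x
  proof -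
    obtain y z where "y \<in> span k" "\<And>w. w \<in> span k \<Longrightarrow> orthogonal z w" "x = y + z"
      using orthogonal_subspace_decomp_exists[of k x] by metis
    moreover have "span k = k" using k by (simp only: span_eq_iff)
    ultimately show ?thesis by (intro exI[of _ y]) (auto simp: orthogonal_def)
  qed
  have f: "f x \<in> k" "\<forall>z\<in>k. (x - f x) \<bullet> z = 0" for x
    using theI'[of "\<lambda>y. y \<in> k \<and> (\<forall>z\<in>k. (x - y) \<bullet> z = 0)"] ex[of x] uniq[of _ x] unfolding f_def by blast+
  have "linear f"
  proof (rule linearI)
    fix x y and c :: real
    show "f (x + y) = f x + f y"
    proof (rule uniq[OF f])
      show "f x + f y \<in> k" using f k by (simp add: subspace_add)
      show "\<forall>z\<in>k. (x + y - (f x + f y)) \<bullet> z = 0"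
      proof
        fix z assume "z \<in> k"
        then have "(x - f x) \<bullet> z + (y - f y) \<bullet> z = 0" using f by simp
        then show "(x + y - (f x + f y)) \<bullet> z = 0" by (simp add: algebra_simps)
      qed
    qed
    show "f (c *\<^sub>R x) = c *\<^sub>R f x"
    proof (rule uniq[OF f])
      show "c *\<^sub>R f x \<in> k" using f k by (simp add: subspace_scale)
      show "\<forall>z\<in>k. (c *\<^sub>R x - c *\<^sub>R f x) \<bullet> z = 0"
      proof
        fix z assume "z \<in> k"
        then have "c * ((x - f x) \<bullet> z) = 0" using f by simp
        then show "(c *\<^sub>R x - c *\<^sub>R f x) \<bullet> z = 0" by (simp add: algebra_simps)
      qed
    qed
  qed
  then have "bounded_linear f" by (simp add: linear_conv_bounded_linear)
  then have op: "oproj k x = f x" for x unfolding oproj_def f_def[abs_def, symmetric] f_def[symmetric]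
    by (simp add: bounded_linear_Blinfun_apply)
  show "oproj k x \<in> k" "z \<in> k \<Longrightarrow> (x - oproj k x) \<bullet> z = 0" using f by (auto simp: op)
  show "y \<in> k \<Longrightarrow> (\<And>z. z \<in> k \<Longrightarrow> (x - y) \<bullet> z = 0) \<Longrightarrow> oproj k x = y" unfolding op by (rule uniq[OF f]) auto
qed

lemma oproj_id: "subspace k \<Longrightarrow> x \<in> k \<Longrightarrow> oproj k x = x"
  by (rule oproj_eqI) auto

lemma oproj_fixed_iff: "subspace k \<Longrightarrow> oproj k x = x \<longleftrightarrow> x \<in> k"
  using oproj_id oproj_in by metis

lemma oproj_inner: 
  assumes "subspace k" shows "oproj k x \<bullet> y = oproj k x \<bullet> oproj k y"
proof -
  have "y \<bullet> oproj k x - oproj k y \<bullet> oproj k x = 0"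
    using oproj_orth[OF assms oproj_in[OF assms, of x], of y] by (simp only: inner_diff_left)
  then have "y \<bullet> oproj k x = oproj k y \<bullet> oproj k x" by simp
  then show ?thesis using inner_commute[of y "oproj k x"] inner_commute[of "oproj k y" "oproj k x"] by metis
qed

lemma symop_oproj: "subspace k \<Longrightarrow> symop (oproj k)"
  unfolding symop_def by (metis oproj_inner inner_commute)

text \<open>Inclusion of subspaces becomes an equation between projections, hence a closed and
  polynomial condition.\<close>

lemma oproj_compose_iff:
  assumes "subspace k" "subspace l"
  shows "oproj k o\<^sub>L oproj l = oproj l \<longleftrightarrow> l \<subseteq> k"
proof
  assume *: "oproj k o\<^sub>L oproj l = oproj l"
  show "l \<subseteq> k"
  proof
    fix x assume "x \<in> l"
    then have "oproj k x = x" using * oproj_id[OF assms(2)] by (metis blinfun_apply_blinfun_compose)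
    then show "x \<in> k" using oproj_in[OF assms(1), of x] by simp
  qed
next
  assume "l \<subseteq> k"
  then show "oproj k o\<^sub>L oproj l = oproj l"
    using oproj_in[OF assms(2)] oproj_id[OF assms(1)] by (intro blinfun_eqI) auto
qed

lemma oproj_inj: "subspace k \<Longrightarrow> subspace l \<Longrightarrow> oproj k = oproj l \<Longrightarrow> k = l"
  by (metis oproj_fixed_iff subsetI subset_antisym)

lemma oproj_UNIV: "oproj UNIV = id_blinfun"
  by (rule blinfun_eqI) (simp add: oproj_id)

lemma optrace_add: "optrace (M + N) = optrace M + optrace N"
  and optrace_diff: "optrace (M - N) = optrace M - optrace N"
  and optrace_scaleR: "optrace (c *\<^sub>R M) = c * optrace M"
  by (simp_all add: optrace_def blinfun.add_left blinfun.diff_left blinfun.scaleR_left inner_add_left inner_diff_left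
      sum.distrib sum_subtractf sum_distrib_left)

lemma optrace_id: "optrace (id_blinfun :: 'g::euclidean_space opr) = DIM('g)"
  by (simp add: optrace_def inner_same_Basis)

lemma optrace_oproj:
  fixes k :: "'g::euclidean_space set"
  assumes k: "subspace k"
  shows "optrace (oproj k) = dim k"
proof -
  obtain B where B: "B \<subseteq> k" "pairwise orthogonal B" "\<And>x. x \<in> B \<Longrightarrow> norm x = 1" "independent B" "card B = dim k" "span B = k"
    using orthonormal_basis_subspace[OF k] by metis
  have fin: "finite B" using B(4) by (rule independent_imp_finite)
  have op: "oproj k x = (\<Sum>b\<in>B. (x \<bullet> b) *\<^sub>R b)" for x
  proof (rule oproj_eqI[OF k])
    show "(\<Sum>b\<in>B. (x \<bullet> b) *\<^sub>R b) \<in> k" using B(1) k by (intro subspace_sum subspace_scale) auto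
    fix z assume z: "z \<in> k"
    have "orthogonal (x - (\<Sum>b\<in>B. (x \<bullet> b) *\<^sub>R b)) z"
    proof (rule orthogonal_to_span)
      show "z \<in> span B" using z B(6) by simp
      fix c assume c: "c \<in> B"
      have "(\<Sum>b\<in>B. (x \<bullet> b) * (b \<bullet> c)) = (\<Sum>b\<in>B. if b = c then x \<bullet> c else 0)"
        using B(2,3) c by (intro sum.cong refl) (auto simp: pairwise_def orthogonal_def dot_square_norm)
      then show "orthogonal (x - (\<Sum>b\<in>B. (x \<bullet> b) *\<^sub>R b)) c" using c fin
        by (simp add: orthogonal_def inner_diff_left inner_sum_left)
    qed
    then show "(x - (\<Sum>b\<in>B. (x \<bullet> b) *\<^sub>R b)) \<bullet> z = 0" by (simp add: orthogonal_def)
  qed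
  have "optrace (oproj k) = (\<Sum>c\<in>Basis. \<Sum>b\<in>B. (b \<bullet> c) * (b \<bullet> c))"
    unfolding optrace_def op inner_sum_left inner_scaleR_left by (simp add: inner_commute)
  also have "\<dots> = (\<Sum>b\<in>B. \<Sum>c\<in>Basis. (b \<bullet> c) * (b \<bullet> c))" by (rule sum.swap)
  also have "\<dots> = (\<Sum>b\<in>B. 1)"
  proof (rule sum.cong)
    fix b assume "b \<in> B"
    then have "b \<bullet> b = 1" using B(3) by (simp add: dot_square_norm)
    then show "(\<Sum>c\<in>Basis. (b \<bullet> c) * (b \<bullet> c)) = 1" by (simp add: euclidean_inner[of b b])
  qed simp
  finally show ?thesis using B(5) by simp
qed

lemma dim_less_iff: "subspace k \<Longrightarrow> dim k < DIM('g) \<longleftrightarrow> k \<noteq> (UNIV :: 'g::euclidean_space set)"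
  by (metis dim_eq_full dim_subset_UNIV le_neq_implies_less less_irrefl span_eq_iff)

lemma chibar_apply: "chibar k x = (1 / real (DIM('g) - dim k)) *\<^sub>R (x - oproj k (x::'g::euclidean_space))"
  by (simp add: chibar_def blinfun.scaleR_left blinfun.diff_left)

text \<open>With a trace in place of the dimension, the vertex depends visibly continuously on the
  projection.\<close>

lemma chibar_via_trace:
  fixes k :: "'g::euclidean_space set"
  assumes "subspace k" 
  shows "chibar k = (1 / (DIM('g) - optrace (oproj k))) *\<^sub>R (id_blinfun - oproj k)"
  using dim_subset_UNIV[of k] by (simp add: chibar_def optrace_oproj[OF assms] of_nat_diff)

subsection \<open>The sets B[k]\<close>

text \<open>Membership in \<open>B k\<close> as a relation between the projection \<open>P\<close>
  onto \<open>k\<close> and \<open>M\<close>: closedness and constructibility then make sense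
  jointly in both while \<open>k\<close> varies.\<close>

definition Brel :: "version \<Rightarrow> ('g::euclidean_space \<Rightarrow> 'g \<Rightarrow> 'g) \<Rightarrow> 'g opr set \<Rightarrow> 'g opr \<Rightarrow> 'g opr \<Rightarrow> bool" where
  "Brel v br A P M \<longleftrightarrow> symop M \<and> (\<forall>x. 0 \<le> M x \<bullet> x) \<and> optrace M = 1 \<and> (\<forall>a\<in>A. M o\<^sub>L a = a o\<^sub>L M) \<and>
     (\<forall>x. M (P x) = 0) \<and> (\<forall>X y. M (br (P X) y) = br (P X) (M y)) \<and> (v = VerX \<longrightarrow> eigen_filtering br M)"

locale lie_setting =
  fixes br :: "'g::euclidean_space \<Rightarrow> 'g \<Rightarrow> 'g" and h :: "'g set" and A :: "'g opr set" and v :: version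
  assumes lie: "compact_lie_algebra br" and h_sub: "subalg br h" and autA: "aut_group br h A"
begin

sublocale br: bounded_bilinear br by (rule bounded_bilinear_br[OF lie])

abbreviation "B k \<equiv> Bk v br A k"
abbreviation "\<P> \<equiv> Pset br h A"
abbreviation "\<I> \<equiv> Iset br h A"

lemma br_self: "br x x = 0" and jacobi: "br x (br y z) + br y (br z x) + br z (br x y) = 0"
  and br_inner: "br x y \<bullet> z = x \<bullet> br y z"
  using lie by (auto simp: compact_lie_algebra_def)

lemma br_anti: "br x y = - br y x"
proof -
  have "br (x + y) (x + y) = br x x + br x y + br y x + br y y" by (simp add: br.add_left br.add_right)
  then show ?thesis by (simp add: br_self eq_neg_iff_add_eq_0)
qed

lemma B_iff:
  assumes k: "subspace k"
  shows "M \<in> B k \<longleftrightarrow> Brel v br A (oproj k) M"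
proof -
  have 1: "(\<forall>x\<in>k. M x = 0) \<longleftrightarrow> (\<forall>x. M (oproj k x) = 0)" using oproj_in[OF k] oproj_id[OF k] by metis
  have 2: "(\<forall>X\<in>k. \<forall>y. M (br X y) = br X (M y)) \<longleftrightarrow> (\<forall>X y. M (br (oproj k X) y) = br (oproj k X) (M y))"
    using oproj_in[OF k] oproj_id[OF k] by metis
  \<comment> \<open>\<open>Brel\<close> covers the convention for \<open>k = UNIV\<close>: an
    operator annihilating everything has trace zero, so the relation is empty there.\<close>
  have 3: "k \<noteq> UNIV" if "\<forall>x. M (oproj k x) = 0" "optrace M = 1"
  proof
    assume "k = UNIV"
    then have "M x = 0" for x using that(1) by (simp add: oproj_UNIV)
    then show False using that(2) by (simp add: optrace_def)
  qed
  show ?thesis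
    unfolding Bk_def Xset_def Dset_def Brel_def Fplus_def
    using 1 2 3 nonneg_spectrum_iff[of M] filtering_iff[OF lie, of M]
    by (cases v) (auto split: if_splits)
qed

lemma B_UNIV [simp]: "B UNIV = {}"
  by (cases v) (auto simp: Bk_def Xset_def Dset_def)

lemma P_sub: "k \<in> \<P> \<Longrightarrow> subspace k" and P_br: "k \<in> \<P> \<Longrightarrow> x \<in> k \<Longrightarrow> y \<in> k \<Longrightarrow> br x y \<in> k"
  and P_h: "k \<in> \<P> \<Longrightarrow> h \<subset> k"
  by (simp_all add: Pset_def subalg_def)

lemma P_A: "k \<in> \<P> \<Longrightarrow> a \<in> A \<Longrightarrow> x \<in> k \<Longrightarrow> blinfun_apply a x \<in> k"
  unfolding Pset_def by blast

lemma A_inv: "a \<in> A \<Longrightarrow> \<exists>b\<in>A. a o\<^sub>L b = id_blinfun \<and> b o\<^sub>L a = id_blinfun"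
  and A_iso: "a \<in> A \<Longrightarrow> blinfun_apply a x \<bullet> blinfun_apply a y = x \<bullet> y"
  using autA by (auto simp: aut_group_def)

lemma B_antimono:
  assumes "subspace k" "subspace l" "k \<subseteq> l" shows "B l \<subseteq> B k"
proof
  fix M assume "M \<in> B l"
  then have *: "Brel v br A (oproj l) M" using B_iff[OF assms(2)] by blast
  have e: "oproj l (oproj k x) = oproj k x" for x using oproj_id[OF assms(2)] oproj_in[OF assms(1)] assms(3) by blast
  have "M (oproj k x) = 0" "M (br (oproj k x) y) = br (oproj k x) (M y)" for x y
    using * e[of x] unfolding Brel_def by metis+
  then show "M \<in> B k" using * unfolding B_iff[OF assms(1)] Brel_def by blast
qed

text \<open>For fixed \<open>M\<close> the elements \<open>X\<close> with \<open>M X = 0\<close>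
  whose adjoint action commutes with \<open>M\<close> form a subalgebra, by the Jacobi identity. It
  contains \<open>k\<close> and \<open>l\<close>, hence what they generate.\<close>

lemma B_join:
  assumes k: "subspace k" "subspace l" and M: "M \<in> B k" "M \<in> B l"
  shows "M \<in> B (subalg_gen br (k \<union> l))" "subspace (subalg_gen br (k \<union> l))"
proof -
  define m where "m = {X. M X = 0 \<and> (\<forall>y. M (br X y) = br X (M y))}"
  have m: "subalg br m"
    unfolding subalg_def
  proof (intro conjI ballI)
    show "subspace m"
      by (auto simp: m_def subspace_def br.add_left br.scaleR_left br.zero_left blinfun.add_right blinfun.scaleR_right blinfun.zero_right)
    fix X Y assume X: "X \<in> m" and Y: "Y \<in> m"
    have "br (br X Y) z = br X (br Y z) - br Y (br X z)" for z
    proof -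
      have "br z (br X Y) = - br X (br Y z) - br Y (br z X)" using jacobi[of X Y z] by (simp add: algebra_simps eq_neg_iff_add_eq_0)
      moreover have "br Y (br z X) = - br Y (br X z)" by (subst br_anti[of z X]) (simp add: br.minus_right)
      ultimately show ?thesis by (subst br_anti) simp
    qed
    then have "M (br (br X Y) y) = br (br X Y) (M y)" for y
      using X Y by (simp add: m_def blinfun.diff_right)
    moreover have "M (br X Y) = 0" using X Y by (simp add: m_def br.zero_right)
    ultimately show "br X Y \<in> m" by (simp add: m_def)
  qed
  have "k \<subseteq> m" "l \<subseteq> m"
    using M unfolding B_iff[OF k(1)] B_iff[OF k(2)] Brel_def m_def
    by (auto; metis oproj_id[OF k(1)] oproj_id[OF k(2)])+
  then have sub: "subalg_gen br (k \<union> l) \<subseteq> m" unfolding subalg_gen_def using m by blast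
  show s: "subspace (subalg_gen br (k \<union> l))"
    unfolding subalg_gen_def by (rule subspace_Inter) (auto simp: subalg_def)
  have "M (oproj (subalg_gen br (k \<union> l)) x) = 0 \<and> (\<forall>y. M (br (oproj (subalg_gen br (k \<union> l)) x) y) = br (oproj (subalg_gen br (k \<union> l)) x) (M y))" for x
    using oproj_in[OF s, of x] sub unfolding m_def by blast
  then show "M \<in> B (subalg_gen br (k \<union> l))"
    using M(1) unfolding B_iff[OF s] B_iff[OF k(1)] Brel_def by blast
qed

text \<open>The adjoint action of \<open>X\<close> is skew for the inner product and preserves
  \<open>k\<close>, so it preserves the orthogonal complement as well.\<close>

lemma oproj_br: "k \<in> \<P> \<Longrightarrow> X \<in> k \<Longrightarrow> oproj k (br X y) = br X (oproj k y)"
proof (rule oproj_eqI)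
  assume k: "k \<in> \<P>" and X: "X \<in> k"
  note s = P_sub[OF k]
  show "subspace k" by (rule s)
  show "br X (oproj k y) \<in> k" using P_br[OF k X] oproj_in[OF s] by blast
  fix z assume z: "z \<in> k"
  have "(br X y - br X (oproj k y)) \<bullet> z = br X (y - oproj k y) \<bullet> z" by (simp add: br.diff_right)
  also have "\<dots> = - (br (y - oproj k y) X \<bullet> z)" by (subst br_anti) simp
  also have "\<dots> = - ((y - oproj k y) \<bullet> br X z)" by (simp add: br_inner)
  also have "\<dots> = 0" using oproj_orth[OF s P_br[OF k X z]] by simp
  finally show "(br X y - br X (oproj k y)) \<bullet> z = 0" .
qed

lemma oproj_A: 
  assumes k: "k \<in> \<P>" and a: "a \<in> A" shows "oproj k o\<^sub>L a = a o\<^sub>L oproj k"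
proof (rule blinfun_eqI)
  fix x
  note s = P_sub[OF k]
  obtain b where b: "b \<in> A" "a o\<^sub>L b = id_blinfun" using A_inv[OF a] by blast
  have "oproj k (blinfun_apply a x) = blinfun_apply a (oproj k x)"
  proof (rule oproj_eqI[OF s])
    show "blinfun_apply a (oproj k x) \<in> k" using P_A[OF k a] oproj_in[OF s] by blast
    fix z assume z: "z \<in> k"
    have "z = blinfun_apply a (blinfun_apply b z)" using b(2) by (metis blinfun_apply_blinfun_compose blinfun_apply_id_blinfun)
    then have "(blinfun_apply a x - blinfun_apply a (oproj k x)) \<bullet> z = (x - oproj k x) \<bullet> blinfun_apply b z"
      by (metis A_iso[OF a] blinfun.diff_right)
    then show "(blinfun_apply a x - blinfun_apply a (oproj k x)) \<bullet> z = 0" using oproj_orth[OF s P_A[OF k b(1) z]] by simp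
  qed
  then show "(oproj k o\<^sub>L a) x = (a o\<^sub>L oproj k) x" by simp
qed

text \<open>On the complement of \<open>k\<close> the eigenvalues of \<open>N\<close> are those of
  \<open>M\<close> scaled by \<open>1 - t\<close> and shifted by \<open>t * c\<close>. So
  \<open>a + b < d\<close> for \<open>N\<close> implies the corresponding inequality for
  \<open>M\<close>: the left side contains the shift twice. Eigenvalue zero of \<open>N\<close>
  means membership in \<open>k\<close>, whose adjoint action preserves the eigenspaces of
  \<open>N\<close>.\<close>

lemma eigen_filtering_shift:
  assumes k: "k \<in> \<P>" and M: "symop M" "\<And>x. 0 \<le> M x \<bullet> x" "\<And>x. x \<in> k \<Longrightarrow> M x = 0"
      "\<And>X y. X \<in> k \<Longrightarrow> M (br X y) = br X (M y)"
    and t: "0 \<le> t" "t \<le> 1" and c: "0 < c" and f: "t < 1 \<Longrightarrow> eigen_filtering br M"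
    and N: "N = (1 - t) *\<^sub>R M + (t * c) *\<^sub>R (id_blinfun - oproj k)"
  shows "eigen_filtering br N"
proof (cases "t = 0")
  case True
  then show ?thesis using f N by simp
next
  case False
  then have tc: "0 < t * c" using t c by simp
  note s = P_sub[OF k]
  have Napp: "N x = (1 - t) *\<^sub>R M x + (t * c) *\<^sub>R (x - oproj k x)" for x
    by (simp add: N blinfun.add_left blinfun.diff_left blinfun.scaleR_left)
  have PM: "oproj k (M x) = 0" for x
  proof -
    have "M x \<bullet> z = 0" if "z \<in> k" for z using M(1,3) that by (simp add: symop_def)
    then show ?thesis using oproj_eqI[OF s subspace_0[OF s], of "M x"] by simp
  qed
  have symN: "symop N"
    using M(1) symop_oproj[OF s] unfolding symop_def Napp
    by (simp add: inner_add_left inner_add_right inner_diff_left inner_diff_right)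
  have psdP: "(x - oproj k x) \<bullet> x = (x - oproj k x) \<bullet> (x - oproj k x)" for x
    using oproj_orth[OF s oproj_in[OF s], of x x] by (simp add: inner_diff_right)
  have Nx: "N x \<bullet> x = (1 - t) * (M x \<bullet> x) + t * c * ((x - oproj k x) \<bullet> (x - oproj k x))" for x
    by (simp only: Napp inner_add_left inner_scaleR_left psdP)
  have pos: "0 \<le> N x \<bullet> x" for x unfolding Nx using t c M(2)[of x] by (intro add_nonneg_nonneg mult_nonneg_nonneg) auto
  have Nbr: "N (br X y) = br X (N y)" if "X \<in> k" for X y
    using M(4)[OF that] oproj_br[OF k that] by (simp add: Napp br.add_right br.diff_right br.scaleR_right)
  have e0: "x \<in> k" if "N x = 0" for x
  proof -
    have "(1 - t) * (M x \<bullet> x) + t * c * ((x - oproj k x) \<bullet> (x - oproj k x)) = 0" using Nx[of x] that by simp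
    moreover have "0 \<le> (1 - t) * (M x \<bullet> x)" using t M(2) by simp
    moreover have "0 \<le> t * c * ((x - oproj k x) \<bullet> (x - oproj k x))" using tc by simp
    ultimately have "t * c * ((x - oproj k x) \<bullet> (x - oproj k x)) = 0" by linarith
    then have "x - oproj k x = 0" using tc by (metis inner_eq_zero_iff mult_eq_0_iff less_irrefl)
    then show ?thesis using oproj_in[OF s, of x] by simp
  qed
  have e1: "oproj k x = 0" "(1 - t) *\<^sub>R M x = (a - t * c) *\<^sub>R x" if "N x = a *\<^sub>R x" "a \<noteq> 0" for x a
  proof -
    have "oproj k (N x) = 0" 
      using PM oproj_id[OF s oproj_in[OF s]] by (simp add: Napp blinfun.add_right blinfun.diff_right blinfun.scaleR_right)
    then have "a *\<^sub>R oproj k x = 0" using that(1) by (simp add: blinfun.scaleR_right)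
    then show z: "oproj k x = 0" using that(2) by simp
    show "(1 - t) *\<^sub>R M x = (a - t * c) *\<^sub>R x" using that(1) z by (simp add: Napp algebra_simps)
  qed
  show ?thesis
    unfolding eigen_filtering_def
  proof (intro allI impI)
    fix x y z a b d assume *: "N x = a *\<^sub>R x" "N y = b *\<^sub>R y" "N z = d *\<^sub>R z" "a + b < d"
    show "br x y \<bullet> z = 0"
    proof (cases "x = 0 \<or> y = 0 \<or> z = 0")
      case True
      then show ?thesis by (auto simp: br.zero_left br.zero_right)
    next
      case False
      have nn: "0 \<le> a" if "N x = a *\<^sub>R x" "x \<noteq> 0" for x a
      proof -
        have "0 \<le> a * (x \<bullet> x)" "0 < x \<bullet> x" using pos[of x] that by simp_all
        then show ?thesis by (simp add: zero_le_mult_iff)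
      qed
      have ab: "0 \<le> a" "0 \<le> b" using nn[OF *(1)] nn[OF *(2)] False by auto
      then have d: "0 < d" using *(4) by linarith
      have zk: "w \<bullet> z = 0" if "w \<in> k" for w
        using e1(1)[OF *(3)] d oproj_orth[OF s that, of z] by (simp add: inner_commute)
      have orth: "br X w \<bullet> z = 0" if "X \<in> k" "N w = b *\<^sub>R w" "b \<noteq> d" for X w b
      proof (rule eigenvectors_orthogonal[OF symN _ *(3) that(3)])
        show "N (br X w) = b *\<^sub>R br X w" using Nbr[OF that(1)] that(2) by (simp add: br.scaleR_right)
      qed
      show ?thesis
      proof (cases "a = 0")
        case True
        then have xk: "x \<in> k" using e0 *(1) by simp
        then show ?thesis using orth[OF xk *(2)] *(4) True by auto
      next
        case a0: False
        show ?thesis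
        proof (cases "b = 0")
          case True
          then have yk: "y \<in> k" using e0 *(2) by simp
          then have "br y x \<bullet> z = 0" using orth[OF yk *(1)] *(4) True by auto
          then show ?thesis by (subst br_anti) simp
        next
          case b0: False
          note ex = e1(2)[OF *(1) a0] and ey = e1(2)[OF *(2) b0] and ez = e1(2)[OF *(3)]
          show ?thesis
          proof (cases "t = 1")
            \<comment> \<open>\<open>N\<close> is then a multiple of a projection with
              \<open>c\<close> as its only nonzero eigenvalue, and \<open>c + c < c\<close> is
              impossible.\<close>
            case True
            then have "a = c" "b = c" "d = c" using ex ey ez d False by auto
            then show ?thesis using *(4) c by simp
          next
            case t1: False
            then have t1': "1 - t > 0" using t by simp
            have div: "M w = (g / (1 - t)) *\<^sub>R w" if "(1 - t) *\<^sub>R M w = g *\<^sub>R w" for w g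
            proof -
              have "M w = (1 / (1 - t)) *\<^sub>R ((1 - t) *\<^sub>R M w)" using t1' by simp
              then show ?thesis using that by simp
            qed
            have "(a - t * c) / (1 - t) + (b - t * c) / (1 - t) < (d - t * c) / (1 - t)"
              unfolding add_divide_distrib[symmetric] by (rule divide_strict_right_mono) (use *(4) tc t1' in linarith)+
            then show ?thesis using f t1' div[OF ex] div[OF ey] div[OF ez] d unfolding eigen_filtering_def by force
          qed
        qed
      qed
    qed
  qed
qed

text \<open>Allowing any \<open>M\<close> at \<open>t = 1\<close> makes the membership of the apex
  \<open>chibar k\<close> a special case. All conditions are convex except filtering, which
  \<open>eigen_filtering_shift\<close> supplies.\<close>

lemma B_shift:
  assumes k: "k \<in> \<P>" "k \<noteq> UNIV" and t: "0 \<le> t" "t \<le> 1" and M: "M \<in> B k \<or> t = 1"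
  shows "(1 - t) *\<^sub>R M + t *\<^sub>R chibar k \<in> B k"
proof -
  note s = P_sub[OF k(1)]
  \<comment> \<open>At \<open>t = 1\<close> nothing is known about \<open>M\<close>; zero is put in
    its place, for which the hypotheses of the shift hold.\<close>
  define M' where "M' = (if t = 1 then 0 else M)"
  define c where "c = 1 / real (DIM('g) - dim k)"
  have cpos: "real (DIM('g) - dim k) > 0" using dim_less_iff[OF s] k(2) by simp
  then have c: "c > 0" by (simp add: c_def)
  have BM: "Brel v br A (oproj k) M" if "t \<noteq> 1" using M that B_iff[OF s] by blast
  have "symop 0" "\<And>x. 0 \<le> blinfun_apply 0 x \<bullet> x" by (auto simp: symop_def)
  then have M': "symop M'" "\<And>x. 0 \<le> M' x \<bullet> x" using BM by (auto simp: M'_def Brel_def)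
  have Mk: "M' x = 0" "M' (br x y) = br x (M' y)" if "x \<in> k" for x y
    using BM oproj_id[OF s that] unfolding M'_def Brel_def by (auto simp: br.zero_right) metis+
  have MA: "M' o\<^sub>L a = a o\<^sub>L M'" if "a \<in> A" for a
    using BM that unfolding M'_def Brel_def by (auto intro!: blinfun_eqI simp: blinfun.zero_right)
  have chi: "chibar k = c *\<^sub>R (id_blinfun - oproj k)" by (simp add: chibar_def c_def)
  define N where "N = (1 - t) *\<^sub>R M' + (t * c) *\<^sub>R (id_blinfun - oproj k)"
  have Neq: "(1 - t) *\<^sub>R M + t *\<^sub>R chibar k = N" by (simp add: N_def M'_def chi)
  have Napp: "N x = (1 - t) *\<^sub>R M' x + (t * c) *\<^sub>R (x - oproj k x)" for x
    by (simp add: N_def blinfun.add_left blinfun.diff_left blinfun.scaleR_left)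
  have "Brel v br A (oproj k) N"
    unfolding Brel_def
  proof (intro conjI allI ballI impI)
    show "symop N" using M'(1) symop_oproj[OF s] unfolding symop_def Napp
      by (simp add: inner_add_left inner_add_right inner_diff_left inner_diff_right)
    show "0 \<le> N x \<bullet> x" for x
    proof -
      have "(x - oproj k x) \<bullet> x = (x - oproj k x) \<bullet> (x - oproj k x)"
        using oproj_orth[OF s oproj_in[OF s], of x x] by (simp add: inner_diff_right)
      then have "N x \<bullet> x = (1 - t) * (M' x \<bullet> x) + t * c * ((x - oproj k x) \<bullet> (x - oproj k x))"
        by (simp only: Napp inner_add_left inner_scaleR_left)
      then show ?thesis using t c M'(2)[of x] by (simp del: inner_eq_zero_iff)
    qed
    have "optrace M' = (if t = 1 then 0 else 1)" using BM by (auto simp: M'_def Brel_def optrace_def)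
    moreover have "c * (real DIM('g) - real (dim k)) = 1"
      using cpos by (simp add: c_def of_nat_diff)
    ultimately show "optrace N = 1"
      using t by (auto simp: N_def optrace_add optrace_diff optrace_scaleR optrace_id optrace_oproj[OF s] mult.assoc)
    show "N o\<^sub>L a = a o\<^sub>L N" if "a \<in> A" for a
    proof (rule blinfun_eqI)
      fix x
      have "M' (blinfun_apply a x) = blinfun_apply a (M' x)" using MA[OF that] by (metis blinfun_apply_blinfun_compose)
      moreover have "oproj k (blinfun_apply a x) = blinfun_apply a (oproj k x)" using oproj_A[OF k(1) that] by (metis blinfun_apply_blinfun_compose)
      ultimately show "(N o\<^sub>L a) x = (a o\<^sub>L N) x" by (simp add: Napp blinfun.add_right blinfun.diff_right blinfun.scaleR_right)
    qed
    show "N (oproj k x) = 0" for x using Mk(1)[OF oproj_in[OF s]] oproj_id[OF s oproj_in[OF s]] by (simp add: Napp)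
    show "N (br (oproj k X) y) = br (oproj k X) (N y)" for X y
      using Mk(2)[OF oproj_in[OF s]] oproj_br[OF k(1) oproj_in[OF s]] by (simp add: Napp br.add_right br.diff_right br.scaleR_right)
    show "eigen_filtering br N" if "v = VerX"
      by (rule eigen_filtering_shift[OF k(1) M' Mk t c _ N_def]) (use BM that in \<open>auto simp: M'_def Brel_def\<close>)
  qed
  then show ?thesis unfolding Neq B_iff[OF s] .
qed

lemma chibar_in_B: "k \<in> \<P> \<Longrightarrow> k \<noteq> UNIV \<Longrightarrow> chibar k \<in> B k"
  using B_shift[of k 1 0] by simp

end

subsection \<open>Simplicial complexes of flags\<close>

text \<open>Flags as finite sets instead of decreasing lists, since subsets and insertions of a
  smallest member are then immediate; \<open>chain_list\<close> converts back.\<close>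

definition is_chain :: "'a set set \<Rightarrow> bool" where
  "is_chain c \<longleftrightarrow> finite c \<and> c \<noteq> {} \<and> (\<forall>a\<in>c. \<forall>b\<in>c. a \<subseteq> b \<or> b \<subseteq> a)"

lemma chain_has_min: "is_chain c \<Longrightarrow> \<exists>l\<in>c. \<forall>k\<in>c. l \<subseteq> k"
proof -
  assume c: "is_chain c"
  then obtain l where l: "l \<in> c" "\<forall>k\<in>c. k \<subseteq> l \<longrightarrow> l = k"
    using finite_has_minimal[of c] by (auto simp: is_chain_def)
  have "l \<subseteq> k" if "k \<in> c" for k
  proof -
    have "l \<subseteq> k \<or> k \<subseteq> l" using c l(1) that by (simp add: is_chain_def)
    then show ?thesis using l(2) that by auto
  qed
  then show ?thesis using l(1) by blast
qed

lemma chain_list: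
  assumes "finite c" "\<forall>a\<in>c. \<forall>b\<in>c. a \<subseteq> b \<or> b \<subseteq> a"
  shows "\<exists>fl. set fl = c \<and> sorted_wrt (\<lambda>a b. b \<subset> a) fl"
  using assms
proof (induction "card c" arbitrary: c)
  case 0
  then show ?case by (intro exI[of _ "[]"]) auto
next
  case (Suc n)
  then have "c \<noteq> {}" by auto
  then obtain m where m: "m \<in> c" "\<forall>b\<in>c. m \<subseteq> b \<longrightarrow> m = b"
    using finite_has_maximal[of c] Suc.prems(1) by auto
  have "n = card (c - {m})" using Suc.hyps(2) Suc.prems(1) m(1) by simp
  then have "\<exists>fl. set fl = c - {m} \<and> sorted_wrt (\<lambda>a b. b \<subset> a) fl"
    by (rule Suc.hyps(1)) (use Suc.prems in auto)
  then obtain fl where fl: "set fl = c - {m}" "sorted_wrt (\<lambda>a b. b \<subset> a) fl" by blast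
  have "b \<subset> m" if "b \<in> set fl" for b
  proof -
    have b: "b \<in> c" "b \<noteq> m" using that fl(1) by auto
    then have "b \<subseteq> m \<or> m \<subseteq> b" using Suc.prems(2) m(1) by simp
    then show ?thesis using m(2) b by auto
  qed
  then show ?case using fl m(1) by (intro exI[of _ "m # fl"]) auto
qed

lemma simp_complex_iff:
  "M \<in> simp_complex S \<longleftrightarrow> (\<exists>c. is_chain c \<and> c \<subseteq> S \<and> M \<in> convex hull (chibar ` c))"
proof
  assume "M \<in> simp_complex S"
  then obtain fl where fl: "flag_in S fl" "M \<in> simp_hull fl" by (auto simp: simp_complex_def)
  have ch: "\<forall>a\<in>set fl. \<forall>b\<in>set fl. a \<subseteq> b \<or> b \<subseteq> a" if "sorted_wrt (\<lambda>a b. b \<subset> a) fl" for fl :: "'a set list"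
    using that by (induction fl) auto
  have "is_chain (set fl)" using fl(1) ch[of fl] by (auto simp: flag_in_def is_chain_def)
  then show "\<exists>c. is_chain c \<and> c \<subseteq> S \<and> M \<in> convex hull (chibar ` c)"
    using fl by (intro exI[of _ "set fl"]) (auto simp: flag_in_def simp_hull_def)
next
  assume "\<exists>c. is_chain c \<and> c \<subseteq> S \<and> M \<in> convex hull (chibar ` c)"
  then obtain c where c: "is_chain c" "c \<subseteq> S" "M \<in> convex hull (chibar ` c)" by blast
  then obtain fl where fl: "set fl = c" "sorted_wrt (\<lambda>a b. b \<subset> a) fl" using chain_list[of c] by (auto simp: is_chain_def)
  then have "flag_in S fl" using c by (auto simp: flag_in_def is_chain_def)
  then show "M \<in> simp_complex S" using fl c by (auto simp: simp_complex_def simp_hull_def)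
qed

lemma simp_complex_mono: "S \<subseteq> S' \<Longrightarrow> simp_complex S \<subseteq> simp_complex S'"
  using simp_complex_iff by blast

lemma simp_complex_empty [simp]: "simp_complex {} = {}"
  unfolding simp_complex_def flag_in_def by auto

lemma simp_complex_chibar: "l \<in> S \<Longrightarrow> chibar l \<in> simp_complex S"
  unfolding simp_complex_iff by (intro exI[of _ "{l}"]) (auto simp: is_chain_def)

lemma simp_complex_join:
  assumes "l \<in> S" "s \<in> simp_complex {k\<in>S. l \<subseteq> k}" "0 \<le> t" "t \<le> 1"
  shows "(1 - t) *\<^sub>R s + t *\<^sub>R chibar l \<in> simp_complex {k\<in>S. l \<subseteq> k}"
proof -
  obtain c where c: "is_chain c" "c \<subseteq> {k\<in>S. l \<subseteq> k}" "s \<in> convex hull (chibar ` c)" using assms(2) simp_complex_iff by blast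
  have "is_chain (insert l c)" using c(1,2) by (auto simp: is_chain_def)
  moreover have "insert l c \<subseteq> {k\<in>S. l \<subseteq> k}" using c(2) assms(1) by auto
  moreover have "(1 - t) *\<^sub>R s + t *\<^sub>R chibar l \<in> convex hull (chibar ` insert l c)"
  proof (rule convexD_alt[OF convex_convex_hull])
    show "s \<in> convex hull (chibar ` insert l c)" using c(3) hull_mono[of "chibar ` c" "chibar ` insert l c" convex] by auto
    show "chibar l \<in> convex hull (chibar ` insert l c)" by (intro hull_inc) auto
  qed (use assms in auto)
  ultimately show ?thesis using simp_complex_iff by blast
qed

text \<open>A simplex is the cone over the face opposite to the vertex of its smallest flag member;
  the first alternative covers the case that this face is empty.\<close>

lemma chain_hull_split:
  assumes c: "is_chain c" and l: "l \<in> c" "\<forall>k\<in>c. l \<subseteq> k" and M: "M \<in> convex hull (chibar ` c)"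
  shows "M = chibar l \<or> (is_chain (c - {l}) \<and> (\<exists>t\<in>{0..1}. \<exists>s\<in>convex hull (chibar ` (c - {l})). M = (1 - t) *\<^sub>R s + t *\<^sub>R chibar l))"
proof (cases "c = {l}")
  case True
  then show ?thesis using M by simp
next
  case False
  then have ne: "c - {l} \<noteq> {}" using l(1) by auto
  have "chibar ` c = insert (chibar l) (chibar ` (c - {l}))" using l(1) by auto
  then have "M \<in> convex hull (insert (chibar l) (chibar ` (c - {l})))" using M by simp
  then obtain u w s where *: "0 \<le> u" "0 \<le> w" "u + w = 1" "s \<in> convex hull (chibar ` (c - {l}))" "M = u *\<^sub>R chibar l + w *\<^sub>R s"
    using convex_hull_insert[of "chibar ` (c - {l})" "chibar l"] ne by auto
  have "w = 1 - u" using *(3) by simp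
  then have "M = (1 - u) *\<^sub>R s + u *\<^sub>R chibar l" "u \<in> {0..1}" using * by (auto simp: add.commute)
  moreover have "is_chain (c - {l})" using c ne by (auto simp: is_chain_def)
  ultimately show ?thesis using *(4) by blast
qed

text \<open>Splitting off the smallest member describes the complex by cones over links, the form
  that is used to define it by formulas.\<close>

lemma simp_complex_rec:
  "M \<in> simp_complex S \<longleftrightarrow>
    (\<exists>l\<in>S. M = chibar l \<or> (\<exists>t\<in>{0..1}. \<exists>s\<in>simp_complex {k\<in>S. l \<subset> k}. M = (1 - t) *\<^sub>R s + t *\<^sub>R chibar l))"
proof
  assume "M \<in> simp_complex S"
  then obtain c where c: "is_chain c" "c \<subseteq> S" "M \<in> convex hull (chibar ` c)" using simp_complex_iff by blast
  obtain l where l: "l \<in> c" "\<forall>k\<in>c. l \<subseteq> k" using chain_has_min[OF c(1)] by blast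
  have sub: "c - {l} \<subseteq> {k\<in>S. l \<subset> k}" using l c(2) by blast
  from chain_hull_split[OF c(1) l c(3)]
  show "\<exists>l\<in>S. M = chibar l \<or> (\<exists>t\<in>{0..1}. \<exists>s\<in>simp_complex {k\<in>S. l \<subset> k}. M = (1 - t) *\<^sub>R s + t *\<^sub>R chibar l)"
  proof
    assume "M = chibar l"
    then show ?thesis using l c(2) by blast
  next
    assume *: "is_chain (c - {l}) \<and> (\<exists>t\<in>{0..1}. \<exists>s\<in>convex hull (chibar ` (c - {l})). M = (1 - t) *\<^sub>R s + t *\<^sub>R chibar l)"
    then obtain t s where t: "t \<in> {0..1}" "s \<in> convex hull (chibar ` (c - {l}))" "M = (1 - t) *\<^sub>R s + t *\<^sub>R chibar l" by blast
    then have "s \<in> simp_complex {k\<in>S. l \<subset> k}" unfolding simp_complex_iff using * sub by blast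
    then show ?thesis using t l c(2) by blast
  qed
next
  assume "\<exists>l\<in>S. M = chibar l \<or> (\<exists>t\<in>{0..1}. \<exists>s\<in>simp_complex {k\<in>S. l \<subset> k}. M = (1 - t) *\<^sub>R s + t *\<^sub>R chibar l)"
  then obtain l where l: "l \<in> S" "M = chibar l \<or> (\<exists>t\<in>{0..1}. \<exists>s\<in>simp_complex {k\<in>S. l \<subset> k}. M = (1 - t) *\<^sub>R s + t *\<^sub>R chibar l)"
    by blast
  from l(2) show "M \<in> simp_complex S"
  proof
    assume "M = chibar l"
    then show ?thesis using l(1) simp_complex_chibar by blast
  next
    assume "\<exists>t\<in>{0..1}. \<exists>s\<in>simp_complex {k\<in>S. l \<subset> k}. M = (1 - t) *\<^sub>R s + t *\<^sub>R chibar l"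
    then obtain t s where t: "t \<in> {0..1}" "s \<in> simp_complex {k\<in>S. l \<subset> k}" "M = (1 - t) *\<^sub>R s + t *\<^sub>R chibar l" by blast
    have "s \<in> simp_complex {k\<in>S. l \<subseteq> k}" using t(2) simp_complex_mono[of "{k\<in>S. l \<subset> k}" "{k\<in>S. l \<subseteq> k}"] by blast
    from simp_complex_join[OF l(1) this] t(1,3) have "M \<in> simp_complex {k\<in>S. l \<subseteq> k}" by auto
    then show ?thesis using simp_complex_mono[of "{k\<in>S. l \<subseteq> k}" S] by blast
  qed
qed

section \<open>Limits of flags and of points in their simplices\<close>

lemma tendsto_optrace: "(f \<longlongrightarrow> P) F \<Longrightarrow> ((\<lambda>n. optrace (f n)) \<longlongrightarrow> optrace P) F"
  unfolding optrace_def by (intro tendsto_intros)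

lemma tendsto_chibar:
  fixes k :: "nat \<Rightarrow> 'g::euclidean_space set"
  assumes "\<And>n. subspace (k n)" "subspace l" "l \<noteq> UNIV" "(\<lambda>n. oproj (k n)) \<longlonglongrightarrow> oproj l"
  shows "(\<lambda>n. chibar (k n)) \<longlonglongrightarrow> chibar l"
proof -
  have "real DIM('g) - optrace (oproj l) \<noteq> 0" using dim_less_iff[OF assms(2)] assms(3) by (simp add: optrace_oproj[OF assms(2)])
  then show ?thesis unfolding chibar_via_trace[OF assms(1)] chibar_via_trace[OF assms(2)]
    by (intro tendsto_intros tendsto_optrace assms(4))
qed

lemma limit_subset:
  assumes "\<And>n. subspace (k n)" "\<And>n. subspace (l n)" "subspace k0" "subspace l0" "\<And>n. l n \<subseteq> k n"
    "(\<lambda>n. oproj (k n)) \<longlonglongrightarrow> oproj k0" "(\<lambda>n. oproj (l n)) \<longlonglongrightarrow> oproj l0"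
  shows "l0 \<subseteq> k0"
proof -
  have L: "(\<lambda>n. oproj (k n) o\<^sub>L oproj (l n)) \<longlonglongrightarrow> (oproj k0 o\<^sub>L oproj l0)"
    by (rule bounded_bilinear.tendsto[OF bounded_bilinear_blinfun_compose assms(6,7)])
  have e: "oproj (k n) o\<^sub>L oproj (l n) = oproj (l n)" for n
    using oproj_compose_iff[OF assms(1,2)] assms(5) by blast
  have "oproj k0 o\<^sub>L oproj l0 = oproj l0" by (rule LIMSEQ_unique[OF L[unfolded e] assms(7)])
  then show ?thesis using oproj_compose_iff[OF assms(3,4)] by blast
qed

text \<open>Dimension separates the members of a chain. The uniform bound makes an induction on the
  length of flags possible for a whole sequence of them.\<close>

lemma chain_card_bound:
  fixes c :: "'g::euclidean_space set set"
  assumes "is_chain c" "\<And>k. k \<in> c \<Longrightarrow> subspace k"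
  shows "card c \<le> Suc DIM('g)"
proof -
  have "inj_on dim c"
  proof (rule inj_onI)
    fix a b assume ab: "a \<in> c" "b \<in> c" "dim a = dim b"
    then have "a \<subseteq> b \<or> b \<subseteq> a" using assms(1) by (auto simp: is_chain_def)
    then show "a = b" using subspace_dim_equal[of a b] subspace_dim_equal[of b a] assms(2) ab by auto
  qed
  then have "card c \<le> card {..DIM('g)}" using dim_subset_UNIV by (intro card_inj_on_le[of dim]) auto
  then show ?thesis by simp
qed

text \<open>The smallest member and its weight converge along a subsequence, and the opposite face
  has a shorter flag. Members may merge in the limit. The last conclusion records that every limit
  member is approached by members of the given flags, because closed conditions on flag members pass
  to the limit through it.\<close>

lemma simp_complex_limit:
  fixes s :: "nat \<Rightarrow> 'g::euclidean_space opr"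
  assumes K: "\<And>k. k \<in> K \<Longrightarrow> subspace k \<and> k \<noteq> UNIV" "compact (oproj ` K)"
    and c: "\<And>n. is_chain (c n)" "\<And>n. c n \<subseteq> K" "\<And>n. card (c n) \<le> N" "\<And>n. s n \<in> convex hull (chibar ` c n)"
    and lim: "s \<longlonglongrightarrow> s0"
  shows "\<exists>\<phi> c0. strict_mono (\<phi> :: nat \<Rightarrow> nat) \<and> is_chain c0 \<and> c0 \<subseteq> K \<and> s0 \<in> convex hull (chibar ` c0) \<and>
    (\<forall>k\<in>c0. \<exists>\<kappa>. (\<forall>n. \<kappa> n \<in> c (\<phi> n)) \<and> (\<lambda>n. oproj (\<kappa> n)) \<longlonglongrightarrow> oproj k)"
  using c lim
proof (induction N arbitrary: s s0 c)
  case 0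
  then show ?case by (auto simp: is_chain_def)
next
  case (Suc N)
  have "\<forall>n. \<exists>l\<in>c n. \<forall>k\<in>c n. l \<subseteq> k" using chain_has_min Suc.prems(1) by blast
  then obtain l where l: "\<And>n. l n \<in> c n" "\<And>n k. k \<in> c n \<Longrightarrow> l n \<subseteq> k" by metis
  have lK: "l n \<in> K" for n using l(1) Suc.prems(2) by blast
  have split: "s n = chibar (l n) \<or> (is_chain (c n - {l n}) \<and> (\<exists>t\<in>{0..1}. \<exists>s'\<in>convex hull (chibar ` (c n - {l n})). s n = (1 - t) *\<^sub>R s' + t *\<^sub>R chibar (l n)))" for n
    using chain_hull_split[OF Suc.prems(1) l(1)] l(2) Suc.prems(4) by blast
  have ex_sub: "\<exists>r m. strict_mono (r :: nat \<Rightarrow> nat) \<and> m \<in> K \<and> (\<lambda>n. oproj (f (r n))) \<longlonglongrightarrow> oproj m" if "\<And>n. f n \<in> K" for f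
  proof -
    have "\<forall>n. oproj (f n) \<in> oproj ` K" using that by blast
    then obtain P r where "P \<in> oproj ` K" "strict_mono r" "((\<lambda>n. oproj (f n)) \<circ> r) \<longlonglongrightarrow> P"
      using seq_compactE[OF compact_imp_seq_compact[OF K(2)], of "\<lambda>n. oproj (f n)"] by metis
    then show ?thesis by (auto simp: o_def)
  qed
  show ?case
  \<comment> \<open>Either the points are apices infinitely often, and the limit is a vertex, or
    from some index on each has a weight and a point of the opposite face.\<close>
  proof (cases "\<exists>r :: nat \<Rightarrow> nat. strict_mono r \<and> (\<forall>n. s (r n) = chibar (l (r n)))")
    case True
    then obtain r :: "nat \<Rightarrow> nat" where r: "strict_mono r" "\<And>n. s (r n) = chibar (l (r n))" by blast
    obtain q m where q: "strict_mono (q :: nat \<Rightarrow> nat)" "m \<in> K" "(\<lambda>n. oproj (l (r (q n)))) \<longlonglongrightarrow> oproj m"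
      using ex_sub[of "\<lambda>n. l (r n)"] lK by blast
    have sm: "strict_mono (\<lambda>n. r (q n))" using r(1) q(1) by (simp add: strict_mono_def)
    have "(\<lambda>n. chibar (l (r (q n)))) \<longlonglongrightarrow> chibar m"
      using K(1)[OF lK] K(1)[OF q(2)] q(3) by (intro tendsto_chibar) auto
    moreover have "(\<lambda>n. s (r (q n))) \<longlonglongrightarrow> s0" using LIMSEQ_subseq_LIMSEQ[OF Suc.prems(5) sm] by (simp add: o_def)
    ultimately have "s0 = chibar m" using r(2) LIMSEQ_unique by simp
    then show ?thesis using sm q(2,3) l(1)
      by (intro exI[of _ "\<lambda>n. r (q n)"] exI[of _ "{m}"]) (auto simp: is_chain_def intro!: exI[of _ "\<lambda>n. l (r (q n))"])
  next
    case False
    have "eventually (\<lambda>n. s n \<noteq> chibar (l n)) sequentially"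
    proof (rule ccontr)
      assume "\<not> ?thesis"
      then obtain r :: "nat \<Rightarrow> nat" where "strict_mono r" "\<And>n. \<not> s (r n) \<noteq> chibar (l (r n))"
        using not_eventually_sequentiallyD by blast
      then show False using False by blast
    qed
    then obtain N0 where N0: "\<And>n. n \<ge> N0 \<Longrightarrow> s n \<noteq> chibar (l n)" by (auto simp: eventually_sequentially)
    define i where "i n = n + N0" for n
    have i: "s (i n) \<noteq> chibar (l (i n))" for n using N0 by (simp add: i_def)
    have ch: "is_chain (c (i n) - {l (i n)})" for n using split[of "i n"] i by blast
    have "\<forall>n. \<exists>t s'. t \<in> {0..1} \<and> s' \<in> convex hull (chibar ` (c (i n) - {l (i n)})) \<and> s (i n) = (1 - t) *\<^sub>R s' + t *\<^sub>R chibar (l (i n))"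
      using split[of "i _"] i by blast
    then obtain t s' where ts: "\<And>n. t n \<in> {0..1::real}" "\<And>n. s' n \<in> convex hull (chibar ` (c (i n) - {l (i n)}))"
      "\<And>n. s (i n) = (1 - t n) *\<^sub>R s' n + t n *\<^sub>R chibar (l (i n))" by metis
    have comp: "compact (chibar ` K)"
    proof -
      have "continuous_on (oproj ` K) (\<lambda>P. (1 / (DIM('g) - optrace P)) *\<^sub>R (id_blinfun - P))"
        unfolding optrace_def
      proof (intro continuous_intros ballI)
        fix P assume "P \<in> oproj ` K"
        then obtain k where k: "k \<in> K" "P = oproj k" by blast
        then have "dim k < DIM('g)" using dim_less_iff K(1) by blast
        then show "real DIM('g) - (\<Sum>b\<in>Basis. blinfun_apply P b \<bullet> b) \<noteq> 0"
          using optrace_oproj[of k] K(1)[OF k(1)] k(2) by (simp add: optrace_def)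
      qed
      from compact_continuous_image[OF this K(2)]
      have "compact ((\<lambda>k. (1 / (DIM('g) - optrace (oproj k))) *\<^sub>R (id_blinfun - oproj k)) ` K)" by (simp add: image_image)
      moreover have "(\<lambda>k. (1 / (DIM('g) - optrace (oproj k))) *\<^sub>R (id_blinfun - oproj k)) ` K = chibar ` K"
        by (intro image_cong refl) (simp add: chibar_via_trace K(1))
      ultimately show ?thesis by simp
    qed
    \<comment> \<open>A ball containing all vertices contains all simplices, which bounds the points
      \<open>s'\<close> of the opposite faces.\<close>
    define CB where "CB = cball (0 :: 'g opr) (SOME b. \<forall>k\<in>K. norm (chibar k) \<le> b)"
    have "\<exists>b. \<forall>k\<in>K. norm (chibar k) \<le> b" using compact_imp_bounded[OF comp] by (auto simp: bounded_iff)
    then have "\<forall>k\<in>K. norm (chibar k) \<le> (SOME b. \<forall>k\<in>K. norm (chibar k) \<le> b)" by (rule someI_ex)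
    then have CB: "chibar ` K \<subseteq> CB" by (auto simp: CB_def)
    have s'CB: "s' n \<in> CB" for n
    proof -
      have "convex hull (chibar ` (c (i n) - {l (i n)})) \<subseteq> CB"
        using CB Suc.prems(2)[of "i n"] by (intro hull_minimal) (auto simp: CB_def)
      then show ?thesis using ts(2) by blast
    qed
    obtain r m where r: "strict_mono (r :: nat \<Rightarrow> nat)" "m \<in> K" "(\<lambda>n. oproj (l (i (r n)))) \<longlonglongrightarrow> oproj m"
      using ex_sub[of "\<lambda>n. l (i n)"] lK by blast
    obtain t0 r2 where r2: "strict_mono (r2 :: nat \<Rightarrow> nat)" "t0 \<in> {0..1}" "((\<lambda>n. t (r n)) \<circ> r2) \<longlonglongrightarrow> t0"
      using seq_compactE[OF compact_imp_seq_compact[OF compact_Icc], of "\<lambda>n. t (r n)" 0 1] ts(1) by metis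
    have "compact CB" by (simp add: CB_def)
    then obtain s1 r3 where r3: "strict_mono (r3 :: nat \<Rightarrow> nat)" "((\<lambda>n. s' (r (r2 n))) \<circ> r3) \<longlonglongrightarrow> s1"
      using seq_compactE[OF compact_imp_seq_compact, of CB "\<lambda>n. s' (r (r2 n))"] s'CB by metis
    define j where "j n = r (r2 (r3 n))" for n
    have j: "strict_mono j" using r(1) r2(1) r3(1) by (simp add: j_def strict_mono_def)
    have lim_s': "(\<lambda>n. s' (j n)) \<longlonglongrightarrow> s1" using r3(2) by (simp add: j_def o_def)
    have lim_t: "(\<lambda>n. t (j n)) \<longlonglongrightarrow> t0" using LIMSEQ_subseq_LIMSEQ[OF r2(3) r3(1)] by (simp add: j_def o_def)
    have "strict_mono (\<lambda>n. r2 (r3 n))" using r2(1) r3(1) by (simp add: strict_mono_def)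
    from LIMSEQ_subseq_LIMSEQ[OF r(3) this] have lim_l: "(\<lambda>n. oproj (l (i (j n)))) \<longlonglongrightarrow> oproj m" by (simp add: j_def o_def)
    have "\<exists>\<phi> c0. strict_mono (\<phi> :: nat \<Rightarrow> nat) \<and> is_chain c0 \<and> c0 \<subseteq> K \<and> s1 \<in> convex hull (chibar ` c0) \<and>
      (\<forall>k\<in>c0. \<exists>\<kappa>. (\<forall>n. \<kappa> n \<in> c (i (j (\<phi> n))) - {l (i (j (\<phi> n)))}) \<and> (\<lambda>n. oproj (\<kappa> n)) \<longlonglongrightarrow> oproj k)"
    proof (rule Suc.IH[of "\<lambda>n. c (i (j n)) - {l (i (j n))}" "\<lambda>n. s' (j n)"])
      show "c (i (j n)) - {l (i (j n))} \<subseteq> K" for n using Suc.prems(2) by blast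
      show "card (c (i (j n)) - {l (i (j n))}) \<le> N" for n
        using Suc.prems(3)[of "i (j n)"] Suc.prems(1)[of "i (j n)"] l(1)[of "i (j n)"] by (simp add: is_chain_def)
    qed (use ch ts(2) lim_s' in auto)
    then obtain \<phi> c0 where c0: "strict_mono (\<phi> :: nat \<Rightarrow> nat)" "is_chain c0" "c0 \<subseteq> K" "s1 \<in> convex hull (chibar ` c0)"
      and \<kappa>ex: "\<And>k. k \<in> c0 \<Longrightarrow> \<exists>\<kappa>. (\<forall>n. \<kappa> n \<in> c (i (j (\<phi> n))) - {l (i (j (\<phi> n)))}) \<and> (\<lambda>n. oproj (\<kappa> n)) \<longlonglongrightarrow> oproj k"
      by blast
    have lim_l\<phi>: "(\<lambda>n. oproj (l (i (j (\<phi> n))))) \<longlonglongrightarrow> oproj m"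
      using LIMSEQ_subseq_LIMSEQ[OF lim_l c0(1)] by (simp add: o_def)
    have m_sub: "m \<subseteq> k" if k: "k \<in> c0" for k
    proof -
      obtain \<kappa> where \<kappa>: "\<And>n. \<kappa> n \<in> c (i (j (\<phi> n))) - {l (i (j (\<phi> n)))}" "(\<lambda>n. oproj (\<kappa> n)) \<longlonglongrightarrow> oproj k" using \<kappa>ex[OF k] by blast
      have \<kappa>K: "\<kappa> n \<in> K" for n using \<kappa>(1) Suc.prems(2) by blast
      show ?thesis
        by (rule limit_subset[OF _ _ _ _ _ \<kappa>(2) lim_l\<phi>]) (use K(1) \<kappa>K lK c0(3) k r(2) l(2) \<kappa>(1) in blast)+
    qed
    have lim_chi: "(\<lambda>n. chibar (l (i (j n)))) \<longlonglongrightarrow> chibar m"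
      using K(1)[OF lK] K(1)[OF r(2)] lim_l by (intro tendsto_chibar) auto
    have "(\<lambda>n. s (i (j n))) \<longlonglongrightarrow> (1 - t0) *\<^sub>R s1 + t0 *\<^sub>R chibar m"
      unfolding ts(3) by (intro tendsto_intros lim_t lim_s' lim_chi)
    moreover have ij: "strict_mono (\<lambda>n. i (j n))" using j by (simp add: i_def strict_mono_def)
    then have "(\<lambda>n. s (i (j n))) \<longlonglongrightarrow> s0" using LIMSEQ_subseq_LIMSEQ[OF Suc.prems(5) ij] by (simp add: o_def)
    ultimately have s0: "s0 = (1 - t0) *\<^sub>R s1 + t0 *\<^sub>R chibar m" using LIMSEQ_unique by blast
    have "s0 \<in> convex hull (chibar ` insert m c0)"
      unfolding s0
    proof (rule convexD_alt[OF convex_convex_hull])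
      show "s1 \<in> convex hull (chibar ` insert m c0)" using c0(4) hull_mono[of "chibar ` c0" "chibar ` insert m c0" convex] by auto
      show "chibar m \<in> convex hull (chibar ` insert m c0)" by (intro hull_inc) auto
    qed (use r2(2) in auto)
    moreover have "is_chain (insert m c0)" using c0(2) m_sub by (auto simp: is_chain_def)
    moreover have "insert m c0 \<subseteq> K" using c0(3) r(2) by blast
    moreover have "strict_mono (\<lambda>n. i (j (\<phi> n)))" using ij c0(1) by (simp add: strict_mono_def)
    moreover have "\<exists>\<kappa>. (\<forall>n. \<kappa> n \<in> c (i (j (\<phi> n)))) \<and> (\<lambda>n. oproj (\<kappa> n)) \<longlonglongrightarrow> oproj k" if "k \<in> insert m c0" for k
    proof (cases "k = m")
      case True
      then show ?thesis using lim_l\<phi> l(1) by (intro exI[of _ "\<lambda>n. l (i (j (\<phi> n)))"]) auto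
    next
      case False
      then show ?thesis using \<kappa>ex[of k] that by blast
    qed
    ultimately show ?thesis by (intro exI[of _ "\<lambda>n. i (j (\<phi> n))"] exI[of _ "insert m c0"]) blast
  qed
qed

lemma simp_complex_limitE:
  fixes s :: "nat \<Rightarrow> 'g::euclidean_space opr"
  assumes K: "\<And>k. k \<in> K \<Longrightarrow> subspace k \<and> k \<noteq> UNIV" "compact (oproj ` K)"
    and s: "\<And>n. s n \<in> simp_complex (S n)" "\<And>n. S n \<subseteq> K" and lim: "s \<longlonglongrightarrow> s0"
  obtains \<phi> S0 where "strict_mono (\<phi> :: nat \<Rightarrow> nat)" "S0 \<subseteq> K" "s0 \<in> simp_complex S0"
    "\<And>k. k \<in> S0 \<Longrightarrow> \<exists>\<kappa>. (\<forall>n. \<kappa> n \<in> S (\<phi> n)) \<and> (\<lambda>n. oproj (\<kappa> n)) \<longlonglongrightarrow> oproj k"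
proof -
  have "\<forall>n. \<exists>c. is_chain c \<and> c \<subseteq> S n \<and> s n \<in> convex hull (chibar ` c)" using s(1) simp_complex_iff by blast
  then obtain c where c: "\<And>n. is_chain (c n)" "\<And>n. c n \<subseteq> S n" "\<And>n. s n \<in> convex hull (chibar ` c n)" by metis
  have cK: "c n \<subseteq> K" for n using c(2) s(2) by blast
  have card: "card (c n) \<le> Suc DIM('g)" for n
    using chain_card_bound[OF c(1)] cK K(1) by blast
  obtain \<phi> c0 where "strict_mono (\<phi> :: nat \<Rightarrow> nat)" "is_chain c0" "c0 \<subseteq> K" "s0 \<in> convex hull (chibar ` c0)"
    "\<forall>k\<in>c0. \<exists>\<kappa>. (\<forall>n. \<kappa> n \<in> c (\<phi> n)) \<and> (\<lambda>n. oproj (\<kappa> n)) \<longlonglongrightarrow> oproj k"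
    using simp_complex_limit[OF K c(1) cK card c(3) lim] by blast
  then show ?thesis using that[of \<phi> c0] c(2) simp_complex_iff by (metis subsetD subset_refl)
qed

context lie_setting
begin

text \<open>All operators in the simplex are nonnegative, so the kernel of a convex combination is
  the intersection of the kernels of the vertices with positive weight, that is, the smallest of
  their flag members.\<close>

lemma chain_hull_kernel:
  assumes "is_chain c" "c \<subseteq> \<P> - {UNIV}" "M \<in> convex hull (chibar ` c)"
  shows "\<exists>l\<in>c. M \<in> convex hull (chibar ` {k\<in>c. l \<subseteq> k}) \<and> M \<in> B l \<and> (\<forall>x. M x = 0 \<longleftrightarrow> x \<in> l)"
  using assms
proof (induction "card c" arbitrary: c M rule: less_induct)
  case less
  obtain l where l: "l \<in> c" "\<forall>k\<in>c. l \<subseteq> k" using chain_has_min[OF less.prems(1)] by blast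
  then have lP: "l \<in> \<P>" "l \<noteq> UNIV" using less.prems(2) by auto
  note s = P_sub[OF lP(1)]
  have all: "{k\<in>c. l \<subseteq> k} = c" using l(2) by blast
  have chi: "chibar l x \<bullet> x = (1 / real (DIM('g) - dim l)) * ((x - oproj l x) \<bullet> (x - oproj l x))" for x
    using oproj_orth[OF s oproj_in[OF s], of x x] by (simp add: chibar_apply inner_diff_right)
  have pos: "1 / real (DIM('g) - dim l) > 0" using dim_less_iff[OF s] lP(2) by simp
  have kerchi: "x \<in> l" if "chibar l x \<bullet> x \<le> 0" for x
  proof -
    have "(x - oproj l x) \<bullet> (x - oproj l x) \<le> 0" using that pos unfolding chi mult_le_0_iff by (meson not_le)
    then have "x - oproj l x = 0" by (metis inner_ge_zero inner_eq_zero_iff antisym)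
    then show ?thesis using oproj_in[OF s, of x] by simp
  qed
  from chain_hull_split[OF less.prems(1) l less.prems(3)] show ?case
  proof
    assume M: "M = chibar l"
    have "M x = 0 \<longleftrightarrow> x \<in> l" for x
      using kerchi[of x] oproj_id[OF s, of x] by (auto simp: M chibar_apply)
    then show ?thesis using chibar_in_B[OF lP] less.prems(3) l(1) all M by (intro bexI[of _ l]) auto
  next
    assume "is_chain (c - {l}) \<and> (\<exists>t\<in>{0..1}. \<exists>s\<in>convex hull (chibar ` (c - {l})). M = (1 - t) *\<^sub>R s + t *\<^sub>R chibar l)"
    then obtain t N where ch: "is_chain (c - {l})" and t: "0 \<le> t" "t \<le> 1" and N: "N \<in> convex hull (chibar ` (c - {l}))"
      and M: "M = (1 - t) *\<^sub>R N + t *\<^sub>R chibar l" by auto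
    have "card (c - {l}) < card c" using less.prems(1) l(1) by (intro card_Diff1_less) (auto simp: is_chain_def)
    then obtain l' where l': "l' \<in> c - {l}" "N \<in> convex hull (chibar ` {k\<in>c - {l}. l' \<subseteq> k})" "N \<in> B l'" "\<And>x. N x = 0 \<longleftrightarrow> x \<in> l'"
      using less.hyps[OF _ ch _ N] less.prems(2) by blast
    show ?thesis
    proof (cases "t = 0")
      \<comment> \<open>The smallest member has weight zero, and the rest of the flag determines the
        kernel.\<close>
      case True
      have "convex hull (chibar ` {k\<in>c - {l}. l' \<subseteq> k}) \<subseteq> convex hull (chibar ` {k\<in>c. l' \<subseteq> k})" by (intro hull_mono) auto
      then show ?thesis using l' M True by (intro bexI[of _ l']) auto
    next
      case False
      have l'P: "l' \<in> \<P>" "l \<subseteq> l'" using l' l(2) less.prems(2) by auto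
      have NB: "N \<in> B l" using B_antimono[OF s P_sub[OF l'P(1)] l'P(2)] l'(3) by blast
      then have MB: "M \<in> B l" using B_shift[OF lP t] M by blast
      have "M x = 0 \<longleftrightarrow> x \<in> l" for x
      proof
        assume "M x = 0"
        moreover have "M x \<bullet> x = (1 - t) * (N x \<bullet> x) + t * (chibar l x \<bullet> x)"
          unfolding M by (simp add: blinfun.add_left blinfun.scaleR_left inner_add_left)
        ultimately have "(1 - t) * (N x \<bullet> x) + t * (chibar l x \<bullet> x) = 0" by simp
        moreover have "0 \<le> (1 - t) * (N x \<bullet> x)" using NB t unfolding B_iff[OF s] Brel_def by simp
        ultimately have "t * (chibar l x \<bullet> x) \<le> 0" by linarith
        moreover have "0 < t" using False t by simp
        ultimately have "chibar l x \<bullet> x \<le> 0" unfolding mult_le_0_iff by (meson not_le)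
        then show "x \<in> l" by (rule kerchi)
      next
        assume "x \<in> l"
        then show "M x = 0" using MB oproj_id[OF s, of x] unfolding B_iff[OF s] Brel_def by metis
      qed
      then show ?thesis using MB less.prems(3) l(1) all by (intro bexI[of _ l]) auto
    qed
  qed
qed

text \<open>The smallest relevant flag member can be read off from the point alone, as its kernel.
  This decides to which strata a point of the complex belongs.\<close>

lemma simp_complex_kernel:
  assumes "S \<subseteq> \<P> - {UNIV}" "M \<in> simp_complex S"
  shows "\<exists>l\<in>S. M \<in> simp_complex {k\<in>S. l \<subseteq> k} \<and> M \<in> B l \<and> (\<forall>x. M x = 0 \<longleftrightarrow> x \<in> l)"
proof -
  obtain c where c: "is_chain c" "c \<subseteq> S" "M \<in> convex hull (chibar ` c)" using assms(2) simp_complex_iff by blast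
  obtain l where l: "l \<in> c" "M \<in> convex hull (chibar ` {k\<in>c. l \<subseteq> k})" "M \<in> B l" "\<forall>x. M x = 0 \<longleftrightarrow> x \<in> l"
    using chain_hull_kernel[OF c(1) _ c(3)] c(2) assms(1) by blast
  have "is_chain {k\<in>c. l \<subseteq> k}" using c(1) l(1) by (auto simp: is_chain_def)
  then have "M \<in> simp_complex {k\<in>S. l \<subseteq> k}" unfolding simp_complex_iff using l(2) c(2) by blast
  then show ?thesis using l c(2) by blast
qed

lemma B_subset_kernel:
  assumes "M \<in> B l" "subspace l" "x \<in> l" shows "M x = 0"
  using assms oproj_id[OF assms(2,3)] unfolding B_iff[OF assms(2)] Brel_def by metis

lemma Brel_limit:
  assumes R: "\<And>n. Brel v br A (P n) (M n)" and lim: "P \<longlonglongrightarrow> P0" "M \<longlonglongrightarrow> M0"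
  shows "Brel v br A P0 M0"
  unfolding Brel_def
proof (intro conjI allI ballI impI)
  show "symop M0" unfolding symop_def
  proof (intro allI)
    fix x y
    have "(\<lambda>n. M n x \<bullet> y) \<longlonglongrightarrow> M0 x \<bullet> y" "(\<lambda>n. x \<bullet> M n y) \<longlonglongrightarrow> x \<bullet> M0 y" by (intro tendsto_intros lim)+
    moreover have "M n x \<bullet> y = x \<bullet> M n y" for n using R[of n] by (simp add: Brel_def symop_def)
    ultimately show "M0 x \<bullet> y = x \<bullet> M0 y" using LIMSEQ_unique by fastforce
  qed
  show "0 \<le> M0 x \<bullet> x" for x
  proof (rule LIMSEQ_le_const)
    show "(\<lambda>n. M n x \<bullet> x) \<longlonglongrightarrow> M0 x \<bullet> x" by (intro tendsto_intros lim)
    show "\<exists>N. \<forall>n\<ge>N. 0 \<le> M n x \<bullet> x" using R by (auto simp: Brel_def)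
  qed
  have "(\<lambda>n. optrace (M n)) \<longlonglongrightarrow> optrace M0" by (rule tendsto_optrace[OF lim(2)])
  moreover have "optrace (M n) = 1" for n using R[of n] by (simp add: Brel_def)
  ultimately show "optrace M0 = 1" by (simp add: LIMSEQ_const_iff)
  show "M0 o\<^sub>L a = a o\<^sub>L M0" if "a \<in> A" for a
  proof (rule LIMSEQ_unique)
    show "(\<lambda>n. M n o\<^sub>L a) \<longlonglongrightarrow> (M0 o\<^sub>L a)"
      by (rule bounded_bilinear.tendsto[OF bounded_bilinear_blinfun_compose lim(2) tendsto_const])
    have "(\<lambda>n. a o\<^sub>L M n) \<longlonglongrightarrow> (a o\<^sub>L M0)"
      by (rule bounded_bilinear.tendsto[OF bounded_bilinear_blinfun_compose tendsto_const lim(2)])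
    moreover have "a o\<^sub>L M n = M n o\<^sub>L a" for n using R[of n] that by (simp add: Brel_def)
    ultimately show "(\<lambda>n. M n o\<^sub>L a) \<longlonglongrightarrow> (a o\<^sub>L M0)" by simp
  qed
  show "M0 (P0 x) = 0" for x
  proof (rule LIMSEQ_unique)
    show "(\<lambda>n. M n (P n x)) \<longlonglongrightarrow> M0 (P0 x)" by (intro tendsto_intros lim)
    show "(\<lambda>n. M n (P n x)) \<longlonglongrightarrow> 0" using R by (simp add: Brel_def)
  qed
  show "M0 (br (P0 X) y) = br (P0 X) (M0 y)" for X y
  proof (rule LIMSEQ_unique)
    show "(\<lambda>n. M n (br (P n X) y)) \<longlonglongrightarrow> M0 (br (P0 X) y)" by (intro tendsto_intros br.tendsto lim)
    have "(\<lambda>n. br (P n X) (M n y)) \<longlonglongrightarrow> br (P0 X) (M0 y)" by (intro tendsto_intros br.tendsto lim)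
    then show "(\<lambda>n. M n (br (P n X) y)) \<longlonglongrightarrow> br (P0 X) (M0 y)" using R by (simp add: Brel_def)
  qed
  show "eigen_filtering br M0" if "v = VerX"
    by (rule eigen_filtering_limit[OF lie _ _ lim(2)]) (use R that in \<open>auto simp: Brel_def\<close>)
qed

text \<open>Trace one bounds the diagonal entries of a nonnegative operator, and these bound the
  other entries; the constant comes from a crude sum over entries.\<close>

lemma Brel_bounded:
  assumes "Brel v br A P M" shows "norm M \<le> real DIM('g) * real DIM('g)"
proof -
  have sym: "symop M" and pos: "\<And>x. 0 \<le> M x \<bullet> x" and tr: "optrace M = 1" using assms by (auto simp: Brel_def)
  have diag: "M b \<bullet> b \<le> 1" if "b \<in> Basis" for b
    using member_le_sum[of b Basis "\<lambda>b. M b \<bullet> b"] that pos tr by (simp add: optrace_def)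
  have entry: "\<bar>M b \<bullet> c\<bar> \<le> 1" if "b \<in> Basis" "c \<in> Basis" for b c
  proof -
    have e: "M c \<bullet> b = M b \<bullet> c" using sym by (metis symop_def inner_commute)
    have "0 \<le> M b \<bullet> b + 2 * (M b \<bullet> c) + M c \<bullet> c"
      using pos[of "b + c"] e by (simp add: blinfun.add_right inner_add_left inner_add_right)
    moreover have "0 \<le> M b \<bullet> b - 2 * (M b \<bullet> c) + M c \<bullet> c"
      using pos[of "b - c"] e by (simp add: blinfun.diff_right inner_diff_left inner_diff_right)
    ultimately show ?thesis using diag[OF that(1)] diag[OF that(2)] by linarith
  qed
  have col: "norm (M b) \<le> DIM('g)" if "b \<in> Basis" for b
  proof -
    have "norm (M b) \<le> (\<Sum>c\<in>Basis. \<bar>M b \<bullet> c\<bar>)" by (rule norm_le_l1)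
    also have "\<dots> \<le> (\<Sum>c\<in>(Basis::'g set). 1)" using entry[OF that] by (intro sum_mono) auto
    finally show ?thesis by simp
  qed
  show ?thesis
  proof (rule norm_blinfun_bound)
    fix x
    have "M x = (\<Sum>b\<in>Basis. (x \<bullet> b) *\<^sub>R M b)"
      by (subst (1) euclidean_representation[of x, symmetric]) (simp only: blinfun.sum_right blinfun.scaleR_right)
    then have "norm (M x) \<le> (\<Sum>b\<in>Basis. norm ((x \<bullet> b) *\<^sub>R M b))" by (simp only: norm_sum)
    also have "\<dots> \<le> (\<Sum>b\<in>(Basis::'g set). norm x * DIM('g))"
      using Basis_le_norm[of _ x] col by (intro sum_mono) (auto intro!: mult_mono)
    finally show "norm (M x) \<le> real DIM('g) * real DIM('g) * norm x" by (simp add: mult_ac)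
  qed simp
qed

end

subsection \<open>Constructibility of conditions on operators\<close>

text \<open>Polynomial dependence of vectors and operators on a parameter, tested on components.
  With the rules below, constructibility proofs simply follow the shape of a first-order
  formula.\<close>

definition polyvec :: "('z::real_normed_vector \<Rightarrow> 'g::euclidean_space) \<Rightarrow> bool" where
  "polyvec f \<longleftrightarrow> (\<forall>c. polyfun (\<lambda>z. f z \<bullet> c))"

definition polyop :: "('z::real_normed_vector \<Rightarrow> 'g::euclidean_space opr) \<Rightarrow> bool" where
  "polyop F \<longleftrightarrow> (\<forall>x c. polyfun (\<lambda>z. F z x \<bullet> c))"

named_theorems poly_rules

lemma polyfun_inner [poly_rules]:
  assumes "polyvec f" "polyvec g" shows "polyfun (\<lambda>z. f z \<bullet> g z)"
  unfolding euclidean_inner[of "f _" "g _"] using assms by (intro polyfun_sum pf_mult) (auto simp: polyvec_def)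

lemma polyvec_apply [poly_rules]:
  assumes F: "polyop F" and f: "polyvec f" shows "polyvec (\<lambda>z. blinfun_apply (F z) (f z))"
  unfolding polyvec_def
proof
  fix c
  have "F z (f z) \<bullet> c = (\<Sum>b\<in>Basis. (f z \<bullet> b) * (F z b \<bullet> c))" for z
  proof -
    have "F z (f z) = F z (\<Sum>b\<in>Basis. (f z \<bullet> b) *\<^sub>R b)" by (simp add: euclidean_representation)
    then show ?thesis by (simp add: blinfun.sum_right blinfun.scaleR_right inner_sum_left)
  qed
  then show "polyfun (\<lambda>z. F z (f z) \<bullet> c)" using F f
    by (simp add: polyvec_def polyop_def polyfun_sum pf_mult)
qed

lemma polyvec_bilinear:
  assumes br: "bounded_bilinear br" and f: "polyvec f" and g: "polyvec g" shows "polyvec (\<lambda>z. br (f z) (g z) :: 'g::euclidean_space)"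
  unfolding polyvec_def
proof
  interpret br: bounded_bilinear br by (rule br)
  fix c
  have "br (f z) (g z) \<bullet> c = (\<Sum>d\<in>Basis. \<Sum>b\<in>Basis. (g z \<bullet> d) * ((f z \<bullet> b) * (br b d \<bullet> c)))" for z
  proof -
    have "br (f z) (g z) = br (\<Sum>b\<in>Basis. (f z \<bullet> b) *\<^sub>R b) (\<Sum>b\<in>Basis. (g z \<bullet> b) *\<^sub>R b)" by (simp add: euclidean_representation)
    then show ?thesis
      by (simp add: br.sum_left br.sum_right br.scaleR_left br.scaleR_right inner_sum_left sum_distrib_left)
  qed
  then show "polyfun (\<lambda>z. br (f z) (g z) \<bullet> c)" using f g
    by (simp add: polyvec_def polyfun_sum pf_mult pf_const)
qed

lemma polyvec_scaleR [poly_rules]: "polyfun a \<Longrightarrow> polyvec f \<Longrightarrow> polyvec (\<lambda>z. a z *\<^sub>R f z)"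
  by (simp add: polyvec_def pf_mult)

lemma polyvec_add [poly_rules]: "polyvec f \<Longrightarrow> polyvec g \<Longrightarrow> polyvec (\<lambda>z. f z + g z)"
  by (simp add: polyvec_def inner_add_left pf_add)

lemma polyvec_diff [poly_rules]: "polyvec f \<Longrightarrow> polyvec g \<Longrightarrow> polyvec (\<lambda>z. f z - g z)"
  by (simp add: polyvec_def inner_diff_left polyfun_diff)

lemma polyvec_const [poly_rules]: "polyvec (\<lambda>z. x)"
  by (simp add: polyvec_def pf_const)

lemma polyvec_linear: "bounded_linear f \<Longrightarrow> polyvec f"
  unfolding polyvec_def by (intro allI pf_lin bounded_linear_compose[OF bounded_linear_inner_left])

lemma polyop_linear: "bounded_linear F \<Longrightarrow> polyop F"
  unfolding polyop_def
  by (intro allI pf_lin bounded_linear_compose[OF bounded_linear_inner_left bounded_linear_compose[OF blinfun.bounded_linear_left]])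

lemma polyfun_optrace [poly_rules]: "polyop F \<Longrightarrow> polyfun (\<lambda>z. optrace (F z))"
  unfolding optrace_def by (intro polyfun_sum) (auto simp: polyop_def)

lemmas poly_leaf = polyvec_linear polyop_linear pf_lin bounded_linear_fst_comp bounded_linear_snd_comp bounded_linear_ident

declare pf_add [poly_rules] pf_mult [poly_rules] pf_const [poly_rules] polyfun_diff [poly_rules]

lemma constructible_vec_eq:
  assumes "polyvec f" "polyvec g" shows "constructible {z. f z = g z}"
proof -
  have "constructible {z. \<forall>b\<in>Basis. f z \<bullet> b = g z \<bullet> b}"
    using assms by (intro constructible_Collect_ball constructible_eq) (auto simp: polyvec_def)
  moreover have "{z. \<forall>b\<in>Basis. f z \<bullet> b = g z \<bullet> b} = {z. f z = g z}" by (auto intro: euclidean_eqI)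
  ultimately show ?thesis by simp
qed

lemma constructible_Collect_all:
  fixes P :: "'a::real_normed_vector \<Rightarrow> 'b::euclidean_space \<Rightarrow> bool"
  assumes "constructible {z. P (fst z) (snd z)}"
  shows "constructible {x. \<forall>y. P x y}"
  using constructible_Collect_not[OF constructible_Collect_ex[of "\<lambda>x y. \<not> P x y", OF constructible_Collect_not[OF assms]]] by simp

lemma constructible_Collect_imp: "constructible {x. P x} \<Longrightarrow> constructible {x. Q x} \<Longrightarrow> constructible {x. P x \<longrightarrow> Q x}"
  unfolding imp_conv_disj by (intro constructible_Collect_disj constructible_Collect_not)

text \<open>Commutation with the possibly infinite group \<open>A\<close> is a linear condition on
  the operator; it is constructible for this reason, although \<open>A\<close> is not assumed
  semialgebraic.\<close>

lemma constructible_subspace: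
  fixes L :: "'g::euclidean_space opr set"
  assumes "subspace L" shows "constructible L"
proof -
  interpret m: bounded_linear "mat_of_op :: 'g opr \<Rightarrow> _" by (rule bounded_linear_mat_of_op)
  have s: "subspace (mat_of_op ` L)" using assms by (intro linear_subspace_image m.linear)
  have "constructible {x. oproj (mat_of_op ` L) x = x}"
    by (intro constructible_vec_eq polyvec_linear bounded_linear_ident blinfun.bounded_linear_right)
  then have "constructible (mat_of_op ` L)" by (simp add: oproj_fixed_iff[OF s])
  from constructible_vimage_linear[OF this bounded_linear_mat_of_op] have "constructible {M. mat_of_op M \<in> mat_of_op ` L}" .
  moreover have "{M. mat_of_op M \<in> mat_of_op ` L} = L" by (auto dest: arg_cong[of _ _ op_of_mat])
  ultimately show ?thesis by simp
qed

lemma constructible_eigen_filtering: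
  assumes br: "bounded_bilinear br"
  shows "constructible {M :: 'g::euclidean_space opr. eigen_filtering br M}"
  unfolding eigen_filtering_def
  by (intro constructible_Collect_all constructible_Collect_imp constructible_vec_eq constructible_less constructible_eq
      poly_rules polyvec_bilinear[OF br] poly_leaf)

context lie_setting
begin

lemma constructible_Brel: "constructible {z. Brel v br A (fst z) (snd z)}"
proof -
  have "subspace {M. \<forall>a\<in>A. M o\<^sub>L a = a o\<^sub>L M}"
    by (auto simp: subspace_def bounded_bilinear.add_left[OF bounded_bilinear_blinfun_compose]
        bounded_bilinear.add_right[OF bounded_bilinear_blinfun_compose] bounded_bilinear.scaleR_left[OF bounded_bilinear_blinfun_compose]
        bounded_bilinear.scaleR_right[OF bounded_bilinear_blinfun_compose] bounded_bilinear.zero_left[OF bounded_bilinear_blinfun_compose]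
        bounded_bilinear.zero_right[OF bounded_bilinear_blinfun_compose])
  from constructible_vimage_linear[OF constructible_subspace[OF this] bounded_linear_snd]
  have A: "constructible {z :: 'g opr \<times> 'g opr. \<forall>a\<in>A. snd z o\<^sub>L a = a o\<^sub>L snd z}" by simp
  have filt: "constructible {z :: 'g opr \<times> 'g opr. eigen_filtering br (snd z)}"
    using constructible_vimage_linear[OF constructible_eigen_filtering[OF br.bounded_bilinear_axioms] bounded_linear_snd] by simp
  show ?thesis
    unfolding Brel_def symop_def
    by (intro constructible_Collect_conj A filt constructible_Collect_all constructible_Collect_imp constructible_Collect_True
        constructible_vec_eq constructible_le constructible_eq poly_rules polyvec_bilinear[OF br.bounded_bilinear_axioms] poly_leaf)
qed

end

subsection \<open>The deformation retraction\<close>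

locale K_setting = lie_setting br h A v
  for br :: "'g::euclidean_space \<Rightarrow> 'g \<Rightarrow> 'g" and h :: "'g set" and A :: "'g opr set" and v :: version +
  fixes K :: "'g set set"
  assumes K_sub: "K \<subseteq> Pset br h A" and K_compact: "compact (oproj ` K)" and K_con: "constructible (oproj ` K)"
    and K_semilat: "upper_semilattice br K"
begin

definition "Ks = K - {UNIV}"
definition "PK = oproj ` Ks"
text \<open>The equation \<open>oproj k o\<^sub>L w = w\<close> says that \<open>k\<close> contains
  the image of \<open>w\<close>, that is, the largest member of the flag which \<open>w\<close>
  remembers.\<close>

definition KK :: "nat \<Rightarrow> 'g opr \<Rightarrow> 'g set set" where
  "KK d w = {k\<in>Ks. d \<le> dim k \<and> oproj k o\<^sub>L w = w}"
definition "Xs W d = {(w, M). w \<in> W \<and> (\<exists>k\<in>KK d w. M \<in> B k)}"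
definition "Ss W d = {(w, s). w \<in> W \<and> s \<in> simp_complex (KK d w)}"

lemma KsP: "k \<in> Ks \<Longrightarrow> k \<in> \<P>" and Ks_sub: "k \<in> Ks \<Longrightarrow> subspace k" and Ks_UNIV: "k \<in> Ks \<Longrightarrow> k \<noteq> UNIV"
  using K_sub P_sub by (auto simp: Ks_def)

lemma Ks_dim: "k \<in> Ks \<Longrightarrow> dim k < DIM('g)"
  using dim_less_iff Ks_sub Ks_UNIV by blast

text \<open>Dimensions are integers, so the whole algebra is isolated in \<open>K\<close>: leaving
  it out is a closed polynomial condition on the trace.\<close>

lemma PK_eq: "PK = oproj ` K \<inter> {P. optrace P \<le> real DIM('g) - 1}"
proof -
  have "k \<noteq> UNIV \<longleftrightarrow> optrace (oproj k) \<le> real DIM('g) - 1" if "k \<in> K" for k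
  proof -
    have s: "subspace k" using P_sub K_sub that by blast
    then show ?thesis using dim_less_iff[OF s] optrace_oproj[OF s] by linarith
  qed
  then show ?thesis unfolding PK_def Ks_def by blast
qed

lemma continuous_on_optrace: "continuous_on S optrace"
  unfolding optrace_def[abs_def] by (intro continuous_intros)

lemma PK_compact: "compact PK"
proof -
  have "closed {P :: 'g opr. optrace P \<le> real DIM('g) - 1}"
    by (intro closed_Collect_le continuous_on_optrace continuous_on_const)
  then show ?thesis unfolding PK_eq using K_compact by (intro compact_Int_closed)
qed

lemma PK_con: "constructible PK"
proof -
  have "constructible {P :: 'g opr. optrace P \<le> real DIM('g) - 1}"
    by (intro constructible_le poly_rules poly_leaf)
  then show ?thesis unfolding PK_eq using K_con by (intro constructible_Int)
qed

lemma compact_Ks: "compact (oproj ` Ks)"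
  using PK_compact by (simp add: PK_def)

lemma Ks_subseq:
  assumes "\<And>n. k n \<in> Ks"
  obtains r m where "strict_mono (r :: nat \<Rightarrow> nat)" "m \<in> Ks" "(\<lambda>n. oproj (k (r n))) \<longlonglongrightarrow> oproj m"
proof -
  have "\<forall>n. oproj (k n) \<in> oproj ` Ks" using assms by blast
  then obtain P r where "P \<in> oproj ` Ks" "strict_mono r" "((\<lambda>n. oproj (k n)) \<circ> r) \<longlonglongrightarrow> P"
    using seq_compactE[OF compact_imp_seq_compact[OF compact_Ks], of "\<lambda>n. oproj (k n)"] by metis
  then show ?thesis using that by (auto simp: o_def)
qed

lemma dim_limit:
  assumes "\<And>n. k n \<in> Ks" "m \<in> Ks" "(\<lambda>n. oproj (k n)) \<longlonglongrightarrow> oproj m" "\<And>n. d \<le> dim (k n)"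
  shows "d \<le> dim m"
proof -
  have "(\<lambda>n. optrace (oproj (k n))) \<longlonglongrightarrow> optrace (oproj m)" by (rule tendsto_optrace[OF assms(3)])
  then have "real d \<le> optrace (oproj m)"
    by (rule LIMSEQ_le_const) (use assms(4) optrace_oproj[OF Ks_sub[OF assms(1)]] in auto)
  then show ?thesis using optrace_oproj[OF Ks_sub[OF assms(2)]] by simp
qed

lemma compose_limit:
  assumes "\<And>n. P n o\<^sub>L w n = w n" "P \<longlonglongrightarrow> P0" "w \<longlonglongrightarrow> w0"
  shows "P0 o\<^sub>L w0 = w0"
proof -
  have "(\<lambda>n. P n o\<^sub>L w n) \<longlonglongrightarrow> (P0 o\<^sub>L w0)"
    by (rule bounded_bilinear.tendsto[OF bounded_bilinear_blinfun_compose assms(2,3)])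
  then show ?thesis using LIMSEQ_unique[OF _ assms(3)] unfolding assms(1) by blast
qed

text \<open>All families consist of operators related to some projection by \<open>Brel\<close>,
  which bounds them uniformly; each application only has to show closedness under sequences.\<close>

lemma closed_pairs_bounded_compact:
  fixes X :: "('g opr \<times> 'g opr) set"
  assumes "compact W" "\<And>w M. (w, M) \<in> X \<Longrightarrow> w \<in> W \<and> (\<exists>P. Brel v br A P M)"
    and "\<And>w M w0 M0. (\<And>n::nat. (w n, M n) \<in> X) \<Longrightarrow> w \<longlonglongrightarrow> w0 \<Longrightarrow> M \<longlonglongrightarrow> M0 \<Longrightarrow> w0 \<in> W \<Longrightarrow> (w0, M0) \<in> X"
  shows "compact X"
proof -
  have sub: "X \<subseteq> W \<times> cball 0 (real DIM('g) * real DIM('g))"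
    using assms(2) Brel_bounded by fastforce
  have "closed X"
    unfolding closed_sequential_limits
  proof (intro allI impI, elim conjE)
    fix z l assume z: "\<forall>n. z n \<in> X" "z \<longlonglongrightarrow> l"
    have l: "(\<lambda>n. fst (z n)) \<longlonglongrightarrow> fst l" "(\<lambda>n. snd (z n)) \<longlonglongrightarrow> snd l" using tendsto_fst[OF z(2)] tendsto_snd[OF z(2)] by auto
    have "\<forall>n. fst (z n) \<in> W" using z(1) assms(2) by (metis prod.collapse)
    then have "fst l \<in> W" using closed_sequentially[OF compact_imp_closed[OF assms(1)] _ l(1)] by simp
    then have "(fst l, snd l) \<in> X" by (intro assms(3)[OF _ l]) (use z(1) in auto)
    then show "l \<in> X" by simp
  qed
  moreover have "compact (W \<times> cball (0::'g opr) (real DIM('g) * real DIM('g)))" using assms(1) by (intro compact_Times compact_cball)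
  ultimately show ?thesis using sub by (metis compact_Int_closed inf.absorb_iff2)
qed

lemma Xs_compact:
  assumes "compact W" shows "compact (Xs W d)"
proof (rule closed_pairs_bounded_compact[OF assms])
  show "w \<in> W \<and> (\<exists>P. Brel v br A P M)" if "(w, M) \<in> Xs W d" for w M
    using that B_iff Ks_sub by (auto simp: Xs_def KK_def)
next
  fix w M w0 M0 assume in_X: "\<And>n::nat. (w n, M n) \<in> Xs W d" and lim: "w \<longlonglongrightarrow> w0" "M \<longlonglongrightarrow> M0" and w0: "w0 \<in> W"
  have "\<forall>n. \<exists>k. k \<in> KK d (w n) \<and> M n \<in> B k" using in_X by (auto simp: Xs_def)
  then obtain k where k: "\<And>n. k n \<in> KK d (w n)" "\<And>n. M n \<in> B (k n)" by metis
  have kK: "k n \<in> Ks" "d \<le> dim (k n)" "oproj (k n) o\<^sub>L w n = w n" for n using k(1)[of n] by (auto simp: KK_def)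
  obtain r m where r: "strict_mono (r :: nat \<Rightarrow> nat)" "m \<in> Ks" "(\<lambda>n. oproj (k (r n))) \<longlonglongrightarrow> oproj m"
    by (rule Ks_subseq[of k, OF kK(1)])
  have lims: "(\<lambda>n. w (r n)) \<longlonglongrightarrow> w0" "(\<lambda>n. M (r n)) \<longlonglongrightarrow> M0"
    using LIMSEQ_subseq_LIMSEQ[OF lim(1) r(1)] LIMSEQ_subseq_LIMSEQ[OF lim(2) r(1)] by (auto simp: o_def)
  have "d \<le> dim m" by (rule dim_limit[OF kK(1) r(2,3) kK(2)])
  moreover have "oproj m o\<^sub>L w0 = w0" by (rule compose_limit[OF kK(3) r(3) lims(1)])
  moreover have "Brel v br A (oproj (k n)) (M n)" for n using k(2)[of n] B_iff[OF Ks_sub[OF kK(1)]] by blast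
  then have "Brel v br A (oproj m) M0" by (intro Brel_limit[OF _ r(3) lims(2)])
  then have "M0 \<in> B m" using B_iff[OF Ks_sub[OF r(2)]] by blast
  ultimately show "(w0, M0) \<in> Xs W d" using w0 r(2) by (auto simp: Xs_def KK_def)
qed

lemma KK_sub: "KK d w \<subseteq> Ks" and KK_P: "KK d w \<subseteq> \<P> - {UNIV}"
  using KsP Ks_UNIV by (auto simp: KK_def)

lemma Ss_sub_Xs: "Ss W d \<subseteq> Xs W d"
  using simp_complex_kernel[OF KK_P] by (fastforce simp: Ss_def Xs_def)

lemma Ss_compact:
  assumes "compact W" shows "compact (Ss W d)"
proof (rule closed_pairs_bounded_compact[OF assms])
  show "w \<in> W \<and> (\<exists>P. Brel v br A P M)" if "(w, M) \<in> Ss W d" for w M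
    using that Ss_sub_Xs B_iff Ks_sub by (fastforce simp: Xs_def KK_def)
next
  fix w s w0 s0 assume in_S: "\<And>n::nat. (w n, s n) \<in> Ss W d" and lim: "w \<longlonglongrightarrow> w0" "s \<longlonglongrightarrow> s0" and w0: "w0 \<in> W"
  have s: "\<And>n. s n \<in> simp_complex (KK d (w n))" using in_S by (auto simp: Ss_def)
  have Ks: "\<And>k. k \<in> Ks \<Longrightarrow> subspace k \<and> k \<noteq> UNIV" using Ks_sub Ks_UNIV by blast
  obtain \<phi> S0 where S0: "strict_mono (\<phi> :: nat \<Rightarrow> nat)" "S0 \<subseteq> Ks" "s0 \<in> simp_complex S0"
    "\<And>k. k \<in> S0 \<Longrightarrow> \<exists>\<kappa>. (\<forall>n. \<kappa> n \<in> KK d (w (\<phi> n))) \<and> (\<lambda>n. oproj (\<kappa> n)) \<longlonglongrightarrow> oproj k"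
    using simp_complex_limitE[OF Ks compact_Ks s KK_sub lim(2)] by blast
  have wl: "(\<lambda>n. w (\<phi> n)) \<longlonglongrightarrow> w0" using LIMSEQ_subseq_LIMSEQ[OF lim(1) S0(1)] by (simp add: o_def)
  have "S0 \<subseteq> KK d w0"
  proof
    fix k assume k: "k \<in> S0"
    then obtain \<kappa> where \<kappa>: "\<And>n. \<kappa> n \<in> KK d (w (\<phi> n))" "(\<lambda>n. oproj (\<kappa> n)) \<longlonglongrightarrow> oproj k" using S0(4) by blast
    have kK: "\<kappa> n \<in> Ks" "d \<le> dim (\<kappa> n)" "oproj (\<kappa> n) o\<^sub>L w (\<phi> n) = w (\<phi> n)" for n using \<kappa>(1)[of n] by (auto simp: KK_def)
    have "k \<in> Ks" using k S0(2) by blast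
    then show "k \<in> KK d w0" using dim_limit[OF kK(1) _ \<kappa>(2) kK(2)] compose_limit[OF kK(3) \<kappa>(2) wl] by (simp add: KK_def)
  qed
  then show "(w0, s0) \<in> Ss W d" using S0(3) w0 simp_complex_mono by (auto simp: Ss_def)
qed

section \<open>Constructibility of the families\<close>

lemma op_fix_iff: "oproj k o\<^sub>L w = w \<longleftrightarrow> (\<forall>x. oproj k (w x) = w x)"
  by (metis blinfun_apply_blinfun_compose blinfun_eqI)

lemma op_fix_mono: "subspace k \<Longrightarrow> subspace l \<Longrightarrow> k \<subseteq> l \<Longrightarrow> oproj k o\<^sub>L w = w \<Longrightarrow> oproj l o\<^sub>L w = w"
  unfolding op_fix_iff by (metis oproj_in oproj_id subsetD)

lemma Xs_con:
  assumes "constructible W" shows "constructible (Xs W d)"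
proof -
  have 1: "constructible {z :: ('g opr \<times> 'g opr). fst z \<in> W}"
    by (rule constructible_vimage_linear[OF assms bounded_linear_fst])
  have 2: "constructible {u :: ('g opr \<times> 'g opr) \<times> 'g opr. snd u \<in> PK}"
    by (rule constructible_vimage_linear[OF PK_con bounded_linear_snd])
  have "bounded_linear (\<lambda>u :: ('g opr \<times> 'g opr) \<times> 'g opr. (snd u, snd (fst u)))"
    by (intro bounded_linear_Pair bounded_linear_snd bounded_linear_snd_comp bounded_linear_fst)
  from constructible_vimage_linear[OF constructible_Brel this]
  have 3: "constructible {u :: ('g opr \<times> 'g opr) \<times> 'g opr. Brel v br A (snd u) (snd (fst u))}" by simp
  have "constructible {z. fst z \<in> W \<and> (\<exists>P. P \<in> PK \<and> real d \<le> optrace P \<and> (\<forall>x. P (fst z x) = fst z x) \<and> Brel v br A P (snd z))}"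
    by (intro constructible_Collect_conj 1 constructible_Collect_ex_op 2 3 constructible_Collect_all constructible_vec_eq
        constructible_le poly_rules poly_leaf)
  moreover have "Xs W d = {z. fst z \<in> W \<and> (\<exists>P. P \<in> PK \<and> real d \<le> optrace P \<and> (\<forall>x. P (fst z x) = fst z x) \<and> Brel v br A P (snd z))}"
  proof -
    have "(\<exists>k\<in>KK d w. M \<in> B k) \<longleftrightarrow> (\<exists>P. P \<in> PK \<and> real d \<le> optrace P \<and> (\<forall>x. P (w x) = w x) \<and> Brel v br A P M)" for w M
    proof -
      have "(\<exists>P. P \<in> PK \<and> real d \<le> optrace P \<and> (\<forall>x. P (w x) = w x) \<and> Brel v br A P M) \<longleftrightarrow>
         (\<exists>k\<in>Ks. real d \<le> optrace (oproj k) \<and> (\<forall>x. oproj k (w x) = w x) \<and> Brel v br A (oproj k) M)"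
        unfolding PK_def by blast
      also have "\<dots> \<longleftrightarrow> (\<exists>k\<in>Ks. d \<le> dim k \<and> oproj k o\<^sub>L w = w \<and> M \<in> B k)"
        using B_iff[OF Ks_sub] optrace_oproj[OF Ks_sub] by (intro bex_cong refl) (simp add: op_fix_iff)
      finally show ?thesis by (auto simp: KK_def)
    qed
    then show ?thesis unfolding Xs_def by auto
  qed
  ultimately show ?thesis by simp
qed

text \<open>A flag above \<open>k\<close> either has \<open>k\<close> as its smallest member or lies
  in the link of \<open>k\<close>, where it counts as a cone point with weight zero at the
  apex.\<close>

lemma cone_iff:
  assumes k: "k \<in> Ks"
  shows "s \<in> simp_complex {l\<in>Ks. k \<subseteq> l} \<longleftrightarrow>
    s = chibar k \<or> (\<exists>t\<in>{0..1}. \<exists>s'\<in>simp_complex {l\<in>Ks. k \<subset> l}. s = (1 - t) *\<^sub>R s' + t *\<^sub>R chibar k)"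
proof
  assume "s \<in> simp_complex {l\<in>Ks. k \<subseteq> l}"
  then obtain l where l: "l \<in> Ks" "k \<subseteq> l"
    "s = chibar l \<or> (\<exists>t\<in>{0..1}. \<exists>s'\<in>simp_complex {m\<in>{l\<in>Ks. k \<subseteq> l}. l \<subset> m}. s = (1 - t) *\<^sub>R s' + t *\<^sub>R chibar l)"
    unfolding simp_complex_rec[of s "{l\<in>Ks. k \<subseteq> l}"] by blast
  show "s = chibar k \<or> (\<exists>t\<in>{0..1}. \<exists>s'\<in>simp_complex {l\<in>Ks. k \<subset> l}. s = (1 - t) *\<^sub>R s' + t *\<^sub>R chibar k)"
  proof (cases "l = k")
    case True
    then have "{m\<in>{l\<in>Ks. k \<subseteq> l}. l \<subset> m} = {l\<in>Ks. k \<subset> l}" by blast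
    then show ?thesis using l(3) True by simp
  next
    case False
    then have "{m\<in>{l\<in>Ks. k \<subseteq> l}. l \<subset> m} = {m\<in>{l\<in>Ks. k \<subset> l}. l \<subset> m}" "l \<in> {l\<in>Ks. k \<subset> l}" using l(1,2) by blast+
    note 1 = this
    have "s \<in> simp_complex {l\<in>Ks. k \<subset> l}" unfolding simp_complex_rec[of s "{l\<in>Ks. k \<subset> l}"]
      by (rule bexI[OF _ 1(2)]) (use l(3)[unfolded 1(1)] in blast)
    then show ?thesis by (intro disjI2 bexI[of _ 0] bexI[of _ s]) auto
  qed
next
  assume 2: "s = chibar k \<or> (\<exists>t\<in>{0..1}. \<exists>s'\<in>simp_complex {l\<in>Ks. k \<subset> l}. s = (1 - t) *\<^sub>R s' + t *\<^sub>R chibar k)"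
  have "{m\<in>{l\<in>Ks. k \<subseteq> l}. k \<subset> m} = {l\<in>Ks. k \<subset> l}" "k \<in> {l\<in>Ks. k \<subseteq> l}" using k by blast+
  note 1 = this
  show "s \<in> simp_complex {l\<in>Ks. k \<subseteq> l}"
    unfolding simp_complex_rec[of s "{l\<in>Ks. k \<subseteq> l}"]
    by (rule bexI[OF _ 1(2)]) (unfold 1(1), rule 2)
qed

lemma simp_complex_min:
  assumes "s \<in> simp_complex S" shows "\<exists>l\<in>S. s \<in> simp_complex {k\<in>S. l \<subseteq> k}"
proof -
  obtain c where c: "is_chain c" "c \<subseteq> S" "s \<in> convex hull (chibar ` c)" using assms simp_complex_iff by blast
  obtain l where l: "l \<in> c" "\<forall>k\<in>c. l \<subseteq> k" using chain_has_min[OF c(1)] by blast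
  then have "c \<subseteq> {k\<in>S. l \<subseteq> k}" using c(2) by blast
  then show ?thesis using l(1) c simp_complex_iff by blast
qed

lemma Ks_psubset_iff:
  assumes "k \<in> Ks" "dim k = d" "l \<in> Ks"
  shows "k \<subset> l \<longleftrightarrow> Suc d \<le> dim l \<and> k \<subseteq> l"
proof
  assume kl: "k \<subset> l"
  then have "\<not> dim l \<le> dim k" using subspace_dim_equal[OF Ks_sub[OF assms(1)] Ks_sub[OF assms(3)]] by blast
  then show "Suc d \<le> dim l \<and> k \<subseteq> l" using kl assms(2) by auto
qed (use assms(2) in auto)

text \<open>With the projection onto \<open>k\<close> as parameter, the next level is the link of
  \<open>k\<close>; so the statement on families covers the links too.\<close>

lemma KK_oproj:
  assumes "k \<in> Ks" "dim k = d" shows "KK (Suc d) (oproj k) = {l\<in>Ks. k \<subset> l}"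
  unfolding KK_def using oproj_compose_iff[OF Ks_sub Ks_sub[OF assms(1)]] Ks_psubset_iff[OF assms] by blast

definition "Cn d = {(P, s). \<exists>k\<in>Ks. dim k = d \<and> P = oproj k \<and> s \<in> simp_complex {l\<in>Ks. k \<subseteq> l}}"

text \<open>The dimension is fixed to \<open>d\<close>, so the normalising factor of
  \<open>chibar k\<close> is a constant \<open>\<alpha>\<close>, and the cone over the link is given
  by a formula in the projection.\<close>

lemma Cn_con:
  assumes S: "constructible {z. snd z \<in> simp_complex (KK (Suc d) (fst z))}"
  shows "constructible (Cn d)"
proof -
  define \<alpha> where "\<alpha> = 1 / real (DIM('g) - d)"
  have chi: "chibar k = \<alpha> *\<^sub>R (id_blinfun - oproj k)" if "dim k = d" for k :: "'g set" by (simp add: chibar_def that \<alpha>_def)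
  have 1: "constructible {z :: 'g opr \<times> 'g opr. fst z \<in> PK}"
    by (rule constructible_vimage_linear[OF PK_con bounded_linear_fst])
  have "bounded_linear (\<lambda>u :: (('g opr \<times> 'g opr) \<times> real) \<times> 'g opr. (fst (fst (fst u)), snd u))"
    by (intro bounded_linear_Pair bounded_linear_snd bounded_linear_fst_comp bounded_linear_fst)
  from constructible_vimage_linear[OF S this]
  have 2: "constructible {u :: (('g opr \<times> 'g opr) \<times> real) \<times> 'g opr. snd u \<in> simp_complex (KK (Suc d) (fst (fst (fst u))))}" by simp
  have "constructible {z :: 'g opr \<times> 'g opr. fst z \<in> PK \<and> optrace (fst z) = real d \<and> ((\<forall>x. blinfun_apply (snd z) x = \<alpha> *\<^sub>R (x - blinfun_apply (fst z) x)) \<or>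
     (\<exists>t s'. 0 \<le> t \<and> t \<le> 1 \<and> s' \<in> simp_complex (KK (Suc d) (fst z)) \<and>
        (\<forall>x. blinfun_apply (snd z) x = (1 - t) *\<^sub>R s' x + t *\<^sub>R (\<alpha> *\<^sub>R (x - blinfun_apply (fst z) x)))))}"
    by (intro constructible_Collect_conj constructible_Collect_disj 1 constructible_Collect_ex_op constructible_Collect_ex 2
        constructible_Collect_all constructible_vec_eq constructible_le constructible_eq poly_rules poly_leaf)
  moreover have "Cn d = {z :: 'g opr \<times> 'g opr. fst z \<in> PK \<and> optrace (fst z) = real d \<and> ((\<forall>x. blinfun_apply (snd z) x = \<alpha> *\<^sub>R (x - blinfun_apply (fst z) x)) \<or>
     (\<exists>t s'. 0 \<le> t \<and> t \<le> 1 \<and> s' \<in> simp_complex (KK (Suc d) (fst z)) \<and>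
        (\<forall>x. blinfun_apply (snd z) x = (1 - t) *\<^sub>R s' x + t *\<^sub>R (\<alpha> *\<^sub>R (x - blinfun_apply (fst z) x)))))}" (is "_ = ?R")
  proof -
    have key: "s \<in> simp_complex {l\<in>Ks. k \<subseteq> l} \<longleftrightarrow> (\<forall>x. s x = \<alpha> *\<^sub>R (x - oproj k x)) \<or>
      (\<exists>t s'. 0 \<le> t \<and> t \<le> 1 \<and> s' \<in> simp_complex (KK (Suc d) (oproj k)) \<and>
        (\<forall>x. s x = (1 - t) *\<^sub>R s' x + t *\<^sub>R (\<alpha> *\<^sub>R (x - oproj k x))))" if k: "k \<in> Ks" "dim k = d" for k s
    proof -
      have a: "(s = chibar k) \<longleftrightarrow> (\<forall>x. s x = \<alpha> *\<^sub>R (x - oproj k x))"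
        by (auto simp: chi[OF k(2)] blinfun.scaleR_left blinfun.diff_left intro!: blinfun_eqI)
      have b: "(s = (1 - t) *\<^sub>R s' + t *\<^sub>R chibar k) \<longleftrightarrow> (\<forall>x. s x = (1 - t) *\<^sub>R s' x + t *\<^sub>R (\<alpha> *\<^sub>R (x - oproj k x)))" for t s'
        by (auto simp: chi[OF k(2)] blinfun.scaleR_left blinfun.diff_left blinfun.add_left intro!: blinfun_eqI)
      show ?thesis unfolding cone_iff[OF k(1)] a b KK_oproj[OF k] Bex_def atLeastAtMost_iff by blast
    qed
    have mem: "P \<in> PK \<and> optrace P = real d \<longleftrightarrow> (\<exists>k\<in>Ks. dim k = d \<and> P = oproj k)" for P
      using optrace_oproj[OF Ks_sub] unfolding PK_def by fastforce
    define Q where "Q P s \<longleftrightarrow> (\<forall>x. s x = \<alpha> *\<^sub>R (x - blinfun_apply P x)) \<or>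
      (\<exists>t s'. 0 \<le> t \<and> t \<le> 1 \<and> s' \<in> simp_complex (KK (Suc d) P) \<and>
        (\<forall>x. s x = (1 - t) *\<^sub>R blinfun_apply s' x + t *\<^sub>R (\<alpha> *\<^sub>R (x - blinfun_apply P x))))" for P and s :: "'g opr"
    have "?R = {z. (fst z \<in> PK \<and> optrace (fst z) = real d) \<and> Q (fst z) (snd z)}"
      unfolding Q_def conj_assoc ..
    also have "\<dots> = Cn d"
    proof -
      have key': "s \<in> simp_complex {l\<in>Ks. k \<subseteq> l} \<longleftrightarrow> Q (oproj k) s" if "k \<in> Ks" "dim k = d" for k s
        unfolding Q_def by (rule key[OF that])
      have "(\<exists>k\<in>Ks. dim k = d \<and> P = oproj k) \<and> Q P s \<longleftrightarrow> (\<exists>k\<in>Ks. dim k = d \<and> P = oproj k \<and> s \<in> simp_complex {l\<in>Ks. k \<subseteq> l})" for P s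
        using key' by (metis (no_types, lifting))
      then show ?thesis unfolding mem Cn_def by auto
    qed
    finally show ?thesis by (rule sym)
  qed
  ultimately show ?thesis by simp
qed

lemma KK_cone_sub:
  assumes "k \<in> Ks" "oproj k o\<^sub>L w = w" "dim k = d" shows "{l\<in>Ks. k \<subseteq> l} \<subseteq> KK d w"
proof
  fix l assume l: "l \<in> {l\<in>Ks. k \<subseteq> l}"
  then have "oproj l o\<^sub>L w = w" using op_fix_mono[OF Ks_sub Ks_sub _ assms(2)] assms(1) by blast
  moreover have "dim k \<le> dim l" using l by (intro dim_subset) auto
  ultimately show "l \<in> KK d w" using l assms(3) by (simp add: KK_def)
qed

text \<open>The smallest flag member either has dimension \<open>d\<close>, and the point lies in
  the cone belonging to it, or it has larger dimension and so has the whole flag.\<close>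

lemma simp_complex_KK_step:
  "s \<in> simp_complex (KK d w) \<longleftrightarrow> s \<in> simp_complex (KK (Suc d) w) \<or> (\<exists>k\<in>Ks. dim k = d \<and> oproj k o\<^sub>L w = w \<and> s \<in> simp_complex {l\<in>Ks. k \<subseteq> l})"
proof
  assume "s \<in> simp_complex (KK d w)"
  then obtain l where l: "l \<in> KK d w" "s \<in> simp_complex {k\<in>KK d w. l \<subseteq> k}" using simp_complex_min by blast
  show "s \<in> simp_complex (KK (Suc d) w) \<or> (\<exists>k\<in>Ks. dim k = d \<and> oproj k o\<^sub>L w = w \<and> s \<in> simp_complex {l\<in>Ks. k \<subseteq> l})"
  proof (cases "dim l = d")
    case True
    have "{k\<in>KK d w. l \<subseteq> k} \<subseteq> {k\<in>Ks. l \<subseteq> k}" by (auto simp: KK_def)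
    then have "s \<in> simp_complex {k\<in>Ks. l \<subseteq> k}" using l(2) simp_complex_mono by blast
    then show ?thesis using l(1) True by (auto simp: KK_def)
  next
    case False
    then have "Suc d \<le> dim l" using l(1) by (auto simp: KK_def)
    have "{k\<in>KK d w. l \<subseteq> k} \<subseteq> KK (Suc d) w"
    proof
      fix k assume k: "k \<in> {k\<in>KK d w. l \<subseteq> k}"
      then have "dim l \<le> dim k" by (intro dim_subset) auto
      then show "k \<in> KK (Suc d) w" using k \<open>Suc d \<le> dim l\<close> by (simp add: KK_def)
    qed
    then show ?thesis using l(2) simp_complex_mono by blast
  qed
next
  have "KK (Suc d) w \<subseteq> KK d w" by (auto simp: KK_def)
  assume "s \<in> simp_complex (KK (Suc d) w) \<or> (\<exists>k\<in>Ks. dim k = d \<and> oproj k o\<^sub>L w = w \<and> s \<in> simp_complex {l\<in>Ks. k \<subseteq> l})"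
  then consider "s \<in> simp_complex (KK (Suc d) w)"
    | k where "k \<in> Ks" "dim k = d" "oproj k o\<^sub>L w = w" "s \<in> simp_complex {l\<in>Ks. k \<subseteq> l}" by blast
  then show "s \<in> simp_complex (KK d w)"
  proof cases
    case 1 then show ?thesis using simp_complex_mono[OF \<open>KK (Suc d) w \<subseteq> KK d w\<close>] by blast
  next
    case 2 then show ?thesis using simp_complex_mono[OF KK_cone_sub[OF 2(1,3,2)]] by blast
  qed
qed

text \<open>Downward induction, starting above the dimensions of all proper subalgebras: the cones
  of members of dimension \<open>d\<close> are defined from the complexes of level
  \<open>Suc d\<close>. This avoids a quantifier over flags.\<close>

lemma Shat_con: "d \<le> DIM('g) \<Longrightarrow> constructible {z. snd z \<in> simp_complex (KK d (fst z))}"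
proof (induction rule: inc_induct)
  case base
  have "KK DIM('g) w = {}" for w using Ks_dim by (fastforce simp: KK_def)
  then show ?case using constructible_Collect_True[of False] simp_complex_empty by simp
next
  case (step d)
  have "bounded_linear (\<lambda>u :: ('g opr \<times> 'g opr) \<times> 'g opr. (snd u, snd (fst u)))"
    by (intro bounded_linear_Pair bounded_linear_snd bounded_linear_snd_comp bounded_linear_fst)
  from constructible_vimage_linear[OF Cn_con[OF step.IH] this]
  have 1: "constructible {u :: ('g opr \<times> 'g opr) \<times> 'g opr. (snd u, snd (fst u)) \<in> Cn d}" .
  have "constructible {z. snd z \<in> simp_complex (KK (Suc d) (fst z)) \<or> (\<exists>P. (P, snd z) \<in> Cn d \<and> (\<forall>x. P (blinfun_apply (fst z) x) = blinfun_apply (fst z) x))}"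
    by (intro constructible_Collect_disj step.IH constructible_Collect_ex_op constructible_Collect_conj 1 constructible_Collect_all
        constructible_vec_eq poly_rules poly_leaf)
  moreover have "(\<exists>P. (P, s) \<in> Cn d \<and> (\<forall>x. P (w x) = w x)) \<longleftrightarrow> (\<exists>k\<in>Ks. dim k = d \<and> oproj k o\<^sub>L w = w \<and> s \<in> simp_complex {l\<in>Ks. k \<subseteq> l})" for s and w :: "'g opr"
    unfolding Cn_def op_fix_iff by auto
  ultimately show ?case by (subst simp_complex_KK_step) simp
qed

end

section \<open>Parameters that remember a flag\<close>

context K_setting
begin

definition good :: "'g opr set \<Rightarrow> bool" where
  "good W \<longleftrightarrow> compact W \<and> constructible W \<and> (\<forall>w\<in>W. symop w \<and> (\<forall>x. 0 \<le> w x \<bullet> x))"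

definition Rs :: "'g opr set \<Rightarrow> nat \<Rightarrow> ('g opr \<times> 'g opr) set" where
  "Rs W d = {(w, P). w \<in> W \<and> P \<in> PK \<and> optrace P = real d \<and> P o\<^sub>L w = w}"

text \<open>The parameters with one more flag member. Storing the sum \<open>w + P\<close> rather
  than the pair keeps the base a set of operators, so the induction hypothesis applies to it as it
  stands.\<close>

definition ext :: "'g opr set \<Rightarrow> nat \<Rightarrow> 'g opr set" where
  "ext W d = (\<lambda>z. fst z + snd z) ` Rs W d"

text \<open>For \<open>w' = w + P\<close> with \<open>w \<ge> 0\<close> and \<open>P w = w\<close>, the projection \<open>P\<close> is recovered as the one onto the orthogonal complement of the kernel of \<open>w'\<close>.\<close>

definition kd :: "'g opr \<Rightarrow> 'g set" where
  "kd w = {x. \<forall>y. w y = 0 \<longrightarrow> x \<bullet> y = 0}"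

text \<open>For nonnegative operators the kernel of a sum is the intersection of the kernels, and
  \<open>w\<close> kills the kernel of the projection because it is symmetric with image in
  \<open>k\<close>.\<close>

lemma kd_eq:
  assumes w: "symop w" "\<And>x. 0 \<le> w x \<bullet> x" and k: "subspace k" and fix_w: "oproj k o\<^sub>L w = w"
  shows "kd (w + oproj k) = k"
proof -
  have sP: "oproj k x \<bullet> y = x \<bullet> oproj k y" for x y using symop_oproj[OF k] by (simp add: symop_def)
  have ker: "(w + oproj k) y = 0 \<longleftrightarrow> oproj k y = 0" for y
  proof
    assume "(w + oproj k) y = 0"
    then have "w y \<bullet> y + oproj k y \<bullet> y = 0" by (simp add: blinfun.add_left flip: inner_add_left)
    then have "oproj k y \<bullet> oproj k y \<le> 0" using w(2)[of y] oproj_inner[OF k, of y y] by linarith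
    then show "oproj k y = 0" using inner_ge_zero[of "oproj k y"] inner_eq_zero_iff[of "oproj k y"] by linarith
  next
    assume P: "oproj k y = 0"
    have "w y \<bullet> z = 0" for z
    proof -
      have "w y \<bullet> z = y \<bullet> w z" using w(1) by (simp add: symop_def)
      also have "\<dots> = y \<bullet> oproj k (w z)" using fix_w by (simp add: op_fix_iff)
      also have "\<dots> = 0" using sP[of y "w z"] P by simp
      finally show ?thesis .
    qed
    then have "w y = 0" using inner_eq_zero_iff by blast
    then show "(w + oproj k) y = 0" using P by (simp add: blinfun.add_left)
  qed
  show ?thesis
  proof (intro set_eqI iffI)
    fix x assume "x \<in> k"
    then have "x \<bullet> y = 0" if "oproj k y = 0" for y using sP[of x y] oproj_id[OF k] that by simp
    then show "x \<in> kd (w + oproj k)" unfolding kd_def ker by blast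
  next
    fix x assume x: "x \<in> kd (w + oproj k)"
    have "oproj k (x - oproj k x) = 0" using oproj_id[OF k oproj_in[OF k]] by (simp add: blinfun.diff_right)
    then have "x \<bullet> (x - oproj k x) = 0" using x unfolding kd_def ker by blast
    moreover have "(x - oproj k x) \<bullet> oproj k x = 0" by (rule oproj_orth[OF k oproj_in[OF k]])
    ultimately have "(x - oproj k x) \<bullet> (x - oproj k x) = 0" by (simp add: inner_diff_left inner_diff_right inner_commute[of "oproj k x" x])
    then have "x = oproj k x" by simp
    then show "x \<in> k" using oproj_in[OF k] by metis
  qed
qed

lemma Rs_iff: "(w, P) \<in> Rs W d \<longleftrightarrow> (\<exists>k\<in>Ks. P = oproj k \<and> dim k = d \<and> w \<in> W \<and> oproj k o\<^sub>L w = w)"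
proof -
  have "P \<in> PK \<and> optrace P = real d \<longleftrightarrow> (\<exists>k\<in>Ks. dim k = d \<and> P = oproj k)"
    using optrace_oproj[OF Ks_sub] unfolding PK_def by fastforce
  then show ?thesis unfolding Rs_def by auto
qed

lemma extE:
  assumes "good W" "u \<in> ext W d"
  obtains w k where "w \<in> W" "k \<in> Ks" "dim k = d" "oproj k o\<^sub>L w = w" "u = w + oproj k" "kd u = k"
proof -
  obtain w P where wP: "(w, P) \<in> Rs W d" "u = w + P" using assms(2) by (auto simp: ext_def)
  then obtain k where k: "k \<in> Ks" "P = oproj k" "dim k = d" "w \<in> W" "oproj k o\<^sub>L w = w" using Rs_iff by blast
  moreover have "kd u = k" using kd_eq[OF _ _ Ks_sub[OF k(1)] k(5)] k(2,4) wP(2) assms(1) by (simp add: good_def)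
  ultimately show ?thesis using wP(2) that by blast
qed

lemma extI:
  assumes "w \<in> W" "k \<in> Ks" "dim k = d" "oproj k o\<^sub>L w = w" shows "w + oproj k \<in> ext W d"
proof -
  have "(w, oproj k) \<in> Rs W d" using assms Rs_iff by blast
  then show ?thesis unfolding ext_def by force
qed

lemma ext_kd:
  assumes "good W" "u \<in> ext W d" shows "kd u \<in> Ks" "dim (kd u) = d"
  using extE[OF assms] by metis+

lemma symop_add: "symop a \<Longrightarrow> symop b \<Longrightarrow> symop (a + b)"
  by (simp add: symop_def blinfun.add_left inner_add_left inner_add_right)

lemma ext_sym:
  assumes "good W" "u \<in> ext W d" shows "symop u \<and> (\<forall>x. 0 \<le> u x \<bullet> x)"
proof -
  obtain w k where w: "w \<in> W" "k \<in> Ks" "u = w + oproj k" using extE[OF assms] by metis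
  have s: "subspace k" by (rule Ks_sub[OF w(2)])
  have "0 \<le> oproj k x \<bullet> x" for x using oproj_inner[OF s, of x x] by simp
  then show ?thesis using w(1,3) assms(1) symop_add[OF _ symop_oproj[OF s]] by (simp add: good_def blinfun.add_left inner_add_left)
qed

text \<open>\<open>kd u\<close> is the image of \<open>u\<close>, so containing the remembered flag
  reduces to containing its last member.\<close>

lemma ext_fix:
  assumes W: "good W" "u \<in> ext W d" and l: "subspace l"
  shows "oproj l o\<^sub>L u = u \<longleftrightarrow> kd u \<subseteq> l"
proof
  obtain w k where w: "w \<in> W" "k \<in> Ks" "dim k = d" "oproj k o\<^sub>L w = w" "u = w + oproj k" "kd u = k" by (rule extE[OF W])
  note k = Ks_sub[OF w(2)]
  assume "kd u \<subseteq> l"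
  then have "k \<subseteq> l" using w(6) by simp
  then have "oproj l o\<^sub>L w = w" "oproj l o\<^sub>L oproj k = oproj k" using op_fix_mono[OF k l _ w(4)] oproj_compose_iff[OF l k] by auto
  then show "oproj l o\<^sub>L u = u" unfolding w(5) by (simp add: bounded_bilinear.add_right[OF bounded_bilinear_blinfun_compose])
next
  assume f: "oproj l o\<^sub>L u = u"
  have s: "u x \<bullet> y = x \<bullet> u y" for x y using ext_sym[OF W] by (simp add: symop_def)
  have ul: "u z \<in> l" for z using f oproj_in[OF l] by (metis op_fix_iff)
  show "kd u \<subseteq> l"
  proof
    fix x assume x: "x \<in> kd u"
    define y where "y = x - oproj l x"
    have y: "y \<bullet> z = 0" if "z \<in> l" for z unfolding y_def by (rule oproj_orth[OF l that])
    have "u y \<bullet> u y = 0" using s[of y "u y"] y[OF ul] by simp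
    then have "u y = 0" by simp
    then have "x \<bullet> y = 0" using x by (simp add: kd_def)
    moreover have "y \<bullet> oproj l x = 0" by (rule y[OF oproj_in[OF l]])
    ultimately have "y \<bullet> y = 0" unfolding y_def[unfolded atomize_eq] by (simp add: inner_diff_left inner_diff_right inner_commute[of "oproj l x" x])
    then have "x = oproj l x" by (simp add: y_def)
    then show "x \<in> l" using oproj_in[OF l] by metis
  qed
qed

text \<open>By this identity the induction hypothesis for the base \<open>ext W d\<close> retracts
  the links of all members of dimension \<open>d\<close> at once.\<close>

lemma KK_ext:
  assumes "good W" "u \<in> ext W d" shows "KK (Suc d) u = {l\<in>Ks. kd u \<subset> l}"
  unfolding KK_def using ext_fix[OF assms Ks_sub] Ks_psubset_iff[OF ext_kd[OF assms]] by blast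

lemma Rs_compact:
  assumes "compact W" shows "compact (Rs W d)"
proof -
  have "Rs W d = (W \<times> PK) \<inter> ({z. optrace (snd z) = real d} \<inter> {z. snd z o\<^sub>L fst z = fst z})" by (auto simp: Rs_def)
  moreover have "closed {z :: 'g opr \<times> 'g opr. optrace (snd z) = real d}" unfolding optrace_def
    by (intro closed_Collect_eq continuous_intros)
  moreover have "closed {z :: 'g opr \<times> 'g opr. snd z o\<^sub>L fst z = fst z}"
    by (intro closed_Collect_eq bounded_bilinear.continuous_on[OF bounded_bilinear_blinfun_compose] continuous_intros)
  ultimately show ?thesis using compact_Int_closed[OF compact_Times[OF assms PK_compact] closed_Int] by simp
qed

lemma ext_compact: "compact W \<Longrightarrow> compact (ext W d)"
  unfolding ext_def by (intro compact_continuous_image Rs_compact continuous_intros)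

lemma ext_iff: "u \<in> ext W d \<longleftrightarrow> (\<exists>P. P \<in> PK \<and> optrace P = real d \<and> u - P \<in> W \<and> (\<forall>x. P ((u - P) x) = (u - P) x))"
proof -
  have "u \<in> ext W d \<longleftrightarrow> (\<exists>P. (u - P, P) \<in> Rs W d)"   proof
    assume "u \<in> ext W d"
    then obtain z where z: "z \<in> Rs W d" "u = fst z + snd z" by (auto simp: ext_def)
    then have "(u - snd z, snd z) \<in> Rs W d" by simp
    then show "\<exists>P. (u - P, P) \<in> Rs W d" ..
  next
    assume "\<exists>P. (u - P, P) \<in> Rs W d"
    then obtain P where R: "(u - P, P) \<in> Rs W d" ..
    show "u \<in> ext W d" unfolding ext_def by (rule image_eqI[OF _ R]) simp
  qed
  also have "\<dots> \<longleftrightarrow> (\<exists>P. u - P \<in> W \<and> P \<in> PK \<and> optrace P = real d \<and> P o\<^sub>L (u - P) = u - P)" by (simp add: Rs_def)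
  finally show ?thesis by (metis blinfun_apply_blinfun_compose blinfun_eqI)
qed

lemma ext_con:
  assumes "constructible W" shows "constructible (ext W d)"
proof -
  have 2: "constructible {u :: 'g opr \<times> 'g opr. snd u \<in> PK}"
    by (rule constructible_vimage_linear[OF PK_con bounded_linear_snd])
  have 3: "constructible {u :: 'g opr \<times> 'g opr. fst u - snd u \<in> W}"
    by (rule constructible_vimage_linear[OF assms]) (intro bounded_linear_sub bounded_linear_fst bounded_linear_snd)
  have "constructible {u. \<exists>P. P \<in> PK \<and> optrace P = real d \<and> u - P \<in> W \<and> (\<forall>x. P ((u - P) x) = (u - P) x)}"
    by (intro constructible_Collect_conj constructible_Collect_ex_op 2 3 constructible_Collect_all constructible_vec_eq
        constructible_eq poly_rules poly_leaf bounded_linear_sub)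
  then show ?thesis by (simp add: ext_iff[symmetric])
qed

lemma good_ext: "good W \<Longrightarrow> good (ext W d)"
  using ext_compact[of W d] ext_con[of W d] ext_sym[of W _ d] by (simp add: good_def)

text \<open>The second component is continuous on the compact set \<open>Rs W d\<close> and depends
  only on the sum, so it is continuous in the sum.\<close>

lemma kd_continuous:
  assumes "good W" shows "continuous_on (ext W d) (\<lambda>u. oproj (kd u))"
  unfolding ext_def
proof (rule continuous_on_quotient)
  show "compact (Rs W d)" using assms Rs_compact by (simp add: good_def)
  show "continuous_on (Rs W d) (\<lambda>z. fst z + snd z)" by (intro continuous_intros)
  have "oproj (kd (fst z + snd z)) = snd z" if z: "z \<in> Rs W d" for z
  proof -
    obtain k where k: "k \<in> Ks" "snd z = oproj k" "fst z \<in> W" "oproj k o\<^sub>L fst z = fst z"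
      using Rs_iff[of "fst z" "snd z" W d] z by auto
    then show ?thesis using kd_eq[OF _ _ Ks_sub[OF k(1)] k(4)] assms by (simp add: good_def)
  qed
  then show "continuous_on (Rs W d) (\<lambda>z. oproj (kd (fst z + snd z)))"
    by (subst continuous_on_cong[OF refl, of _ _ snd]) (auto intro: continuous_intros)
qed

text \<open>The bundle with fibre \<open>B (kd u)\<close> over \<open>u\<close>, while
  \<open>Ts\<close> consists of the simplicial cones in it. Keeping \<open>u\<close> separates the
  occurrences of an operator over several members of the same dimension.\<close>

definition Es :: "'g opr set \<Rightarrow> nat \<Rightarrow> ('g opr \<times> 'g opr) set" where
  "Es W d = {(u, M). u \<in> ext W d \<and> M \<in> B (kd u)}"

definition Ts :: "'g opr set \<Rightarrow> nat \<Rightarrow> ('g opr \<times> 'g opr) set" where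
  "Ts W d = {(u, s). u \<in> ext W d \<and> s \<in> simp_complex {l\<in>Ks. kd u \<subseteq> l}}"

lemma kd_tendsto:
  assumes "good W" "\<And>n::nat. w n \<in> ext W d" "w0 \<in> ext W d" "w \<longlonglongrightarrow> w0"
  shows "(\<lambda>n. oproj (kd (w n))) \<longlonglongrightarrow> oproj (kd w0)"
  using kd_continuous[OF assms(1), of d] assms(2,3,4) unfolding continuous_on_sequentially by (auto simp: o_def)

lemma Ts_sub_Es:
  assumes W: "good W" shows "Ts W d \<subseteq> Es W d"
proof (clarsimp simp: Ts_def Es_def)
  fix u s assume u: "u \<in> ext W d" and s: "s \<in> simp_complex {l\<in>Ks. kd u \<subseteq> l}"
  have "{l\<in>Ks. kd u \<subseteq> l} \<subseteq> \<P> - {UNIV}" using KsP Ks_UNIV by blast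
  from simp_complex_kernel[OF this s] obtain l where "l \<in> Ks" "kd u \<subseteq> l" "s \<in> B l" by blast
  then show "s \<in> B (kd u)" using B_antimono[OF Ks_sub[OF ext_kd(1)[OF W u]] Ks_sub] by blast
qed

lemma Es_compact:
  assumes W: "good W" shows "compact (Es W d)"
proof (rule closed_pairs_bounded_compact[of "ext W d"])
  show "compact (ext W d)" using W ext_compact by (simp add: good_def)
  show "w \<in> ext W d \<and> (\<exists>P. Brel v br A P M)" if "(w, M) \<in> Es W d" for w M
    using that B_iff[OF Ks_sub[OF ext_kd(1)[OF W]]] by (auto simp: Es_def)
next
  fix w M w0 M0 assume in_E: "\<And>n::nat. (w n, M n) \<in> Es W d" and lim: "w \<longlonglongrightarrow> w0" "M \<longlonglongrightarrow> M0" and w0: "w0 \<in> ext W d"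
  have w: "w n \<in> ext W d" "M n \<in> B (kd (w n))" for n using in_E[of n] by (auto simp: Es_def)
  have "Brel v br A (oproj (kd (w n))) (M n)" for n using B_iff[OF Ks_sub[OF ext_kd(1)[OF W w(1)]]] w(2) by blast
  from Brel_limit[OF this kd_tendsto[OF W w(1) w0 lim(1)] lim(2)]
  have "M0 \<in> B (kd w0)" using B_iff[OF Ks_sub[OF ext_kd(1)[OF W w0]]] by blast
  then show "(w0, M0) \<in> Es W d" using w0 by (simp add: Es_def)
qed

lemma Ts_compact:
  assumes W: "good W" shows "compact (Ts W d)"
proof (rule closed_pairs_bounded_compact[of "ext W d"])
  show "compact (ext W d)" using W ext_compact by (simp add: good_def)
  show "w \<in> ext W d \<and> (\<exists>P. Brel v br A P M)" if "(w, M) \<in> Ts W d" for w M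
  proof -
    have "(w, M) \<in> Es W d" using that Ts_sub_Es[OF W] by blast
    then show ?thesis using B_iff[OF Ks_sub[OF ext_kd(1)[OF W]]] by (auto simp: Es_def)
  qed
next
  fix w s w0 s0 assume in_T: "\<And>n::nat. (w n, s n) \<in> Ts W d" and lim: "w \<longlonglongrightarrow> w0" "s \<longlonglongrightarrow> s0" and w0: "w0 \<in> ext W d"
  have w: "\<And>n. w n \<in> ext W d" and s: "\<And>n. s n \<in> simp_complex {l\<in>Ks. kd (w n) \<subseteq> l}" using in_T by (auto simp: Ts_def)
  have Ks: "\<And>k. k \<in> Ks \<Longrightarrow> subspace k \<and> k \<noteq> UNIV" using Ks_sub Ks_UNIV by blast
  obtain \<phi> S0 where S0: "strict_mono (\<phi> :: nat \<Rightarrow> nat)" "S0 \<subseteq> Ks" "s0 \<in> simp_complex S0"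
    "\<And>k. k \<in> S0 \<Longrightarrow> \<exists>\<kappa>. (\<forall>n. \<kappa> n \<in> {l\<in>Ks. kd (w (\<phi> n)) \<subseteq> l}) \<and> (\<lambda>n. oproj (\<kappa> n)) \<longlonglongrightarrow> oproj k"
    by (rule simp_complex_limitE[OF Ks compact_Ks s _ lim(2)]) auto
  have kl: "(\<lambda>n. oproj (kd (w (\<phi> n)))) \<longlonglongrightarrow> oproj (kd w0)"
    using LIMSEQ_subseq_LIMSEQ[OF kd_tendsto[OF W w w0 lim(1)] S0(1)] by (simp add: o_def)
  have "S0 \<subseteq> {l\<in>Ks. kd w0 \<subseteq> l}"
  proof
    fix k assume k: "k \<in> S0"
    then obtain \<kappa> where \<kappa>: "\<And>n. \<kappa> n \<in> {l\<in>Ks. kd (w (\<phi> n)) \<subseteq> l}" "(\<lambda>n. oproj (\<kappa> n)) \<longlonglongrightarrow> oproj k" using S0(4) by blast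
    have kK: "k \<in> Ks" using k S0(2) by blast
    have "\<And>n. subspace (\<kappa> n)" "\<And>n. kd (w (\<phi> n)) \<subseteq> \<kappa> n" using \<kappa>(1) Ks_sub by auto
    from limit_subset[OF this(1) Ks_sub[OF ext_kd(1)[OF W w]] Ks_sub[OF kK] Ks_sub[OF ext_kd(1)[OF W w0]] this(2) \<kappa>(2) kl]
    show "k \<in> {l\<in>Ks. kd w0 \<subseteq> l}" using kK by blast
  qed
  from subsetD[OF simp_complex_mono[OF this] S0(3)] show "(w0, s0) \<in> Ts W d" using w0 by (simp add: Ts_def)
qed

text \<open>The graph of the passage from \<open>u\<close> to \<open>oproj (kd u)\<close>, expressed
  by \<open>Rs\<close>; in this form the fibres over \<open>ext W d\<close> enter first-order
  formulas.\<close>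

lemma Rs_kd:
  assumes W: "good W" shows "(u - P, P) \<in> Rs W d \<longleftrightarrow> u \<in> ext W d \<and> P = oproj (kd u)"
proof
  assume R: "(u - P, P) \<in> Rs W d"
  then obtain k where k: "k \<in> Ks" "P = oproj k" "u - P \<in> W" "oproj k o\<^sub>L (u - P) = u - P" using Rs_iff by blast
  have "kd (u - P + oproj k) = k" using kd_eq[OF _ _ Ks_sub[OF k(1)] k(4)] k(3) W by (simp add: good_def)
  moreover have "u \<in> ext W d" unfolding ext_def by (rule image_eqI[OF _ R]) simp
  ultimately show "u \<in> ext W d \<and> P = oproj (kd u)" using k(2) by simp
next
  assume u: "u \<in> ext W d \<and> P = oproj (kd u)"
  obtain w k where w: "w \<in> W" "k \<in> Ks" "dim k = d" "oproj k o\<^sub>L w = w" "u = w + oproj k" "kd u = k" using extE[OF W] u by metis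
  then show "(u - P, P) \<in> Rs W d" using u Rs_iff by auto
qed

lemma Rs_con:
  assumes "constructible W" shows "constructible {z. (fst z - snd z, snd z) \<in> Rs W d}"
proof -
  have 2: "constructible {u :: 'g opr \<times> 'g opr. snd u \<in> PK}"
    by (rule constructible_vimage_linear[OF PK_con bounded_linear_snd])
  have 3: "constructible {u :: 'g opr \<times> 'g opr. fst u - snd u \<in> W}"
    by (rule constructible_vimage_linear[OF assms]) (intro bounded_linear_sub bounded_linear_fst bounded_linear_snd)
  have "constructible {z :: 'g opr \<times> 'g opr. fst z - snd z \<in> W \<and> snd z \<in> PK \<and> optrace (snd z) = real d \<and>
     (\<forall>x. blinfun_apply (snd z) (blinfun_apply (fst z - snd z) x) = blinfun_apply (fst z - snd z) x)}"
    by (intro constructible_Collect_conj 2 3 constructible_Collect_all constructible_vec_eq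
        constructible_eq poly_rules poly_leaf bounded_linear_sub)
  moreover have "P o\<^sub>L w = w \<longleftrightarrow> (\<forall>x. P (w x) = w x)" for P w :: "'g opr"
    by (metis blinfun_apply_blinfun_compose blinfun_eqI)
  ultimately show ?thesis by (simp add: Rs_def)
qed

lemma Es_con:
  assumes W: "good W" shows "constructible (Es W d)"
proof -
  have "constructible W" using W by (simp add: good_def)
  have "bounded_linear (\<lambda>z :: ('g opr \<times> 'g opr) \<times> 'g opr. (fst (fst z), snd z))"
    by (intro bounded_linear_Pair bounded_linear_snd bounded_linear_fst_comp bounded_linear_fst)
  from constructible_vimage_linear[OF Rs_con[OF \<open>constructible W\<close>] this]
  have 1: "constructible {z :: ('g opr \<times> 'g opr) \<times> 'g opr. (fst (fst z) - snd z, snd z) \<in> Rs W d}" by simp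
  have "bounded_linear (\<lambda>z :: ('g opr \<times> 'g opr) \<times> 'g opr. (snd z, snd (fst z)))"
    by (intro bounded_linear_Pair bounded_linear_snd bounded_linear_snd_comp bounded_linear_fst)
  from constructible_vimage_linear[OF constructible_Brel this]
  have 2: "constructible {z :: ('g opr \<times> 'g opr) \<times> 'g opr. Brel v br A (snd z) (snd (fst z))}" by simp
  have "constructible {z. \<exists>P. (fst z - P, P) \<in> Rs W d \<and> Brel v br A P (snd z)}"
    by (intro constructible_Collect_ex_op constructible_Collect_conj 1 2)
  moreover have "Es W d = {z. \<exists>P. (fst z - P, P) \<in> Rs W d \<and> Brel v br A P (snd z)}"
    unfolding Rs_kd[OF W] Es_def using B_iff[OF Ks_sub[OF ext_kd(1)[OF W]]] by auto
  ultimately show ?thesis by simp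
qed

lemma Ts_con:
  assumes W: "good W" and d: "d < DIM('g)" shows "constructible (Ts W d)"
proof -
  have "constructible W" using W by (simp add: good_def)
  have "bounded_linear (\<lambda>z :: ('g opr \<times> 'g opr) \<times> 'g opr. (fst (fst z), snd z))"
    by (intro bounded_linear_Pair bounded_linear_snd bounded_linear_fst_comp bounded_linear_fst)
  from constructible_vimage_linear[OF Rs_con[OF \<open>constructible W\<close>] this]
  have 1: "constructible {z :: ('g opr \<times> 'g opr) \<times> 'g opr. (fst (fst z) - snd z, snd z) \<in> Rs W d}" by simp
  have lin: "bounded_linear (\<lambda>z :: ('g opr \<times> 'g opr) \<times> 'g opr. (snd z, snd (fst z)))"
    by (intro bounded_linear_Pair bounded_linear_snd bounded_linear_snd_comp bounded_linear_fst)
  have "constructible (Cn d)" using Cn_con[OF Shat_con, of d] d by simp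
  from constructible_vimage_linear[OF this lin]
  have 2: "constructible {z :: ('g opr \<times> 'g opr) \<times> 'g opr. (snd z, snd (fst z)) \<in> Cn d}" .
  have "constructible {z. \<exists>P. (fst z - P, P) \<in> Rs W d \<and> (P, snd z) \<in> Cn d}"
    by (intro constructible_Collect_ex_op constructible_Collect_conj 1 2)
  moreover have "(oproj k, s) \<in> Cn d \<longleftrightarrow> s \<in> simp_complex {l\<in>Ks. k \<subseteq> l}" if "k \<in> Ks" "dim k = d" for k s
    unfolding Cn_def using that oproj_inj[OF Ks_sub Ks_sub] by auto
  then have "Ts W d = {z. \<exists>P. (fst z - P, P) \<in> Rs W d \<and> (P, snd z) \<in> Cn d}"
    unfolding Rs_kd[OF W] Ts_def using ext_kd[OF W] by auto
  ultimately show ?thesis by simp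
qed

text \<open>The semilattice property enters here: an operator common to two of the sets lies in the
  one of the join, and the join is proper since \<open>B UNIV\<close> is empty.\<close>

lemma K_join:
  assumes k: "k \<in> Ks" "l \<in> Ks" and M: "M \<in> B k" "M \<in> B l"
  obtains j where "j \<in> Ks" "k \<subseteq> j" "l \<subseteq> j" "M \<in> B j"
proof -
  have "subalg_gen br (k \<union> l) \<in> K" using K_semilat k by (auto simp: upper_semilattice_def Ks_def)
  moreover have MB: "M \<in> B (subalg_gen br (k \<union> l))" by (rule B_join(1)[OF Ks_sub[OF k(1)] Ks_sub[OF k(2)] M])
  moreover have "subalg_gen br (k \<union> l) \<noteq> UNIV" using MB B_UNIV by force
  moreover have "k \<subseteq> subalg_gen br (k \<union> l)" "l \<subseteq> subalg_gen br (k \<union> l)" unfolding subalg_gen_def by blast+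
  ultimately show ?thesis using that by (auto simp: Ks_def)
qed

section \<open>The inductive step\<close>

lemma Ss_mono: "Ss W (Suc d) \<subseteq> Ss W d"
proof -
  have "KK (Suc d) w \<subseteq> KK d w" for w by (auto simp: KK_def)
  from simp_complex_mono[OF this] show ?thesis unfolding Ss_def by auto
qed

text \<open>An operator in \<open>B l\<close> is annihilated by \<open>l\<close>, so its kernel
  contains \<open>l\<close> and has dimension at least \<open>Suc d\<close>; the flag above the
  kernel, which suffices to represent the operator, then has no member of dimension
  \<open>d\<close>.\<close>

lemma Xs_Ss_inter: "Xs W (Suc d) \<inter> Ss W d \<subseteq> Ss W (Suc d)"
proof clarify
  fix w s assume X: "(w, s) \<in> Xs W (Suc d)" and S: "(w, s) \<in> Ss W d"
  obtain l where l: "l \<in> KK (Suc d) w" "s \<in> B l" using X by (auto simp: Xs_def)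
  have w: "w \<in> W" and s: "s \<in> simp_complex (KK d w)" using S by (auto simp: Ss_def)
  obtain m where m: "m \<in> KK d w" "s \<in> simp_complex {k\<in>KK d w. m \<subseteq> k}" "\<forall>x. s x = 0 \<longleftrightarrow> x \<in> m"
    using simp_complex_kernel[OF KK_P s] by blast
  have "l \<subseteq> m" using B_subset_kernel[OF l(2)] m(3) l(1) Ks_sub by (auto simp: KK_def)
  have "{k\<in>KK d w. m \<subseteq> k} \<subseteq> KK (Suc d) w"
  proof
    fix k assume k: "k \<in> {k\<in>KK d w. m \<subseteq> k}"
    have "dim l \<le> dim k" by (rule dim_subset) (use k \<open>l \<subseteq> m\<close> in blast)
    then show "k \<in> KK (Suc d) w" using k l(1) by (auto simp: KK_def)
  qed
  from subsetD[OF simp_complex_mono[OF this] m(2)] show "(w, s) \<in> Ss W (Suc d)" using w by (simp add: Ss_def)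
qed

lemma Xs_ext_sub:
  assumes W: "good W" shows "Xs (ext W d) (Suc d) \<subseteq> Es W d"
proof (clarsimp simp: Xs_def Es_def)
  fix u M k assume u: "u \<in> ext W d" and k: "k \<in> KK (Suc d) u" "M \<in> B k"
  have "k \<in> Ks" "kd u \<subseteq> k" using k(1) KK_ext[OF W u] by auto
  then show "M \<in> B (kd u)" using B_antimono[OF Ks_sub[OF ext_kd(1)[OF W u]] Ks_sub] k(2) by blast
qed

text \<open>The induction hypothesis retracts the links, which yields a retraction of
  \<open>Xs (ext W d) (Suc d) \<union> Ts W d\<close> to \<open>Ts W d\<close>, and
  \<open>Es W d\<close> is deformed fibrewise into \<open>Ts W d\<close> towards the apices. These
  are the two equivalences that \<open>sdr_of_constructible\<close> asks for.\<close>

lemma sdr_Es: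
  assumes W: "good W" and d: "d < DIM('g)" and IH: "sdr (Ss (ext W d) (Suc d)) (Xs (ext W d) (Suc d))"
  shows "sdr (Xs (ext W d) (Suc d) \<union> Ts W d) (Es W d)"
proof -
  have cW: "compact (ext W d)" "constructible (ext W d)" using good_ext[OF W] by (auto simp: good_def)
  have Xcl: "closed (Xs (ext W d) (Suc d))" and Tcl: "closed (Ts W d)"
    using Xs_compact[OF cW(1)] Ts_compact[OF W] compact_imp_closed by blast+
  have sub1: "Xs (ext W d) (Suc d) \<inter> Ts W d \<subseteq> Ss (ext W d) (Suc d)"
  proof clarify
    fix u s assume X: "(u, s) \<in> Xs (ext W d) (Suc d)" and T: "(u, s) \<in> Ts W d"
    have u: "u \<in> ext W d" and s: "s \<in> simp_complex {l\<in>Ks. kd u \<subseteq> l}" using T by (auto simp: Ts_def)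
    have P: "{l\<in>Ks. kd u \<subseteq> l} \<subseteq> \<P> - {UNIV}" using KsP Ks_UNIV by blast
    obtain l where l: "l \<in> Ks" "kd u \<subset> l" "s \<in> B l" using X KK_ext[OF W u] by (auto simp: Xs_def)
    obtain m where m: "m \<in> Ks" "s \<in> simp_complex {k\<in>{l\<in>Ks. kd u \<subseteq> l}. m \<subseteq> k}" "\<forall>x. s x = 0 \<longleftrightarrow> x \<in> m"
      using simp_complex_kernel[OF P s] by blast
    have "l \<subseteq> m" using B_subset_kernel[OF l(3) Ks_sub[OF l(1)]] m(3) by auto
    then have "{k\<in>{l\<in>Ks. kd u \<subseteq> l}. m \<subseteq> k} \<subseteq> KK (Suc d) u" unfolding KK_ext[OF W u] using l(2) by blast
    from subsetD[OF simp_complex_mono[OF this] m(2)] show "(u, s) \<in> Ss (ext W d) (Suc d)" using u by (simp add: Ss_def)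
  qed
  have sub2: "Ss (ext W d) (Suc d) \<subseteq> Ts W d"
  proof clarify
    fix u s assume S: "(u, s) \<in> Ss (ext W d) (Suc d)"
    then have u: "u \<in> ext W d" and s: "s \<in> simp_complex (KK (Suc d) u)" by (auto simp: Ss_def)
    have "KK (Suc d) u \<subseteq> {l\<in>Ks. kd u \<subseteq> l}" unfolding KK_ext[OF W u] by blast
    from subsetD[OF simp_complex_mono[OF this] s] show "(u, s) \<in> Ts W d" using u by (simp add: Ts_def)
  qed
  have sdrT: "sdr (Ts W d) (Xs (ext W d) (Suc d) \<union> Ts W d)" by (rule sdr_glue[OF IH Xcl Tcl sub1 sub2])
  \<comment> \<open>The straight line to the apex, written with the constant
    \<open>DIM('g) - d\<close> so that continuity is evident; it preserves the simplicial cones as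
    well.\<close>
  define C where "C z = (fst (snd z), (1 - fst z) *\<^sub>R snd (snd z) + fst z *\<^sub>R ((1 / real (DIM('g) - d)) *\<^sub>R (id_blinfun - oproj (kd (fst (snd z))))))"
    for z :: "real \<times> 'g opr \<times> 'g opr"
  have C_eq: "C (t, (u, M)) = (u, (1 - t) *\<^sub>R M + t *\<^sub>R chibar (kd u))" if "u \<in> ext W d" for t u M
    using ext_kd(2)[OF W that] by (simp add: C_def chibar_def)
  show ?thesis
  proof (rule sdr_of_constructible[OF _ _ _ _ _ sdrT])
    show "closed (Es W d)" using Es_compact[OF W] compact_imp_closed by blast
    show "constructible (Es W d)" by (rule Es_con[OF W])
    show "closed (Xs (ext W d) (Suc d) \<union> Ts W d)" using Xcl Tcl by (rule closed_Un)
    show "constructible (Xs (ext W d) (Suc d) \<union> Ts W d)" by (intro constructible_Un Xs_con cW Ts_con W d)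
    show "Xs (ext W d) (Suc d) \<union> Ts W d \<subseteq> Es W d" using Xs_ext_sub[OF W] Ts_sub_Es[OF W] by blast
    have "continuous_on ({0..1::real} \<times> Es W d) (\<lambda>z. oproj (kd (fst (snd z))))"
      by (rule continuous_on_compose2[OF kd_continuous[OF W]]) (auto simp: Es_def intro!: continuous_intros)
    then show "continuous_on ({0..1} \<times> Es W d) C" unfolding C_def[abs_def] by (intro continuous_intros)
    fix t :: real and x
    show "C (t, x) \<in> Es W d" if t: "t \<in> {0..1}" and x: "x \<in> Es W d"
    proof -
      obtain u M where u: "x = (u, M)" "u \<in> ext W d" "M \<in> B (kd u)" using x by (auto simp: Es_def)
      have "(1 - t) *\<^sub>R M + t *\<^sub>R chibar (kd u) \<in> B (kd u)"
        using B_shift[of "kd u" t M] KsP[OF ext_kd(1)[OF W u(2)]] Ks_UNIV[OF ext_kd(1)[OF W u(2)]] t u(3) by simp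
      then show ?thesis using C_eq[OF u(2)] u by (simp add: Es_def)
    qed
    show "C (0, x) = x" by (simp add: C_def)
    show "C (1, x) \<in> Ts W d" if x: "x \<in> Es W d"
    proof -
      obtain u M where u: "x = (u, M)" "u \<in> ext W d" using x by (auto simp: Es_def)
      have "chibar (kd u) \<in> simp_complex {l\<in>Ks. kd u \<subseteq> l}" by (rule simp_complex_chibar) (use ext_kd(1)[OF W u(2)] in simp)
      then show ?thesis using C_eq[OF u(2)] u by (simp add: Ts_def)
    qed
    show "C (t, x) \<in> Ts W d" if t: "t \<in> {0..1}" and x: "x \<in> Ts W d"
    proof -
      obtain u M where u: "x = (u, M)" "u \<in> ext W d" "M \<in> simp_complex {l\<in>Ks. kd u \<subseteq> l}" using x by (auto simp: Ts_def)
      have "(1 - t) *\<^sub>R M + t *\<^sub>R chibar (kd u) \<in> simp_complex {l\<in>Ks. kd u \<subseteq> l}"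
        using simp_complex_join[OF ext_kd(1)[OF W u(2)] u(3)] t by simp
      then show ?thesis using C_eq[OF u(2)] u by (simp add: Ts_def)
    qed
  qed
qed

text \<open>\<open>\<pi>\<close> forgets the chosen member of dimension \<open>d\<close>. Two
  choices for one operator generate, by \<open>K_join\<close>, a larger member whose set contains
  the operator, so \<open>\<pi>\<close> is injective away from the part of higher dimension.\<close>

lemma Xs_step:
  assumes W: "good W" and d: "d < DIM('g)" and IH: "\<And>W. good W \<Longrightarrow> sdr (Ss W (Suc d)) (Xs W (Suc d))"
  shows "sdr (Ss W d) (Xs W d)"
proof -
  define \<pi> where "\<pi> z = (fst z - oproj (kd (fst z)), snd z)" for z :: "'g opr \<times> 'g opr"
  have cW: "compact W" using W by (simp add: good_def)
  have Xcl: "closed (Xs W (Suc d))" and Scl: "closed (Ss W d)" using Xs_compact[OF cW] Ss_compact[OF cW] compact_imp_closed by blast+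
  \<comment> \<open>An operator of \<open>B k\<close> that also lies in \<open>B l\<close> with
    \<open>dim l > d\<close> lies in \<open>B j\<close> for a \<open>j\<close> containing both. As
    \<open>j\<close> is strictly larger than \<open>k\<close>, the operator belongs to the link part
    of its own fibre.\<close>
  have X_iff: "\<pi> e \<in> Xs W (Suc d) \<longleftrightarrow> e \<in> Xs (ext W d) (Suc d)" if e: "e \<in> Es W d" for e
  proof -
    obtain u M where u: "e = (u, M)" "u \<in> ext W d" "M \<in> B (kd u)" using e by (auto simp: Es_def)
    obtain w k where w: "w \<in> W" "k \<in> Ks" "dim k = d" "oproj k o\<^sub>L w = w" "u = w + oproj k" "kd u = k" by (rule extE[OF W u(2)])
    have pe: "\<pi> e = (w, M)" using u(1) w(5,6) by (simp add: \<pi>_def)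
    have "(w, M) \<in> Xs W (Suc d) \<longleftrightarrow> (\<exists>l\<in>KK (Suc d) w. M \<in> B l)" using w(1) by (simp add: Xs_def)
    also have "\<dots> \<longleftrightarrow> (\<exists>l\<in>Ks. k \<subset> l \<and> M \<in> B l)"
    proof
      assume "\<exists>l\<in>KK (Suc d) w. M \<in> B l"
      then obtain l where l: "l \<in> Ks" "Suc d \<le> dim l" "M \<in> B l" by (auto simp: KK_def)
      obtain j where j: "j \<in> Ks" "k \<subseteq> j" "l \<subseteq> j" "M \<in> B j" using K_join[OF w(2) l(1) _ l(3)] u(3) w(6) by metis
      have "dim l \<le> dim j" by (rule dim_subset[OF j(3)])
      then have "k \<noteq> j" using w(3) l(2) by auto
      then show "\<exists>l\<in>Ks. k \<subset> l \<and> M \<in> B l" using j by blast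
    next
      assume "\<exists>l\<in>Ks. k \<subset> l \<and> M \<in> B l"
      then obtain l where l: "l \<in> Ks" "k \<subset> l" "M \<in> B l" by blast
      have "oproj l o\<^sub>L w = w" using op_fix_mono[OF Ks_sub[OF w(2)] Ks_sub[OF l(1)] _ w(4)] l(2) by blast
      then have "l \<in> KK (Suc d) w" using l(1,2) Ks_psubset_iff[OF w(2,3) l(1)] by (simp add: KK_def)
      then show "\<exists>l\<in>KK (Suc d) w. M \<in> B l" using l(3) by blast
    qed
    also have "\<dots> \<longleftrightarrow> e \<in> Xs (ext W d) (Suc d)" unfolding u(1) Xs_def using KK_ext[OF W u(2)] u(2) w(6) by auto
    finally show ?thesis unfolding pe .
  qed
  have inj: "e = e'" if e: "e \<in> Es W d" "e' \<in> Es W d" "\<pi> e = \<pi> e'" "e \<notin> Xs (ext W d) (Suc d)" for e e'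
  proof -
    obtain u M where u: "e = (u, M)" "u \<in> ext W d" "M \<in> B (kd u)" using e(1) by (auto simp: Es_def)
    obtain u' M' where u': "e' = (u', M')" "u' \<in> ext W d" "M' \<in> B (kd u')" using e(2) by (auto simp: Es_def)
    have eq: "M' = M" "u - oproj (kd u) = u' - oproj (kd u')" using e(3) u(1) u'(1) by (auto simp: \<pi>_def)
    note k = ext_kd[OF W u(2)] and k' = ext_kd[OF W u'(2)]
    obtain j where j: "j \<in> Ks" "kd u \<subseteq> j" "kd u' \<subseteq> j" "M \<in> B j" using K_join[OF k(1) k'(1) u(3)] u'(3) eq(1) by metis
    have "j \<notin> KK (Suc d) u" using e(4) u j(4) by (auto simp: Xs_def)
    then have "j = kd u" unfolding KK_ext[OF W u(2)] using j by blast
    then have "kd u' = kd u" using subspace_dim_equal[OF Ks_sub[OF k'(1)] Ks_sub[OF k(1)]] j(3) k(2) k'(2) by simp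
    then show ?thesis using eq u(1) u'(1) by simp
  qed
  have cont: "continuous_on (Es W d) \<pi>"
  proof -
    have "continuous_on (Es W d) (\<lambda>z. oproj (kd (fst z)))"
      by (rule continuous_on_compose2[OF kd_continuous[OF W]]) (auto simp: Es_def intro!: continuous_intros)
    then show ?thesis unfolding \<pi>_def[abs_def] by (intro continuous_intros)
  qed
  have "sdr (Xs W (Suc d) \<union> \<pi> ` (Xs (ext W d) (Suc d) \<union> Ts W d)) (Xs W (Suc d) \<union> \<pi> ` Es W d)"
    by (rule sdr_push[OF sdr_Es[OF W d IH[OF good_ext[OF W]]] Es_compact[OF W] cont Xcl X_iff _ inj]) auto
  moreover have "Xs W (Suc d) \<union> \<pi> ` Es W d = Xs W d"
  proof (intro equalityI subsetI)
    fix z assume "z \<in> Xs W (Suc d) \<union> \<pi> ` Es W d"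
    then show "z \<in> Xs W d"
    proof
      assume "z \<in> Xs W (Suc d)" then show ?thesis by (auto simp: Xs_def KK_def)
    next
      assume "z \<in> \<pi> ` Es W d"
      then obtain u M where u: "z = \<pi> (u, M)" "u \<in> ext W d" "M \<in> B (kd u)" by (auto simp: Es_def)
      obtain w k where w: "w \<in> W" "k \<in> Ks" "dim k = d" "oproj k o\<^sub>L w = w" "u = w + oproj k" "kd u = k" by (rule extE[OF W u(2)])
      then show ?thesis using u(1,3) by (auto simp: \<pi>_def Xs_def KK_def)
    qed
  next
    fix z assume "z \<in> Xs W d"
    then obtain w M k where w: "z = (w, M)" "w \<in> W" "k \<in> Ks" "d \<le> dim k" "oproj k o\<^sub>L w = w" "M \<in> B k" by (auto simp: Xs_def KK_def)
    show "z \<in> Xs W (Suc d) \<union> \<pi> ` Es W d"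
    proof (cases "dim k = d")
      case True
      have kd: "kd (w + oproj k) = k" using kd_eq[OF _ _ Ks_sub[OF w(3)] w(5)] w(2) W by (simp add: good_def)
      have "(w + oproj k, M) \<in> Es W d" using extI[OF w(2,3) True w(5)] kd w(6) by (simp add: Es_def)
      moreover have "z = \<pi> (w + oproj k, M)" using w(1) kd by (simp add: \<pi>_def)
      ultimately show ?thesis by blast
    next
      case False
      then have "k \<in> KK (Suc d) w" using w by (simp add: KK_def)
      then show ?thesis using w by (auto simp: Xs_def)
    qed
  qed
  moreover have "Xs W (Suc d) \<union> \<pi> ` (Xs (ext W d) (Suc d) \<union> Ts W d) = Xs W (Suc d) \<union> Ss W d"
  proof (intro equalityI subsetI)
    fix z assume "z \<in> Xs W (Suc d) \<union> \<pi> ` (Xs (ext W d) (Suc d) \<union> Ts W d)"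
    then consider "z \<in> Xs W (Suc d)" | e where "z = \<pi> e" "e \<in> Xs (ext W d) (Suc d)" | e where "z = \<pi> e" "e \<in> Ts W d" by blast
    then show "z \<in> Xs W (Suc d) \<union> Ss W d"
    proof cases
      case 2 then show ?thesis using X_iff Xs_ext_sub[OF W] by blast
    next
      case 3
      then obtain u s where u: "e = (u, s)" "u \<in> ext W d" "s \<in> simp_complex {l\<in>Ks. kd u \<subseteq> l}" by (auto simp: Ts_def)
      obtain w k where w: "w \<in> W" "k \<in> Ks" "dim k = d" "oproj k o\<^sub>L w = w" "u = w + oproj k" "kd u = k" by (rule extE[OF W u(2)])
      have "s \<in> simp_complex (KK d w)" using simp_complex_mono[OF KK_cone_sub[OF w(2,4,3)]] u(3) w(6) by blast
      then show ?thesis using 3(1) u(1) w(1,5,6) by (auto simp: \<pi>_def Ss_def)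
    qed blast
  next
    fix z assume "z \<in> Xs W (Suc d) \<union> Ss W d"
    then show "z \<in> Xs W (Suc d) \<union> \<pi> ` (Xs (ext W d) (Suc d) \<union> Ts W d)"
    proof
      assume "z \<in> Ss W d"
      then obtain w s where w: "z = (w, s)" "w \<in> W" "s \<in> simp_complex (KK d w)" by (auto simp: Ss_def)
      then consider "s \<in> simp_complex (KK (Suc d) w)"
        | k where "k \<in> Ks" "dim k = d" "oproj k o\<^sub>L w = w" "s \<in> simp_complex {l\<in>Ks. k \<subseteq> l}"
        using simp_complex_KK_step by blast
      then show ?thesis
      proof cases
        case 1
        then have "z \<in> Ss W (Suc d)" using w by (simp add: Ss_def)
        then show ?thesis using Ss_sub_Xs by blast
      next
        case 2
        have kd: "kd (w + oproj k) = k" using kd_eq[OF _ _ Ks_sub[OF 2(1)] 2(3)] w(2) W by (simp add: good_def)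
        have "(w + oproj k, s) \<in> Ts W d" using extI[OF w(2) 2(1,2,3)] kd 2(4) by (simp add: Ts_def)
        moreover have "z = \<pi> (w + oproj k, s)" using w(1) kd by (simp add: \<pi>_def)
        ultimately show ?thesis by blast
      qed
    qed blast
  qed
  \<comment> \<open>The higher strata are retracted by the induction hypothesis for the unchanged
    base, with the new simplices held fixed.\<close>
  moreover have "sdr (Ss W d) (Xs W (Suc d) \<union> Ss W d)"
    by (rule sdr_glue[OF IH[OF W] Xcl Scl Xs_Ss_inter Ss_mono])
  ultimately show ?thesis using sdr_trans by metis
qed

text \<open>All good bases are treated at once, since the step for \<open>W\<close> appeals to
  \<open>ext W d\<close> at the next level.\<close>

lemma sdr_Xs: "d \<le> DIM('g) \<Longrightarrow> good W \<Longrightarrow> sdr (Ss W d) (Xs W d)"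
proof (induction arbitrary: W rule: inc_induct)
  case base
  have "KK DIM('g) w = {}" for w using Ks_dim by (fastforce simp: KK_def)
  then have "Ss W DIM('g) = {}" "Xs W DIM('g) = {}" by (auto simp: Ss_def Xs_def)
  then show ?case by (simp add: sdr_refl)
next
  case (step d)
  show ?case by (rule Xs_step[OF step.prems step.hyps(2) step.IH])
qed

section \<open>Specialisation to the empty flag\<close>

lemma good_0: "good {0}"
  by (auto simp: good_def symop_def subspace_def intro!: constructible_subspace)

lemma KK_0: "KK 0 0 = Ks"
  by (auto simp: KK_def bounded_bilinear.zero_right[OF bounded_bilinear_blinfun_compose])

lemma Ss_0: "Ss {0} 0 = {0} \<times> simp_complex Ks" and Xs_0: "Xs {0} 0 = {0} \<times> BK v br A K"
  by (auto simp: Ss_def Xs_def KK_0 BK_def simp flip: Ks_def)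

lemma compact_simp_complex: "compact (simp_complex Ks)"
proof -
  have "compact (snd ` Ss {0} 0)" by (intro compact_continuous_image Ss_compact continuous_intros) auto
  then show ?thesis by (simp add: Ss_0)
qed

lemma compact_BK: "compact (BK v br A K)"
proof -
  have "compact (snd ` Xs {0} 0)" by (intro compact_continuous_image Xs_compact continuous_intros) auto
  then show ?thesis by (simp add: Xs_0)
qed

theorem sdr_BK: "sdr (simp_complex Ks) (BK v br A K)"
proof -
  have "homeomorphism (Xs {0} 0) (BK v br A K) snd (\<lambda>M. (0, M))"
    unfolding Xs_0 by (auto simp: homeomorphism_def intro!: continuous_intros)
  from sdr_homeomorphism[OF this sdr_Xs[OF _ good_0]] show ?thesis by (simp add: Ss_0)
qed

end

subsection \<open>The coefficient of a butterfly point\<close>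

lemma symop_zeroI:
  fixes Z :: "'g::euclidean_space opr"
  assumes Z: "symop Z" and ev: "\<And>l x. Z x = l *\<^sub>R x \<Longrightarrow> l *\<^sub>R x = 0"
  shows "Z = 0"
proof -
  obtain e \<mu> where e: "\<forall>i<DIM('g). \<forall>j<DIM('g). e i \<bullet> e j = (if i = j then 1 else 0)" "\<forall>i<DIM('g). Z (e i) = \<mu> i *\<^sub>R e i"
    using symop_eigenbasis[OF Z] by blast
  show ?thesis
  proof (rule blinfun_eqI)
    fix x
    have "Z (e i) = 0" if "i < DIM('g)" for i using ev[of "e i" "\<mu> i"] e(2) that by simp
    moreover have "Z x = Z (\<Sum>i<DIM('g). (x \<bullet> e i) *\<^sub>R e i)" using orthonormal_expansion[OF e(1), of x] by simp
    ultimately show "Z x = blinfun_apply 0 x" by (simp add: blinfun.sum_right blinfun.scaleR_right)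
  qed
qed

text \<open>For an eigenvector of \<open>N' - N\<close> with eigenvalue \<open>l\<close>,
  orthogonality gives \<open>l * (N x \<bullet> x + D x \<bullet> x) + l * l * (x \<bullet> x) =
  0\<close>, where both terms are nonnegative if \<open>0 \<le> l\<close>; exchanging the roles
  covers negative \<open>l\<close>.\<close>

lemma pos_neg_part_unique:
  fixes N D N' D' :: "'g::euclidean_space opr"
  assumes sym: "symop N" "symop N'" and pos: "\<And>x. 0 \<le> N x \<bullet> x" "\<And>x. 0 \<le> D x \<bullet> x" "\<And>x. 0 \<le> N' x \<bullet> x" "\<And>x. 0 \<le> D' x \<bullet> x"
    and orth: "\<And>x. N x \<bullet> D x = 0" "\<And>x. N' x \<bullet> D' x = 0" and eq: "N - D = N' - D'"
  shows "N = N'"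
proof -
  have "N' - N = 0"
  proof (rule symop_zeroI)
    show "symop (N' - N)" using sym by (simp add: symop_def blinfun.diff_left inner_diff_left inner_diff_right)
    fix l x assume l: "(N' - N) x = l *\<^sub>R x"
    have N': "N' x = N x + l *\<^sub>R x" using l by (simp add: blinfun.diff_left algebra_simps)
    have "(N - D) x = (N' - D') x" using eq by simp
    then have D': "D' x = D x + l *\<^sub>R x" using N' by (simp add: blinfun.diff_left algebra_simps)
    have 1: "l * (N x \<bullet> x + D x \<bullet> x) + l * l * (x \<bullet> x) = 0"
      using orth(2)[of x] orth(1)[of x] unfolding N' D'
      by (simp add: inner_add_left inner_add_right inner_commute[of x "D x"] algebra_simps)
    have 2: "(- l) * (N' x \<bullet> x + D' x \<bullet> x) + l * l * (x \<bullet> x) = 0"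
      using 1 unfolding N' D' by (simp add: inner_add_left algebra_simps)
    have sq: "0 \<le> l * l * (x \<bullet> x)" by simp
    have "l * l * (x \<bullet> x) = 0"
    proof (cases "0 \<le> l")
      case True
      then have "0 \<le> l * (N x \<bullet> x + D x \<bullet> x)" using pos(1,2) by (intro mult_nonneg_nonneg add_nonneg_nonneg)
      then show ?thesis using 1 sq by linarith
    next
      case False
      then have "0 \<le> (- l) * (N' x \<bullet> x + D' x \<bullet> x)" using pos(3,4) by (intro mult_nonneg_nonneg add_nonneg_nonneg) auto
      then show ?thesis using 2 sq by linarith
    qed
    then show "l *\<^sub>R x = 0" by simp
  qed
  then show ?thesis by simp
qed

lemma orthogonal_complement_in:
  fixes e :: "'g::euclidean_space set"
  assumes e: "subspace e" and d: "\<And>z. (\<forall>y\<in>e. z \<bullet> y = 0) \<Longrightarrow> d \<bullet> z = 0"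
  shows "d \<in> e"
proof -
  define z where "z = d - oproj e d"
  have z: "\<forall>y\<in>e. z \<bullet> y = 0" unfolding z_def using oproj_orth[OF e] by blast
  have "z \<bullet> z = d \<bullet> z - oproj e d \<bullet> z" by (simp add: z_def inner_diff_left)
  also have "\<dots> = 0" using d[OF z] z oproj_in[OF e] by (simp add: inner_commute[of "oproj e d" z])
  finally have "d = oproj e d" by (simp add: z_def)
  then show ?thesis using oproj_in[OF e] by metis
qed

text \<open>Iterating \<open>M\<close> on a vector of \<open>f\<close> grows at most like \<open>m\<^sup>n\<close>, but its component orthogonal to \<open>e\<close> grows at least like \<open>m'\<^sup>n\<close>.\<close>

lemma growth_subset:
  fixes M b N b' N' :: "'g::euclidean_space opr"
  assumes M: "M = b + N" "M = b' + N'"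
    and f: "\<And>x. x \<in> f \<Longrightarrow> b x \<in> f" "\<And>x. x \<in> f \<Longrightarrow> N x = 0" and b: "\<And>x. norm (b x) \<le> m * norm x" and m: "0 \<le> m" "m < m'"
    and e: "subspace e" "\<And>x. (\<forall>y\<in>e. x \<bullet> y = 0) \<Longrightarrow> b' x = m' *\<^sub>R x" "symop b'" "symop N'" "\<And>x. x \<in> e \<Longrightarrow> N' x = 0"
      "\<And>x. 0 \<le> N' x \<bullet> x"
  shows "f \<subseteq> e"
proof
  fix x assume x: "x \<in> f"
  define y where "y = oproj e x"
  define z where "z = x - y"
  have up: "((blinfun_apply M ^^ n) x) \<in> f \<and> norm ((blinfun_apply M ^^ n) x) \<le> m ^ n * norm x" for n
  proof (induction n)
    case (Suc n)
    define w where "w = (blinfun_apply M ^^ n) x"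
    have w: "w \<in> f" "norm w \<le> m ^ n * norm x" using Suc by (auto simp: w_def)
    have Mw: "M w = b w" using f(2)[OF w(1)] by (simp add: M(1) blinfun.add_left)
    have "norm (b w) \<le> m * norm w" by (rule b)
    also have "\<dots> \<le> m * (m ^ n * norm x)" by (rule mult_left_mono[OF w(2) m(1)])
    finally show ?case using f(1)[OF w(1)] Mw by (simp add: w_def[symmetric] mult.assoc)
  qed (use x in simp)
  \<comment> \<open>\<open>M\<close> respects the splitting into \<open>e\<close> and its
    complement. On the complement \<open>b'\<close> is the scalar \<open>m'\<close> and
    \<open>N'\<close> only adds to the quadratic form, so the norm of \<open>q\<close> grows at
    least by the factor \<open>m'\<close>.\<close>
  have dn: "\<exists>p q. p \<in> e \<and> (\<forall>y\<in>e. q \<bullet> y = 0) \<and> (blinfun_apply M ^^ n) x = p + q \<and> m' ^ n * norm z \<le> norm q" for n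
  proof (induction n)
    case 0
    show ?case
      by (intro exI[of _ y] exI[of _ z]) (use oproj_in[OF e(1)] oproj_orth[OF e(1), of _ x] in \<open>auto simp: y_def z_def\<close>)
  next
    case (Suc n)
    then obtain p q where pq: "p \<in> e" "\<forall>y\<in>e. q \<bullet> y = 0" "(blinfun_apply M ^^ n) x = p + q" "m' ^ n * norm z \<le> norm q" by blast
    have b'q: "b' q = m' *\<^sub>R q" by (rule e(2)[OF pq(2)])
    have Mp: "M p = b' p" using e(5)[OF pq(1)] by (simp add: M(2) blinfun.add_left)
    have "b' p \<in> e"
    proof (rule orthogonal_complement_in[OF e(1)])
      fix z assume z: "\<forall>y\<in>e. z \<bullet> y = 0"
      have "b' p \<bullet> z = p \<bullet> b' z" using e(3) by (simp add: symop_def)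
      also have "\<dots> = 0" using e(2)[OF z] z pq(1) by (simp add: inner_commute[of p z])
      finally show "b' p \<bullet> z = 0" .
    qed
    moreover have "\<forall>y\<in>e. M q \<bullet> y = 0"
    proof
      fix y assume y: "y \<in> e"
      have "N' q \<bullet> y = q \<bullet> N' y" using e(4) by (simp add: symop_def)
      then show "M q \<bullet> y = 0" using e(5)[OF y] b'q pq(2) y by (simp add: M(2) blinfun.add_left inner_add_left)
    qed
    moreover have "m' ^ Suc n * norm z \<le> norm (M q)"
    proof -
      have "m' * (norm q * norm q) \<le> M q \<bullet> q"
        using e(6)[of q] b'q by (simp add: M(2) blinfun.add_left inner_add_left dot_square_norm power2_eq_square)
      also have "\<dots> \<le> norm (M q) * norm q" by (rule norm_cauchy_schwarz)
      finally have "m' * norm q \<le> norm (M q)" by (cases "q = 0") (auto simp: mult.assoc[symmetric])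
      moreover have "m' * (m' ^ n * norm z) \<le> m' * norm q" using pq(4) m by (intro mult_left_mono) auto
      ultimately show ?thesis by (simp add: mult.assoc)
    qed
    moreover have "(blinfun_apply M ^^ Suc n) x = b' p + M q" using pq(3) Mp by (simp add: blinfun.add_right)
    ultimately show ?case by blast
  qed
  have le: "norm z \<le> (m / m') ^ n * norm x" for n
  proof -
    obtain p q where pq: "p \<in> e" "\<forall>y\<in>e. q \<bullet> y = 0" "(blinfun_apply M ^^ n) x = p + q" "m' ^ n * norm z \<le> norm q" using dn by blast
    have "q \<bullet> p = 0" using pq by blast
    then have "q \<bullet> q \<le> (p + q) \<bullet> (p + q)" by (simp add: inner_add_left inner_add_right inner_commute[of p q])
    then have "norm q \<le> norm (p + q)" by (simp add: norm_le)
    then have "m' ^ n * norm z \<le> m ^ n * norm x" using up[of n] pq(3,4) by simp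
    then show ?thesis using m by (simp add: power_divide field_simps)
  qed
  have "(\<lambda>n. (m / m') ^ n * norm x) \<longlonglongrightarrow> 0 * norm x"
    by (intro tendsto_mult tendsto_const LIMSEQ_realpow_zero) (use m in auto)
  then have "norm z \<le> 0 * norm x" by (rule LIMSEQ_le_const) (use le in blast)
  then have "x = y" by (simp add: z_def)
  then show "x \<in> e" using oproj_in[OF e(1)] by (metis y_def)
qed

section \<open>Toral parts as truncated operators\<close>

lemma norm_oproj_compl: "subspace k \<Longrightarrow> norm (x - oproj k x) \<le> norm x"
proof -
  assume k: "subspace k"
  have "(x - oproj k x) \<bullet> oproj k x = 0" by (rule oproj_orth[OF k oproj_in[OF k]])
  then have "x \<bullet> x = (x - oproj k x) \<bullet> (x - oproj k x) + oproj k x \<bullet> oproj k x"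
    by (simp add: inner_diff_left inner_diff_right inner_commute[of "oproj k x" x])
  then have "(x - oproj k x) \<bullet> (x - oproj k x) \<le> x \<bullet> x" using inner_ge_zero[of "oproj k x"] by linarith
  then show ?thesis by (simp add: norm_le)
qed

text \<open>The properties of points in the simplex of a flag inside \<open>f\<close> with largest
  member \<open>e\<close> that are needed for comparison: the bound \<open>m\<close> is attained on
  the whole complement of \<open>e\<close>. They are stable under sums and nonnegative multiples,
  with \<open>m\<close> behaving additively.\<close>

definition flagop :: "'g::euclidean_space set \<Rightarrow> 'g set \<Rightarrow> 'g opr \<Rightarrow> real \<Rightarrow> bool" where
  "flagop f e M m \<longleftrightarrow> 0 \<le> m \<and> symop M \<and> (\<forall>x. norm (M x) \<le> m * norm x) \<and> (\<forall>x. 0 \<le> (m *\<^sub>R x - M x) \<bullet> x) \<and>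
     (\<forall>x. (\<forall>y\<in>e. x \<bullet> y = 0) \<longrightarrow> M x = m *\<^sub>R x) \<and> (\<forall>x\<in>f. M x \<in> f)"

lemma flagop_scaleR:
  assumes f: "subspace f" and M: "flagop f e M m" and c: "0 \<le> c" shows "flagop f e (c *\<^sub>R M) (c * m)"
  unfolding flagop_def
proof (intro conjI allI ballI impI)
  show "0 \<le> c * m" using M c by (simp add: flagop_def)
  show "symop (c *\<^sub>R M)" using M by (simp add: flagop_def symop_def blinfun.scaleR_left)
  fix x
  have "norm (M x) \<le> m * norm x" "0 \<le> (m *\<^sub>R x - M x) \<bullet> x" using M by (auto simp: flagop_def)
  then show "norm ((c *\<^sub>R M) x) \<le> c * m * norm x" using mult_left_mono[of "norm (M x)" "m * norm x" c] c
    by (simp add: blinfun.scaleR_left mult.assoc)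
  have "((c * m) *\<^sub>R x - (c *\<^sub>R M) x) \<bullet> x = c * ((m *\<^sub>R x - M x) \<bullet> x)"
    by (simp add: blinfun.scaleR_left inner_diff_left algebra_simps)
  then show "0 \<le> ((c * m) *\<^sub>R x - (c *\<^sub>R M) x) \<bullet> x" using \<open>0 \<le> (m *\<^sub>R x - M x) \<bullet> x\<close> c by simp
  show "(c *\<^sub>R M) x = (c * m) *\<^sub>R x" if "\<forall>y\<in>e. x \<bullet> y = 0" using M that by (simp add: flagop_def blinfun.scaleR_left)
  show "(c *\<^sub>R M) x \<in> f" if "x \<in> f" using M that subspace_scale[OF f] by (simp add: flagop_def blinfun.scaleR_left)
qed

lemma flagop_add:
  assumes f: "subspace f" and M: "flagop f e M m" and N: "flagop f e N n" shows "flagop f e (M + N) (m + n)"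
  unfolding flagop_def
proof (intro conjI allI ballI impI)
  show "0 \<le> m + n" using M N by (simp add: flagop_def)
  show "symop (M + N)" using M N by (simp add: flagop_def symop_def blinfun.add_left inner_add_left inner_add_right)
  fix x
  have "norm (M x) \<le> m * norm x" "0 \<le> (m *\<^sub>R x - M x) \<bullet> x" "norm (N x) \<le> n * norm x" "0 \<le> (n *\<^sub>R x - N x) \<bullet> x"
    using M N by (auto simp: flagop_def)
  note 1 = this
  have "norm ((M + N) x) \<le> norm (M x) + norm (N x)" by (simp add: blinfun.add_left norm_triangle_ineq)
  then show "norm ((M + N) x) \<le> (m + n) * norm x" using 1 by (simp add: distrib_right)
  have "((m + n) *\<^sub>R x - (M + N) x) \<bullet> x = (m *\<^sub>R x - M x) \<bullet> x + (n *\<^sub>R x - N x) \<bullet> x"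
    by (simp add: blinfun.add_left inner_diff_left inner_add_left algebra_simps)
  then show "0 \<le> ((m + n) *\<^sub>R x - (M + N) x) \<bullet> x" using 1 by simp
  show "(M + N) x = (m + n) *\<^sub>R x" if "\<forall>y\<in>e. x \<bullet> y = 0" using M N that by (simp add: flagop_def blinfun.add_left scaleR_add_left)
  show "(M + N) x \<in> f" if "x \<in> f" using M N that subspace_add[OF f] by (simp add: flagop_def blinfun.add_left)
qed

lemma flagop_chibar:
  assumes f: "subspace f" and k: "subspace k" "k \<subseteq> e" "k \<subseteq> f"
  shows "flagop f e (chibar k) (1 / real (DIM('g) - dim (k :: 'g::euclidean_space set)))"
  unfolding flagop_def
proof (intro conjI allI ballI impI)
  define \<alpha> where "\<alpha> = 1 / real (DIM('g) - dim k)"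
  have a: "0 \<le> \<alpha>" by (simp add: \<alpha>_def)
  show "0 \<le> 1 / real (DIM('g) - dim k)" by simp
  have chi: "chibar k x = \<alpha> *\<^sub>R (x - oproj k x)" for x by (simp add: chibar_apply \<alpha>_def)
  show "symop (chibar k)" using symop_oproj[OF k(1)] by (simp add: symop_def chi inner_diff_left inner_diff_right)
  fix x
  show "norm (chibar k x) \<le> 1 / real (DIM('g) - dim k) * norm x"
    unfolding chi \<alpha>_def[symmetric] using norm_oproj_compl[OF k(1), of x] a by (simp add: mult_left_mono)
  have "(\<alpha> *\<^sub>R x - chibar k x) \<bullet> x = \<alpha> * (oproj k x \<bullet> x)" by (simp add: chi algebra_simps)
  then show "0 \<le> ((1 / real (DIM('g) - dim k)) *\<^sub>R x - chibar k x) \<bullet> x"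
    unfolding \<alpha>_def[symmetric] using a oproj_inner[OF k(1), of x x] by simp
  show "chibar k x = (1 / real (DIM('g) - dim k)) *\<^sub>R x" if "\<forall>y\<in>e. x \<bullet> y = 0"
  proof -
    have "oproj k x = 0" by (rule oproj_eqI) (use k that subspace_0 in auto)
    then show ?thesis by (simp add: chi \<alpha>_def)
  qed
  show "chibar k x \<in> f" if "x \<in> f"
    unfolding chi using that oproj_in[OF k(1)] k(3) by (intro subspace_scale[OF f] subspace_diff[OF f]) auto
qed

text \<open>Every vertex of the flag satisfies \<open>flagop\<close> with the same \<open>f\<close>
  and \<open>e\<close>, and the operators that do so for some \<open>m\<close> form a convex
  set.\<close>

lemma simp_complex_flagop:
  assumes f: "subspace f" and S: "\<And>k. k \<in> S \<Longrightarrow> subspace k \<and> k \<subseteq> f" and M: "M \<in> simp_complex S"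
  obtains e m where "e \<in> S" "flagop f e M m"
proof -
  obtain fl where fl: "flag_in S fl" "M \<in> convex hull (chibar ` set fl)" using M by (auto simp: simp_complex_def simp_hull_def)
  obtain e rest where er: "fl = e # rest" using fl(1) by (cases fl) (auto simp: flag_in_def)
  have sub: "k \<subseteq> e" "k \<in> S" if "k \<in> set fl" for k using fl(1) that by (auto simp: flag_in_def er)
  have "convex hull (chibar ` set fl) \<subseteq> {M. \<exists>m. flagop f e M m}"
  proof (rule hull_minimal)
    show "chibar ` set fl \<subseteq> {M. \<exists>m. flagop f e M m}" using flagop_chibar[OF f] sub S by blast
    show "convex {M. \<exists>m. flagop f e M m}"
      unfolding convex_def using flagop_add[OF f] flagop_scaleR[OF f] by blast
  qed
  then show ?thesis using fl(2) sub(2) er that by auto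
qed

section \<open>Uniqueness of the toral part and of the coefficient\<close>

context lie_setting
begin

lemma I_P: "k \<in> \<I> \<Longrightarrow> k \<in> \<P>"
  by (simp add: Iset_def)

lemma I_subset: "k \<in> \<P> \<Longrightarrow> k \<subseteq> l \<Longrightarrow> l \<in> \<I> \<Longrightarrow> k \<in> \<I>"
  by (auto simp: Iset_def)

text \<open>One relation for the three kinds of butterflies: a component is unconstrained when its
  coefficient vanishes. In particular \<open>f = UNIV\<close> occurs only for \<open>c = 0\<close>,
  since \<open>B UNIV\<close> is empty.\<close>

definition Dec :: "'g set \<Rightarrow> 'g opr \<Rightarrow> 'g opr \<Rightarrow> real \<Rightarrow> 'g opr \<Rightarrow> bool" where
  "Dec f M1 M2 c M \<longleftrightarrow> f \<in> \<P> - \<I> \<and> 0 \<le> c \<and> c \<le> 1 \<and> (c < 1 \<longrightarrow> M1 \<in> simp_complex {k\<in>\<I>. k \<subseteq> f}) \<and>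
     (0 < c \<longrightarrow> M2 \<in> B f) \<and> M = (1 - c) *\<^sub>R M1 + c *\<^sub>R M2"

text \<open>\<open>b\<close> and \<open>N\<close> stand for the weighted components of a
  decomposition, and \<open>m\<close> is the value at which the sum is truncated. The alternative
  \<open>b = 0\<close> corresponds to \<open>c = 1\<close>.\<close>

definition Ddata :: "'g set \<Rightarrow> 'g opr \<Rightarrow> 'g opr \<Rightarrow> real \<Rightarrow> bool" where
  "Ddata f b N m \<longleftrightarrow> f \<in> \<P> - \<I> \<and> symop N \<and> (\<forall>x. 0 \<le> N x \<bullet> x) \<and> (\<forall>x\<in>f. N x = 0) \<and>
     ((b = 0 \<and> m = 0) \<or> (\<exists>e\<in>\<I>. e \<subseteq> f \<and> flagop f e b m))"

lemma Dec_Ddata: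
  assumes D: "Dec f M1 M2 c M" shows "\<exists>m. Ddata f ((1 - c) *\<^sub>R M1) (c *\<^sub>R M2) m"
proof -
  have f: "f \<in> \<P> - \<I>" and c: "0 \<le> c" "c \<le> 1" using D by (auto simp: Dec_def)
  have fs: "subspace f" using f P_sub by blast
  have N: "symop (c *\<^sub>R M2) \<and> (\<forall>x. 0 \<le> (c *\<^sub>R M2) x \<bullet> x) \<and> (\<forall>x\<in>f. (c *\<^sub>R M2) x = 0)"
  proof (cases "c = 0")
    case True then show ?thesis by (simp add: symop_def)
  next
    case False
    then have M2: "M2 \<in> B f" using D c by (simp add: Dec_def)
    then have "symop M2" "\<forall>x. 0 \<le> M2 x \<bullet> x" using B_iff[OF fs] by (auto simp: Brel_def)
    moreover have "\<forall>x\<in>f. M2 x = 0" using B_subset_kernel[OF M2 fs] by blast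
    ultimately show ?thesis using c by (simp add: symop_def blinfun.scaleR_left)
  qed
  show ?thesis
  proof (cases "c = 1")
    case True then show ?thesis using f N by (intro exI[of _ 0]) (simp add: Ddata_def)
  next
    case False
    then have M1: "M1 \<in> simp_complex {k\<in>\<I>. k \<subseteq> f}" using D c by (simp add: Dec_def)
    have kf: "subspace k \<and> k \<subseteq> f" if "k \<in> {k\<in>\<I>. k \<subseteq> f}" for k using that P_sub I_P by blast
    obtain e m where e: "e \<in> {k\<in>\<I>. k \<subseteq> f}" "flagop f e M1 m" by (rule simp_complex_flagop[OF fs kf M1])
    have "flagop f e ((1 - c) *\<^sub>R M1) ((1 - c) * m)" using flagop_scaleR[OF fs e(2)] c by simp
    then show ?thesis using e(1) f N unfolding Ddata_def by blast
  qed
qed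

text \<open>A larger \<open>m'\<close> would force, by the growth comparison, the nontoral
  \<open>f\<close> into the toral \<open>e\<close>, although members of \<open>\<P>\<close> inside
  toral ones are toral.\<close>

lemma Ddata_le:
  assumes D: "Ddata f b N m" and D': "Ddata f' b' N' m'" and eq: "b + N = b' + N'"
  shows "m' \<le> m"
proof (rule ccontr)
  assume "\<not> m' \<le> m"
  then have lt: "m < m'" by simp
  have f: "f \<in> \<P>" "f \<notin> \<I>" using D by (auto simp: Ddata_def)
  have fs: "subspace f" using f P_sub by blast
  have bf: "(\<forall>x\<in>f. b x \<in> f) \<and> (\<forall>x. norm (b x) \<le> m * norm x) \<and> 0 \<le> m"
    using D subspace_0[OF fs] by (auto simp: Ddata_def flagop_def)
  have N: "\<forall>x\<in>f. N x = 0" using D by (simp add: Ddata_def)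
  have "m' \<noteq> 0" using lt bf by linarith
  then obtain e where e: "e \<in> \<I>" "e \<subseteq> f'" "flagop f' e b' m'" using D' unfolding Ddata_def by blast
  have es: "subspace e" using e(1) I_P P_sub by blast
  have N': "symop N'" "\<And>x. 0 \<le> N' x \<bullet> x" "\<And>x. x \<in> e \<Longrightarrow> N' x = 0" using D' e(2) by (auto simp: Ddata_def)
  have "f \<subseteq> e"
    by (rule growth_subset[of "b + N" b N b' N' f m m']) (use bf N lt es e(3) N' eq in \<open>auto simp: flagop_def\<close>)
  then show False using I_subset[OF f(1) _ e(1)] f(2) by blast
qed

text \<open>\<open>N\<close> and \<open>m - b\<close> are the positive and negative parts of
  \<open>b + N - m\<close>: the image of \<open>m - b\<close> lies in
  \<open>e \<subseteq> f\<close>, where \<open>N\<close> vanishes.\<close>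

lemma Ddata_neg_part:
  assumes D: "Ddata f b N m"
  shows "symop N" "0 \<le> N x \<bullet> x" "0 \<le> (m *\<^sub>R id_blinfun - b) x \<bullet> x" "N x \<bullet> (m *\<^sub>R id_blinfun - b) x = 0"
proof -
  show "symop N" "0 \<le> N x \<bullet> x" using D by (auto simp: Ddata_def)
  have sN: "N x \<bullet> y = x \<bullet> N y" for y using D by (simp add: Ddata_def symop_def)
  have Dx: "(m *\<^sub>R id_blinfun - b) x = m *\<^sub>R x - b x" for x by (simp add: blinfun.diff_left blinfun.scaleR_left)
  show "0 \<le> (m *\<^sub>R id_blinfun - b) x \<bullet> x" unfolding Dx using D by (auto simp: Ddata_def flagop_def)
  consider "b = 0" "m = 0" | e where "e \<in> \<I>" "e \<subseteq> f" "flagop f e b m" using D unfolding Ddata_def by blast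
  then show "N x \<bullet> (m *\<^sub>R id_blinfun - b) x = 0"
  proof cases
    case 2
    have es: "subspace e" using 2(1) I_P P_sub by blast
    have sb: "symop b" and be: "\<And>z. (\<forall>y\<in>e. z \<bullet> y = 0) \<Longrightarrow> b z = m *\<^sub>R z" using 2(3) by (auto simp: flagop_def)
    have "m *\<^sub>R x - b x \<in> e"
    proof (rule orthogonal_complement_in[OF es])
      fix z assume z: "\<forall>y\<in>e. z \<bullet> y = 0"
      have "b x \<bullet> z = x \<bullet> b z" using sb by (simp add: symop_def)
      then show "(m *\<^sub>R x - b x) \<bullet> z = 0" using be[OF z] by (simp add: inner_diff_left)
    qed
    then have "N (m *\<^sub>R x - b x) = 0" using 2(2) D by (auto simp: Ddata_def)
    then show ?thesis unfolding Dx sN by simp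
  qed simp
qed

lemma Ddata_unique:
  assumes D: "Ddata f b N m" and D': "Ddata f' b' N' m'" and eq: "b + N = b' + N'"
  shows "b = b'"
proof -
  have m: "m' = m" using Ddata_le[OF D D' eq] Ddata_le[OF D' D eq[symmetric]] by simp
  have "N = N'"
  proof (rule pos_neg_part_unique[of N N' "m *\<^sub>R id_blinfun - b" "m *\<^sub>R id_blinfun - b'"])
    have "N - (m *\<^sub>R id_blinfun - b) = (b + N) - m *\<^sub>R id_blinfun" by simp
    also have "\<dots> = N' - (m *\<^sub>R id_blinfun - b')" unfolding eq by simp
    finally show "N - (m *\<^sub>R id_blinfun - b) = N' - (m *\<^sub>R id_blinfun - b')" .
  qed (use Ddata_neg_part[OF D] Ddata_neg_part[OF D'[unfolded m]] in auto)
  then show ?thesis using eq by simp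
qed

lemma toral_proper: "f \<in> \<P> - \<I> \<Longrightarrow> {k\<in>\<I>. k \<subseteq> f} \<subseteq> \<P> - {UNIV}"
proof
  fix k assume f: "f \<in> \<P> - \<I>" and k: "k \<in> {k\<in>\<I>. k \<subseteq> f}"
  then have "k \<noteq> f" by blast
  then show "k \<in> \<P> - {UNIV}" using k I_P by auto
qed

text \<open>Points of the simplices have trace one, so the coefficient can be recovered from the
  trace of the toral part.\<close>

lemma Dec_optrace:
  assumes D: "Dec f M1 M2 c M" shows "optrace ((1 - c) *\<^sub>R M1) = 1 - c"
proof (cases "c = 1")
  case False
  have f: "f \<in> \<P> - \<I>" and M1: "M1 \<in> simp_complex {k\<in>\<I>. k \<subseteq> f}" using D False by (auto simp: Dec_def)
  obtain l where l: "l \<in> {k\<in>\<I>. k \<subseteq> f}" "M1 \<in> B l" using simp_complex_kernel[OF toral_proper[OF f] M1] by blast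
  then have "subspace l" using I_P P_sub by blast
  then have "optrace M1 = 1" using l(2) B_iff by (simp add: Brel_def)
  then show ?thesis by (simp add: optrace_scaleR)
qed (simp add: optrace_def)

lemma Dec_unique:
  assumes D: "Dec f M1 M2 c M" and D': "Dec f' M1' M2' c' M"
  shows "c = c'" "(1 - c) *\<^sub>R M1 = (1 - c') *\<^sub>R M1'"
proof -
  obtain m m' where "Ddata f ((1 - c) *\<^sub>R M1) (c *\<^sub>R M2) m" "Ddata f' ((1 - c') *\<^sub>R M1') (c' *\<^sub>R M2') m'"
    using Dec_Ddata[OF D] Dec_Ddata[OF D'] by blast
  moreover have "(1 - c) *\<^sub>R M1 + c *\<^sub>R M2 = (1 - c') *\<^sub>R M1' + c' *\<^sub>R M2'" using D D' by (simp add: Dec_def)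
  ultimately show eq: "(1 - c) *\<^sub>R M1 = (1 - c') *\<^sub>R M1'" by (rule Ddata_unique)
  then show "c = c'" using Dec_optrace[OF D] Dec_optrace[OF D'] by simp
qed

lemma IIflags_Cons: "f # fl \<in> IIflags br h A \<longleftrightarrow> f \<in> \<P> - \<I> \<and> sorted_wrt (\<lambda>a b. b \<subset> a) fl \<and> set fl \<subseteq> {k\<in>\<I>. k \<subset> f}"
  using I_P unfolding IIflags_def flag_in_def by auto

text \<open>This removes flags and case distinctions from the definition of the coefficient; the
  sequel argues with \<open>Dec\<close> alone.\<close>

lemma flag_Dec:
  "(\<exists>fl\<in>IIflags br h A. M \<in> Bflag v br A fl \<and> kappa_rel v br A fl M c) \<longleftrightarrow> (\<exists>f M1 M2. Dec f M1 M2 c M)"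
proof
  assume "\<exists>fl\<in>IIflags br h A. M \<in> Bflag v br A fl \<and> kappa_rel v br A fl M c"
  then obtain fl' where fl': "fl' \<in> IIflags br h A" "M \<in> Bflag v br A fl'" "kappa_rel v br A fl' M c" by blast
  then obtain f fl where eq: "fl' = f # fl" by (cases fl') (auto simp: IIflags_def flag_in_def)
  have f: "f \<in> \<P> - \<I>" and fl: "sorted_wrt (\<lambda>a b. b \<subset> a) fl" "set fl \<subseteq> {k\<in>\<I>. k \<subset> f}"
    using fl'(1) IIflags_Cons by (simp_all add: eq)
  have hull: "M1 \<in> simp_complex {k\<in>\<I>. k \<subseteq> f}" if "M1 \<in> simp_hull fl" "fl \<noteq> []" for M1
  proof -
    have "flag_in {k\<in>\<I>. k \<subseteq> f} fl" using fl that(2) unfolding flag_in_def by blast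
    then show ?thesis using that(1) unfolding simp_complex_def by blast
  qed
  show "\<exists>f M1 M2. Dec f M1 M2 c M"
  proof (cases "f = UNIV")
    case True
    have c: "c = 0" using fl'(3) True by (simp add: kappa_rel_def eq)
    have "fl \<noteq> []" using fl'(2) True by (auto simp: Bflag_def eq)
    then have "M \<in> simp_hull fl" using fl'(2) True by (auto simp: Bflag_def eq)
    then have "Dec f M 0 0 M" using hull \<open>fl \<noteq> []\<close> f by (simp add: Dec_def)
    then show ?thesis using c by blast
  next
    case False
    show ?thesis
    proof (cases "fl = []")
      case True
      then have "c = 1" "M \<in> B f" using fl'(2,3) False by (simp_all add: kappa_rel_def Bflag_def eq)
      then have "Dec f 0 M c M" using f by (simp add: Dec_def)
      then show ?thesis by blast
    next
      case fl_ne: False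
      then obtain M1 M2 where "c \<in> {0..1}" "M1 \<in> simp_hull fl" "M2 \<in> B f" "M = (1 - c) *\<^sub>R M1 + c *\<^sub>R M2"
        using fl'(3) False by (auto simp: kappa_rel_def eq)
      then have "Dec f M1 M2 c M" using f hull[OF _ fl_ne] by (simp add: Dec_def)
      then show ?thesis by blast
    qed
  qed
next
  assume "\<exists>f M1 M2. Dec f M1 M2 c M"
  then obtain f M1 M2 where D: "Dec f M1 M2 c M" by blast
  have f: "f \<in> \<P> - \<I>" and c: "0 \<le> c" "c \<le> 1" and M: "M = (1 - c) *\<^sub>R M1 + c *\<^sub>R M2" using D by (auto simp: Dec_def)
  have M2: "f \<noteq> UNIV" "M2 \<in> B f" if "0 < c" using D that B_UNIV by (auto simp: Dec_def)
  show "\<exists>fl\<in>IIflags br h A. M \<in> Bflag v br A fl \<and> kappa_rel v br A fl M c"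
  proof (cases "c = 1")
    case True
    then have "f \<noteq> UNIV" "M2 \<in> B f" using M2 by auto
    moreover have "[f] \<in> IIflags br h A" using f IIflags_Cons[of f "[]"] by simp
    ultimately show ?thesis using True M by (intro bexI[of _ "[f]"]) (auto simp: Bflag_def kappa_rel_def)
  next
    case False
    then have "M1 \<in> simp_complex {k\<in>\<I>. k \<subseteq> f}" using D by (auto simp: Dec_def)
    then obtain fl where fl: "flag_in {k\<in>\<I>. k \<subseteq> f} fl" "M1 \<in> simp_hull fl" by (auto simp: simp_complex_def)
    have ne: "fl \<noteq> []" "sorted_wrt (\<lambda>a b. b \<subset> a) fl" "set fl \<subseteq> {k\<in>\<I>. k \<subset> f}" using fl(1) f by (auto simp: flag_in_def)
    have II: "f # fl \<in> IIflags br h A" using f ne IIflags_Cons by blast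
    have "M \<in> Bflag v br A (f # fl) \<and> kappa_rel v br A (f # fl) M c"
    proof (cases "f = UNIV")
      case True
      then have "c = 0" using M2(1) c by force
      then show ?thesis using True M fl(2) ne(1) by (simp add: Bflag_def kappa_rel_def)
    next
      case fU: False
      \<comment> \<open>For \<open>c = 0\<close> the relation \<open>Dec\<close> provides no second
        component in \<open>B f\<close>, while the butterfly asks for one; the apex serves.\<close>
      define M2' where "M2' = (if 0 < c then M2 else chibar f)"
      have "M2' \<in> B f" using M2(2) chibar_in_B f fU by (auto simp: M2'_def)
      moreover have "M = (1 - c) *\<^sub>R M1 + c *\<^sub>R M2'" using M c by (auto simp: M2'_def)
      ultimately show ?thesis using fU fl(2) ne(1) c unfolding Bflag_def kappa_rel_def by auto
    qed
    then show ?thesis using II by blast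
  qed
qed

lemma Bflag_kappa_ex:
  assumes "M \<in> Bflag v br A fl" shows "\<exists>c. kappa_rel v br A fl M c"
  using assms unfolding Bflag_def kappa_rel_def by (auto split: if_splits)

lemma BII_Dec: "M \<in> BII v br h A \<longleftrightarrow> (\<exists>c f M1 M2. Dec f M1 M2 c M)"
  unfolding BII_def flag_Dec[symmetric] using Bflag_kappa_ex by blast

lemma kappa_Dec:
  assumes D: "Dec f M1 M2 c M" shows "kappa v br h A M = c"
  unfolding kappa_def flag_Dec
proof (rule the_equality)
  show "\<exists>f M1 M2. Dec f M1 M2 c M" using D by blast
  show "c' = c" if "\<exists>f M1 M2. Dec f M1 M2 c' M" for c' using that Dec_unique(1)[OF _ D] by blast
qed

definition XX :: "real \<Rightarrow> 'g opr set" where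
  "XX \<theta> = {M. \<exists>f M1 M2 c. Dec f M1 M2 c M \<and> \<theta> \<le> c}"

lemma Xeps_XX: "Xeps v br h A L e = XX (e ^ L)"
proof (intro set_eqI iffI)
  fix M assume M: "M \<in> Xeps v br h A L e"
  then obtain c f M1 M2 where D: "Dec f M1 M2 c M" using BII_Dec by (auto simp: Xeps_def)
  then show "M \<in> XX (e ^ L)" using M kappa_Dec[OF D] unfolding Xeps_def XX_def by blast
next
  fix M assume "M \<in> XX (e ^ L)"
  then obtain f M1 M2 c where D: "Dec f M1 M2 c M" "e ^ L \<le> c" by (auto simp: XX_def)
  then show "M \<in> Xeps v br h A L e" using kappa_Dec[OF D(1)] BII_Dec unfolding Xeps_def by blast
qed

end

section \<open>Limits of invariant subalgebras\<close>

lemma norm_oproj: "subspace k \<Longrightarrow> norm (oproj k) \<le> 1"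
proof (rule norm_blinfun_bound)
  fix x assume k: "subspace k"
  have "oproj k x \<bullet> (x - oproj k x) = 0" using oproj_orth[OF k oproj_in[OF k], of x x] by (simp add: inner_commute)
  then have "x \<bullet> x = oproj k x \<bullet> oproj k x + (x - oproj k x) \<bullet> (x - oproj k x)"
    by (simp add: inner_diff_left inner_diff_right inner_commute[of "oproj k x" x])
  then have "oproj k x \<bullet> oproj k x \<le> x \<bullet> x" using inner_ge_zero[of "x - oproj k x"] by linarith
  then show "norm (oproj k x) \<le> 1 * norm x" by (simp add: norm_le)
qed simp

text \<open>Idempotence and symmetry pass to the limit, which is therefore the projection onto its
  fixed space.\<close>

lemma oproj_limit:
  fixes k :: "nat \<Rightarrow> 'g::euclidean_space set"
  assumes k: "\<And>n. subspace (k n)" and lim: "(\<lambda>n. oproj (k n)) \<longlonglongrightarrow> P"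
  obtains k0 where "subspace k0" "P = oproj k0"
proof -
  define k0 where "k0 = {x. P x = x}"
  have s: "subspace k0" by (auto simp: k0_def subspace_def blinfun.add_right blinfun.scaleR_right)
  have lx: "(\<lambda>n. oproj (k n) x) \<longlonglongrightarrow> P x" for x by (intro blinfun.tendsto lim tendsto_const)
  have "(\<lambda>n. oproj (k n) (oproj (k n) x)) \<longlonglongrightarrow> P (P x)" for x by (intro blinfun.tendsto lim lx)
  then have PP: "P (P x) = P x" for x using LIMSEQ_unique[OF _ lx[of x]] oproj_id[OF k oproj_in[OF k]] by simp
  have "oproj k0 x = P x" for x
  proof (rule oproj_eqI[OF s])
    show "P x \<in> k0" using PP by (simp add: k0_def)
    fix z assume "z \<in> k0"
    then have z: "P z = z" by (simp add: k0_def)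
    have "(\<lambda>n. oproj (k n) x \<bullet> z) \<longlonglongrightarrow> P x \<bullet> z" "(\<lambda>n. x \<bullet> oproj (k n) z) \<longlonglongrightarrow> x \<bullet> P z" by (intro tendsto_inner lx tendsto_const)+
    moreover have "oproj (k n) x \<bullet> z = x \<bullet> oproj (k n) z" for n using symop_oproj[OF k] by (simp add: symop_def)
    ultimately have "P x \<bullet> z = x \<bullet> P z" using LIMSEQ_unique by fastforce
    then show "(x - P x) \<bullet> z = 0" using z by (simp add: inner_diff_left)
  qed
  then have "P = oproj k0" by (intro blinfun_eqI) simp
  then show ?thesis using s that by blast
qed

context lie_setting
begin

text \<open>Elements of the limit are limits of their own projections to the \<open>k n\<close>, so
  bracket, group action and torality pass to the limit.\<close>

lemma P_limit:
  assumes k: "\<And>n. k n \<in> \<P>" and s: "subspace k0" and lim: "(\<lambda>n. oproj (k n)) \<longlonglongrightarrow> oproj k0"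
  shows "k0 \<in> \<P>" "(\<And>n. k n \<in> \<I>) \<Longrightarrow> k0 \<in> \<I>"
proof -
  note ks = P_sub[OF k]
  have lx: "(\<lambda>n. oproj (k n) x) \<longlonglongrightarrow> x" if "x \<in> k0" for x
    using blinfun.tendsto[OF lim tendsto_const[of x]] oproj_id[OF s that] by simp
  have mem: "x \<in> k0" if "\<And>n. u n \<in> k n" "u \<longlonglongrightarrow> x" for u x
  proof -
    have "(\<lambda>n. oproj (k n) (u n)) \<longlonglongrightarrow> oproj k0 x" by (intro blinfun.tendsto lim that(2))
    then have "u \<longlonglongrightarrow> oproj k0 x" using oproj_id[OF ks that(1)] by simp
    then show ?thesis using LIMSEQ_unique[OF that(2)] oproj_fixed_iff[OF s] by metis
  qed
  have hs: "subspace h" using h_sub by (simp add: subalg_def)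
  have hk: "h \<subseteq> k0"
  proof
    fix x assume "x \<in> h"
    then have "x \<in> k n" for n using P_h[OF k] by blast
    then show "x \<in> k0" by (rule mem[of "\<lambda>_. x"]) simp
  qed
  have "h \<noteq> k0"
  proof
    assume eq: "h = k0"
    \<comment> \<open>Strictness of the inclusion survives because the traces are integers exceeding
      the dimension of \<open>h\<close> by at least one.\<close>
    have "real (dim h) + 1 \<le> optrace (oproj (k n))" for n
    proof -
      have "\<not> dim (k n) \<le> dim h" using subspace_dim_equal[OF hs ks] P_h[OF k] by blast
      then show ?thesis using optrace_oproj[OF ks] by simp
    qed
    then have "real (dim h) + 1 \<le> optrace (oproj k0)" by (intro LIMSEQ_le_const[OF tendsto_optrace[OF lim]]) blast
    then show False using eq optrace_oproj[OF s] by simp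
  qed
  moreover have "br x y \<in> k0" if "x \<in> k0" "y \<in> k0" for x y
    by (rule mem[of "\<lambda>n. br (oproj (k n) x) (oproj (k n) y)"])
      (intro P_br k oproj_in ks, intro br.tendsto lx that)
  moreover have "blinfun_apply a x \<in> k0" if "a \<in> A" "x \<in> k0" for a x
    by (rule mem[of "\<lambda>n. a (oproj (k n) x)"])
      (intro P_A k oproj_in ks that(1), intro blinfun.tendsto tendsto_const lx that(2))
  ultimately show P: "k0 \<in> \<P>" using hk s by (auto simp: Pset_def subalg_def)
  assume I: "\<And>n. k n \<in> \<I>"
  have "br x y \<in> h" if "x \<in> k0" "y \<in> k0" for x y
  proof -
    have lim_br: "(\<lambda>n. br (oproj (k n) x) (oproj (k n) y)) \<longlonglongrightarrow> br x y" by (intro br.tendsto lx that)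
    have "br (oproj (k n) x) (oproj (k n) y) \<in> h" for n using I[of n] oproj_in[OF ks] by (simp add: Iset_def)
    then show ?thesis by (rule closed_sequentially[OF closed_subspace[OF hs] _ lim_br])
  qed
  then show "k0 \<in> \<I>" using P by (simp add: Iset_def)
qed

lemma P_subseq:
  assumes k: "\<And>n. k n \<in> \<P>"
  obtains r k0 where "strict_mono (r :: nat \<Rightarrow> nat)" "k0 \<in> \<P>" "(\<lambda>n. oproj (k (r n))) \<longlonglongrightarrow> oproj k0"
    "(\<And>n. k n \<in> \<I>) \<Longrightarrow> k0 \<in> \<I>"
proof -
  note ks = P_sub[OF k]
  have "\<forall>n. oproj (k n) \<in> cball 0 1" using norm_oproj[OF ks] by simp
  then obtain P r where r: "strict_mono (r :: nat \<Rightarrow> nat)" "((\<lambda>n. oproj (k n)) \<circ> r) \<longlonglongrightarrow> P"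
    using seq_compactE[OF compact_imp_seq_compact[OF compact_cball], of "\<lambda>n. oproj (k n)" 0 1] by metis
  have lim: "(\<lambda>n. oproj (k (r n))) \<longlonglongrightarrow> P" using r(2) by (simp add: o_def)
  obtain k0 where k0: "subspace k0" "P = oproj k0" by (rule oproj_limit[OF ks lim])
  show ?thesis
    by (rule that[OF r(1) P_limit(1)[OF k k0(1) lim[unfolded k0(2)]] lim[unfolded k0(2)] P_limit(2)[OF k k0(1) lim[unfolded k0(2)]]])
qed

lemma compact_oproj_I: "compact (oproj ` \<I>)"
  unfolding compact_eq_seq_compact_metric seq_compact_def
proof (intro allI impI)
  fix u :: "nat \<Rightarrow> 'g opr" assume "\<forall>n. u n \<in> oproj ` \<I>"
  then have "\<forall>n. \<exists>k. k \<in> \<I> \<and> u n = oproj k" by blast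
  then obtain k where k: "\<And>n. k n \<in> \<I>" "\<And>n. u n = oproj (k n)" by metis
  obtain r k0 where r: "strict_mono (r :: nat \<Rightarrow> nat)" "(\<lambda>n. oproj (k (r n))) \<longlonglongrightarrow> oproj k0" "k0 \<in> \<I>"
    using P_subseq[of k, OF I_P[OF k(1)]] k(1) by metis
  then show "\<exists>l\<in>oproj ` \<I>. \<exists>r. strict_mono r \<and> (u \<circ> r) \<longlonglongrightarrow> l"
    using k by (intro bexI[of _ "oproj k0"] exI[of _ r]) (auto simp: o_def)
qed

lemma subalg_subalg_gen: "subalg br (subalg_gen br S)"
  unfolding subalg_def subalg_gen_def by (auto intro!: subspace_Inter)

lemma P_join:
  assumes k: "k \<in> \<P>" "l \<in> \<P>" shows "subalg_gen br (k \<union> l) \<in> \<P>"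
proof -
  define j where "j = subalg_gen br (k \<union> l)"
  have j: "subalg br j" "k \<subseteq> j" "l \<subseteq> j" using subalg_subalg_gen by (auto simp: j_def) (auto simp: subalg_gen_def)
  have "blinfun_apply a ` j \<subseteq> j" if a: "a \<in> A" for a
  proof -
    have "subalg br {x. a x \<in> j}"
      using j(1) autA a by (auto simp: subalg_def subspace_def aut_group_def blinfun.add_right blinfun.scaleR_right blinfun.zero_right)
    moreover have "k \<union> l \<subseteq> {x. a x \<in> j}" using P_A[OF k(1) a] P_A[OF k(2) a] j(2,3) by blast
    ultimately have "j \<subseteq> {x. a x \<in> j}" unfolding j_def[unfolded atomize_eq] subalg_gen_def by (intro Inter_lower) simp
    then show ?thesis by blast
  qed
  moreover have "h \<subset> j" using P_h[OF k(1)] j(2) by blast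
  ultimately show ?thesis using j(1) unfolding j_def[symmetric] Pset_def by blast
qed

end

section \<open>Raising the coefficient to one\<close>

locale nontoral_setting = K_setting br h A v K
  for br :: "'g::euclidean_space \<Rightarrow> 'g \<Rightarrow> 'g" and h :: "'g set" and A :: "'g opr set" and v :: version and K :: "'g set set" +
  assumes nonab: "\<not> (\<forall>x y. br x y \<in> h)" and Kmin: "Kmin br h A \<subseteq> K" and K_nontoral: "K \<subseteq> Pset br h A - Iset br h A"
begin

lemma I_proper: "k \<in> \<I> \<Longrightarrow> k \<noteq> UNIV"
  using nonab by (auto simp: Iset_def)

text \<open>A nontoral member of least dimension inside \<open>f\<close> is minimal among the
  nontoral ones, hence belongs to \<open>Kmin\<close> and so to \<open>K\<close>.\<close>

lemma contains_minimal:
  assumes f: "f \<in> \<P> - \<I>" obtains m where "m \<in> K" "m \<subseteq> f"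
proof -
  define Q where "Q m \<longleftrightarrow> m \<in> \<P> - \<I> \<and> m \<subseteq> f" for m
  have "Q f" using f by (simp add: Q_def)
  then obtain m where m: "Q m" "\<And>y. Q y \<Longrightarrow> dim m \<le> dim y" using ex_has_least_nat[of Q f dim] by blast
  have min: "l = m" if l: "l \<in> \<P> - \<I>" "l \<subseteq> m" for l
  proof -
    have "Q l" using l m(1) by (auto simp: Q_def)
    then show ?thesis using subspace_dim_equal[OF P_sub P_sub l(2)] l(1) m by (auto simp: Q_def)
  qed
  have "m \<in> {k \<in> \<P> - \<I>. \<forall>m \<in> \<P> - \<I>. m \<subseteq> k \<longrightarrow> m = k}" using m(1) min by (simp add: Q_def)
  then have "m \<in> Kmin br h A" unfolding Kmin_def by blast
  then show ?thesis using m(1) Kmin that by (auto simp: Q_def)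
qed

lemma BK_nontoral: "(\<Union>f\<in>\<P> - \<I>. B f) = BK v br A K"
proof (intro equalityI subsetI)
  fix M assume "M \<in> (\<Union>f\<in>\<P> - \<I>. B f)"
  then obtain f where f: "f \<in> \<P> - \<I>" "M \<in> B f" by blast
  obtain m where m: "m \<in> K" "m \<subseteq> f" by (rule contains_minimal[OF f(1)])
  have "M \<in> B m" using B_antimono[OF P_sub P_sub m(2)] f m(1) K_sub by blast
  moreover from this have "m \<noteq> UNIV" using B_UNIV by force
  ultimately show "M \<in> BK v br A K" using m(1) by (auto simp: BK_def)
next
  fix M assume "M \<in> BK v br A K"
  then show "M \<in> (\<Union>f\<in>\<P> - \<I>. B f)" using K_nontoral by (auto simp: BK_def)
qed

lemma B_BK: "f \<in> \<P> - \<I> \<Longrightarrow> M \<in> B f \<Longrightarrow> M \<in> BK v br A K"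
  using BK_nontoral by blast

lemma BK_Dec: "M \<in> BK v br A K \<Longrightarrow> \<exists>f. Dec f 0 M 1 M"
  using BK_nontoral by (auto simp: Dec_def)

text \<open>A parameter space of decompositions on which the deformation has an explicit formula.
  The member \<open>f\<close> is not part of the data, since it need not converge among the nontoral
  ones.\<close>

definition YY :: "real \<Rightarrow> ('g opr \<times> real \<times> 'g opr) set" where
  "YY \<theta> = {(M1, c, M2). c \<in> {\<theta>..1} \<and> (\<exists>f\<in>\<P> - \<I>. M1 \<in> simp_complex {k\<in>\<I>. k \<subseteq> f} \<and> M2 \<in> B f)}"

text \<open>The flag member \<open>f\<close> may become toral in a limit. Since the limit of the \<open>M2\<close> still lies in some \<open>B k\<close> with \<open>k \<in> K\<close>, the join of \<open>k\<close> with the limit of the \<open>f\<close> takes its place.\<close>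

lemma YY_compact: "compact (YY \<theta>)"
proof -
  define R where "R = real DIM('g) * real DIM('g)"
  have sub: "YY \<theta> \<subseteq> cball 0 R \<times> {\<theta>..1} \<times> BK v br A K"
  proof
    fix z assume "z \<in> YY \<theta>"
    then obtain M1 c M2 f where z: "z = (M1, c, M2)" "c \<in> {\<theta>..1}" "f \<in> \<P> - \<I>" "M1 \<in> simp_complex {k\<in>\<I>. k \<subseteq> f}" "M2 \<in> B f"
      by (auto simp: YY_def)
    obtain l where l: "l \<in> {k\<in>\<I>. k \<subseteq> f}" "M1 \<in> B l" using simp_complex_kernel[OF toral_proper[OF z(3)] z(4)] by blast
    have "Brel v br A (oproj l) M1" using l B_iff[OF P_sub[OF I_P]] by blast
    then have "norm M1 \<le> R" unfolding R_def by (rule Brel_bounded)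
    then show "z \<in> cball 0 R \<times> {\<theta>..1} \<times> BK v br A K" using z B_BK by auto
  qed
  have "closed (YY \<theta>)"
    unfolding closed_sequential_limits
  proof (intro allI impI, elim conjE)
    fix z l assume z: "\<forall>n. z n \<in> YY \<theta>" "z \<longlonglongrightarrow> l"
    define M1 where "M1 n = fst (z n)" for n
    define c where "c n = fst (snd (z n))" for n
    define M2 where "M2 n = snd (snd (z n))" for n
    have lim: "M1 \<longlonglongrightarrow> fst l" "c \<longlonglongrightarrow> fst (snd l)" "M2 \<longlonglongrightarrow> snd (snd l)"
      unfolding M1_def[abs_def] c_def[abs_def] M2_def[abs_def]
      by (rule tendsto_fst[OF z(2)], rule tendsto_fst[OF tendsto_snd[OF z(2)]], rule tendsto_snd[OF tendsto_snd[OF z(2)]])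
    have c: "c n \<in> {\<theta>..1}" and ex: "\<exists>f. f \<in> \<P> - \<I> \<and> M1 n \<in> simp_complex {k\<in>\<I>. k \<subseteq> f} \<and> M2 n \<in> B f" for n
      using z(1) by (auto simp: YY_def c_def M1_def M2_def case_prod_beta)
    from ex obtain f where f: "\<And>n. f n \<in> \<P> - \<I>" "\<And>n. M1 n \<in> simp_complex {k\<in>\<I>. k \<subseteq> f n}" "\<And>n. M2 n \<in> B (f n)" by metis
    have fP: "f n \<in> \<P>" for n using f(1) by blast
    obtain r f0 where r: "strict_mono (r :: nat \<Rightarrow> nat)" "f0 \<in> \<P>" "(\<lambda>n. oproj (f (r n))) \<longlonglongrightarrow> oproj f0"
      by (rule P_subseq[of f, OF fP])
    have M1r: "(\<lambda>n. M1 (r n)) \<longlonglongrightarrow> fst l" and M2r: "(\<lambda>n. M2 (r n)) \<longlonglongrightarrow> snd (snd l)"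
      using LIMSEQ_subseq_LIMSEQ[OF lim(1) r(1)] LIMSEQ_subseq_LIMSEQ[OF lim(3) r(1)] by (auto simp: o_def)
    have IK: "subspace k \<and> k \<noteq> UNIV" if "k \<in> \<I>" for k using that I_proper I_P P_sub by blast
    obtain \<phi> S0 where S0: "strict_mono (\<phi> :: nat \<Rightarrow> nat)" "S0 \<subseteq> \<I>" "fst l \<in> simp_complex S0"
      "\<And>k. k \<in> S0 \<Longrightarrow> \<exists>\<kappa>. (\<forall>n. \<kappa> n \<in> {k\<in>\<I>. k \<subseteq> f (r (\<phi> n))}) \<and> (\<lambda>n. oproj (\<kappa> n)) \<longlonglongrightarrow> oproj k"
      by (rule simp_complex_limitE[of \<I> "\<lambda>n. M1 (r n)" "\<lambda>n. {k\<in>\<I>. k \<subseteq> f (r n)}", OF IK compact_oproj_I f(2) _ M1r]) auto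
    have rl: "(\<lambda>n. oproj (f (r (\<phi> n)))) \<longlonglongrightarrow> oproj f0" using LIMSEQ_subseq_LIMSEQ[OF r(3) S0(1)] by (simp add: o_def)
    have S0f: "k \<subseteq> f0" if kS: "k \<in> S0" for k
    proof -
      obtain \<kappa> where \<kappa>: "\<And>n. \<kappa> n \<in> {k\<in>\<I>. k \<subseteq> f (r (\<phi> n))}" "(\<lambda>n. oproj (\<kappa> n)) \<longlonglongrightarrow> oproj k" using S0(4)[OF kS] by blast
      have "\<And>n. subspace (\<kappa> n)" "\<And>n. \<kappa> n \<subseteq> f (r (\<phi> n))" "subspace k" using \<kappa>(1) IK kS S0(2) by blast+
      then show ?thesis using limit_subset[OF P_sub[OF fP] _ P_sub[OF r(2)] _ _ rl \<kappa>(2)] by blast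
    qed
    have "Brel v br A (oproj (f (r n))) (M2 (r n))" for n using B_iff[OF P_sub[OF fP]] f(3) by blast
    then have "Brel v br A (oproj f0) (snd (snd l))" by (intro Brel_limit[OF _ r(3) M2r])
    then have M2f: "snd (snd l) \<in> B f0" using B_iff[OF P_sub[OF r(2)]] by blast
    have "M2 n \<in> BK v br A K" for n using B_BK[OF f(1,3)] .
    then have "snd (snd l) \<in> BK v br A K" using closed_sequentially[OF compact_imp_closed[OF compact_BK] _ lim(3)] by blast
    then obtain k where k: "k \<in> K" "snd (snd l) \<in> B k" by (auto simp: BK_def)
    have kP: "k \<in> \<P>" "k \<notin> \<I>" using k(1) K_nontoral by auto
    define j where "j = subalg_gen br (f0 \<union> k)"
    have j: "j \<in> \<P>" "snd (snd l) \<in> B j" "f0 \<subseteq> j" "k \<subseteq> j"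
      unfolding j_def using P_join[OF r(2) kP(1)] B_join(1)[OF P_sub[OF r(2)] P_sub[OF kP(1)] M2f k(2)] by (auto simp: subalg_gen_def)
    have "j \<notin> \<I>" using I_subset[OF kP(1) j(4)] kP(2) by blast
    moreover have "S0 \<subseteq> {k\<in>\<I>. k \<subseteq> j}" using S0f S0(2) j(3) by blast
    then have "fst l \<in> simp_complex {k\<in>\<I>. k \<subseteq> j}" using subsetD[OF simp_complex_mono S0(3)] by blast
    moreover have "fst (snd l) \<in> {\<theta>..1}" using closed_sequentially[OF closed_atLeastAtMost _ lim(2)] c by blast
    ultimately show "l \<in> YY \<theta>" unfolding YY_def case_prod_beta using j(1,2) by blast
  qed
  moreover have "compact (cball (0 :: 'g opr) R \<times> {\<theta>..1} \<times> BK v br A K)"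
    by (intro compact_Times compact_cball compact_Icc compact_BK)
  ultimately show ?thesis using sub by (metis compact_Int_closed inf.absorb_iff2)
qed

definition qY :: "'g opr \<times> real \<times> 'g opr \<Rightarrow> 'g opr" where
  "qY y = (1 - fst (snd y)) *\<^sub>R fst y + fst (snd y) *\<^sub>R snd (snd y)"

lemma YY_Dec: "0 < \<theta> \<Longrightarrow> (M1, c, M2) \<in> YY \<theta> \<Longrightarrow> \<exists>f. Dec f M1 M2 c (qY (M1, c, M2))"
  unfolding YY_def Dec_def qY_def by auto

text \<open>Points with \<open>c = 1\<close> are listed separately: their \<open>f\<close> need not
  contain any toral member, and then it offers no first component for
  \<open>YY \<theta>\<close>.\<close>

lemma XX_eq: assumes \<theta>: "0 < \<theta>" "\<theta> \<le> 1" shows "XX \<theta> = BK v br A K \<union> qY ` YY \<theta>"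
proof (intro equalityI subsetI)
  fix M assume "M \<in> XX \<theta>"
  then obtain f M1 M2 c where D: "Dec f M1 M2 c M" "\<theta> \<le> c" by (auto simp: XX_def)
  have f: "f \<in> \<P> - \<I>" "c \<le> 1" "M2 \<in> B f" "M = (1 - c) *\<^sub>R M1 + c *\<^sub>R M2" using D \<theta> by (auto simp: Dec_def)
  show "M \<in> BK v br A K \<union> qY ` YY \<theta>"
  proof (cases "c = 1")
    case True then show ?thesis using f B_BK by simp
  next
    case False
    then have "M1 \<in> simp_complex {k\<in>\<I>. k \<subseteq> f}" using D f(2) by (simp add: Dec_def)
    then have "(M1, c, M2) \<in> YY \<theta>" using f D(2) by (auto simp: YY_def)
    moreover have "M = qY (M1, c, M2)" using f(4) by (simp add: qY_def)
    ultimately show ?thesis by blast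
  qed
next
  fix M assume "M \<in> BK v br A K \<union> qY ` YY \<theta>"
  then show "M \<in> XX \<theta>"
  proof
    assume "M \<in> BK v br A K" then show ?thesis using BK_Dec[of M] \<theta> by (auto simp: XX_def)
  next
    assume "M \<in> qY ` YY \<theta>"
    then obtain M1 c M2 where y: "(M1, c, M2) \<in> YY \<theta>" "M = qY (M1, c, M2)" by auto
    then show ?thesis using YY_Dec[OF \<theta>(1) y(1)] by (auto simp: XX_def YY_def)
  qed
qed

text \<open>The choice is harmless because \<open>Dec_unique\<close> shows that \<open>M\<close>
  determines the weighted toral component.\<close>

definition \<beta> :: "'g opr \<Rightarrow> 'g opr" where
  "\<beta> M = (SOME b. \<exists>f M1 M2 c. Dec f M1 M2 c M \<and> b = (1 - c) *\<^sub>R M1)"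

lemma \<beta>_Dec: assumes D: "Dec f M1 M2 c M" shows "\<beta> M = (1 - c) *\<^sub>R M1"
proof -
  have "\<exists>f' M1' M2' c'. Dec f' M1' M2' c' M \<and> \<beta> M = (1 - c') *\<^sub>R M1'"
    unfolding \<beta>_def by (rule someI_ex) (use D in blast)
  then obtain f' M1' M2' c' where "Dec f' M1' M2' c' M" "\<beta> M = (1 - c') *\<^sub>R M1'" by blast
  then show ?thesis using Dec_unique(2)[OF D] by metis
qed

text \<open>Both components are kept while the coefficient \<open>c\<close> moves linearly to
  \<open>1\<close>. The formula uses only \<open>\<beta>\<close> and the coefficient, which are
  functions of the operator: the difference \<open>M - \<beta> M\<close> is \<open>c\<close> times
  the second component, so dividing by \<open>c\<close> recovers the latter.\<close>

definition HH :: "real \<times> 'g opr \<Rightarrow> 'g opr" where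
  "HH z = (1 - fst z) *\<^sub>R \<beta> (snd z) + (((1 - fst z) * kappa v br h A (snd z) + fst z) / kappa v br h A (snd z)) *\<^sub>R (snd z - \<beta> (snd z))"

lemma HH_Dec:
  assumes D: "Dec f M1 M2 c M" and c: "0 < c"
  shows "HH (t, M) = ((1 - t) * (1 - c)) *\<^sub>R M1 + ((1 - t) * c + t) *\<^sub>R M2"
proof -
  have "M - (1 - c) *\<^sub>R M1 = c *\<^sub>R M2" using D by (simp add: Dec_def)
  then show ?thesis unfolding HH_def using kappa_Dec[OF D] \<beta>_Dec[OF D] c by (simp add: distrib_right)
qed

lemma HH_Dec':
  assumes D: "Dec f M1 M2 c M" and c: "0 < c" and t: "t \<in> {0..1}"
  shows "Dec f M1 M2 ((1 - t) * c + t) (HH (t, M))" "c \<le> (1 - t) * c + t"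
proof -
  have f: "f \<in> \<P> - \<I>" "c \<le> 1" "M2 \<in> B f" using D c by (auto simp: Dec_def)
  have e: "1 - ((1 - t) * c + t) = (1 - t) * (1 - c)" by (simp add: algebra_simps)
  have ge: "0 \<le> t * (1 - c)" using t f(2) by simp
  show cle: "c \<le> (1 - t) * c + t" using ge by (simp add: algebra_simps)
  have "0 \<le> (1 - t) * (1 - c)" using t f(2) by simp
  then have le: "(1 - t) * c + t \<le> 1" using e by linarith
  have "M1 \<in> simp_complex {k\<in>\<I>. k \<subseteq> f}" if "(1 - t) * c + t < 1" using D cle that by (simp add: Dec_def)
  then show "Dec f M1 M2 ((1 - t) * c + t) (HH (t, M))"
    unfolding Dec_def HH_Dec[OF D c] e using f le cle c by auto
qed

text \<open>Continuity of \<open>HH\<close> is checked on two closed pieces: on \<open>BK\<close> it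
  is the projection to the operator, and on the image of \<open>YY \<theta>\<close> it lifts to a
  polynomial formula on a compact space. The bound \<open>\<theta> > 0\<close> keeps the second
  component determined.\<close>

lemma sdr_BK_XX:
  assumes \<theta>: "0 < \<theta>" "\<theta> \<le> 1" shows "sdr (BK v br A K) (XX \<theta>)"
proof (rule sdrI[of _ _ HH])
  show "BK v br A K \<subseteq> XX \<theta>" using XX_eq[OF \<theta>] by blast
  have fixed: "HH (t, M) = M" if M: "M \<in> BK v br A K" for t M
  proof -
    obtain f where "Dec f 0 M 1 M" using BK_Dec[OF M] by blast
    from HH_Dec[OF this] show ?thesis by simp
  qed
  then show "HH (t, s) = s" if "s \<in> BK v br A K" for t s using that by blast
  have "continuous_on ({0..1} \<times> BK v br A K) HH"
    by (subst continuous_on_cong[OF refl, of _ _ snd]) (auto simp: fixed intro: continuous_intros)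
  moreover have "continuous_on ((\<lambda>z. (fst z, qY (snd z))) ` ({0..1::real} \<times> YY \<theta>)) HH"
  proof (rule continuous_on_quotient)
    show "compact ({0..1::real} \<times> YY \<theta>)" by (intro compact_Times compact_Icc YY_compact)
    show "continuous_on ({0..1::real} \<times> YY \<theta>) (\<lambda>z. (fst z, qY (snd z)))" unfolding qY_def by (intro continuous_intros)
    define G where "G z = ((1 - fst z) * (1 - fst (snd (snd z)))) *\<^sub>R fst (snd z) + ((1 - fst z) * fst (snd (snd z)) + fst z) *\<^sub>R snd (snd (snd z))"
      for z :: "real \<times> 'g opr \<times> real \<times> 'g opr"
    have "HH (fst z, qY (snd z)) = G z" if z: "z \<in> {0..1} \<times> YY \<theta>" for z
    proof -
      obtain t M1 c M2 where z': "z = (t, M1, c, M2)" by (cases z) auto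
      have y: "(M1, c, M2) \<in> YY \<theta>" using z z' by simp
      then have "0 < c" using \<theta>(1) by (auto simp: YY_def)
      moreover obtain f where "Dec f M1 M2 c (qY (M1, c, M2))" using YY_Dec[OF \<theta>(1) y] by blast
      ultimately show ?thesis using HH_Dec z' by (simp add: G_def)
    qed
    moreover have "continuous_on ({0..1} \<times> YY \<theta>) G" unfolding G_def[abs_def] by (intro continuous_intros)
    ultimately show "continuous_on ({0..1} \<times> YY \<theta>) (\<lambda>z. HH (fst z, qY (snd z)))"
      using continuous_on_cong[OF refl, of _ "\<lambda>z. HH (fst z, qY (snd z))" G] by blast
  qed
  moreover have "(\<lambda>z. (fst z, qY (snd z))) ` ({0..1::real} \<times> YY \<theta>) = {0..1} \<times> qY ` YY \<theta>" by (force simp: image_iff)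
  moreover have "closed ({0..1::real} \<times> BK v br A K)" "closed ({0..1::real} \<times> qY ` YY \<theta>)"
  proof -
    have "compact (qY ` YY \<theta>)" unfolding qY_def by (intro compact_continuous_image YY_compact continuous_intros)
    then show "closed ({0..1::real} \<times> BK v br A K)" "closed ({0..1::real} \<times> qY ` YY \<theta>)"
      using compact_BK by (auto intro: closed_Times compact_imp_closed)
  qed
  ultimately have "continuous_on ({0..1} \<times> BK v br A K \<union> {0..1::real} \<times> qY ` YY \<theta>) HH"
    by (intro continuous_on_closed_Un) auto
  then show "continuous_on ({0..1} \<times> XX \<theta>) HH" unfolding XX_eq[OF \<theta>] by (simp add: Times_Un_distrib1 Sigma_Un_distrib2)
  fix t :: real and M
  show "HH (t, M) \<in> XX \<theta>" if t: "t \<in> {0..1}" and M: "M \<in> XX \<theta>"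
  proof -
    obtain f M1 M2 c where D: "Dec f M1 M2 c M" "\<theta> \<le> c" using M by (auto simp: XX_def)
    have "0 < c" using D \<theta> by simp
    note H = HH_Dec'[OF D(1) this t]
    have "\<theta> \<le> (1 - t) * c + t" using H(2) D(2) by simp
    then show ?thesis using H(1) unfolding XX_def by blast
  qed
  show "HH (0, M) = M" if M: "M \<in> XX \<theta>"
  proof -
    obtain f M1 M2 c where D: "Dec f M1 M2 c M" "\<theta> \<le> c" using M by (auto simp: XX_def)
    then show ?thesis using HH_Dec[OF D(1), of 0] \<theta> by (simp add: Dec_def)
  qed
  show "HH (1, M) \<in> BK v br A K" if M: "M \<in> XX \<theta>"
  proof -
    obtain f M1 M2 c where D: "Dec f M1 M2 c M" "\<theta> \<le> c" using M by (auto simp: XX_def)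
    then have "f \<in> \<P> - \<I>" "M2 \<in> B f" using \<theta> by (auto simp: Dec_def)
    moreover have "HH (1, M) = M2" using HH_Dec[OF D(1), of 1] D(2) \<theta> by simp
    ultimately show ?thesis using B_BK by simp
  qed
qed

lemma sdr_Xeps:
  assumes "0 < e" "e \<le> 1" shows "sdr (simp_complex Ks) (Xeps v br h A L e)"
proof -
  have "0 < e ^ L" "e ^ L \<le> 1" using assms by (auto simp: power_le_one)
  from sdr_trans[OF sdr_BK sdr_BK_XX[OF this]] show ?thesis unfolding Xeps_XX .
qed

end

theorem theorem6p6:
  fixes br :: "'g::euclidean_space \<Rightarrow> 'g \<Rightarrow> 'g"
    and h :: "'g set" and A :: "('g \<Rightarrow>\<^sub>L 'g) set" and K :: "'g set set"
    and v :: version and L :: nat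
  assumes lie: "compact_lie_algebra br"
    and h_sub: "subalg br h" and h_proper: "h \<noteq> UNIV"
    and autA: "aut_group br h A"
    and L_bound: "\<And>fl. flag_in (Iset br h A) fl \<Longrightarrow> length fl \<le> L"
    and K_sub: "K \<subseteq> Pset br h A"
    and K_compact: "compact (oproj ` K)"
    and K_semialg: "semialgebraic (oproj ` K)"
    and K_semilat: "upper_semilattice br K"
    and g_in_K: "UNIV \<in> K"
  shows "compact (simp_complex (K - {UNIV})) \<and>
         strong_deformation_retract (simp_complex (K - {UNIV})) (BK v br A K) \<and>
         ((\<not> (\<forall>x y. br x y \<in> h) \<and> Kmin br h A \<subseteq> K \<and> K \<subseteq> Pset br h A - Iset br h A) \<longrightarrow>
            (\<forall>e::real. 0 < e \<and> e < 1 \<longrightarrow>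
               strong_deformation_retract (simp_complex (K - {UNIV})) (Xeps v br h A L e)) \<and>
            strong_deformation_retract (simp_complex (K - {UNIV})) (Xeps v br h A L 1) \<and>
            strong_deformation_retract (simp_complex (K - {UNIV}))
              (\<Union>f\<in>Pset br h A - Iset br h A. Bk v br A f))"
proof -
  interpret K_setting br h A v K
    by unfold_locales (rule lie h_sub autA K_sub K_compact semialgebraic_imp_constructible[OF K_semialg] K_semilat)+
  show ?thesis
    unfolding Ks_def[symmetric]
  proof (intro conjI impI allI)
    show "compact (simp_complex Ks)" "sdr (simp_complex Ks) (BK v br A K)" by (rule compact_simp_complex sdr_BK)+
    assume nt: "\<not> (\<forall>x y. br x y \<in> h) \<and> Kmin br h A \<subseteq> K \<and> K \<subseteq> \<P> - \<I>"
    interpret nontoral_setting br h A v K by unfold_locales (use nt in auto)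
    show "sdr (simp_complex Ks) (Xeps v br h A L e)" if "0 < e \<and> e < 1" for e using sdr_Xeps that by simp
    show "sdr (simp_complex Ks) (Xeps v br h A L 1)" by (rule sdr_Xeps) auto
    show "sdr (simp_complex Ks) (\<Union>f\<in>\<P> - \<I>. B f)" unfolding BK_nontoral by (rule sdr_BK)
  qed
qed

end
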